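(* Assume the Riemann hypothesis. Then there exist constants $T_{0}$ and $c_{0}$ such that for every $T\geqslant T_{0}$, with $H=0.8\ln\ln\ln T+c_{0}$, the segment $[T-H,T+H]$ contains a Gram interval $G_{k}=(t_{k-1},t_{k}]$ containing at least two zeros of $\zeta(0.5+it)$ (counted with multiplicity).
   Context: Let $\vartheta(t)$ denote the increment of a continuous branch of the argument of $\pi^{-s/2}\Gamma(s/2)$ along the segment joining $s=0.5$ and $s=0.5+it$. For $n\geqslant 0$, the Gram point $t_{n}$ is the unique solution of $\vartheta(t_{n})=(n-1)\pi$ with $\vartheta'(t_{n})>0$. The Gram interval is $G_{n}=(t_{n-1},t_{n}]$, $n\geqslant 1$. *)

theory Defs
  imports "HOL-Complex_Analysis.Complex_Analysis"
begin

text \<open>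
  The Riemann zeta function is the analytic continuation of its Dirichlet series. The conditions
  determine it on the punctured plane; the value at the pole \<open>1\<close> is left unspecified.
\<close>

definition zeta :: "complex \<Rightarrow> complex" where
  "zeta = (SOME f. f holomorphic_on (- {1}) \<and>
             (\<forall>s. Re s > 1 \<longrightarrow> f s = (\<Sum>n. 1 / of_nat (Suc n) powr s)))"

definition Riemann_hypothesis :: bool where
  "Riemann_hypothesis \<longleftrightarrow> (\<forall>s. 0 < Re s \<and> Re s < 1 \<and> zeta s = 0 \<longrightarrow> Re s = 1 / 2)"

text \<open>
  The increment does not depend on the branch \<open>\<phi>\<close>, provided that \<open>f\<close> is continuous and
  zero-free along the path \<open>g\<close>.
\<close>

definition arg_increment :: "(complex \<Rightarrow> complex) \<Rightarrow> (real \<Rightarrow> complex) \<Rightarrow> real" where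
  "arg_increment f g = (THE d. \<exists>\<phi>. continuous_on {0..1} \<phi> \<and>
     (\<forall>u\<in>{0..1}. is_Arg (f (g u)) (\<phi> u)) \<and> d = \<phi> 1 - \<phi> 0)"

definition theta :: "real \<Rightarrow> real" where
  "theta t = arg_increment (\<lambda>s. of_real pi powr (- s / 2) * Gamma (s / 2))
               (linepath (1 / 2) (Complex (1 / 2) t))"

text \<open>
  The function \<open>theta\<close> is odd, so the restriction to positive \<open>t\<close> is needed for uniqueness:
  every value \<open>(n - 1) * pi\<close> is also attained with positive derivative at some negative \<open>t\<close>
  when \<open>n \<le> 2\<close>.
\<close>

definition gram_point :: "nat \<Rightarrow> real" where
  "gram_point n = (THE t. t > 0 \<and> theta t = (real n - 1) * pi \<and> deriv theta t > 0)"

text \<open>Only used for \<open>k \<ge> 1\<close>.\<close>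

definition gram_interval :: "nat \<Rightarrow> real set" where
  "gram_interval k = {gram_point (k - 1)<..gram_point k}"

definition critical_zero_count :: "real set \<Rightarrow> int" where
  "critical_zero_count A =
     (\<Sum>t | t \<in> A \<and> zeta (Complex (1 / 2) t) = 0. zorder zeta (Complex (1 / 2) t))"

end

theory Submission
  imports Defs "HOL-Probability.Probability" "HOL-Real_Asymp.Real_Asymp" "HOL-Number_Theory.Number_Theory"
begin

text \<open>
  Let \<open>g(t) = exp (b - b * cosh (5 / 4 * (t - \<tau>)))\<close>. Since \<open>cos (5 / 4) > 0\<close>, the entire extension of
  this weight decays doubly exponentially in the strip of width 2 around the critical line, so at
  distance \<open>0.8 * ln (ln (ln T)) + c\<close> from \<open>\<tau>\<close> it is already smaller than a large negative power
  of \<open>ln T\<close>, which beats the size of \<open>\<zeta>'/\<zeta>\<close> on suitable horizontal segments. The argument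
  principle for the completed zeta function therefore yields a localized explicit formula

  \<open>\<pi> * (\<Sum>\<gamma>. g \<gamma>) = \<integral> \<theta>' g + Re (\<integral> (\<zeta>'/\<zeta>)(3/2 + i y) g(y - i) dy) + o(1)\<close>

  with sum and integrals restricted to the window \<open>[T - H, T + H]\<close>. If every Gram interval in the
  window contained at most one zero, comparing each zero with its own Gram interval (over which
  \<open>\<theta>\<close> increases by exactly \<open>\<pi>\<close>) would bound the sum over zeros by \<open>\<integral> \<theta>' g + 2\<pi>\<close>, since \<open>g\<close> is
  unimodal with maximum 1. But the prime sum on the right can be made larger than any constant:
  by Kronecker's theorem for the logarithms of primes one may choose \<open>\<tau>\<close>, at bounded distance
  from \<open>T\<close>, so that the terms of all primes in a large initial range have the same sign.
\<close>

section \<open>Rectangles, Gaussian integrals and the theta transformation\<close>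

text \<open>The rate 5/4 governs the quantitative side. Contours run over the abscissas 1/2 to 3/2,
  so the weight must decay for real parts up to 1, which asks for 5/4 < \<pi>/2. At distance d the
  weight is about exp (- c * exp (5 * d / 4)), and beating a power of ln T makes exp (5 * d / 4) a
  large multiple of ln (ln T): hence d = 0.8 * ln (ln (ln T)) + O(1), with 0.8 = 4/5. RH enters
  twice. It places the zeros where the weight is real, positive and unimodal, and it bounds
  \<zeta>'/\<zeta> by a power of ln T on suitable horizontal segments. The excess 2\<pi> in the
  comparison is an absolute constant, so the prime sum has to exceed a fixed bound only. That is
  possible because the transform of the weight is of size 1 / sqrt b for frequencies up to a
  multiple of sqrt b, while the sum of ln p / sqrt p over p <= x exceeds any multiple of ln x for a
  suitable x. The steepness b and the primes to be aligned are then chosen once and for all,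
  independently of T, so the displacement of \<tau> stays bounded and disappears in c0.\<close>

lemma has_contour_integral_horizontal:
  fixes f :: "complex \<Rightarrow> complex"
  assumes "a \<le> b" and "continuous_on {a..b} (\<lambda>x. f (Complex x y))"
  shows "(f has_contour_integral integral {a..b} (\<lambda>x. f (Complex x y)))
    (linepath (Complex a y) (Complex b y))"
proof (cases "a = b")
  case True
  then show ?thesis
    using has_contour_integral_trivial[of f "Complex b y"] by simp
next
  case False
  with assms have "a < b" by simp
  have "((\<lambda>x. f (Complex x y)) has_integral integral {a..b} (\<lambda>x. f (Complex x y))) (cbox a b)"
    using assms by (simp add: integrable_continuous_real integrable_integral)
  from has_integral_affinity[OF this, of "b - a" a]
  have "((\<lambda>x. f (Complex ((b - a) * x + a) y)) has_integral
    (1 / (b - a)) *\<^sub>R integral {a..b} (\<lambda>x. f (Complex x y))) ((\<lambda>x. (1 / (b - a)) * x + - ((1 / (b - a)) * a)) ` {a..b})"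
    using \<open>a < b\<close> by simp
  also have "(\<lambda>x. (1 / (b - a)) * x + - ((1 / (b - a)) * a)) ` {a..b} = {0..1}"
    using \<open>a < b\<close> by (subst image_affinity_atLeastAtMost) (auto simp: divide_simps)
  finally have "((\<lambda>x. (b - a) *\<^sub>R f (Complex ((b - a) * x + a) y)) has_integral
    (b - a) *\<^sub>R ((1 / (b - a)) *\<^sub>R integral {a..b} (\<lambda>x. f (Complex x y)))) {0..1}"
    by (rule has_integral_cmul)
  then have "((\<lambda>x. (b - a) *\<^sub>R f (Complex (linepath a b x) y)) has_integral
    integral {a..b} (\<lambda>x. f (Complex x y))) {0..1}"
    using \<open>a < b\<close> by (simp add: linepath_def algebra_simps)
  moreover have "Complex (linepath a b x) y = linepath (Complex a y) (Complex b y) x" for x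
    by (simp add: linepath_def complex_eq_iff algebra_simps)
  moreover have "Complex b y - Complex a y = of_real (b - a)"
    by (simp add: complex_eq_iff)
  ultimately show ?thesis
    by (simp add: has_contour_integral_linepath scaleR_conv_of_real mult.commute)
qed

lemma has_contour_integral_vertical:
  fixes f :: "complex \<Rightarrow> complex"
  assumes "a \<le> b" and "continuous_on {a..b} (\<lambda>y. f (Complex x y))"
  shows "(f has_contour_integral \<i> * integral {a..b} (\<lambda>y. f (Complex x y)))
    (linepath (Complex x a) (Complex x b))"
proof (cases "a = b")
  case True
  then show ?thesis
    using has_contour_integral_trivial[of f "Complex x b"] by simp
next
  case False
  with assms have "a < b" by simp
  have "((\<lambda>y. f (Complex x y)) has_integral integral {a..b} (\<lambda>y. f (Complex x y))) {a..b}"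
    using assms by (simp add: integrable_continuous_real integrable_integral)
  then show ?thesis using \<open>a < b\<close>
    by (subst has_contour_integral_linepath_same_Re_iff[of _ x _ a b]) auto
qed

text \<open>Each contour argument below (theta series, Fourier transform of the weight, argument
  principle, archimedean factor) is in the end an identity between four real-variable integrals;
  this form supplies them with the orientation signs in place.\<close>

lemma contour_integral_rectpath:
  fixes f :: "complex \<Rightarrow> complex"
  assumes ab: "a \<le> b" and cd: "c \<le> d"
    and cont: "continuous_on (path_image (rectpath (Complex a c) (Complex b d))) f"
  shows "contour_integral (rectpath (Complex a c) (Complex b d)) f =
    integral {a..b} (\<lambda>x. f (Complex x c)) + \<i> * integral {c..d} (\<lambda>y. f (Complex b y))
    - integral {a..b} (\<lambda>x. f (Complex x d)) - \<i> * integral {c..d} (\<lambda>y. f (Complex a y))"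
proof -
  have pi: "path_image (rectpath (Complex a c) (Complex b d)) =
           {z. Re z \<in> {a, b} \<and> Im z \<in> {c..d}} \<union> {z. Im z \<in> {c, d} \<and> Re z \<in> {a..b}}"
    using path_image_rectpath[of "Complex a c" "Complex b d"] ab cd by simp
  have ch: "continuous_on {a..b} (\<lambda>x. f (Complex x y))" if "y \<in> {c, d}" for y
    by (rule continuous_on_compose2[OF cont])
       (use that ab cd in \<open>auto simp: pi intro!: continuous_intros\<close>)
  have cv: "continuous_on {c..d} (\<lambda>y. f (Complex x y))" if "x \<in> {a, b}" for x
    by (rule continuous_on_compose2[OF cont])
       (use that ab cd in \<open>auto simp: pi intro!: continuous_intros\<close>)
  have 1: "(f has_contour_integral integral {a..b} (\<lambda>x. f (Complex x c)))
      (linepath (Complex a c) (Complex b c))"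
    by (rule has_contour_integral_horizontal[OF ab ch]) simp
  have 2: "(f has_contour_integral \<i> * integral {c..d} (\<lambda>y. f (Complex b y)))
      (linepath (Complex b c) (Complex b d))"
    by (rule has_contour_integral_vertical[OF cd cv]) simp
  have 3: "(f has_contour_integral - integral {a..b} (\<lambda>x. f (Complex x d)))
      (linepath (Complex b d) (Complex a d))"
    using has_contour_integral_reversepath[OF _ has_contour_integral_horizontal[OF ab ch[of d]]] 
    by simp
  have 4: "(f has_contour_integral - (\<i> * integral {c..d} (\<lambda>y. f (Complex a y))))
      (linepath (Complex a d) (Complex a c))"
    using has_contour_integral_reversepath[OF _ has_contour_integral_vertical[OF cd cv[of a]]] 
    by simp
  have "(f has_contour_integral (integral {a..b} (\<lambda>x. f (Complex x c)) + (\<i> * integral {c..d} (\<lambda>y. f (Complex b y))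
    + (- integral {a..b} (\<lambda>x. f (Complex x d)) + - (\<i> * integral {c..d} (\<lambda>y. f (Complex a y)))))))
     (rectpath (Complex a c) (Complex b d))"
    unfolding rectpath_def Let_def
    by (simp only: complex.sel, intro has_contour_integral_join 1 2 3 4 valid_path_join) simp_all
  then show ?thesis
    by (simp add: contour_integral_unique)
qed

text \<open>This is the characteristic function of the standard normal law after rescaling the
  variable by \<open>r = sqrt (2 * pi * a)\<close>, so no separate contour argument is needed to
  complete the square.\<close>

lemma gaussian_fourier:
  fixes a \<xi> :: real
  assumes "a > 0"
  shows "integrable lborel (\<lambda>x. exp (of_real (- pi * a * x\<^sup>2) + \<i> * of_real (2 * pi * \<xi> * x)))" (is ?I)
    and "(LINT x|lborel. exp (of_real (- pi * a * x\<^sup>2) + \<i> * of_real (2 * pi * \<xi> * x)))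
       = of_real (exp (- pi * \<xi>\<^sup>2 / a) / sqrt a)" (is ?E)
proof -
  define r where "r = sqrt (2 * pi * a)"
  have r: "r > 0" "r\<^sup>2 = 2 * pi * a" using assms by (auto simp: r_def)
  define t where "t = 2 * pi * \<xi> / r"
  have tr: "t * r = 2 * pi * \<xi>" using r by (simp add: t_def)
  let ?g = "\<lambda>x. of_real (std_normal_density x) * exp (\<i> * of_real (t * x)) :: complex"
  have int: "integrable lborel ?g"
  proof (rule Bochner_Integration.integrable_bound[of _ "\<lambda>x. std_normal_density x"])
    show "integrable lborel std_normal_density" using integrable_std_normal_moment[of 0] by simp
    show "?g \<in> borel_measurable lborel" by measurable
    show "AE x in lborel. norm (?g x) \<le> norm (std_normal_density x)" by (auto simp: norm_mult)
  qed
  have val: "(LINT x|lborel. ?g x) = of_real (exp (- (t^2) / 2))"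
  proof -
    have "char std_normal_distribution t = (LINT x|lborel. std_normal_density x *\<^sub>R iexp (t * x))"
      unfolding char_def by (subst integral_density) (auto simp: normal_density_nonneg)
    then show ?thesis by (simp add: char_std_normal_distribution scaleR_conv_of_real)
  qed
  have eq: "?g (0 + r * x) * of_real (sqrt (2 * pi)) = exp (of_real (- pi * a * x\<^sup>2) + \<i> * of_real (2 * pi * \<xi> * x))" for x
  proof -
    have "std_normal_density (r * x) * sqrt (2 * pi) = exp (- pi * a * x\<^sup>2)"
      using r by (simp add: std_normal_density_def power_mult_distrib algebra_simps)
    moreover have "t * (r * x) = 2 * pi * \<xi> * x" using tr by (metis mult.assoc)
    moreover have "?g (0 + r * x) * of_real (sqrt (2 * pi)) =
        of_real (std_normal_density (r * x) * sqrt (2 * pi)) * exp (\<i> * of_real (t * (r * x)))"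
      by simp
    ultimately show ?thesis
      by (simp only: exp_add exp_of_real)
  qed
  have "integrable lborel (\<lambda>x. ?g (0 + r * x))"
    by (rule lborel_integrable_real_affine[OF int]) (use r in auto)
  then have "integrable lborel (\<lambda>x. ?g (0 + r * x) * of_real (sqrt (2 * pi)))"
    by simp
  then show ?I by (simp only: eq)
  have "(LINT x|lborel. ?g x) = r *\<^sub>R (LINT x|lborel. ?g (0 + r * x))"
    using lborel_integral_real_affine[of r ?g 0] r by simp
  then have "(LINT x|lborel. ?g (0 + r * x)) * of_real (sqrt (2 * pi)) = of_real (exp (- (t^2) / 2)) * of_real (sqrt (2 * pi) / r)"
    using r val by (simp add: scaleR_conv_of_real field_simps)
  then have "(LINT x|lborel. ?g (0 + r * x) * of_real (sqrt (2 * pi))) = of_real (exp (- (t^2) / 2) * (sqrt (2 * pi) / r))"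
    by simp
  moreover have "- (t^2) / 2 = - pi * \<xi>\<^sup>2 / a"
    using r assms by (simp add: t_def power_divide power_mult_distrib) (simp add: field_simps power2_eq_square)
  moreover have "sqrt (2 * pi) / r = 1 / sqrt a" unfolding r_def by (simp add: real_sqrt_mult)
  ultimately show ?E by (simp only: eq) simp
qed

text \<open>Contour sides come as gauge integrals over bounded intervals, whereas termwise
  integration produces Lebesgue integrals over the line; dominated convergence passes from one to
  the other.\<close>

lemma tendsto_integral_symmetric:
  fixes f :: "real \<Rightarrow> complex"
  assumes f: "integrable lborel f" and X: "filterlim X at_top sequentially"
  shows "(\<lambda>n. integral {-X n..X n} f) \<longlonglongrightarrow> (LINT x|lborel. f x)"
proof -
  have "integral {-X n..X n} f = (LINT x|lborel. indicator {-X n..X n} x *\<^sub>R f x)" for n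
    using set_borel_integral_eq_integral(2)[of "{-X n..X n}" f] set_integrable_subset[of lborel UNIV f "{-X n..X n}"] f
    by (simp add: set_lebesgue_integral_def set_integrable_def)
  moreover have "(\<lambda>n. LINT x|lborel. indicator {-X n..X n} x *\<^sub>R f x) \<longlonglongrightarrow> (LINT x|lborel. f x)"
  proof (rule integral_dominated_convergence[where w = "\<lambda>x. norm (f x)"])
    show "f \<in> borel_measurable lborel" using f by simp
    then show "(\<lambda>x. indicator {-X n..X n} x *\<^sub>R f x) \<in> borel_measurable lborel" for n
      by measurable
    show "integrable lborel (\<lambda>x. norm (f x))" using f by simp
    show "AE x in lborel. (\<lambda>n. indicator {-X n..X n} x *\<^sub>R f x) \<longlonglongrightarrow> f x"
    proof (intro AE_I2 tendsto_eventually)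
      fix x
      have "eventually (\<lambda>n. X n \<ge> \<bar>x\<bar>) sequentially"
        using X by (simp add: filterlim_at_top)
      then show "\<forall>\<^sub>F n in sequentially. indicator {-X n..X n} x *\<^sub>R f x = f x"
        by eventually_elim (auto simp: indicator_def)
    qed
    show "AE x in lborel. norm (indicator {-X n..X n} x *\<^sub>R f x) \<le> norm (f x)" for n
      by (auto simp: indicator_def)
  qed
  ultimately show ?thesis by simp
qed

section \<open>Jacobi's theta transformation by residues\<close>

lemma summable_exp_square:
  fixes a :: real assumes "a > 0"
  shows "summable (\<lambda>n. exp (- pi * a * real n ^ 2))"
proof (rule summable_comparison_test')
  show "summable (\<lambda>n. exp (- pi * a) ^ n)"
    using assms by (intro summable_geometric) auto
  show "norm (exp (- pi * a * real n ^ 2)) \<le> exp (- pi * a) ^ n" if "n \<ge> 0" for n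
  proof -
    have "real n \<le> real n ^ 2" by (cases n) (auto simp: power2_eq_square)
    then have "pi * a * real n \<le> pi * a * real n ^ 2" using assms by (intro mult_left_mono) auto
    then have "exp (- pi * a * real n ^ 2) \<le> exp (real n * (- pi * a))" by (simp add: mult_ac)
    also have "\<dots> = exp (- pi * a) ^ n" by (rule exp_of_nat_mult)
    finally show ?thesis by simp
  qed
qed

text \<open>On Im z = \<sigma> the factor \<open>u\<close> has constant modulus exp (- 2 \<pi>), so
  1 / (1 - u) is a geometric series that may be integrated termwise. The term of index m is a
  Gaussian with frequency \<sigma> (m - a), and the prefactor exp (\<pi> a - 2 \<pi> m) turns its
  transform into exp (- \<pi> m^2 / a) / sqrt a.\<close>

lemma gaussian_geometric_line:
  fixes a \<sigma> :: real
  assumes a: "a > 0" and \<sigma>: "\<sigma> = 1 \<or> \<sigma> = -1"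
  defines "F \<equiv> \<lambda>x. exp (- of_real (pi * a) * (Complex x \<sigma>)\<^sup>2)"
    and "u \<equiv> \<lambda>x. exp (2 * of_real pi * \<i> * of_real \<sigma> * Complex x \<sigma>)"
  shows "integrable lborel (\<lambda>x. F x)" "(LINT x|lborel. F x) = of_real (1 / sqrt a)"
    and "integrable lborel (\<lambda>x. F x / (1 - u x))"
    and "(\<lambda>m. of_real (exp (- pi * (1 / a) * real m ^ 2) / sqrt a)) sums (LINT x|lborel. F x / (1 - u x))"
proof -
  have \<sigma>2: "\<sigma> * \<sigma> = 1" using \<sigma> by auto
  have eq: "F x * u x ^ m = exp (of_real (- pi * a * x\<^sup>2) + \<i> * of_real (2 * pi * (\<sigma> * (m - a)) * x))
      * of_real (exp (pi * a - 2 * pi * m))" for x and m :: nat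
    unfolding F_def u_def exp_of_real[symmetric] exp_of_nat_mult[symmetric] exp_add[symmetric]
    by (rule arg_cong[of _ _ exp]) (use \<sigma> in \<open>auto simp: complex_eq_iff power2_eq_square algebra_simps\<close>)
  have nu: "norm (u x) = exp (- 2 * pi)" for x
    using \<sigma>2 by (simp add: u_def)
  have int: "integrable lborel (\<lambda>x. F x * u x ^ m)" for m
    unfolding eq by (intro integrable_mult_left gaussian_fourier(1) a)
  have val: "(LINT x|lborel. F x * u x ^ m) = of_real (exp (- pi * (1 / a) * real m ^ 2) / sqrt a)" for m :: nat
  proof -
    have "(\<sigma> * (m - a))\<^sup>2 = (m - a)\<^sup>2" using \<sigma> by (auto simp: power2_commute)
    then have "exp (- pi * (\<sigma> * (m - a))\<^sup>2 / a) * exp (pi * a - 2 * pi * m) = exp (- pi * (1 / a) * real m ^ 2)"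
      unfolding exp_add[symmetric] using a by (simp only:) (simp add: field_simps power2_eq_square)
    then show ?thesis
      unfolding eq integral_mult_left_zero gaussian_fourier(2)[OF a] of_real_mult[symmetric]
      by (simp add: mult.commute)
  qed
  show "integrable lborel F" "(LINT x|lborel. F x) = of_real (1 / sqrt a)" using int[of 0] val[of 0] by auto
  have lt: "exp (- 2 * pi) < 1" by simp
  have nF: "integrable lborel (\<lambda>x. norm (F x))" using int[of 0] by simp
  have nFu: "norm (F x * u x ^ m) = norm (F x) * exp (- 2 * pi) ^ m" for x m by (simp add: norm_mult norm_power nu)
  have sF: "summable (\<lambda>m. norm (F x * u x ^ m))" for x
    unfolding nFu using lt by (intro summable_mult summable_geometric) simp
  have sI: "summable (\<lambda>m. LINT x|lborel. norm (F x * u x ^ m))"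
    unfolding nFu using lt by (simp add: summable_mult summable_geometric)
  have sm: "(\<Sum>m. F x * u x ^ m) = F x / (1 - u x)" for x
  proof -
    have "norm (u x) < 1" using nu lt by simp
    then have "(\<lambda>m. F x * u x ^ m) sums (F x * (1 / (1 - u x)))"
      by (intro sums_mult geometric_sums)
    then show ?thesis by (simp add: sums_iff)
  qed
  show "integrable lborel (\<lambda>x. F x / (1 - u x))"
    using integrable_suminf[OF int _ sI] sF by (simp add: sm)
  show "(\<lambda>m. of_real (exp (- pi * (1 / a) * real m ^ 2) / sqrt a)) sums (LINT x|lborel. F x / (1 - u x))"
    using sums_integral[OF int _ sI] sF by (simp only: sm val) auto
qed

text \<open>\<open>E\<close> has a simple zero at each integer, with derivative 2 \<pi> i, so the
  residues of F / E add up to the theta sum over |n| <= N. Pairing n with - n counts 0 once, whence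
  the \<open>- 1\<close>. A half-integer \<open>R\<close> keeps the vertical sides away from the
  zeros.\<close>

lemma jacobi_theta_contour:
  fixes a :: real and N :: nat
  assumes a: "a > 0"
  defines "F \<equiv> \<lambda>z. exp (- of_real (pi * a) * z\<^sup>2)" and "E \<equiv> \<lambda>z. exp (2 * of_real pi * \<i> * z) - 1"
    and "R \<equiv> real N + 1 / 2"
  shows "of_real (2 * (\<Sum>n\<le>N. exp (- pi * a * real n ^ 2)) - 1) =
    integral {-R..R} (\<lambda>x. F (Complex x (-1)) / E (Complex x (-1))) + \<i> * integral {-1..1} (\<lambda>y. F (Complex R y) / E (Complex R y))
    - integral {-R..R} (\<lambda>x. F (Complex x 1) / E (Complex x 1)) - \<i> * integral {-1..1} (\<lambda>y. F (Complex (-R) y) / E (Complex (-R) y))"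
proof -
  define pts where "pts = complex_of_int ` {-int N..int N}"
  \<comment> \<open>3/4 lies between the 1/2 of the contour and the distance 1 to the next integer,
    so \<open>S\<close> contains the rectangle but no zero of \<open>E\<close> outside
    \<open>pts\<close>.\<close>
  define S where "S = box (Complex (- real N - 3/4) (-2)) (Complex (real N + 3/4) 2)"
  let ?g = "rectpath (Complex (-R) (-1)) (Complex R 1)"
  have R: "R > 0" by (simp add: R_def)
  have E0: "E z = 0 \<longleftrightarrow> z \<in> range of_int" for z
  proof -
    have "E z = 0 \<longleftrightarrow> (\<exists>n::int. 2 * of_real pi * \<i> * z = of_real (2 * of_int n * pi) * \<i>)"
      by (simp add: E_def) (simp only: exp_eq_1, auto simp: complex_eq_iff)
    also have "\<dots> \<longleftrightarrow> (\<exists>n::int. z = of_int n)"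
      by (intro iff_exI) (auto simp: complex_eq_iff)
    finally show ?thesis by auto
  qed
  have S_pts: "E z \<noteq> 0" if "z \<in> S - pts" for z
  proof
    assume "E z = 0"
    then obtain n where n: "z = of_int n" using E0 by auto
    with that have "\<bar>real_of_int n\<bar> < real N + 3/4" by (auto simp: S_def in_box_complex_iff)
    then have "n \<in> {-int N..int N}" by auto
    with n that show False by (auto simp: pts_def)
  qed
  have pi: "path_image ?g =
           {z. Re z \<in> {-R, R} \<and> Im z \<in> {-1..1}} \<union> {z. Im z \<in> {-1, 1} \<and> Re z \<in> {-R..R}}"
    using path_image_rectpath[of "Complex (-R) (-1)" "Complex R 1"] R by simp
  have pS: "path_image ?g \<subseteq> S - pts"
  proof
    fix z assume z: "z \<in> path_image ?g"
    have "z \<in> S" using z R unfolding pi S_def by (auto simp: in_box_complex_iff R_def)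
    moreover have "z \<notin> pts"
    proof
      assume "z \<in> pts"
      then obtain n where n: "z = of_int n" "n \<in> {-int N..int N}" by (auto simp: pts_def)
      with z have "real_of_int n = R \<or> real_of_int n = -R" by (auto simp: pi)
      moreover have "\<bar>real_of_int n\<bar> \<le> real N" using n by auto
      ultimately show False by (auto simp: R_def)
    qed
    ultimately show "z \<in> S - pts" by simp
  qed
  have res: "winding_number ?g p * residue (\<lambda>w. F w / E w) p = F p / (2 * of_real pi * \<i>)" if p: "p \<in> pts" for p
  proof -
    obtain n where n: "p = of_int n" "n \<in> {-int N..int N}" using p by (auto simp: pts_def)
    have "\<bar>real_of_int n\<bar> \<le> real N" using n by auto
    then have "p \<in> box (Complex (-R) (-1)) (Complex R 1)"
      using n by (auto simp: in_box_complex_iff R_def)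
    then have w: "winding_number ?g p = 1" by (rule winding_number_rectpath)
    have e1: "exp (2 * of_real pi * \<i> * p) = 1" using E0[of p] n by (simp add: E_def)
    have "(E has_field_derivative (2 * of_real pi * \<i>)) (at p)"
      unfolding E_def by (rule derivative_eq_intros refl | simp add: e1)+
    then have "residue (\<lambda>w. F w / E w) p = F p / (2 * of_real pi * \<i>)"
      by (rule residue_simple_pole_deriv[of F UNIV E p, rotated 5])
         (use e1 in \<open>auto simp: F_def E_def intro!: holomorphic_intros\<close>)
    with w show ?thesis by simp
  qed
  have "contour_integral ?g (\<lambda>w. F w / E w) = 2 * pi * \<i> * (\<Sum>p\<in>pts. winding_number ?g p * residue (\<lambda>w. F w / E w) p)"
  proof (rule Residue_theorem)
    show "open S" "connected S" by (auto simp: S_def convex_connected)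
    show "finite pts" by (simp add: pts_def)
    show "(\<lambda>w. F w / E w) holomorphic_on S - pts"
      using S_pts by (auto simp: F_def E_def intro!: holomorphic_intros)
    show "path_image ?g \<subseteq> S - pts" by (rule pS)
    show "\<forall>z. z \<notin> S \<longrightarrow> winding_number ?g z = 0"
      using R by (auto intro!: winding_number_rectpath_outside simp: S_def in_cbox_complex_iff in_box_complex_iff R_def)
  qed auto
  also have "\<dots> = (\<Sum>p\<in>pts. F p)"
    by (simp add: res sum_divide_distrib[symmetric])
  also have "\<dots> = (\<Sum>n\<in>{-int N..int N}. F (of_int n))"
    unfolding pts_def by (subst sum.reindex) (auto simp: inj_on_def)
  also have "\<dots> = of_real (2 * (\<Sum>n\<le>N. exp (- pi * a * real n ^ 2)) - 1)"
  proof (induction N)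
    case 0
    then show ?case by (simp add: F_def)
  next
    case (Suc N)
    have "{-int (Suc N)..int (Suc N)} = insert (- int (Suc N)) (insert (int (Suc N)) {-int N..int N})" by auto
    moreover have "F (of_int (- int (Suc N))) = of_real (exp (- pi * a * real (Suc N) ^ 2))"
        "F (of_int (int (Suc N))) = of_real (exp (- pi * a * real (Suc N) ^ 2))"
      by (simp_all add: F_def exp_of_real[symmetric] power2_eq_square algebra_simps)
    ultimately show ?case using Suc by simp
  qed
  finally have "of_real (2 * (\<Sum>n\<le>N. exp (- pi * a * real n ^ 2)) - 1) = contour_integral ?g (\<lambda>w. F w / E w)" ..
  also have "\<dots> = integral {-R..R} (\<lambda>x. F (Complex x (-1)) / E (Complex x (-1))) + \<i> * integral {-1..1} (\<lambda>y. F (Complex R y) / E (Complex R y))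
    - integral {-R..R} (\<lambda>x. F (Complex x 1) / E (Complex x 1)) - \<i> * integral {-1..1} (\<lambda>y. F (Complex (-R) y) / E (Complex (-R) y))"
  proof (rule contour_integral_rectpath)
    show "continuous_on (path_image ?g) (\<lambda>w. F w / E w)"
      using pS S_pts by (auto simp: F_def E_def intro!: continuous_intros)
  qed (use R in auto)
  finally show ?thesis .
qed

text \<open>As N grows the vertical sides vanish. On the lower line exp (2 \<pi> i z) is large and
  on the upper line it is small, so 1 / E is expanded in opposite directions. Both lines give the
  same series \<open>q\<close> in 1 / a, and the lower one loses the plain Gaussian integral 1 /
  sqrt a.\<close>

theorem jacobi_theta_transformation:
  fixes a :: real
  assumes a: "a > 0"
  shows "2 * (\<Sum>n. exp (- pi * a * real n ^ 2)) - 1 = (2 * (\<Sum>n. exp (- pi * (1 / a) * real n ^ 2)) - 1) / sqrt a"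
proof -
  define F where "F \<equiv> \<lambda>z::complex. exp (- of_real (pi * a) * z\<^sup>2)"
  define E where "E \<equiv> \<lambda>z. exp (2 * of_real pi * \<i> * z) - 1"
  define X where "X = (\<lambda>N. real N + 1 / 2)"
  define J where "J = (2 * (\<Sum>n. exp (- pi * (1 / a) * real n ^ 2)) - 1) / sqrt a"
  define q where "q = (\<Sum>n. exp (- pi * (1 / a) * real n ^ 2)) / sqrt a"
  have X: "filterlim X at_top sequentially" unfolding X_def by real_asymp
  have qs: "(\<lambda>m. of_real (exp (- pi * (1 / a) * real m ^ 2) / sqrt a)) sums complex_of_real q"
    unfolding q_def using a by (intro sums_of_real sums_divide summable_sums summable_exp_square) auto
  have up: "integrable lborel (\<lambda>x. F (Complex x 1) / (1 - exp (2 * of_real pi * \<i> * of_real 1 * Complex x 1)))"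
    "(LINT x|lborel. F (Complex x 1) / (1 - exp (2 * of_real pi * \<i> * of_real 1 * Complex x 1))) = of_real q"
    using gaussian_geometric_line(3,4)[OF a, of 1] qs unfolding F_def by (auto simp: sums_unique2)
  have upE: "F (Complex x 1) / E (Complex x 1) = - (F (Complex x 1) / (1 - exp (2 * of_real pi * \<i> * of_real 1 * Complex x 1)))" for x
    unfolding E_def by (simp add: minus_divide_right)
  have dn: "integrable lborel (\<lambda>x. F (Complex x (-1)) / (1 - exp (2 * of_real pi * \<i> * of_real (-1) * Complex x (-1))))"
    "(LINT x|lborel. F (Complex x (-1)) / (1 - exp (2 * of_real pi * \<i> * of_real (-1) * Complex x (-1)))) = of_real q"
    "integrable lborel (\<lambda>x. F (Complex x (-1)))" "(LINT x|lborel. F (Complex x (-1))) = of_real (1 / sqrt a)"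
    using gaussian_geometric_line[OF a, of "-1"] qs unfolding F_def by (auto simp: sums_unique2)
  have dnE: "F (Complex x (-1)) / E (Complex x (-1)) =
      F (Complex x (-1)) / (1 - exp (2 * of_real pi * \<i> * of_real (-1) * Complex x (-1))) - F (Complex x (-1))" for x
  proof -
    define w where "w = exp (2 * of_real pi * \<i> * Complex x (-1))"
    have "norm w = exp (2 * pi)" by (simp add: w_def)
    then have w: "w \<noteq> 0" "w \<noteq> 1" by auto
    have "exp (2 * of_real pi * \<i> * of_real (-1) * Complex x (-1)) = inverse w"
      by (simp add: w_def exp_minus[symmetric])
    moreover have "E (Complex x (-1)) = w - 1" by (simp add: E_def w_def)
    moreover have "z / (w - 1) = z / (1 - inverse w) - z" for z using w by (simp add: field_simps)
    ultimately show ?thesis by simp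
  qed
  \<comment> \<open>At a half-integer abscissa exp (2 \<pi> i z) is real and negative, hence |E| >=
    1 and only the Gaussian decay of \<open>F\<close> matters.\<close>
  have vert: "(\<lambda>N. integral {-1..1} (\<lambda>y. F (Complex (\<sigma> * X N) y) / E (Complex (\<sigma> * X N) y))) \<longlonglongrightarrow> 0" if \<sigma>: "\<sigma> = 1 \<or> \<sigma> = -1" for \<sigma>
  proof (rule Lim_null_comparison)
    show "\<forall>\<^sub>F N in sequentially. norm (integral {-1..1} (\<lambda>y. F (Complex (\<sigma> * X N) y) / E (Complex (\<sigma> * X N) y))) \<le> exp (- pi * a * (X N ^ 2 - 1)) * (1 - (-1))"
    proof (intro always_eventually allI integral_bound)
      fix N
      have e: "exp (2 * of_real pi * \<i> * Complex (\<sigma> * X N) y) = - of_real (exp (- 2 * pi * y))" for y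
      proof -
        have "exp (2 * of_real pi * \<i> * Complex (\<sigma> * X N) y) = of_real (exp (- 2 * pi * y)) * cis (2 * pi * \<sigma> * X N)"
          by (simp add: exp_eq_polar mult.assoc)
        moreover have "cis (2 * pi * \<sigma> * X N) = -1"
        proof -
          have "cis (2 * pi * (\<sigma> * real N)) = 1" using \<sigma> by (auto simp: cis_multiple_2pi intro!: cis_multiple_2pi)
          moreover have "cis (pi * \<sigma>) = -1" using \<sigma> by (auto simp: complex_eq_iff)
          moreover have "2 * pi * \<sigma> * X N = 2 * pi * (\<sigma> * real N) + pi * \<sigma>" by (simp add: X_def algebra_simps)
          ultimately show ?thesis by (simp flip: cis_mult)
        qed
        ultimately show ?thesis by simp
      qed
      have E1: "norm (E (Complex (\<sigma> * X N) y)) \<ge> 1" for y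
      proof -
        have "E (Complex (\<sigma> * X N) y) = - of_real (exp (- 2 * pi * y) + 1)" unfolding E_def e by simp
        then show ?thesis by (simp only: norm_minus_cancel norm_of_real) simp
      qed
      show "continuous_on {-1..1} (\<lambda>y. F (Complex (\<sigma> * X N) y) / E (Complex (\<sigma> * X N) y))"
      proof (rule continuous_on_divide)
        show "\<forall>y\<in>{-1..1}. E (Complex (\<sigma> * X N) y) \<noteq> 0" using E1 by (metis norm_zero not_one_le_zero)
      qed (auto simp: F_def E_def Complex_eq intro!: continuous_intros)
      fix y :: real assume y: "y \<in> {-1..1}"
      have "norm (F (Complex (\<sigma> * X N) y)) = exp (- pi * a * ((\<sigma> * X N)\<^sup>2 - y\<^sup>2))"
        by (simp add: F_def power2_eq_square)
      also have "(\<sigma> * X N)\<^sup>2 = X N ^ 2" using \<sigma> by auto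
      also have "exp (- pi * a * (X N ^ 2 - y\<^sup>2)) \<le> exp (- pi * a * (X N ^ 2 - 1))"
        using y a by (simp add: abs_square_le_1 abs_le_iff)
      finally have "norm (F (Complex (\<sigma> * X N) y)) / norm (E (Complex (\<sigma> * X N) y)) \<le> exp (- pi * a * (X N ^ 2 - 1)) / 1"
        using E1 by (intro frac_le) auto
      then show "norm (F (Complex (\<sigma> * X N) y) / E (Complex (\<sigma> * X N) y)) \<le> exp (- pi * a * (X N ^ 2 - 1))"
        by (simp add: norm_divide)
    qed auto
    show "(\<lambda>N. exp (- pi * a * (X N ^ 2 - 1)) * (1 - (-1))) \<longlonglongrightarrow> 0"
      unfolding X_def using a by real_asymp
  qed
  have "(\<lambda>N. integral {-X N..X N} (\<lambda>x. F (Complex x (-1)) / E (Complex x (-1))) + \<i> * integral {-1..1} (\<lambda>y. F (Complex (1 * X N) y) / E (Complex (1 * X N) y))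
    - integral {-X N..X N} (\<lambda>x. F (Complex x 1) / E (Complex x 1)) - \<i> * integral {-1..1} (\<lambda>y. F (Complex ((-1) * X N) y) / E (Complex ((-1) * X N) y)))
    \<longlonglongrightarrow> (LINT x|lborel. F (Complex x (-1)) / E (Complex x (-1))) + \<i> * 0 - (LINT x|lborel. F (Complex x 1) / E (Complex x 1)) - \<i> * 0"
    by (intro tendsto_intros tendsto_integral_symmetric X vert)
       (unfold dnE upE, use up dn in \<open>auto simp del: of_real_minus of_real_1\<close>)
  also have "(LINT x|lborel. F (Complex x (-1)) / E (Complex x (-1))) + \<i> * 0 - (LINT x|lborel. F (Complex x 1) / E (Complex x 1)) - \<i> * 0 = of_real J"
  proof -
    have "J = q - 1 / sqrt a + q" by (simp add: J_def q_def diff_divide_distrib)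
    then have "complex_of_real J = of_real q - of_real (1 / sqrt a) + of_real q" by simp
    then show ?thesis
      unfolding dnE upE by (simp only: Bochner_Integration.integral_diff[OF dn(1) dn(3)] integral_minus up(2) dn(2) dn(4)) simp
  qed
  finally have "(\<lambda>N. complex_of_real (2 * (\<Sum>n\<le>N. exp (- pi * a * real n ^ 2)) - 1)) \<longlonglongrightarrow> of_real J"
    using jacobi_theta_contour[OF a] unfolding F_def E_def X_def by simp
  then have "(\<lambda>N. 2 * (\<Sum>n\<le>N. exp (- pi * a * real n ^ 2)) - 1) \<longlonglongrightarrow> J"
    by (simp only: tendsto_of_real_iff)
  moreover have "(\<lambda>N. 2 * (\<Sum>n\<le>N. exp (- pi * a * real n ^ 2)) - 1) \<longlonglongrightarrow> 2 * (\<Sum>n. exp (- pi * a * real n ^ 2)) - 1"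
    by (intro tendsto_intros summable_LIMSEQ' summable_exp_square a)
  ultimately show ?thesis unfolding J_def using LIMSEQ_unique by blast
qed

section \<open>Analytic continuation and functional equation\<close>

text \<open>Riemann's psi function, (theta - 1) / 2, in the logarithmic variable v = ln x. The
  inversion x -> 1 / x becomes the reflection v -> - v, and Mellin integrals become two-sided
  Laplace integrals.\<close>

definition theta_tail :: "real \<Rightarrow> real" where
  "theta_tail v = (\<Sum>n. exp (- pi * exp v * real (Suc n) ^ 2))"

lemma summable_theta_tail: "summable (\<lambda>n. exp (- pi * exp v * real (Suc n) ^ 2))"
  using summable_exp_square[of "exp v"] by (subst summable_Suc_iff) auto

lemma theta_tail_nonneg: "theta_tail v \<ge> 0"
  unfolding theta_tail_def by (intro suminf_nonneg summable_theta_tail) auto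

lemma theta_tail_measurable [measurable]: "theta_tail \<in> borel_measurable borel"
  unfolding theta_tail_def by measurable

lemma theta_tail_reflect:
  "theta_tail (- v) = exp (v / 2) * theta_tail v + (exp (v / 2) - 1) / 2"
proof -
  have *: "(\<Sum>n. exp (- pi * exp u * real n ^ 2)) = 1 + theta_tail u" for u
    using suminf_split_head[OF summable_exp_square[of "exp u"]] by (simp add: theta_tail_def)
  have "sqrt (exp v) = exp (v / 2)"
    by (rule real_sqrt_unique) (auto simp: exp_add[symmetric] power2_eq_square)
  moreover have "1 / exp v = exp (- v)" by (simp add: exp_minus field_simps)
  ultimately have "2 * (1 + theta_tail v) - 1 = (2 * (1 + theta_tail (-v)) - 1) / exp (v / 2)"
    using jacobi_theta_transformation[of "exp v"] by (simp only: *) simp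
  then show ?thesis by (simp add: field_simps)
qed

text \<open>The true decay is doubly exponential; a Gaussian is enough to dominate every exp (B v).
  The bound compares the tail with a geometric series of ratio q = exp (- \<pi> exp v) <= 1/2, using
  n^2 >= n and exp v >= 1 + v + v^2 / 2.\<close>

lemma theta_tail_bound:
  assumes "v \<ge> 0"
  shows "theta_tail v \<le> 2 * exp (- (v\<^sup>2))"
proof -
  define q where "q = exp (- pi * exp v)"
  have ev: "exp v \<ge> 1 + v + v\<^sup>2 / 2" using exp_lower_Taylor_quadratic[OF assms] by simp
  have pi: "pi > 2" by (rule pi_gt_zero[THEN order.strict_trans2, THEN asm_rl] | simp add: pi_gt3 order.strict_trans[of 2 3])+
  have "pi * exp v \<ge> 2 * (1 + v\<^sup>2 / 2)" using pi ev assms by (intro mult_mono) auto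
  then have q1: "q \<le> exp (- (2 + v\<^sup>2))" by (simp add: q_def)
  have "exp (-2) \<le> (1/2 :: real)"
    using exp_ge_add_one_self[of "2::real"] by (simp add: exp_minus field_simps)
  moreover have "exp (- (2 + v\<^sup>2)) \<le> exp (-2)" by simp
  ultimately have q2: "q \<le> 1/2" using q1 by linarith
  have q0: "q > 0" by (simp add: q_def)
  have "theta_tail v \<le> (\<Sum>n. q * q ^ n)" unfolding theta_tail_def
  proof (rule suminf_le)
    fix n
    have "real (Suc n) \<le> real (Suc n) ^ 2" by (simp add: power2_eq_square)
    then have "pi * exp v * real (Suc n) \<le> pi * exp v * real (Suc n) ^ 2" by (intro mult_left_mono) auto
    then have "exp (- pi * exp v * real (Suc n) ^ 2) \<le> exp (real (Suc n) * (- pi * exp v))" by (simp add: mult_ac)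
    also have "\<dots> = q ^ Suc n" unfolding q_def by (rule exp_of_nat_mult)
    finally show "exp (- pi * exp v * real (Suc n) ^ 2) \<le> q * q ^ n" by simp
  qed (use q0 q2 summable_theta_tail in \<open>auto intro!: summable_mult summable_geometric\<close>)
  also have "\<dots> = q * (1 / (1 - q))" using q0 q2 by (subst suminf_mult) (auto simp: suminf_geometric)
  also have "\<dots> \<le> q * 2" using q0 q2 by (intro mult_left_mono) (auto simp: field_simps)
  also have "\<dots> \<le> exp (- (2 + v\<^sup>2)) * 2" using q1 by simp
  also have "\<dots> \<le> 2 * exp (- (v\<^sup>2))" by simp
  finally show ?thesis .
qed

lemma continuous_on_theta_tail: "continuous_on {0..} theta_tail"
proof -
  have "uniform_limit {0..} (\<lambda>n v. \<Sum>i<n. exp (- pi * exp v * real (Suc i) ^ 2)) (\<lambda>v. \<Sum>i. exp (- pi * exp v * real (Suc i) ^ 2)) sequentially"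
  proof (rule Weierstrass_m_test)
    show "summable (\<lambda>n. exp (- pi * exp 0 * real (Suc n) ^ 2))" by (rule summable_theta_tail)
    fix n v assume "v \<in> {0::real..}"
    then have "exp v \<ge> exp 0" by (subst exp_le_cancel_iff) auto
    then have "pi * exp 0 * real (Suc n) ^ 2 \<le> pi * exp v * real (Suc n) ^ 2" by (intro mult_left_mono mult_right_mono) auto
    then show "norm (exp (- pi * exp v * real (Suc n) ^ 2)) \<le> exp (- pi * exp 0 * real (Suc n) ^ 2)"
      by simp
  qed
  then show ?thesis unfolding theta_tail_def
    by (rule uniform_limit_theorem[rotated]) (auto intro!: always_eventually continuous_intros)
qed

section \<open>Mellin transform of the theta series\<close>

lemma nn_integral_exp_Gamma:
  fixes z c :: real
  assumes z: "z > 0" and c: "c > 0"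
  shows "(\<integral>\<^sup>+v. ennreal (exp (z * v) * exp (- c * exp v)) \<partial>lborel) = ennreal (c powr (- z) * Gamma z)"
proof -
  define f where "f = (\<lambda>t::real. t powr (z - 1) / exp t)"
  have "(f has_integral Gamma z) {0..}" unfolding f_def by (rule Gamma_integral_real[OF z])
  then have "((\<lambda>t. if t \<in> {0<..} then f t else 0) has_integral Gamma z) {0..}"
    by (rule has_integral_spike [of "{0}", rotated 2]) auto
  then have hi: "(f has_integral Gamma z) {0<..}"
    by (subst (asm) has_integral_restrict) auto
  moreover from hi have "f absolutely_integrable_on {0<..}"
    by (intro nonnegative_absolutely_integrable_1) (auto simp: f_def has_integral_integrable)
  moreover have "range exp = {0::real<..}" by (auto simp: image_iff) (metis exp_ln)
  ultimately have "f absolutely_integrable_on (exp ` UNIV) \<and> integral (exp ` UNIV) f = Gamma z" by auto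
  then have "(\<lambda>v. \<bar>exp v\<bar> * f (exp v)) absolutely_integrable_on UNIV \<and> integral UNIV (\<lambda>v. \<bar>exp v\<bar> * f (exp v)) = Gamma z"
    using has_absolute_integral_change_of_variables_1'[of UNIV exp exp f "Gamma z"]
    by (simp add: inj_on_def)
  moreover have eq: "\<bar>exp v\<bar> * f (exp v) = exp (z * v) * exp (- exp v)" for v
    by (simp add: f_def powr_def algebra_simps exp_diff exp_minus field_simps)
  ultimately have "((\<lambda>v. exp (z * v) * exp (- exp v)) has_integral Gamma z) UNIV"
    using set_lebesgue_integral_eq_integral(1)[of UNIV "\<lambda>v. exp (z * v) * exp (- exp v)"]
    by (simp only: eq has_integral_iff)
  then have *: "(\<integral>\<^sup>+v. ennreal (exp (z * v) * exp (- exp v)) \<partial>lborel) = ennreal (Gamma z)"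
    by (subst nn_integral_has_integral_lebesgue[where \<Omega> = UNIV, symmetric]) auto
  have "(\<integral>\<^sup>+v. ennreal (exp (z * v) * exp (- exp v)) \<partial>lborel) =
      (\<integral>\<^sup>+v. ennreal (exp (z * (ln c + v)) * exp (- exp (ln c + v))) \<partial>lborel)"
    using nn_integral_real_affine[of "\<lambda>v. ennreal (exp (z * v) * exp (- exp v))" 1 "ln c"] by simp
  also have "\<dots> = (\<integral>\<^sup>+v. ennreal (c powr z) * ennreal (exp (z * v) * exp (- c * exp v)) \<partial>lborel)"
    using c by (intro nn_integral_cong) (simp add: ennreal_mult' exp_add powr_def algebra_simps flip: ennreal_mult')
  also have "\<dots> = ennreal (c powr z) * (\<integral>\<^sup>+v. ennreal (exp (z * v) * exp (- c * exp v)) \<partial>lborel)"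
    by (rule nn_integral_cmult) measurable
  finally have "ennreal (c powr (-z)) * ennreal (Gamma z) = ennreal (c powr (-z)) * (ennreal (c powr z) * (\<integral>\<^sup>+v. ennreal (exp (z * v) * exp (- c * exp v)) \<partial>lborel))"
    using * by simp
  also have "\<dots> = (\<integral>\<^sup>+v. ennreal (exp (z * v) * exp (- c * exp v)) \<partial>lborel)"
    using c by (simp add: mult.assoc[symmetric] ennreal_mult'[symmetric] powr_add[symmetric])
  finally show ?thesis by (simp add: ennreal_mult')
qed

text \<open>With nonnegative extended integrals the exchange of sum and integral is free, and
  finiteness of the right-hand side afterwards yields integrability for real s > 1.\<close>

lemma nn_integral_theta_tail:
  fixes s :: real
  assumes s: "s > 1"
  shows "(\<integral>\<^sup>+v. ennreal (exp (s / 2 * v) * theta_tail v) \<partial>lborel) = ennreal (pi powr (- s / 2) * Gamma (s / 2) * (\<Sum>n. real (Suc n) powr (- s)))"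
proof -
  have sm: "summable (\<lambda>n. real (Suc n) powr (- s))"
    using s summable_real_powr_iff[of "-s"] summable_Suc_iff[of "\<lambda>n. real n powr (-s)"] by simp
  have "(\<integral>\<^sup>+v. ennreal (exp (s / 2 * v) * theta_tail v) \<partial>lborel) =
    (\<integral>\<^sup>+v. (\<Sum>n. ennreal (exp (s / 2 * v) * exp (- (pi * real (Suc n) ^ 2) * exp v))) \<partial>lborel)"
  proof (rule nn_integral_cong)
    fix v
    have "(\<lambda>n. exp (s / 2 * v) * exp (- (pi * real (Suc n) ^ 2) * exp v)) sums (exp (s / 2 * v) * theta_tail v)"
      using summable_sums[OF summable_theta_tail[of v]] unfolding theta_tail_def by (intro sums_mult) (simp add: mult_ac)
    then show "ennreal (exp (s / 2 * v) * theta_tail v) = (\<Sum>n. ennreal (exp (s / 2 * v) * exp (- (pi * real (Suc n) ^ 2) * exp v)))"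
      by (subst suminf_ennreal2) (auto simp: sums_iff)
  qed
  also have "\<dots> = (\<Sum>n. (\<integral>\<^sup>+v. ennreal (exp (s / 2 * v) * exp (- (pi * real (Suc n) ^ 2) * exp v)) \<partial>lborel))"
    by (rule nn_integral_suminf) measurable
  also have "\<dots> = (\<Sum>n. ennreal ((pi powr (- s / 2) * Gamma (s / 2)) * real (Suc n) powr (- s)))"
  proof (rule suminf_cong)
    fix n
    have "real (Suc n) ^ 2 = real (Suc n) powr 2" by (simp add: powr_numeral)
    then have "(pi * real (Suc n) ^ 2) powr (- (s / 2)) = pi powr (- (s / 2)) * (real (Suc n) powr 2) powr (- (s / 2))"
      by (simp only: powr_mult)
    also have "\<dots> = pi powr (- s / 2) * real (Suc n) powr (- s)"
      by (simp only: powr_powr) simp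
    finally have "(pi * real (Suc n) ^ 2) powr (- (s / 2)) = pi powr (- s / 2) * real (Suc n) powr (- s)" .
    then show "(\<integral>\<^sup>+v. ennreal (exp (s / 2 * v) * exp (- (pi * real (Suc n) ^ 2) * exp v)) \<partial>lborel) = ennreal ((pi powr (- s / 2) * Gamma (s / 2)) * real (Suc n) powr (- s))"
      using s by (subst nn_integral_exp_Gamma) (auto simp: mult_ac)
  qed
  also have "\<dots> = ennreal (\<Sum>n. (pi powr (- s / 2) * Gamma (s / 2)) * real (Suc n) powr (- s))"
    using s by (intro suminf_ennreal2 summable_mult sm) (auto intro!: mult_nonneg_nonneg less_imp_le[OF Gamma_real_pos])
  also have "(\<Sum>n. (pi powr (- s / 2) * Gamma (s / 2)) * real (Suc n) powr (- s)) = pi powr (- s / 2) * Gamma (s / 2) * (\<Sum>n. real (Suc n) powr (- s))"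
    by (rule suminf_mult[OF sm])
  finally show ?thesis .
qed

text \<open>Riemann's integral over x >= 1, where the theta tail decays, with the range x <= 1
  folded onto it. It converges for every s, and the symmetry s -> 1 - s is visible in the
  integrand.\<close>

definition theta_mellin :: "complex \<Rightarrow> complex" where
  "theta_mellin s = (LINT v:{0..}|lborel. of_real (theta_tail v) * (exp (s / 2 * of_real v) + exp ((1 - s) / 2 * of_real v)))"

lemma theta_mellin_reflect: "theta_mellin (1 - s) = theta_mellin s"
  by (simp add: theta_mellin_def add.commute)

text \<open>Completing the square gives a multiple of a normal density with mean B / 2. The factor 4
  is that of the majorant in \<open>theta_mellin_integrand_bound\<close>.\<close>

lemma set_integrable_gaussian_times_exp:
  fixes B :: real
  shows "set_integrable lborel {0..} (\<lambda>v. 4 * (exp (- (v\<^sup>2)) * exp (B * v)))"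
proof -
  have "integrable lborel (\<lambda>x::real. indicator {0..} x *\<^sub>R exp (- x\<^sup>2))"
    using gaussian_moment_0 by (simp add: has_bochner_integral_iff)
  have "integrable lborel (\<lambda>x. normal_density (B / 2) (1 / sqrt 2) x)"
    by (rule integrable_normal_density) auto
  then have "integrable lborel (\<lambda>x. (4 * sqrt pi * exp (B\<^sup>2 / 4)) * normal_density (B / 2) (1 / sqrt 2) x)"
    by simp
  also have "(\<lambda>x. (4 * sqrt pi * exp (B\<^sup>2 / 4)) * normal_density (B / 2) (1 / sqrt 2) x) = (\<lambda>v. 4 * (exp (- (v\<^sup>2)) * exp (B * v)))"
  proof
    fix x
    have "normal_density (B / 2) (1 / sqrt 2) x = 1 / sqrt pi * exp (- ((x - B / 2)\<^sup>2))"
      by (simp add: normal_density_def power_divide)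
    moreover have "exp (B\<^sup>2 / 4) * exp (- ((x - B / 2)\<^sup>2)) = exp (- (x\<^sup>2)) * exp (B * x)"
      unfolding exp_add[symmetric] by (simp add: power2_eq_square algebra_simps)
    ultimately show "(4 * sqrt pi * exp (B\<^sup>2 / 4)) * normal_density (B / 2) (1 / sqrt 2) x = 4 * (exp (- (x\<^sup>2)) * exp (B * x))"
      by simp
  qed
  finally show ?thesis
    unfolding set_integrable_def by (intro integrable_mult_indicator) auto
qed

lemma theta_mellin_integrand_bound:
  fixes s :: complex
  assumes "norm s \<le> B" "v \<ge> 0"
  shows "norm (of_real (theta_tail v) * (exp (s / 2 * of_real v) + exp ((1 - s) / 2 * of_real v)))
    \<le> 4 * (exp (- (v\<^sup>2)) * exp ((B + 1) * v))"
proof -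
  have "Re s / 2 * v \<le> (B + 1) * v" "(1 - Re s) / 2 * v \<le> (B + 1) * v"
    using assms abs_Re_le_cmod[of s] by (intro mult_right_mono; simp)+
  then have "norm (exp (s / 2 * of_real v)) \<le> exp ((B + 1) * v)" "norm (exp ((1 - s) / 2 * of_real v)) \<le> exp ((B + 1) * v)"
    by (auto simp: norm_exp_eq_Re)
  then have "norm (exp (s / 2 * of_real v) + exp ((1 - s) / 2 * of_real v)) \<le> 2 * exp ((B + 1) * v)"
    using norm_triangle_ineq by (smt (verit))
  then have "norm (of_real (theta_tail v) * (exp (s / 2 * of_real v) + exp ((1 - s) / 2 * of_real v))) \<le> (2 * exp (- (v\<^sup>2))) * (2 * exp ((B + 1) * v))"
    unfolding norm_mult using theta_tail_bound[of v] theta_tail_nonneg[of v] assms by (intro mult_mono) auto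
  then show ?thesis by simp
qed

text \<open>The integrals over [0, n] are holomorphic by differentiation under the integral sign,
  and the Gaussian majorant makes them converge uniformly on discs.\<close>

lemma holomorphic_theta_mellin: "theta_mellin holomorphic_on UNIV"
proof -
  define f where "f = (\<lambda>s v. of_real (theta_tail v) * (exp (s / 2 * of_real v) + exp ((1 - s) / 2 * of_real v)) :: complex)"
  have cont: "continuous_on {0..real n} (\<lambda>v. complex_of_real (theta_tail v))" for n
    by (intro continuous_on_of_real continuous_on_subset[OF continuous_on_theta_tail]) auto
  have contf: "continuous_on {0..real n} (f s)" for n s
    unfolding f_def by (intro continuous_intros cont) 
  have meas: "set_borel_measurable lborel {0..} (f s)" for s
    unfolding f_def set_borel_measurable_def by measurable
  have int: "set_integrable lborel {0..} (f s)" for s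
    unfolding set_integrable_def
  proof (rule Bochner_Integration.integrable_bound)
    show "integrable lborel (\<lambda>v. indicat_real {0..} v *\<^sub>R (4 * (exp (- (v\<^sup>2)) * exp ((norm s + 1) * v))))"
      using set_integrable_gaussian_times_exp[of "norm s + 1"] unfolding set_integrable_def .
    show "AE v in lborel. norm (indicat_real {0..} v *\<^sub>R f s v) \<le> norm (indicat_real {0..} v *\<^sub>R (4 * (exp (- (v\<^sup>2)) * exp ((norm s + 1) * v))))"
      using theta_mellin_integrand_bound[of s "norm s"] by (auto simp: f_def indicator_def)
  qed (use meas in \<open>simp add: set_borel_measurable_def\<close>)
  show ?thesis
  proof (rule holomorphic_uniform_sequence[where f = "\<lambda>n s. integral (cbox 0 (real n)) (f s)"])
    fix n
    show "(\<lambda>s. integral (cbox 0 (real n)) (f s)) holomorphic_on UNIV"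
    proof (rule leibniz_rule_holomorphic[where fx = "\<lambda>s v. of_real (theta_tail v) * (exp (s / 2 * of_real v) * (of_real v / 2) - exp ((1 - s) / 2 * of_real v) * (of_real v / 2))"])
      fix s v
      show "((\<lambda>s. f s v) has_field_derivative of_real (theta_tail v) * (exp (s / 2 * of_real v) * (of_real v / 2) - exp ((1 - s) / 2 * of_real v) * (of_real v / 2))) (at s within UNIV)"
        unfolding f_def by (rule derivative_eq_intros refl | simp)+
    next
      show "f s integrable_on cbox 0 (real n)" for s
        using integrable_continuous_real[OF contf] by simp
    next
      have "continuous_on (UNIV \<times> cbox 0 (real n)) (\<lambda>x. complex_of_real (theta_tail (snd x)))"
        by (rule continuous_on_compose2[OF cont[of n]]) (auto intro!: continuous_intros)
      then show "continuous_on (UNIV \<times> cbox 0 (real n)) (\<lambda>(s, v). complex_of_real (theta_tail v) * (exp (s / 2 * of_real v) * (of_real v / 2) - exp ((1 - s) / 2 * of_real v) * (of_real v / 2)))"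
        unfolding case_prod_beta by (intro continuous_intros) auto
    qed auto
  next
    fix s :: complex
    have "uniform_limit (cball s 1) (\<lambda>b x. LINT y:{0..b}|lborel. f x y) (\<lambda>x. LINT y:{0..}|lborel. f x y) at_top"
    proof (rule uniform_limit_set_lebesgue_integral_at_top)
      fix x v assume x: "x \<in> cball s 1" and v: "v \<ge> (0::real)"
      have "norm x \<le> norm s + 1" using x norm_triangle_sub[of x s] by (simp add: dist_norm norm_minus_commute)
      then show "norm (f x v) \<le> 4 * (exp (- (v\<^sup>2)) * exp ((norm s + 1 + 1) * v))"
        unfolding f_def using v by (rule theta_mellin_integrand_bound)
    qed (use set_integrable_gaussian_times_exp meas in auto)
    then have "uniform_limit (cball s 1) (\<lambda>n x. LINT y:{0..real n}|lborel. f x y) (\<lambda>x. LINT y:{0..}|lborel. f x y) sequentially"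
      unfolding uniform_limit_iff using filterlim_real_sequentially unfolding filterlim_iff by blast
    moreover have "(LINT y:{0..real n}|lborel. f x y) = integral (cbox 0 (real n)) (f x)" for x n
      using set_borel_integral_eq_integral(2)[of "{0..real n}" "f x"] set_integrable_subset[OF int[of x], of "{0..real n}"] by simp
    ultimately have "uniform_limit (cball s 1) (\<lambda>n s. integral (cbox 0 (real n)) (f s)) theta_mellin sequentially"
      unfolding theta_mellin_def f_def by simp
    then show "\<exists>d>0. cball s d \<subseteq> UNIV \<and> uniform_limit (cball s d) (\<lambda>n s. integral (cbox 0 (real n)) (f s)) theta_mellin sequentially"
      by (intro exI[of _ 1]) auto
  qed simp
qed

lemma zeta_series_powr:
  fixes s :: complex
  shows "norm (1 / of_nat (Suc n) powr s) = real (Suc n) powr (- Re s)"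
  by (simp add: norm_divide norm_powr_real_powr powr_minus_divide del: of_nat_Suc)

lemma summable_powr_Suc: "x > 1 \<Longrightarrow> summable (\<lambda>n. real (Suc n) powr (- x))"
  using summable_real_powr_iff[of "-x"] summable_Suc_iff[of "\<lambda>n. real n powr (-x)"] by simp

lemma holomorphic_zeta_series:
  "(\<lambda>s. \<Sum>n. 1 / of_nat (Suc n) powr s :: complex) holomorphic_on {s. Re s > 1}"
proof (rule holomorphic_uniform_sequence[where f = "\<lambda>n s. \<Sum>i<n. 1 / of_nat (Suc i) powr s"])
  show "open {s. Re s > 1}" by (rule open_halfspace_Re_gt)
  show "(\<lambda>s. \<Sum>i<n. 1 / of_nat (Suc i) powr s :: complex) holomorphic_on {s. Re s > 1}" for n
    by (intro holomorphic_intros) (auto simp del: of_nat_Suc)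
  fix s :: complex assume "s \<in> {s. Re s > 1}"
  then have s: "Re s > 1" by simp
  define d where "d = (Re s - 1) / 2"
  have d: "d > 0" using s by (simp add: d_def)
  have re: "Re x \<ge> 1 + d" if "x \<in> cball s d" for x
    using that abs_Re_le_cmod[of "s - x"] by (auto simp: dist_norm d_def field_simps)
  have "uniform_limit (cball s d) (\<lambda>n s. \<Sum>i<n. 1 / of_nat (Suc i) powr s :: complex) (\<lambda>s. \<Sum>i. 1 / of_nat (Suc i) powr s) sequentially"
  proof (rule Weierstrass_m_test)
    show "summable (\<lambda>n. real (Suc n) powr (- (1 + d)))" by (rule summable_powr_Suc) (use d in auto)
    show "norm (1 / of_nat (Suc n) powr x :: complex) \<le> real (Suc n) powr (- (1 + d))" if "x \<in> cball s d" for n x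
      unfolding zeta_series_powr using re[OF that] by (intro powr_mono) auto
  qed
  then show "\<exists>d>0. cball s d \<subseteq> {s. Re s > 1} \<and> uniform_limit (cball s d) (\<lambda>n s. \<Sum>i<n. 1 / of_nat (Suc i) powr s) (\<lambda>s. \<Sum>n. 1 / of_nat (Suc n) powr s) sequentially"
    using d re by (intro exI[of _ d]) force
qed

text \<open>The half line v < 0 is reflected by \<open>theta_tail_reflect\<close>. Its theta part
  supplies the second exponential of \<open>theta_mellin\<close>, and its elementary part,
  integrable because s > 1, integrates to 1 / (s - 1) - 1 / s.\<close>

lemma theta_mellin_real:
  fixes s :: real
  assumes s: "s > 1"
  shows "theta_mellin (of_real s) + 1 / (of_real s - 1) - 1 / of_real s
    = of_real (pi powr (- s / 2) * Gamma (s / 2) * (\<Sum>n. real (Suc n) powr (- s)))"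
proof -
  define A where "A = pi powr (- s / 2) * Gamma (s / 2) * (\<Sum>n. real (Suc n) powr (- s))"
  define W where "W = (\<lambda>v. exp (s / 2 * v) * theta_tail v)"
  define h where "h = (\<lambda>v. theta_tail v * (exp (s / 2 * v) + exp ((1 - s) / 2 * v)))"
  have A0: "A \<ge> 0" unfolding A_def using s
    by (intro mult_nonneg_nonneg suminf_nonneg summable_powr_Suc) (auto intro: less_imp_le Gamma_real_pos)
  have Wm: "W \<in> borel_measurable lborel" unfolding W_def by measurable
  have W: "has_bochner_integral lborel W A"
    using nn_integral_theta_tail[OF s] A0 unfolding A_def[symmetric] W_def[symmetric]
    by (intro has_bochner_integral_nn_integral Wm) (auto simp: W_def theta_tail_nonneg)
  have Wi: "integrable lborel W" and WA: "(LINT v|lborel. W v) = A"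
    using W by (auto simp: has_bochner_integral_iff)
  have W1: "integrable lborel (\<lambda>v. indicator {0..} v * W v)" 
    using integrable_mult_indicator[OF _ Wi, of "{0..}"] by simp
  have W2: "integrable lborel (\<lambda>v. indicator {..<0} v * W v)"
    using integrable_mult_indicator[OF _ Wi, of "{..<0}"] by simp
  have "W v = indicator {0..} v * W v + indicator {..<0} v * W v" for v by (auto simp: indicator_def)
  then have "A = (LINT v|lborel. indicator {0..} v * W v + indicator {..<0} v * W v)" using WA by simp
  also have "\<dots> = (LINT v|lborel. indicator {0..} v * W v) + (LINT v|lborel. indicator {..<0} v * W v)"
    by (rule Bochner_Integration.integral_add[OF W1 W2])
  also have "(LINT v|lborel. indicator {..<0} v * W v) = (LINT v|lborel. indicator {..<0} (-v) * W (-v))"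
    using lborel_integral_real_affine[of "-1" "\<lambda>v. indicator {..<0} v * W v" 0] by simp
  also have "\<dots> = (LINT v|lborel. indicator {0..} v * W (-v))"
    by (rule integral_cong_AE) (use AE_lborel_singleton[of 0] Wm in \<open>auto simp: indicator_def\<close>)
  finally have A1: "A = (LINT v|lborel. indicator {0..} v * W v) + (LINT v|lborel. indicator {0..} v * W (-v))" .
  have W2': "integrable lborel (\<lambda>v. indicator {0..} v * W (-v))"
  proof -
    have "integrable lborel (\<lambda>v. W (0 + (-1) * v))" by (rule lborel_integrable_real_affine[OF Wi]) simp
    then show ?thesis using integrable_mult_indicator[of "{0..}" lborel "\<lambda>v. W (-v)"] by simp
  qed
  have Wr: "W (-v) = exp ((1 - s) / 2 * v) * theta_tail v + (exp (- ((s - 1) / 2) * v) - exp (- (s / 2) * v)) / 2" for v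
  proof -
    have "W (-v) = exp (- (s / 2 * v)) * (exp (v / 2) * theta_tail v + (exp (v / 2) - 1) / 2)"
      by (simp add: W_def theta_tail_reflect)
    also have "\<dots> = exp (- (s / 2 * v)) * exp (v / 2) * theta_tail v + (exp (- (s / 2 * v)) * exp (v / 2) - exp (- (s / 2 * v))) / 2"
      by (simp add: field_simps)
    also have "exp (- (s / 2 * v)) * exp (v / 2) = exp ((1 - s) / 2 * v)"
      unfolding exp_add[symmetric] by (simp add: field_simps)
    also have "(1 - s) / 2 * v = - ((s - 1) / 2) * v" by (simp add: field_simps)
    finally show ?thesis by (simp add: field_simps)
  qed
  have ex: "has_bochner_integral lborel (\<lambda>v. indicator {0..} v * exp (- c * v)) (1 / c)" if c: "c > 0" for c :: real
  proof -
    have "((\<lambda>v. exp (- c * v)) has_integral exp (- c * 0) / c) {0..}"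
      using has_integral_exp_minus_to_infinity[OF c, of 0] by simp
    then have "(\<integral>\<^sup>+v. ennreal (indicator {0..} v * exp (- c * v)) \<partial>lborel) = ennreal (1 / c)"
      by (intro trans[OF nn_integral_has_integral_lebesgue]) auto
    then show ?thesis using c by (intro has_bochner_integral_nn_integral) auto
  qed
  have e1: "has_bochner_integral lborel (\<lambda>v. indicator {0..} v * exp (- ((s - 1) / 2) * v)) (2 / (s - 1))" 
    and e2: "has_bochner_integral lborel (\<lambda>v. indicator {0..} v * exp (- (s / 2) * v)) (2 / s)"
    using ex[of "(s - 1) / 2"] ex[of "s / 2"] s by auto
  have h_eq: "indicator {0..} v * h v = (indicator {0..} v * W v + indicator {0..} v * W (-v)) -
      (indicator {0..} v * exp (- ((s - 1) / 2) * v) - indicator {0..} v * exp (- (s / 2) * v)) / 2" for v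
    unfolding Wr by (simp add: h_def W_def field_simps)
  have hi: "has_bochner_integral lborel (\<lambda>v. indicator {0..} v * h v) (A - (2 / (s - 1) - 2 / s) / 2)"
    unfolding h_eq A1
    by (intro has_bochner_integral_diff has_bochner_integral_add has_bochner_integral_divide e1 e2
         has_bochner_integral_integrable W1 W2') 
  have "theta_mellin (of_real s) = (LINT v|lborel. complex_of_real (indicator {0..} v * h v))"
    unfolding theta_mellin_def set_lebesgue_integral_def
    by (rule Bochner_Integration.integral_cong) (auto simp: h_def exp_of_real[symmetric] indicator_def)
  also have "\<dots> = of_real (A - (2 / (s - 1) - 2 / s) / 2)"
    using hi by (subst integral_complex_of_real) (simp add: has_bochner_integral_iff)
  also have "(2 / (s - 1) - 2 / s) / 2 = 1 / (s - 1) - 1 / s" using s by (simp add: divide_simps)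
  finally show ?thesis unfolding A_def[symmetric] by simp
qed

section \<open>Continuation of zeta and the functional equation\<close>

definition zeta_completed :: "complex \<Rightarrow> complex" where
  "zeta_completed s = of_real pi powr (- s / 2) * Gamma (s / 2) * zeta s"

context
begin

text \<open>The completed expression solved for zeta. The term - 1 / s is merged with the reciprocal
  Gamma factor by rGamma (s / 2) / s = rGamma (s / 2 + 1) / 2, which leaves 1 as the only
  singularity in sight.\<close>

private definition cont :: "complex \<Rightarrow> complex" where
  "cont s = of_real pi powr (s / 2) * (rGamma (s / 2) * (theta_mellin s + 1 / (s - 1)) - rGamma (s / 2 + 1) / 2)"

private lemma cont_holo: "cont holomorphic_on (- {1})"
  unfolding cont_def
  by (intro holomorphic_intros holomorphic_on_subset[OF holomorphic_theta_mellin]) auto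

private lemma cont_completed:
  assumes "s \<noteq> 0"
  shows "cont s = of_real pi powr (s / 2) * rGamma (s / 2) * (theta_mellin s + 1 / (s - 1) - 1 / s)"
proof -
  have "rGamma (s / 2 + 1) / 2 = rGamma (s / 2) * (1 / s)"
    using rGamma_plus1[of "s / 2"] assms by (simp add: field_simps)
  then show ?thesis unfolding cont_def by (simp add: algebra_simps)
qed

text \<open>The Mellin identity is available on the real ray s > 1 only; the ray accumulates at 2,
  so the identity theorem carries it to the half-plane.\<close>

private lemma cont_series:
  assumes "Re s > 1"
  shows "cont s = (\<Sum>n. 1 / of_nat (Suc n) powr s)"
proof -
  have real: "cont (of_real x) = (\<Sum>n. 1 / of_nat (Suc n) powr of_real x)" if x: "x > 1" for x
  proof -
    have "(\<Sum>n. 1 / of_nat (Suc n) powr complex_of_real x) = (\<Sum>n. complex_of_real (real (Suc n) powr (- x)))"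
    proof (intro suminf_cong)
      fix n
      have "complex_of_nat (Suc n) powr complex_of_real x = complex_of_real (real (Suc n)) powr complex_of_real x" by simp
      also have "\<dots> = complex_of_real (real (Suc n) powr x)" by (rule powr_of_real) auto
      finally show "1 / of_nat (Suc n) powr complex_of_real x = complex_of_real (real (Suc n) powr (- x))"
        by (simp add: powr_minus_divide)
    qed
    also have "\<dots> = of_real (\<Sum>n. real (Suc n) powr (- x))"
      by (rule suminf_of_real[symmetric, OF summable_powr_Suc[OF x]])
    finally have 1: "(\<Sum>n. 1 / of_nat (Suc n) powr complex_of_real x) = of_real (\<Sum>n. real (Suc n) powr (- x))" .
    have "cont (of_real x) = of_real (pi powr (x / 2) * rGamma (x / 2)) * of_real (pi powr (- x / 2) * Gamma (x / 2) * (\<Sum>n. real (Suc n) powr (- x)))"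
      using x by (subst cont_completed) (auto simp: theta_mellin_real rGamma_complex_of_real[symmetric] powr_of_real[symmetric])
    also have "\<dots> = of_real ((pi powr (x / 2) * pi powr (- x / 2)) * (rGamma (x / 2) * Gamma (x / 2)) * (\<Sum>n. real (Suc n) powr (- x)))"
      by (simp add: mult_ac)
    also have "pi powr (x / 2) * pi powr (- x / 2) = 1" by (simp add: powr_add[symmetric])
    also have "rGamma (x / 2) * Gamma (x / 2) = 1"
    proof -
      have "Gamma (x / 2) > 0" using x by (intro Gamma_real_pos) simp
      then show ?thesis by (simp add: rGamma_inverse_Gamma)
    qed
    finally show ?thesis unfolding 1 by simp
  qed
  show ?thesis
  proof -
    have "cont s - (\<Sum>n. 1 / of_nat (Suc n) powr s) = 0"
    proof (rule analytic_continuation[where f = "\<lambda>s. cont s - (\<Sum>n. 1 / of_nat (Suc n) powr s)" and S = "{s. Re s > 1}" and U = "complex_of_real ` {1<..}" and \<xi> = 2])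
      show "(\<lambda>s. cont s - (\<Sum>n. 1 / of_nat (Suc n) powr s)) holomorphic_on {s. Re s > 1}"
        by (intro holomorphic_on_diff holomorphic_zeta_series holomorphic_on_subset[OF cont_holo]) auto
      show "2 islimpt complex_of_real ` {1<..}"
      proof (rule islimptI)
        fix T assume T: "2 \<in> T" "open (T::complex set)"
        then obtain e where e: "e > 0" "ball 2 e \<subseteq> T" using openE by blast
        have "complex_of_real (2 + e / 2) \<in> ball 2 e" using e by (simp add: dist_norm norm_mult)
        then show "\<exists>y\<in>complex_of_real ` {1<..}. y \<in> T \<and> y \<noteq> 2"
          using e by (intro bexI[of _ "of_real (2 + e / 2)"]) (auto simp: image_iff intro!: bexI[of _ "2 + e / 2"])
      qed
      show "connected {s. Re s > 1}" by (intro convex_connected convex_halfspace_Re_gt)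
    qed (use assms real in \<open>auto simp: open_halfspace_Re_gt\<close>)
    then show ?thesis by simp
  qed
qed

text \<open>\<open>cont\<close> witnesses the choice in the definition of \<open>zeta\<close>; away
  from 1 the two then agree by continuation from the half-plane of the series.\<close>

lemma zeta_spec: "zeta holomorphic_on (- {1}) \<and> (\<forall>s. Re s > 1 \<longrightarrow> zeta s = (\<Sum>n. 1 / of_nat (Suc n) powr s))"
  unfolding zeta_def by (rule someI[of _ cont]) (auto simp: cont_holo cont_series)

private lemma zeta_eq_cont:
  assumes "s \<noteq> 1"
  shows "zeta s = cont s"
proof (rule analytic_continuation_open[where s = "{s. Re s > 1}" and s' = "- {1}" and f = zeta and g = cont])
  show "{s. Re s > 1} \<noteq> {}" by (auto intro: exI[of _ 2])
  show "connected (- {1::complex})" by (rule connected_punctured_universe) simp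
qed (use assms zeta_spec cont_holo cont_series in \<open>auto simp: open_halfspace_Re_gt\<close>)

text \<open>Off the real axis the Gamma factor is finite and nonzero and both fractions are genuine
  quotients. The later arguments of \<open>zeta_completed\<close> all have nonzero imaginary
  part.\<close>

lemma zeta_completed_eq:
  assumes "Im s \<noteq> 0"
  shows "zeta_completed s = theta_mellin s + 1 / (s - 1) - 1 / s"
proof -
  have s: "s \<noteq> 0" "s \<noteq> 1" using assms by auto
  have "s / 2 \<notin> \<int>\<^sub>\<le>\<^sub>0" using assms by (auto elim!: nonpos_Ints_cases simp: complex_eq_iff)
  then have "Gamma (s / 2) \<noteq> 0" by (simp add: Gamma_eq_zero_iff)
  then have "Gamma (s / 2) * rGamma (s / 2) = 1" by (simp add: rGamma_inverse_Gamma)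
  moreover have "of_real pi powr (- s / 2) * of_real pi powr (s / 2) = (1 :: complex)"
    by (simp add: powr_add[symmetric])
  moreover have "P * G * (Q * R * X) = (G * R) * ((P * Q) * X)" for P G Q R X :: complex
    by (simp add: mult_ac)
  ultimately show ?thesis
    unfolding zeta_completed_def zeta_eq_cont[OF s(2)] cont_completed[OF s(1)]
    by (simp only:) simp
qed

end

theorem zeta_functional_equation:
  assumes "Im s \<noteq> 0"
  shows "zeta_completed (1 - s) = zeta_completed s"
proof -
  have s: "s \<noteq> 0" "s \<noteq> 1" using assms by auto
  then have "1 / (1 - s - 1) - 1 / (1 - s) = 1 / (s - 1) - 1 / s"
    by (simp add: divide_simps)
  then show ?thesis using assms by (simp add: zeta_completed_eq theta_mellin_reflect algebra_simps)
qed

lemma zeta_completed_cnj: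
  assumes "Im s \<noteq> 0"
  shows "zeta_completed (cnj s) = cnj (zeta_completed s)"
proof -
  have "theta_mellin (cnj s) = cnj (theta_mellin s)"
    unfolding theta_mellin_def set_lebesgue_integral_def
    unfolding Bochner_Integration.integral_cnj[symmetric]
    by (auto simp: exp_cnj intro!: Bochner_Integration.integral_cong)
  then show ?thesis using assms by (simp add: zeta_completed_eq)
qed

section \<open>Dirichlet series and growth of zeta\<close>

lemma holomorphic_zeta: "zeta holomorphic_on (- {1})"
  using zeta_spec by blast

text \<open>The summand at \<open>n = 0\<close> vanishes because \<open>0 powr s = 0\<close> and division by zero is zero.\<close>

lemma zeta_sums:
  assumes "Re s > 1"
  shows "(\<lambda>n. 1 / of_nat n powr s) sums zeta s"
proof -
  have "summable (\<lambda>n. norm (1 / of_nat (Suc n) powr s :: complex))"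
    unfolding zeta_series_powr by (rule summable_powr_Suc[OF assms])
  then have "(\<lambda>n. 1 / of_nat (Suc n) powr s) sums zeta s"
    using zeta_spec assms summable_sums[OF summable_norm_cancel] by metis
  then show ?thesis using sums_Suc_iff[of "\<lambda>n. 1 / of_nat n powr s" "zeta s"] by simp
qed

lemma norm_dirichlet_term:
  fixes a :: complex
  shows "norm (a / of_nat n powr s) = norm a * real n powr (- Re s)"
  by (cases "n = 0") (simp_all add: norm_divide norm_powr_real_powr powr_minus_divide)

text \<open>On a ball reaching half way to the line Re s = 1 all terms are dominated by those at 1 +
  d, so termwise differentiation is justified. The coefficients 1 and the von Mangoldt function are
  the two instances.\<close>

lemma dirichlet_series_has_derivative:
  fixes a :: "nat \<Rightarrow> complex"
  assumes a: "\<And>\<sigma>. \<sigma> > 1 \<Longrightarrow> summable (\<lambda>n. norm (a n) * real n powr (- \<sigma>))"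
  obtains g where "\<And>s. Re s > 1 \<Longrightarrow> (\<lambda>n. a n / of_nat n powr s) sums g s"
    "\<And>s. Re s > 1 \<Longrightarrow> \<exists>g'. (g has_field_derivative g') (at s) \<and> (\<lambda>n. - of_real (ln (real n)) * (a n / of_nat n powr s)) sums g'"
proof -
  let ?S = "{s. Re s > 1}"
  have "\<exists>g g'. \<forall>x \<in> ?S. ((\<lambda>n. a n / of_nat n powr x) sums g x) \<and> ((\<lambda>n. - of_real (ln (real n)) * (a n / of_nat n powr x)) sums g' x) \<and> (g has_field_derivative g' x) (at x)"
  proof (rule series_and_derivative_comparison_complex)
    show "open ?S" by (rule open_halfspace_Re_gt)
  next
    fix n and x :: complex assume x: "x \<in> ?S"
    show "((\<lambda>x. a n / of_nat n powr x) has_field_derivative - of_real (ln (real n)) * (a n / of_nat n powr x)) (at x)"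
    proof (cases "n = 0")
      case False
      then have "Ln (of_nat n) = of_real (ln (real n))"
        using Ln_of_real[of "real n"] by simp
      moreover have "((\<lambda>x. a n * exp (- x * Ln (of_nat n))) has_field_derivative a n * (exp (- x * Ln (of_nat n)) * (- Ln (of_nat n)))) (at x)"
        by (auto intro!: derivative_eq_intros)
      moreover have "a n / of_nat n powr x = a n * exp (- x * Ln (of_nat n))" for x
        using False by (simp add: powr_def exp_minus field_simps)
      ultimately show ?thesis by (simp add: mult_ac)
    qed auto
  next
    fix x :: complex assume "x \<in> ?S"
    then have x: "Re x > 1" by simp
    define d where "d = (Re x - 1) / 2"
    have d: "d > 0" using x by (simp add: d_def)
    define h where "h n = complex_of_real (norm (a n) * real n powr (- (1 + d)))" for n
    have "summable h" unfolding h_def by (intro summable_of_real a) (use d in auto)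
    moreover have "norm (a n / of_nat n powr y) \<le> norm (h n)" if y: "y \<in> ball x d" for n y
    proof (cases "n = 0")
      case False
      have "\<bar>Re (x - y)\<bar> < d" using y abs_Re_le_cmod[of "x - y"] by (simp add: dist_norm)
      then have "Re x - Re y < d" by simp
      moreover have "Re x = 1 + 2 * d" by (simp add: d_def field_simps)
      ultimately have "Re y \<ge> 1 + d" by linarith
      then have "real n powr (- Re y) \<le> real n powr (- (1 + d))" using False by (intro powr_mono) auto
      then show ?thesis unfolding norm_dirichlet_term h_def norm_of_real by (simp add: abs_mult mult_left_mono)
    qed (simp add: h_def)
    ultimately show "\<exists>d h. 0 < d \<and> summable h \<and> range h \<subseteq> \<real>\<^sub>\<ge>\<^sub>0 \<and> (\<forall>\<^sub>F n in sequentially. \<forall>y\<in>ball x d \<inter> ?S. cmod (a n / of_nat n powr y) \<le> cmod (h n))"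
      using d by (intro exI[of _ d] exI[of _ h]) (auto simp: h_def)
  qed
  then show ?thesis using that by simp blast
qed

lemma summable_ln_powr:
  assumes "\<sigma> > 1"
  shows "summable (\<lambda>n. ln (real n) * real n powr (- \<sigma>))"
proof (rule summable_comparison_test')
  define e where "e = (\<sigma> - 1) / 2"
  have e: "e > 0" "\<sigma> - e > 1" using assms by (auto simp: e_def field_simps)
  show "summable (\<lambda>n. (1 / e) * real n powr (- (\<sigma> - e)))"
    using e by (intro summable_mult) (simp add: summable_real_powr_iff)
  fix n :: nat assume n: "n \<ge> 1"
  have "ln (real n) = ln (real n powr e) / e" using e n by (simp add: ln_powr)
  also have "\<dots> \<le> real n powr e / e" using e n by (intro divide_right_mono ln_bound) auto
  finally have "ln (real n) * real n powr (- \<sigma>) \<le> (real n powr e / e) * real n powr (- \<sigma>)"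
    by (intro mult_right_mono) auto
  also have "\<dots> = (1 / e) * (real n powr e * real n powr (- \<sigma>))" by simp
  also have "real n powr e * real n powr (- \<sigma>) = real n powr (- (\<sigma> - e))" by (simp add: powr_add[symmetric])
  finally show "norm (ln (real n) * real n powr (- \<sigma>)) \<le> (1 / e) * real n powr (- (\<sigma> - e))" using n by simp
qed

lemma mangoldt_le_ln: "(mangoldt n :: real) \<le> ln (real n)"
  using mangoldt_le[of n] by (cases "n = 0") auto

lemma summable_mangoldt_powr:
  assumes "\<sigma> > 1"
  shows "summable (\<lambda>n. mangoldt n * real n powr (- \<sigma>))"
  by (rule summable_comparison_test'[OF summable_ln_powr[OF assms], of 0])
     (auto intro!: mult_right_mono mangoldt_le_ln simp: mangoldt_nonneg)

definition mangoldt_series :: "complex \<Rightarrow> complex" where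
  "mangoldt_series s = (\<Sum>n. mangoldt n / of_nat n powr s)"

lemma mangoldt_series_sums:
  assumes "Re s > 1"
  shows "(\<lambda>n. mangoldt n / of_nat n powr s) sums mangoldt_series s"
proof -
  have "summable (\<lambda>n. norm (mangoldt n / of_nat n powr s :: complex))"
    unfolding norm_dirichlet_term using summable_mangoldt_powr[OF assms] by simp
  then show ?thesis unfolding mangoldt_series_def by (rule summable_sums[OF summable_norm_cancel])
qed

lemma holomorphic_mangoldt_series: "mangoldt_series holomorphic_on {s. Re s > 1}"
proof -
  obtain g where g: "\<And>s. Re s > 1 \<Longrightarrow> (\<lambda>n. mangoldt n / of_nat n powr s) sums g s"
    "\<And>s. Re s > 1 \<Longrightarrow> \<exists>g'. (g has_field_derivative g') (at s) \<and> (\<lambda>n. - of_real (ln (real n)) * (mangoldt n / of_nat n powr s)) sums g'"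
    by (rule dirichlet_series_has_derivative[of mangoldt]) (auto simp: summable_mangoldt_powr)
  have "g holomorphic_on {s. Re s > 1}"
    using g(2) by (force simp: holomorphic_on_open open_halfspace_Re_gt)
  moreover have "g s = mangoldt_series s" if "Re s > 1" for s
    using g(1)[OF that] mangoldt_series_sums[OF that] by (rule sums_unique2)
  ultimately show ?thesis by (auto intro: holomorphic_transform)
qed

lemma zeta_deriv_sums:
  assumes "Re s > 1"
  shows "(\<lambda>n. of_real (ln (real n)) / of_nat n powr s) sums (- deriv zeta s)"
proof -
  have "summable (\<lambda>n. norm (1::complex) * real n powr (- \<sigma>))" if "\<sigma> > 1" for \<sigma>
    using that by (simp add: summable_real_powr_iff)
  then obtain g where
    g: "\<And>s. Re s > 1 \<Longrightarrow> (\<lambda>n. 1 / of_nat n powr s) sums g s"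
      "\<And>s. Re s > 1 \<Longrightarrow> \<exists>g'. (g has_field_derivative g') (at s) \<and> (\<lambda>n. - of_real (ln (real n)) * (1 / of_nat n powr s)) sums g'"
    by (rule dirichlet_series_has_derivative[of "\<lambda>_. 1"]) auto
  obtain g' where g': "(g has_field_derivative g') (at s)" "(\<lambda>n. - of_real (ln (real n)) * (1 / of_nat n powr s)) sums g'"
    using g(2)[OF assms] by blast
  have eq: "g z = zeta z" if "Re z > 1" for z
    using g(1)[OF that] zeta_sums[OF that] by (rule sums_unique2)
  have "eventually (\<lambda>z. z \<in> {z. Re z > 1}) (nhds s)"
    using assms by (intro eventually_nhds_in_open open_halfspace_Re_gt) auto
  then have "eventually (\<lambda>z. g z = zeta z) (nhds s)" by eventually_elim (auto simp: eq)
  then have "(zeta has_field_derivative g') (at s)" using g'(1) by (subst (asm) DERIV_cong_ev) auto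
  then have "g' = deriv zeta s" by (simp add: DERIV_imp_deriv)
  then show ?thesis using sums_minus[OF g'(2)] by simp
qed

text \<open>Dirichlet convolution: the absolutely convergent double series is regrouped by n = d *
  e, and the von Mangoldt function summed over the divisors of n is ln n.\<close>

lemma zeta_mult_mangoldt_series:
  assumes s: "Re s > 1"
  shows "zeta s * mangoldt_series s = - deriv zeta s"
proof -
  define f :: "nat \<Rightarrow> complex" where "f = (\<lambda>n. 1 / of_nat n powr s)"
  define g :: "nat \<Rightarrow> complex" where "g = (\<lambda>n. mangoldt n / of_nat n powr s)"
  have f: "summable (\<lambda>n. norm (f n))" unfolding f_def norm_dirichlet_term using s by (simp add: summable_real_powr_iff)
  have g: "summable (\<lambda>n. norm (g n))" unfolding g_def norm_dirichlet_term using summable_mangoldt_powr[OF s] by simp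
  have fs: "(f has_sum zeta s) UNIV" using norm_summable_imp_has_sum[OF f] zeta_sums[OF s] by (simp add: f_def)
  have gs: "(g has_sum mangoldt_series s) UNIV" using norm_summable_imp_has_sum[OF g] mangoldt_series_sums[OF s] by (simp add: g_def)
  have fa: "(\<lambda>n. norm (f n)) summable_on UNIV" and ga: "(\<lambda>n. norm (g n)) summable_on UNIV"
    using f g norm_summable_imp_summable_on[of "\<lambda>n. norm (f n)"] norm_summable_imp_summable_on[of "\<lambda>n. norm (g n)"] by auto
  have ab: "(\<lambda>x. norm (case x of (d, e) \<Rightarrow> g d * f e)) summable_on (UNIV \<times> UNIV)"
    unfolding Infinite_Sum.abs_summable_on_Sigma_iff using fa ga
    by (auto simp: norm_mult infsum_cmult_right abs_mult intro!: summable_on_cmult_right summable_on_cmult_left)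
  have prod: "((\<lambda>(d, e). g d * f e) has_sum (mangoldt_series s * zeta s)) (UNIV \<times> UNIV)"
  proof -
    have "infsum (\<lambda>(d, e). g d * f e) (UNIV \<times> UNIV) = infsum (\<lambda>d. infsum (\<lambda>e. g d * f e) UNIV) UNIV"
      using infsum_Sigma_banach[OF abs_summable_summable[OF ab]] by simp
    also have "\<dots> = mangoldt_series s * zeta s"
      using fs gs by (simp add: infsum_cmult_right' infsum_cmult_left' infsumI)
    finally show ?thesis using abs_summable_summable[OF ab] by (metis has_sum_infsum)
  qed
  \<comment> \<open>Index 0 carries zero terms. Without it, (d, e) -> (d * e, d) is a bijection onto
    the pairs (n, d) with n > 0 and d dvd n.\<close>
  then have "((\<lambda>(d, e). g d * f e) has_sum (mangoldt_series s * zeta s)) ({0<..} \<times> {0<..})"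
    by (rule has_sum_cong_neutral[THEN iffD1, rotated 3]) (auto simp: f_def g_def)
  then have "((\<lambda>(n, d). mangoldt d / of_nat n powr s) has_sum (mangoldt_series s * zeta s)) (Sigma {0<..} (\<lambda>n. {d. d dvd n}))"
  proof (rule has_sum_reindex_bij_witness[where i = "\<lambda>(n, d). (d, n div d)" and j = "\<lambda>(d, e). (d * e, d)", THEN iffD1, rotated -1])
    fix a :: "nat \<times> nat" assume "a \<in> {0<..} \<times> {0<..}"
    then show "(case case a of (d, e) \<Rightarrow> (d * e, d) of (n, d) \<Rightarrow> mangoldt d / of_nat n powr s) = (case a of (d, e) \<Rightarrow> g d * f e)"
      by (cases a) (simp add: f_def g_def powr_times_real)
  qed (auto simp: dvd_div_eq_0_iff intro!: Nat.gr0I)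
  then have "((\<lambda>n. \<Sum>d | d dvd n. mangoldt d / of_nat n powr s) has_sum (mangoldt_series s * zeta s)) {0<..}"
    by (rule has_sum_SigmaD) (auto intro!: has_sum_finiteI)
  then have "((\<lambda>n. of_real (ln (real n)) / of_nat n powr s) has_sum (mangoldt_series s * zeta s)) {0<..}"
    by (rule has_sum_cong[THEN iffD1, rotated]) (simp add: sum_divide_distrib[symmetric] mangoldt_sum)
  then have "((\<lambda>n. of_real (ln (real n)) / of_nat n powr s) has_sum (mangoldt_series s * zeta s)) UNIV"
    by (rule has_sum_cong_neutral[THEN iffD1, rotated 3]) auto
  then have "(\<lambda>n. of_real (ln (real n)) / of_nat n powr s) sums (mangoldt_series s * zeta s)"
    by (rule has_sum_imp_sums)
  then show ?thesis using zeta_deriv_sums[OF s] sums_unique2 by (metis mult.commute)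
qed

text \<open>zeta - 1 is at most \<pi>^2 / 6 - 1 <= 3/4 in modulus, uniformly in t. The points 2 + i
  t are the centres of the disc arguments below, where such a lower bound normalises the growth of
  zeta.\<close>

lemma norm_zeta_two_ge: "norm (zeta (Complex 2 t)) \<ge> 1 / 4"
proof -
  have "(\<lambda>n. 1 / of_nat n powr Complex 2 t) sums zeta (Complex 2 t)" by (rule zeta_sums) simp
  then have "(\<lambda>n. 1 / of_nat (Suc n) powr Complex 2 t) sums zeta (Complex 2 t)"
    by (subst sums_Suc_iff) simp
  then have s2: "(\<lambda>n. 1 / of_nat (Suc (Suc n)) powr Complex 2 t) sums (zeta (Complex 2 t) - 1)"
    by (subst sums_Suc_iff) simp
  have nrm: "norm (1 / of_nat (Suc (Suc n)) powr Complex 2 t) = 1 / real (Suc (Suc n)) ^ 2" for n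
    unfolding norm_dirichlet_term by (simp add: powr_minus_divide powr_numeral)
  have "(\<lambda>n. 1 / real (Suc n) ^ 2) sums (pi\<^sup>2 / 6)" using inverse_squares_sums by simp
  then have b: "(\<lambda>n. 1 / real (Suc (Suc n)) ^ 2) sums (pi\<^sup>2 / 6 - 1)" by (subst sums_Suc_iff) simp
  have "norm (zeta (Complex 2 t) - 1) \<le> pi\<^sup>2 / 6 - 1"
    using norm_suminf_le[of "\<lambda>n. 1 / of_nat (Suc (Suc n)) powr Complex 2 t" "\<lambda>n. 1 / real (Suc (Suc n)) ^ 2"] s2 b
    by (simp only: nrm sums_iff)
  also have "pi\<^sup>2 / 6 - 1 \<le> 3 / 4"
  proof -
    have "pi \<le> 3.2" using pi_approx by simp
    then have "pi\<^sup>2 \<le> 3.2\<^sup>2" by (intro power_mono) auto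
    then show ?thesis by (simp add: power2_eq_square)
  qed
  finally show ?thesis using norm_triangle_ineq2[of 1 "1 - zeta (Complex 2 t)"] by (simp add: norm_minus_commute[of _ "zeta _"])
qed

text \<open>In place of the Euler product: with a primitive \<open>P\<close> of the von Mangoldt
  series, zeta * exp P has derivative zero, so it is constant, and it does not vanish at 2.\<close>

lemma zeta_nonzero_gt_1:
  assumes "Re s > 1"
  shows "zeta s \<noteq> 0"
proof -
  let ?S = "{s. Re s > 1}"
  have S: "convex ?S" "open ?S" by (auto intro: convex_halfspace_Re_gt open_halfspace_Re_gt)
  obtain P where P: "\<And>x. x \<in> ?S \<Longrightarrow> (P has_field_derivative mangoldt_series x) (at x)"
    using holomorphic_convex_primitive'[OF S holomorphic_mangoldt_series] by (metis at_within_open S(2))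
  have zd: "(zeta has_field_derivative deriv zeta x) (at x)" if "x \<in> ?S" for x
    by (rule holomorphic_derivI[OF holomorphic_zeta]) (use that in \<open>auto simp: open_Compl\<close>)
  have "((\<lambda>x. zeta x * exp (P x)) has_field_derivative 0) (at x within ?S)" if x: "x \<in> ?S" for x
  proof -
    have "((\<lambda>x. zeta x * exp (P x)) has_field_derivative deriv zeta x * exp (P x) + zeta x * (exp (P x) * mangoldt_series x)) (at x)"
      using x by (auto intro!: derivative_eq_intros zd P)
    also have "deriv zeta x * exp (P x) + zeta x * (exp (P x) * mangoldt_series x) = exp (P x) * (deriv zeta x + zeta x * mangoldt_series x)"
      by (simp add: algebra_simps)
    also have "\<dots> = 0" using zeta_mult_mangoldt_series x by simp
    finally show ?thesis by (rule has_field_derivative_at_within)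
  qed
  then obtain c where c: "\<And>x. x \<in> ?S \<Longrightarrow> zeta x * exp (P x) = c"
    using has_field_derivative_zero_constant[OF S(1), of "\<lambda>x. zeta x * exp (P x)"] by auto
  have "zeta (Complex 2 0) \<noteq> 0" using norm_zeta_two_ge[of 0] by auto
  then have "c \<noteq> 0" using c[of "Complex 2 0"] by auto
  then show ?thesis using c[of s] assms by auto
qed

lemma zeta_log_deriv:
  assumes "Re s > 1"
  shows "deriv zeta s / zeta s = - mangoldt_series s"
  using zeta_mult_mangoldt_series[OF assms] zeta_nonzero_gt_1[OF assms] by (simp add: field_simps)

lemma powr_real_deriv:
  assumes "x > 0"
  shows "((\<lambda>z. z powr (w :: complex)) has_field_derivative w * of_real x powr (w - 1)) (at (of_real x) within A)"
  using has_field_derivative_powr[of "of_real x" w] assms by (auto intro: has_field_derivative_at_within)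

section \<open>Growth of zeta to the right of the imaginary axis\<close>

lemma powr_difference_bound:
  fixes s :: complex and n :: nat and x :: real
  assumes "n > 0" and s: "Re s \<ge> 0" and x: "real n \<le> x" "x \<le> real n + 1"
  shows "norm (of_nat n powr (- s) - of_real x powr (- s)) \<le> norm s * real n powr (- Re s - 1)"
proof -
  have "norm ((of_real x) powr (- s) - (of_real (real n)) powr (- s)) \<le> (norm s * real n powr (- Re s - 1)) * norm (complex_of_real x - of_real (real n))"
  proof (rule field_differentiable_bound[of "complex_of_real ` {real n..x}" "\<lambda>z. z powr (-s)" "\<lambda>z. (-s) * z powr (- s - 1)"])
    show "convex (complex_of_real ` {real n..x})"
      by (intro convex_linear_image) (auto simp: linear_iff scaleR_conv_of_real)
    fix z assume "z \<in> complex_of_real ` {real n..x}"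
    then obtain y where y: "z = of_real y" "real n \<le> y" "y \<le> x" by auto
    have y0: "y > 0" using y assms by linarith
    show "((\<lambda>z. z powr - s) has_field_derivative - s * z powr (- s - 1)) (at z within complex_of_real ` {real n..x})"
      unfolding y by (rule powr_real_deriv[OF y0])
    have "norm (z powr (- s - 1)) = y powr (- Re s - 1)" using y0 y by (simp add: norm_powr_real_powr)
    also have "\<dots> \<le> real n powr (- Re s - 1)" using assms y by (intro powr_mono2') auto
    finally show "norm (- s * z powr (- s - 1)) \<le> norm s * real n powr (- Re s - 1)"
      by (simp add: norm_mult mult_left_mono)
  next
    show "complex_of_real x \<in> complex_of_real ` {real n..x}" "complex_of_real (real n) \<in> complex_of_real ` {real n..x}"
      using x by (auto intro!: imageI simp del: of_real_of_nat_eq)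
  qed
  also have "\<dots> \<le> (norm s * real n powr (- Re s - 1)) * 1"
  proof (rule mult_left_mono)
    have "complex_of_real x - of_real (real n) = of_real (x - real n)" by simp
    then show "norm (complex_of_real x - of_real (real n)) \<le> 1" using x by (simp only: norm_of_real)
  qed auto
  finally show ?thesis by (simp add: norm_minus_commute)
qed

text \<open>For N = n + 1 this is s - 1 times the difference between N^(-s) and the integral of
  x^(-s) over [N, N + 1], with the integral evaluated. The difference gains one power of N, which
  extends convergence to Re s > 0.\<close>

definition zeta_regular_term :: "nat \<Rightarrow> complex \<Rightarrow> complex" where
  "zeta_regular_term n s = (s - 1) * of_nat (Suc n) powr (- s) + of_nat (Suc (Suc n)) powr (1 - s) - of_nat (Suc n) powr (1 - s)"

lemma norm_zeta_regular_term:
  assumes s: "Re s \<ge> 0"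
  shows "norm (zeta_regular_term n s) \<le> norm (s - 1) * norm s * real (Suc n) powr (- Re s - 1)"
proof -
  define N where "N = real (Suc n)"
  have N: "N > 0" by (simp add: N_def)
  define f where "f = (\<lambda>z. (s - 1) * of_nat (Suc n) powr (- s) * (z - of_real N) + z powr (1 - s))"
  have "norm (f (of_real (N + 1)) - f (of_real N)) \<le> (norm (s - 1) * (norm s * N powr (- Re s - 1))) * norm (complex_of_real (N + 1) - of_real N)"
  proof (rule field_differentiable_bound[of "complex_of_real ` {N..N+1}" f "\<lambda>z. (s - 1) * of_nat (Suc n) powr (- s) + (1 - s) * z powr (1 - s - 1)"])
    show "convex (complex_of_real ` {N..N+1})"
      by (intro convex_linear_image) (auto simp: linear_iff scaleR_conv_of_real)
    fix z assume "z \<in> complex_of_real ` {N..N+1}"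
    then obtain y where y: "z = of_real y" "N \<le> y" "y \<le> N + 1" by auto
    have y0: "y > 0" using y N by linarith
    show "(f has_field_derivative (s - 1) * of_nat (Suc n) powr (- s) + (1 - s) * z powr (1 - s - 1)) (at z within complex_of_real ` {N..N+1})"
      unfolding f_def y using y0 by (auto intro!: derivative_eq_intros powr_real_deriv[OF y0] simp del: of_nat_Suc)
    have "(s - 1) * of_nat (Suc n) powr (- s) + (1 - s) * z powr (1 - s - 1) = (s - 1) * (of_nat (Suc n) powr (- s) - of_real y powr (- s))"
      by (simp add: y algebra_simps del: of_nat_Suc)
    also have "norm \<dots> \<le> norm (s - 1) * (norm s * N powr (- Re s - 1))"
      unfolding norm_mult N_def using y s unfolding N_def by (intro mult_left_mono powr_difference_bound) auto
    finally show "norm ((s - 1) * of_nat (Suc n) powr (- s) + (1 - s) * z powr (1 - s - 1)) \<le> norm (s - 1) * (norm s * N powr (- Re s - 1))" .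
  next
    show "complex_of_real (N + 1) \<in> complex_of_real ` {N..N+1}" "complex_of_real N \<in> complex_of_real ` {N..N+1}"
      by (auto intro!: imageI simp del: of_real_add)
  qed
  moreover have "f (of_real (N + 1)) - f (of_real N) = zeta_regular_term n s"
    by (simp add: f_def zeta_regular_term_def N_def algebra_simps)
  moreover have "complex_of_real (N + 1) - of_real N = 1" by simp
  ultimately show ?thesis by (simp add: N_def mult.assoc del: of_nat_Suc)
qed

text \<open>Besides s - 1 times the zeta series, the terms contain a telescoping sum with value - 1
  for Re s > 1; the leading 1 compensates it, so this is (s - 1) * zeta s, made holomorphic at the
  pole.\<close>

definition zeta_regular :: "complex \<Rightarrow> complex" where
  "zeta_regular s = 1 + (\<Sum>n. zeta_regular_term n s)"

lemma holomorphic_zeta_regular: "zeta_regular holomorphic_on {s. Re s > 0}"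
proof -
  have "(\<lambda>s. \<Sum>n. zeta_regular_term n s) holomorphic_on {s. Re s > 0}"
  proof (rule holomorphic_uniform_sequence[where f = "\<lambda>n s. \<Sum>i<n. zeta_regular_term i s"])
    show "open {s. Re s > 0}" by (rule open_halfspace_Re_gt)
    show "(\<lambda>s. \<Sum>i<n. zeta_regular_term i s) holomorphic_on {s. Re s > 0}" for n
      unfolding zeta_regular_term_def by (intro holomorphic_intros) (auto simp del: of_nat_Suc)
    fix s :: complex assume "s \<in> {s. Re s > 0}"
    then have s: "Re s > 0" by simp
    define d where "d = Re s / 2"
    have d: "d > 0" using s by (simp add: d_def)
    have re: "Re x \<ge> d" if "x \<in> cball s d" for x
    proof -
      have "\<bar>Re s - Re x\<bar> \<le> d" using that abs_Re_le_cmod[of "s - x"] by (simp add: dist_norm)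
      then show ?thesis unfolding d_def by linarith
    qed
    have "uniform_limit (cball s d) (\<lambda>n s. \<Sum>i<n. zeta_regular_term i s) (\<lambda>s. \<Sum>i. zeta_regular_term i s) sequentially"
    proof (rule Weierstrass_m_test)
      show "summable (\<lambda>n. ((norm s + d + 1) * (norm s + d)) * real (Suc n) powr (- (1 + d)))"
        by (intro summable_mult summable_powr_Suc) (use d in auto)
      fix n x assume x: "x \<in> cball s d"
      have nx: "norm x \<le> norm s + d" using x norm_triangle_sub[of x s] by (simp add: dist_norm norm_minus_commute)
      have "norm (zeta_regular_term n x) \<le> norm (x - 1) * norm x * real (Suc n) powr (- Re x - 1)"
        by (rule norm_zeta_regular_term) (use re[OF x] d in linarith)
      also have "\<dots> \<le> ((norm s + d + 1) * (norm s + d)) * real (Suc n) powr (- (1 + d))"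
        using nx norm_triangle_ineq4[of x 1] d re[OF x] by (intro mult_mono powr_mono) auto
      finally show "norm (zeta_regular_term n x) \<le> ((norm s + d + 1) * (norm s + d)) * real (Suc n) powr (- (1 + d))" .
    qed
    then show "\<exists>d>0. cball s d \<subseteq> {s. Re s > 0} \<and> uniform_limit (cball s d) (\<lambda>n s. \<Sum>i<n. zeta_regular_term i s) (\<lambda>s. \<Sum>n. zeta_regular_term n s) sequentially"
      using d re by (intro exI[of _ d]) force
  qed
  then show ?thesis unfolding zeta_regular_def by (intro holomorphic_intros)
qed

lemma zeta_regular_one: "zeta_regular 1 = 1"
proof -
  have "zeta_regular_term n 1 = 0" for n
    unfolding zeta_regular_term_def by (simp del: of_nat_Suc)
  then show ?thesis by (simp add: zeta_regular_def)
qed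

lemma zeta_regular_eq:
  assumes "Re s > 0" "s \<noteq> 1"
  shows "zeta_regular s = (s - 1) * zeta s"
proof (rule analytic_continuation_open[where s = "{s. Re s > 1}" and s' = "{s. Re s > 0}  - {1}" and f = zeta_regular and g = "\<lambda>s. (s - 1) * zeta s"])
  show "open ({s. Re s > 0} - {1})" by (intro open_Diff open_halfspace_Re_gt) auto
  show "connected ({s. Re s > 0} - {1})"
    by (intro connected_open_delete convex_connected convex_halfspace_Re_gt open_halfspace_Re_gt) simp
  show "{s. Re s > 1} \<noteq> {}" by (auto intro: exI[of _ 2])
  show "zeta_regular holomorphic_on {s. Re s > 0} - {1}"
    by (rule holomorphic_on_subset[OF holomorphic_zeta_regular]) auto
  show "(\<lambda>s. (s - 1) * zeta s) holomorphic_on {s. Re s > 0} - {1}"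
    by (intro holomorphic_intros holomorphic_on_subset[OF holomorphic_zeta]) auto
  fix z assume "z \<in> {s. Re s > 1}"
  then have z: "Re z > 1" by simp
  have "(\<lambda>n. 1 / of_nat n powr z) sums zeta z" by (rule zeta_sums[OF z])
  then have "(\<lambda>n. 1 / of_nat (Suc n) powr z) sums zeta z" by (subst sums_Suc_iff) simp
  then have 1: "(\<lambda>n. (z - 1) * (1 / of_nat (Suc n) powr z)) sums ((z - 1) * zeta z)" by (rule sums_mult)
  have "(\<lambda>n. of_nat (Suc n) powr (1 - z) :: complex) \<longlonglongrightarrow> 0"
  proof (rule tendsto_norm_zero_cancel)
    have "(\<lambda>n. real (Suc n) powr (1 - Re z)) \<longlonglongrightarrow> 0"
      by (rule tendsto_neg_powr) (use z in \<open>simp, real_asymp\<close>)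
    then show "(\<lambda>n. norm (of_nat (Suc n) powr (1 - z) :: complex)) \<longlonglongrightarrow> 0"
      by (simp add: norm_powr_real_powr del: of_nat_Suc)
  qed
  from telescope_sums[OF this] have 2: "(\<lambda>n. of_nat (Suc (Suc n)) powr (1 - z) - of_nat (Suc n) powr (1 - z) :: complex) sums (0 - 1)"
    by simp
  have "(\<lambda>n. zeta_regular_term n z) sums ((z - 1) * zeta z + (0 - 1))"
    using sums_add[OF 1 2] by (simp add: zeta_regular_term_def powr_minus field_simps)
  then show "zeta_regular z = (z - 1) * zeta z" by (simp add: zeta_regular_def sums_iff)
qed (use assms in \<open>auto simp: open_halfspace_Re_gt\<close>)

text \<open>The term bound has the factors |s - 1| and |s|; division by s - 1 removes one, so the
  growth is linear in |Im s|. The edge 1/20 is where a disc of radius 39/20 about 2 + i y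
  ends.\<close>

lemma zeta_growth:
  obtains C where "C > 0" "\<And>s. 1 / 20 \<le> Re s \<Longrightarrow> Re s \<le> 4 \<Longrightarrow> \<bar>Im s\<bar> \<ge> 1 \<Longrightarrow> norm (zeta s) \<le> C * \<bar>Im s\<bar>"
proof
  define K where "K = (\<Sum>n. real (Suc n) powr (- (1 + 1 / 20)))"
  have sm: "summable (\<lambda>n. real (Suc n) powr (- (1 + 1 / 20)))" by (rule summable_powr_Suc) simp
  have K: "K \<ge> 0" unfolding K_def by (intro suminf_nonneg sm) auto
  show "1 + 5 * K > 0" using K by simp
  fix s :: complex assume s: "1 / 20 \<le> Re s" "Re s \<le> 4" "\<bar>Im s\<bar> \<ge> 1"
  have s1: "norm (s - 1) \<ge> 1" using s abs_Im_le_cmod[of "s - 1"] by simp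
  have "s \<noteq> 1" using s by auto
  have "norm s \<le> \<bar>Re s\<bar> + \<bar>Im s\<bar>" by (rule cmod_le)
  then have ns: "norm s \<le> 5 * \<bar>Im s\<bar>" using s by linarith
  have "norm (\<Sum>n. zeta_regular_term n s) \<le> (\<Sum>n. (norm (s - 1) * norm s) * real (Suc n) powr (- (1 + 1 / 20)))"
  proof (rule norm_suminf_le)
    fix n
    have "norm (zeta_regular_term n s) \<le> norm (s - 1) * norm s * real (Suc n) powr (- Re s - 1)"
      by (rule norm_zeta_regular_term) (use s in linarith)
    also have "\<dots> \<le> (norm (s - 1) * norm s) * real (Suc n) powr (- (1 + 1 / 20))"
      using s by (intro mult_left_mono powr_mono) auto
    finally show "norm (zeta_regular_term n s) \<le> (norm (s - 1) * norm s) * real (Suc n) powr (- (1 + 1 / 20))" .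
  qed (intro summable_mult sm)
  also have "\<dots> = norm (s - 1) * norm s * K" unfolding K_def by (rule suminf_mult[OF sm])
  finally have "norm (zeta_regular s) \<le> 1 + norm (s - 1) * norm s * K"
    unfolding zeta_regular_def using norm_triangle_ineq[of 1 "\<Sum>n. zeta_regular_term n s"] by simp
  also have "\<dots> \<le> norm (s - 1) * (1 + norm s * K)" using s1 by (simp add: algebra_simps)
  finally have "norm (s - 1) * norm (zeta s) \<le> norm (s - 1) * (1 + norm s * K)"
    using zeta_regular_eq[of s] s \<open>s \<noteq> 1\<close> by (simp add: norm_mult)
  then have "norm (zeta s) \<le> 1 + norm s * K" using s1 by (subst (asm) mult_le_cancel_left_pos) auto
  also have "\<dots> \<le> \<bar>Im s\<bar> + (5 * \<bar>Im s\<bar>) * K" using s ns K by (intro add_mono mult_right_mono) auto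
  finally show "norm (zeta s) \<le> (1 + 5 * K) * \<bar>Im s\<bar>" by (simp add: algebra_simps)
qed

section \<open>Non-vanishing on the line Re s = 1\<close>

lemma log_deriv_tendsto_order:
  fixes f :: "complex \<Rightarrow> complex"
  assumes holf: "f holomorphic_on S" and S: "open S" "connected S" and \<rho>: "\<rho> \<in> S" and nc: "\<not> f constant_on S"
  obtains n :: nat where "((\<lambda>w. (w - \<rho>) * (deriv f w / f w)) \<longlongrightarrow> of_nat n) (at \<rho>)" "f \<rho> = 0 \<Longrightarrow> n \<ge> 1"
proof -
  have lim: "((\<lambda>w. of_nat n + (w - \<rho>) * (deriv g w / g w)) \<longlongrightarrow> of_nat n) (at \<rho>)"
    if g: "g holomorphic_on ball \<rho> r" "g \<rho> \<noteq> 0" "r > 0" for g :: "complex \<Rightarrow> complex" and r and n :: nat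
  proof -
    have "isCont g \<rho>" "isCont (deriv g) \<rho>"
      using g holomorphic_on_imp_continuous_on[OF g(1)] holomorphic_on_imp_continuous_on[OF holomorphic_deriv[OF g(1)]]
      by (auto simp: continuous_on_eq_continuous_at)
    then have "((\<lambda>w. of_nat n + (w - \<rho>) * (deriv g w / g w)) \<longlongrightarrow> of_nat n + (\<rho> - \<rho>) * (deriv g \<rho> / g \<rho>)) (at \<rho>)"
      using g(2) by (intro tendsto_intros) (auto simp: isCont_def)
    then show ?thesis by simp
  qed
  show ?thesis
  proof (cases "f \<rho> = 0")
    case True
    obtain g r and n :: nat where
      g: "0 < n" "0 < r" "ball \<rho> r \<subseteq> S" "g holomorphic_on ball \<rho> r"
        "\<And>w. w \<in> ball \<rho> r \<Longrightarrow> f w = (w - \<rho>)^n * g w" "\<And>w. w \<in> ball \<rho> r \<Longrightarrow> g w \<noteq> 0"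
      by (rule holomorphic_factor_zero_nonconstant[OF holf S \<rho> True nc], rule that)
    have "eventually (\<lambda>w. w \<in> ball \<rho> r - {\<rho>}) (at \<rho>)"
      using g by (intro eventually_at_in_open) auto
    then have "eventually (\<lambda>w. of_nat n + (w - \<rho>) * (deriv g w / g w) = (w - \<rho>) * (deriv f w / f w)) (at \<rho>)"
    proof eventually_elim
      case (elim w)
      then have w: "w \<in> ball \<rho> r" "w \<noteq> \<rho>" by auto
      have "(g has_field_derivative deriv g w) (at w)"
        using holomorphic_derivI[OF g(4) open_ball w(1)] .
      then have "((\<lambda>w. (w - \<rho>)^n * g w) has_field_derivative (of_nat n * (w - \<rho>)^(n - 1) * g w + (w - \<rho>)^n * deriv g w)) (at w)"
        by (auto intro!: derivative_eq_intros)
      moreover have "eventually (\<lambda>w. w \<in> ball \<rho> r) (nhds w)" using w by (intro eventually_nhds_in_open) auto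
      then have "eventually (\<lambda>w. f w = (w - \<rho>)^n * g w) (nhds w)" by eventually_elim (simp add: g)
      ultimately have "deriv f w = of_nat n * (w - \<rho>)^(n - 1) * g w + (w - \<rho>)^n * deriv g w"
        by (simp add: DERIV_imp_deriv deriv_cong_ev)
      moreover have "(w - \<rho>)^n = (w - \<rho>) * (w - \<rho>)^(n - 1)" using g(1) by (cases n) auto
      moreover have alg: "c + x * (D / G) = x * ((c * p * G + (x * p) * D) / ((x * p) * G))" if "x \<noteq> 0" "p \<noteq> 0" "G \<noteq> 0" for x p G c D :: complex
        using that by (simp add: field_simps)
      ultimately show ?case using w g(5,6)[OF w(1)] alg[of "w - \<rho>" "(w - \<rho>)^(n - 1)" "g w" "of_nat n" "deriv g w"] by simp
    qed
    then have "((\<lambda>w. (w - \<rho>) * (deriv f w / f w)) \<longlongrightarrow> of_nat n) (at \<rho>)"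
      by (rule Lim_transform_eventually[rotated]) (rule lim[OF g(4) _ g(2)], simp add: g)
    then show ?thesis using that g(1) by auto
  next
    case False
    obtain r where "r > 0" "ball \<rho> r \<subseteq> S" using S(1) \<rho> openE by blast
    then have "((\<lambda>w. of_nat 0 + (w - \<rho>) * (deriv f w / f w)) \<longlongrightarrow> of_nat 0) (at \<rho>)"
      using False holomorphic_on_subset[OF holf] by (intro lim) auto
    then show ?thesis using that[of 0] False by simp
  qed
qed

lemma three_four_one: "3 + 4 * cos x + cos (2 * x) \<ge> (0 :: real)"
proof -
  have "3 + 4 * cos x + cos (2 * x) = 2 * (1 + cos x)\<^sup>2"
    by (simp only: cos_double_cos) (simp add: power2_eq_square algebra_simps)
  then show ?thesis by simp
qed

lemma Re_mangoldt_series_sums: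
  assumes "\<sigma> > 1"
  shows "(\<lambda>n. mangoldt n * real n powr (- \<sigma>) * cos (t * ln (real n))) sums Re (mangoldt_series (Complex \<sigma> t))"
proof -
  have "(\<lambda>n. Re (mangoldt n / of_nat n powr (Complex \<sigma> t))) sums Re (mangoldt_series (Complex \<sigma> t))"
    by (rule sums_Re[OF mangoldt_series_sums]) (use assms in simp)
  moreover have "Re (mangoldt n / of_nat n powr (Complex \<sigma> t)) = mangoldt n * real n powr (- \<sigma>) * cos (t * ln (real n))" for n
  proof (cases "n = 0")
    case False
    have "mangoldt n / of_nat n powr (Complex \<sigma> t) = of_real (mangoldt n) * exp (- Complex \<sigma> t * of_real (ln (real n)))"
      using False Ln_of_real[of "real n"] by (simp add: powr_def exp_minus field_simps)
    also have "Re \<dots> = mangoldt n * (exp (- (\<sigma> * ln (real n))) * cos (t * ln (real n)))"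
      by (simp add: Re_exp)
    also have "exp (- (\<sigma> * ln (real n))) = real n powr (- \<sigma>)" using False by (simp add: powr_def)
    finally show ?thesis by simp
  qed simp
  ultimately show ?thesis by simp
qed

lemma mangoldt_series_3_4_1:
  assumes "\<sigma> > 1"
  shows "3 * Re (mangoldt_series (Complex \<sigma> 0)) + 4 * Re (mangoldt_series (Complex \<sigma> t)) + Re (mangoldt_series (Complex \<sigma> (2 * t))) \<ge> 0"
proof -
  have "(\<lambda>n. 3 * (mangoldt n * real n powr (- \<sigma>) * cos (0 * ln (real n))) + 4 * (mangoldt n * real n powr (- \<sigma>) * cos (t * ln (real n)))
     + mangoldt n * real n powr (- \<sigma>) * cos (2 * t * ln (real n))) sums
    (3 * Re (mangoldt_series (Complex \<sigma> 0)) + 4 * Re (mangoldt_series (Complex \<sigma> t)) + Re (mangoldt_series (Complex \<sigma> (2 * t))))"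
    by (intro sums_add sums_mult Re_mangoldt_series_sums assms)
  moreover have "3 * (mangoldt n * real n powr (- \<sigma>) * cos (0 * ln (real n))) + 4 * (mangoldt n * real n powr (- \<sigma>) * cos (t * ln (real n)))
     + mangoldt n * real n powr (- \<sigma>) * cos (2 * t * ln (real n)) = mangoldt n * real n powr (- \<sigma>) * (3 + 4 * cos (t * ln (real n)) + cos (2 * (t * ln (real n))))" for n
    by (simp add: algebra_simps)
  moreover have "mangoldt n * real n powr (- \<sigma>) * (3 + 4 * cos (t * ln (real n)) + cos (2 * (t * ln (real n)))) \<ge> 0" for n
    by (intro mult_nonneg_nonneg three_four_one mangoldt_nonneg) auto
  ultimately show ?thesis using sums_le[OF _ sums_zero] by (metis (no_types, lifting))
qed

text \<open>\<open>Riemann_hypothesis\<close> speaks of the open strip, so its boundary line needs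
  an argument of its own. The 3-4-1 inequality at 1 + \<delta>, multiplied by \<delta> -> 0, becomes
  3 - 4 n1 - n2 >= 0: the 3 comes from the pole at 1, and n1 and n2 are the orders of vanishing at 1
  + i t and 1 + 2 i t. A zero means n1 >= 1.\<close>

theorem zeta_nonzero_Re_1:
  assumes t: "t \<noteq> 0"
  shows "zeta (Complex 1 t) \<noteq> 0"
proof
  assume z: "zeta (Complex 1 t) = 0"
  have nconst: "\<not> zeta constant_on (- {1})"
  proof
    assume "zeta constant_on (- {1})"
    then obtain c where c: "\<And>x. x \<noteq> 1 \<Longrightarrow> zeta x = c" unfolding constant_on_def by auto
    have "zeta (Complex 1 t) = zeta (Complex 2 0)" using c[of "Complex 1 t"] c[of "Complex 2 0"] t by (simp add: complex_eq_iff)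
    then show False using z norm_zeta_two_ge[of 0] by auto
  qed
  have *: "\<exists>n::nat. ((\<lambda>w. (w - Complex 1 u) * (deriv zeta w / zeta w)) \<longlongrightarrow> of_nat n) (at (Complex 1 u)) \<and> (zeta (Complex 1 u) = 0 \<longrightarrow> n \<ge> 1)" if "u \<noteq> 0" for u
    by (rule log_deriv_tendsto_order[OF holomorphic_zeta _ _ _ nconst, of "Complex 1 u"])
       (use that in \<open>auto simp: connected_punctured_universe open_Compl complex_eq_iff\<close>)
  obtain n1 :: nat where n1: "((\<lambda>w. (w - Complex 1 t) * (deriv zeta w / zeta w)) \<longlongrightarrow> of_nat n1) (at (Complex 1 t))" "n1 \<ge> 1"
    using *[of t] t z by auto
  obtain n2 :: nat where n2: "((\<lambda>w. (w - Complex 1 (2 * t)) * (deriv zeta w / zeta w)) \<longlongrightarrow> of_nat n2) (at (Complex 1 (2 * t)))"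
    using *[of "2 * t"] t by auto
  \<comment> \<open>The pole counts as order - 1, read off from \<open>zeta_regular\<close>, which
    is (s - 1) * zeta s nearby and equals 1 at 1.\<close>
  have n0: "((\<lambda>w. (w - Complex 1 0) * (deriv zeta w / zeta w)) \<longlongrightarrow> -1) (at (Complex 1 0))"
  proof -
    have one: "Complex 1 0 = 1" by (simp add: complex_eq_iff)
    have op: "open {s. Re s > 0}" by (rule open_halfspace_Re_gt)
    have "isCont zeta_regular 1" "isCont (deriv zeta_regular) 1"
      using holomorphic_on_imp_continuous_on[OF holomorphic_zeta_regular] holomorphic_on_imp_continuous_on[OF holomorphic_deriv[OF holomorphic_zeta_regular op]] op
      by (auto simp: continuous_on_eq_continuous_at)
    then have "((\<lambda>w. (w - 1) * (deriv zeta_regular w / zeta_regular w) - 1) \<longlongrightarrow> (1 - 1) * (deriv zeta_regular 1 / zeta_regular 1) - 1) (at 1)"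
      by (intro tendsto_intros) (auto simp: isCont_def zeta_regular_one)
    moreover have "eventually (\<lambda>w. w \<in> {s. Re s > 0} - {1}) (at (1::complex))"
      using op by (intro eventually_at_in_open) auto
    moreover have "eventually (\<lambda>w. zeta_regular w \<noteq> 0) (at 1)"
      using \<open>isCont zeta_regular 1\<close> unfolding isCont_def by (rule tendsto_imp_eventually_ne) (simp add: zeta_regular_one)
    ultimately have "eventually (\<lambda>w. (w - 1) * (deriv zeta_regular w / zeta_regular w) - 1 = (w - 1) * (deriv zeta w / zeta w)) (at 1)"
      "((\<lambda>w. (w - 1) * (deriv zeta_regular w / zeta_regular w) - 1) \<longlongrightarrow> -1) (at 1)"
    proof -
      assume "\<forall>\<^sub>F w in at 1. w \<in> {s. 0 < Re s} - {1}" "\<forall>\<^sub>F w in at 1. zeta_regular w \<noteq> 0"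
      then show "eventually (\<lambda>w. (w - 1) * (deriv zeta_regular w / zeta_regular w) - 1 = (w - 1) * (deriv zeta w / zeta w)) (at 1)"
      proof eventually_elim
        case (elim w)
        then have w: "Re w > 0" "w \<noteq> 1" and nz: "zeta_regular w \<noteq> 0" by auto
        have zd: "(zeta has_field_derivative deriv zeta w) (at w)"
          by (rule holomorphic_derivI[OF holomorphic_zeta]) (use w in \<open>auto simp: open_Compl\<close>)
        have "((\<lambda>w. (w - 1) * zeta w) has_field_derivative (zeta w + (w - 1) * deriv zeta w)) (at w)"
          using zd by (auto intro!: derivative_eq_intros)
        moreover have "eventually (\<lambda>w. w \<in> {s. Re s > 0} - {1}) (nhds w)"
          using w by (intro eventually_nhds_in_open open_Diff op) auto
        then have "eventually (\<lambda>w. zeta_regular w = (w - 1) * zeta w) (nhds w)"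
          by eventually_elim (auto simp: zeta_regular_eq)
        ultimately have "deriv zeta_regular w = zeta w + (w - 1) * deriv zeta w"
          by (simp add: DERIV_imp_deriv deriv_cong_ev)
        moreover have "x * ((Z + x * Z') / (x * Z)) - 1 = x * (Z' / Z)" if "x \<noteq> 0" "Z \<noteq> 0" for x Z Z' :: complex
          using that by (simp add: field_simps)
        ultimately show ?case using w nz zeta_regular_eq[OF w] by simp
      qed
    qed simp
    then have "((\<lambda>w. (w - 1) * (deriv zeta w / zeta w)) \<longlongrightarrow> -1) (at 1)"
      by (rule Lim_transform_eventually[rotated])
    then show ?thesis by (simp add: one)
  qed
  have path: "filterlim (\<lambda>\<delta>. Complex (1 + \<delta>) u) (at (Complex 1 u)) (at_right 0)" for u
  proof (rule filterlim_atI)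
    have "((\<lambda>\<delta>. Complex (1 + \<delta>) u) \<longlongrightarrow> Complex (1 + 0) u) (at_right 0)" by (intro tendsto_intros)
    then show "((\<lambda>\<delta>. Complex (1 + \<delta>) u) \<longlongrightarrow> Complex 1 u) (at_right 0)" by simp
    show "eventually (\<lambda>\<delta>. Complex (1 + \<delta>) u \<noteq> Complex 1 u) (at_right 0)"
      by (auto simp: eventually_at_right_field intro: exI[of _ 1])
  qed
  have lim: "((\<lambda>\<delta>. \<delta> * Re (mangoldt_series (Complex (1 + \<delta>) u))) \<longlongrightarrow> - Re c) (at_right 0)"
    if c: "((\<lambda>w. (w - Complex 1 u) * (deriv zeta w / zeta w)) \<longlongrightarrow> c) (at (Complex 1 u))" for u c
  proof -
    have "((\<lambda>\<delta>. (Complex (1 + \<delta>) u - Complex 1 u) * (deriv zeta (Complex (1 + \<delta>) u) / zeta (Complex (1 + \<delta>) u))) \<longlongrightarrow> c) (at_right 0)"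
      by (rule filterlim_compose[OF c path])
    then have "((\<lambda>\<delta>. - Re ((Complex (1 + \<delta>) u - Complex 1 u) * (deriv zeta (Complex (1 + \<delta>) u) / zeta (Complex (1 + \<delta>) u)))) \<longlongrightarrow> - Re c) (at_right 0)"
      by (intro tendsto_intros)
    moreover have "eventually (\<lambda>\<delta>. - Re ((Complex (1 + \<delta>) u - Complex 1 u) * (deriv zeta (Complex (1 + \<delta>) u) / zeta (Complex (1 + \<delta>) u))) = \<delta> * Re (mangoldt_series (Complex (1 + \<delta>) u))) (at_right 0)"
      using eventually_at_right_less[of "0::real"]
    proof eventually_elim
      case (elim \<delta>)
      have "Complex (1 + \<delta>) u - Complex 1 u = of_real \<delta>" by (simp add: complex_eq_iff)
      then show ?case using elim by (simp add: zeta_log_deriv)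
    qed
    ultimately show ?thesis by (rule Lim_transform_eventually)
  qed
  have "((\<lambda>\<delta>. 3 * (\<delta> * Re (mangoldt_series (Complex (1 + \<delta>) 0))) + 4 * (\<delta> * Re (mangoldt_series (Complex (1 + \<delta>) t)))
    + \<delta> * Re (mangoldt_series (Complex (1 + \<delta>) (2 * t)))) \<longlongrightarrow> 3 * (- Re (- 1)) + 4 * (- Re (of_nat n1)) + (- Re (of_nat n2))) (at_right 0)"
    by (intro tendsto_intros lim n0 n1(1) n2)
  moreover have "eventually (\<lambda>\<delta>. 3 * (\<delta> * Re (mangoldt_series (Complex (1 + \<delta>) 0))) + 4 * (\<delta> * Re (mangoldt_series (Complex (1 + \<delta>) t)))
    + \<delta> * Re (mangoldt_series (Complex (1 + \<delta>) (2 * t))) \<ge> 0) (at_right 0)"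
    using eventually_at_right_less[of "0::real"]
  proof eventually_elim
    case (elim \<delta>)
    have "0 \<le> \<delta> * (3 * Re (mangoldt_series (Complex (1 + \<delta>) 0)) + 4 * Re (mangoldt_series (Complex (1 + \<delta>) t)) + Re (mangoldt_series (Complex (1 + \<delta>) (2 * t))))"
      using elim by (intro mult_nonneg_nonneg mangoldt_series_3_4_1) auto
    then show ?case by (simp add: algebra_simps)
  qed
  ultimately have "0 \<le> 3 * (- Re (- 1)) + 4 * (- Re (of_nat n1)) + (- Re (of_nat n2))"
    by (rule tendsto_lowerbound) simp
  then show False using n1(2) by simp
qed

section \<open>Bounds for the logarithmic derivative under RH\<close>

text \<open>Since Re h < A, the value of h is closer to 0 than to 2 A, so h / (2 A - h) maps the
  rescaled disc into the unit disc and fixes 0. The Schwarz lemma bounds it by |w|, and the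
  inequality is solved for |h|.\<close>

lemma borel_caratheodory:
  fixes h :: "complex \<Rightarrow> complex"
  assumes holh: "h holomorphic_on ball c R" and hc: "h c = 0"
    and Re_h: "\<And>z. z \<in> ball c R \<Longrightarrow> Re (h z) < A"
    and z: "dist c z \<le> r" "r < R"
  shows "norm (h z) \<le> 2 * A * r / (R - r)"
proof -
  have r: "r \<ge> 0" using z zero_le_dist[of c z] by linarith
  have R: "R > 0" using z r by linarith
  have A: "A > 0" using Re_h[of c] hc R by simp
  define \<phi> where "\<phi> = (\<lambda>w. h (c + of_real R * w) / (2 * of_real A - h (c + of_real R * w)))"
  have inb: "c + of_real R * w \<in> ball c R" if "norm w < 1" for w
    using that R by (simp add: dist_norm norm_mult)
  have nz: "2 * of_real A - h (c + of_real R * w) \<noteq> 0" if "norm w < 1" for w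
  proof
    assume "2 * of_real A - h (c + of_real R * w) = 0"
    then have "Re (h (c + of_real R * w)) = 2 * A" by (simp add: complex_eq_iff)
    then show False using Re_h[OF inb[OF that]] A by simp
  qed
  define w where "w = (z - c) / of_real R"
  have zw: "z = c + of_real R * w" using R by (simp add: w_def)
  have nw: "norm w = dist c z / R" using R by (simp add: w_def norm_divide dist_norm norm_minus_commute)
  have w1: "norm w < 1" unfolding nw using z R by (subst divide_less_eq_1_pos) linarith+
  have "norm (\<phi> w) \<le> norm w"
  proof (rule Schwarz_Lemma(1)[OF _ _ _ w1])
    have "(\<lambda>w. h (c + of_real R * w)) holomorphic_on ball 0 1"
      by (rule holomorphic_on_compose_gen[OF _ holh, unfolded o_def])
         (use inb in \<open>auto intro!: holomorphic_intros\<close>)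
    then show "\<phi> holomorphic_on ball 0 1" unfolding \<phi>_def
      using nz by (intro holomorphic_intros) auto
    show "\<phi> 0 = 0" by (simp add: \<phi>_def hc)
    fix v :: complex assume v: "norm v < 1"
    define q where "q = h (c + of_real R * v)"
    have q: "Re q < A" using Re_h[OF inb[OF v]] by (simp add: q_def)
    have "(norm q)\<^sup>2 < (norm (2 * of_real A - q))\<^sup>2"
    proof -
      have "(norm (2 * of_real A - q))\<^sup>2 - (norm q)\<^sup>2 = 4 * A * (A - Re q)"
        unfolding cmod_power2 by (simp add: power2_eq_square algebra_simps)
      moreover have "4 * A * (A - Re q) > 0" using A q by simp
      ultimately show ?thesis by simp
    qed
    then have "norm q < norm (2 * of_real A - q)" by (rule power2_less_imp_less) simp
    then show "norm (\<phi> v) < 1" unfolding \<phi>_def q_def[symmetric] norm_divide by (simp add: divide_simps)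
  qed
  then have "norm (h z) \<le> norm w * norm (2 * of_real A - h z)"
    using nz[OF w1] unfolding \<phi>_def zw[symmetric] norm_divide by (simp add: divide_simps)
  also have "\<dots> \<le> norm w * (2 * A + norm (h z))"
    using norm_triangle_ineq4[of "2 * of_real A" "h z"] A by (intro mult_left_mono) (auto simp: norm_mult)
  also have "\<dots> \<le> r / R * (2 * A + norm (h z))"
    unfolding nw using z R A by (intro mult_right_mono divide_right_mono) auto
  finally have "R * norm (h z) \<le> r * (2 * A + norm (h z))" using R by (simp add: field_simps)
  then have "norm (h z) * (R - r) \<le> 2 * A * r" by (simp add: algebra_simps)
  then show ?thesis using z by (simp add: pos_le_divide_eq)
qed

text \<open>A logarithm \<open>h\<close> of f / f(c) exists on the disc and has Re h < A.
  Borel-Caratheodory bounds |h|: through the real part this gives the lower bound for |f|, and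
  through Cauchy's inequality on a circle of radius (R - r) / 2 the bound for h' = f'/f.\<close>

lemma zero_free_disc_bounds:
  fixes f :: "complex \<Rightarrow> complex"
  assumes holf: "f holomorphic_on ball c R" and nz: "\<And>z. z \<in> ball c R \<Longrightarrow> f z \<noteq> 0"
    and bd: "\<And>z. z \<in> ball c R \<Longrightarrow> norm (f z) < norm (f c) * exp A"
    and z: "dist c z \<le> r" "r < R"
  shows "norm (f z) \<ge> norm (f c) * exp (- (2 * A * r / (R - r)))"
    and "norm (deriv f z / f z) \<le> 8 * A * R / (R - r)\<^sup>2"
proof -
  have r: "r \<ge> 0" using z zero_le_dist[of c z] by linarith
  have R: "R > 0" using z r by linarith
  have cR: "c \<in> ball c R" using R by simp
  obtain g where g: "g holomorphic_on ball c R" "\<And>x. x \<in> ball c R \<Longrightarrow> exp (g x) = f x"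
    using holomorphic_logarithm_exists[of "ball c R" f c] holf nz R by auto
  define h where "h = (\<lambda>x. g x - g c)"
  have holh: "h holomorphic_on ball c R" unfolding h_def by (intro holomorphic_intros g)
  have eh: "exp (h x) = f x / f c" if "x \<in> ball c R" for x
    using g(2)[OF that] g(2)[OF cR] by (simp add: h_def exp_diff)
  have Re_h: "Re (h x) < A" if "x \<in> ball c R" for x
  proof -
    have "exp (Re (h x)) = norm (f x) / norm (f c)" using eh[OF that] by (metis norm_exp_eq_Re norm_divide)
    also have "\<dots> < exp A" using bd[OF that] nz[OF cR] by (simp add: pos_divide_less_eq mult.commute)
    finally show ?thesis by simp
  qed
  have A: "A > 0" using Re_h[OF cR] by (simp add: h_def)
  have bc: "norm (h x) \<le> 2 * A * q / (R - q)" if "dist c x \<le> q" "q < R" for x q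
    by (rule borel_caratheodory[OF holh _ Re_h that]) (simp_all add: h_def)
  have zR: "z \<in> ball c R" using z by simp
  have "- (2 * A * r / (R - r)) \<le> Re (h z)"
    using bc[OF z] abs_Re_le_cmod[of "h z"] by linarith
  then have "exp (- (2 * A * r / (R - r))) \<le> exp (Re (h z))" by simp
  also have "\<dots> = norm (f z) / norm (f c)" using eh[OF zR] by (metis norm_exp_eq_Re norm_divide)
  finally show "norm (f z) \<ge> norm (f c) * exp (- (2 * A * r / (R - r)))"
    using nz[OF cR] by (simp add: pos_le_divide_eq mult.commute)
  define d where "d = (R - r) / 2"
  have d: "d > 0" using z by (simp add: d_def)
  have sub: "dist c x \<le> (R + r) / 2" if "dist z x \<le> d" for x
    using dist_triangle[of c x z] that z by (simp add: d_def field_simps)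
  have subR: "cball z d \<subseteq> ball c R"
  proof
    fix x assume "x \<in> cball z d"
    then have "dist c x \<le> (R + r) / 2" using sub by simp
    then show "x \<in> ball c R" using z by simp
  qed
  have "norm ((deriv ^^ 1) h z) \<le> fact 1 * (4 * A * R / (R - r)) / d ^ 1"
  proof (rule Cauchy_inequality)
    show "h holomorphic_on ball z d" using holomorphic_on_subset[OF holh] subR ball_subset_cball by blast
    show "continuous_on (cball z d) h" using holomorphic_on_imp_continuous_on[OF holomorphic_on_subset[OF holh subR]] .
    show "d > 0" by (rule d)
    fix x assume "norm (z - x) = d"
    then have "dist z x \<le> d" by (simp add: dist_norm)
    from bc[OF sub[OF this]] z have "norm (h x) \<le> 2 * A * ((R + r) / 2) / (R - (R + r) / 2)" by simp
    also have "\<dots> = 2 * A * (R + r) / (R - r)" using z by (simp add: field_simps)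
    also have "\<dots> \<le> 4 * A * R / (R - r)" using z A r by (intro divide_right_mono) (auto simp: algebra_simps)
    finally show "norm (h x) \<le> 4 * A * R / (R - r)" .
  qed
  also have "fact 1 * (4 * A * R / (R - r)) / d ^ 1 = 8 * A * R / (R - r)\<^sup>2"
    using z by (simp add: d_def power2_eq_square field_simps)
  finally have dh: "norm (deriv h z) \<le> 8 * A * R / (R - r)\<^sup>2" by simp
  have "((\<lambda>x. exp (h x)) has_field_derivative exp (h z) * deriv h z) (at z)"
    using holomorphic_derivI[OF holh open_ball zR] by (auto intro!: derivative_eq_intros)
  moreover have "eventually (\<lambda>x. x \<in> ball c R) (nhds z)" using zR by (intro eventually_nhds_in_open) auto
  then have "eventually (\<lambda>x. exp (h x) = f x / f c) (nhds z)" by eventually_elim (simp add: eh)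
  ultimately have "((\<lambda>x. f x / f c) has_field_derivative exp (h z) * deriv h z) (at z)"
    by (subst (asm) DERIV_cong_ev) auto
  moreover have "((\<lambda>x. f x / f c) has_field_derivative deriv f z / f c) (at z)"
    using DERIV_cdivide[OF holomorphic_derivI[OF holf open_ball zR]] by simp
  ultimately have "deriv f z / f c = f z / f c * deriv h z" using eh[OF zR] DERIV_unique by metis
  then have "deriv f z / f z = deriv h z" using nz[OF cR] nz[OF zR] by (simp add: field_simps)
  with dh show "norm (deriv f z / f z) \<le> 8 * A * R / (R - r)\<^sup>2" by simp
qed

text \<open>Each zero is divided out by a Blaschke factor, which has modulus one on the outer circle.\<close>

lemma card_zeros_bound_0:
  fixes f :: "complex \<Rightarrow> complex"
  assumes "finite Z" and S: "open S" "cball 0 R \<subseteq> S" and r: "0 < r" "r < R"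
    and "f holomorphic_on S" and "\<And>z. z \<in> Z \<Longrightarrow> norm z \<le> r \<and> f z = 0"
    and "\<And>z. norm z = R \<Longrightarrow> norm (f z) \<le> M"
  shows "norm (f 0) * (R / r) ^ card Z \<le> M"
  using assms(1,6,7,8)
proof (induction Z arbitrary: f rule: finite_induct)
  case empty
  have "norm (f 0) \<le> M"
  proof (rule maximum_modulus_frontier[of f "cball 0 R"])
    show "f holomorphic_on interior (cball 0 R)"
      using holomorphic_on_subset[OF empty(1)] S(2) interior_subset by blast
    show "continuous_on (closure (cball 0 R)) f"
      using holomorphic_on_imp_continuous_on[OF holomorphic_on_subset[OF empty(1) S(2)]] by simp
  qed (use empty r in \<open>auto simp: frontier_cball\<close>)
  then show ?case by simp
next
  case (insert a Z)
  define g where "g = (\<lambda>z. if z = a then deriv f a else (f z - f a) / (z - a))"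
  have fa: "f a = 0" "norm a \<le> r" using insert by auto
  have g: "g holomorphic_on S" unfolding g_def by (rule pole_lemma_open[OF insert(4) S(1)])
  have fg: "f z = (z - a) * g z" for z using fa by (simp add: g_def)
  define f1 where "f1 = (\<lambda>z. g z * ((of_real (R\<^sup>2) - cnj a * z) / of_real R))"
  have "norm (f1 0) * (R / r) ^ card Z \<le> M"
  proof (rule insert.IH)
    show "f1 holomorphic_on S" unfolding f1_def using r by (intro holomorphic_intros g) auto
    show "norm z \<le> r \<and> f1 z = 0" if "z \<in> Z" for z
      using insert(5)[of z] that insert(2) fa(1) by (auto simp: f1_def g_def)
    fix z :: complex assume z: "norm z = R"
    have "of_real (R\<^sup>2) = z * cnj z" using z by (simp add: complex_norm_square[symmetric])
    then have "of_real (R\<^sup>2) - cnj a * z = z * cnj (z - a)" by (simp add: algebra_simps)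
    then have "norm (of_real (R\<^sup>2) - cnj a * z) = R * norm (z - a)" using z by (simp only: norm_mult complex_mod_cnj)
    then have "norm (f1 z) = norm (f z)" using r unfolding f1_def fg[of z] norm_mult norm_divide by simp
    then show "norm (f1 z) \<le> M" using insert(6)[OF z] by simp
  qed
  \<comment> \<open>At the centre the exchange of factors multiplies |f| by R / |a| >= R / r (for a
    = 0 the left side is 0). This gain per zero is what gets counted.\<close>
  moreover have "norm (f 0) * (R / r) \<le> norm (f1 0)"
  proof -
    have "norm (f 0) = norm a * norm (g 0)" using fg[of 0] by (simp add: norm_mult)
    also have "\<dots> \<le> r * norm (g 0)" using fa by (intro mult_right_mono) auto
    finally have "norm (f 0) * (R / r) \<le> r * norm (g 0) * (R / r)" using r by (intro mult_right_mono) auto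
    also have "\<dots> = norm (f1 0)" using r by (simp add: f1_def norm_mult norm_divide norm_power power2_eq_square)
    finally show ?thesis .
  qed
  then have "norm (f 0) * (R / r) * (R / r) ^ card Z \<le> norm (f1 0) * (R / r) ^ card Z"
    using r by (intro mult_right_mono) auto
  ultimately show ?case using insert(1,2) by (simp add: mult.assoc)
qed

lemma card_zeros_bound:
  fixes f :: "complex \<Rightarrow> complex"
  assumes "finite Z" and S: "open S" "cball c R \<subseteq> S" and r: "0 < r" "r < R"
    and f: "f holomorphic_on S" "\<And>z. z \<in> Z \<Longrightarrow> dist c z \<le> r \<and> f z = 0"
    and M: "\<And>z. dist c z = R \<Longrightarrow> norm (f z) \<le> M"
  shows "norm (f c) * (R / r) ^ card Z \<le> M"
proof -
  have "norm (f (c + 0)) * (R / r) ^ card ((\<lambda>z. z - c) ` Z) \<le> M"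
  proof (rule card_zeros_bound_0[where S = "(\<lambda>z. z - c) ` S"])
    show "open ((\<lambda>z. z - c) ` S)" using open_translation_subtract[OF S(1)] .
    show "cball 0 R \<subseteq> (\<lambda>z. z - c) ` S"
    proof
      fix x :: complex assume "x \<in> cball 0 R"
      then have "c + x \<in> S" using S(2) by (auto simp: dist_norm)
      then show "x \<in> (\<lambda>z. z - c) ` S" by (intro image_eqI[of _ _ "c + x"]) auto
    qed
    show "(\<lambda>x. f (c + x)) holomorphic_on (\<lambda>z. z - c) ` S"
      by (rule holomorphic_on_compose_gen[OF _ f(1), unfolded o_def]) (auto intro!: holomorphic_intros)
    show "norm z \<le> r \<and> f (c + z) = 0" if "z \<in> (\<lambda>z. z - c) ` Z" for z
      using that f(2) by (auto simp: dist_norm norm_minus_commute)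
    show "norm (f (c + z)) \<le> M" if "norm z = R" for z using M[of "c + z"] that by (simp add: dist_norm)
  qed (use assms in auto)
  moreover have "card ((\<lambda>z. z - c) ` Z) = card Z" by (intro card_image) (auto simp: inj_on_def)
  ultimately show ?thesis by simp
qed

section \<open>Zeros and the logarithmic derivative near a given height\<close>

lemma RH_zeta_nonzero:
  assumes "Riemann_hypothesis" "Re s > 1 / 2" "Im s \<noteq> 0"
  shows "zeta s \<noteq> 0"
proof -
  consider "Re s < 1" | "Re s = 1" | "Re s > 1" by linarith
  then show ?thesis
  proof cases
    case 1
    have "Re s > 0" "Re s \<noteq> 1 / 2" using assms(2) by auto
    then show ?thesis using 1 assms(1) unfolding Riemann_hypothesis_def by blast
  next
    case 2
    then have "s = Complex 1 (Im s)" by (simp add: complex_eq_iff)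
    then show ?thesis using zeta_nonzero_Re_1[of "Im s"] assms by metis
  next
    case 3
    then show ?thesis by (rule zeta_nonzero_gt_1)
  qed
qed

text \<open>The radius 39/20 keeps the disc inside Re z > 1/20, within reach of
  \<open>zeta_growth\<close>, yet takes it well past the critical line. The bound is relative to the
  value at the centre, the form in which the disc lemmas want it; constants are absorbed by ln y >=
  1.\<close>

lemma zeta_disc_bound:
  obtains K where "K > 0" "\<And>y z. y \<ge> 4 \<Longrightarrow> dist (Complex 2 y) z < 39 / 20 \<Longrightarrow> norm (zeta z) < norm (zeta (Complex 2 y)) * exp (K * ln y)"
proof -
  obtain C where C: "C > 0" "\<And>s. 1 / 20 \<le> Re s \<Longrightarrow> Re s \<le> 4 \<Longrightarrow> \<bar>Im s\<bar> \<ge> 1 \<Longrightarrow> norm (zeta s) \<le> C * \<bar>Im s\<bar>"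
    by (rule zeta_growth) blast
  define K where "K = 1 + ln (8 * (C + 1))"
  have K: "K > 0" using C by (simp add: K_def add_pos_nonneg)
  show ?thesis
  proof (rule that[OF K])
    fix y :: real and z assume y: "y \<ge> 4" and z: "dist (Complex 2 y) z < 39 / 20"
    have "\<bar>2 - Re z\<bar> < 39 / 20" "\<bar>y - Im z\<bar> < 39 / 20"
      using z abs_Re_le_cmod[of "Complex 2 y - z"] abs_Im_le_cmod[of "Complex 2 y - z"] by (auto simp: dist_norm)
    then have zz: "1 / 20 \<le> Re z" "Re z \<le> 4" "\<bar>Im z\<bar> \<ge> 1" "\<bar>Im z\<bar> \<le> 2 * y" using y by linarith+
    have "norm (zeta z) \<le> C * \<bar>Im z\<bar>" using C zz by auto
    also have "\<dots> \<le> C * (2 * y)" using C zz by (intro mult_left_mono) auto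
    also have "\<dots> < (C + 1) * (2 * y)" using y by simp
    also have "\<dots> = 1 / 4 * (8 * (C + 1) * y)" by simp
    also have "\<dots> \<le> norm (zeta (Complex 2 y)) * (8 * (C + 1) * y)"
      using norm_zeta_two_ge C y by (intro mult_right_mono) auto
    also have "8 * (C + 1) * y = exp (ln (8 * (C + 1)) + ln y)" using C y by (simp add: exp_add)
    also have "\<dots> \<le> exp (K * ln y)"
    proof -
      have "ln y \<ge> 1"
      proof -
        have "exp 1 \<le> y" using y exp_le by linarith
        then show ?thesis using y by (subst ln_ge_iff) auto
      qed
      moreover have "ln (8 * (C + 1)) \<ge> 0" using C by simp
      ultimately have "ln (8 * (C + 1)) * 1 \<le> ln (8 * (C + 1)) * ln y" by (intro mult_left_mono)
      then show ?thesis by (simp add: K_def algebra_simps)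
    qed
    finally show "norm (zeta z) < norm (zeta (Complex 2 y)) * exp (K * ln y)"
      by (simp add: mult_left_mono)
  qed
qed

text \<open>A Jensen-type count. The zeros lie within sqrt (9/4 + 1/4) < 8/5 of 2 + i y and zeta is
  bounded on the radius 19/10, so each zero costs a factor 19/16. Counting distinct ordinates is
  enough, as the aim is a gap between them.\<close>

lemma card_critical_zeros_bound:
  obtains K where "K > 0" "\<And>y X. y \<ge> 4 \<Longrightarrow> finite X \<Longrightarrow> (\<And>t. t \<in> X \<Longrightarrow> \<bar>t - y\<bar> \<le> 1 / 2 \<and> zeta (Complex (1 / 2) t) = 0) \<Longrightarrow> real (card X) \<le> K * ln y"
proof -
  obtain K where K: "K > 0" "\<And>y z. y \<ge> 4 \<Longrightarrow> dist (Complex 2 y) z < 39 / 20 \<Longrightarrow> norm (zeta z) < norm (zeta (Complex 2 y)) * exp (K * ln y)"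
    by (rule zeta_disc_bound) blast
  define q where "q = ln (19 / 16 :: real)"
  have q: "q > 0" by (simp add: q_def)
  show ?thesis
  proof (rule that[of "K / q"])
    show "K / q > 0" using K q by simp
  next
    fix y :: real and X assume y: "y \<ge> 4" and X: "finite X" "\<And>t. t \<in> X \<Longrightarrow> \<bar>t - y\<bar> \<le> 1 / 2 \<and> zeta (Complex (1 / 2) t) = 0"
    let ?c = "Complex 2 y"
    have one: "1 \<notin> ball ?c (39 / 20)"
    proof
      assume "1 \<in> ball ?c (39 / 20)"
      then have "norm (?c - 1) < 39 / 20" by (simp add: dist_norm)
      then show False using abs_Im_le_cmod[of "?c - 1"] y by simp
    qed
    have "norm (zeta ?c) * ((19 / 10) / (8 / 5)) ^ card (Complex (1 / 2) ` X) \<le> norm (zeta ?c) * exp (K * ln y)"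
    proof (rule card_zeros_bound[where S = "ball ?c (39 / 20)" and f = zeta and c = ?c])
      show "finite (Complex (1 / 2) ` X)" using X(1) by simp
      show "cball ?c (19 / 10) \<subseteq> ball ?c (39 / 20)" by auto
      show "zeta holomorphic_on ball ?c (39 / 20)" by (rule holomorphic_on_subset[OF holomorphic_zeta]) (use one in auto)
      show "dist ?c z \<le> 8 / 5 \<and> zeta z = 0" if zX: "z \<in> Complex (1 / 2) ` X" for z
      proof -
        obtain t where t: "t \<in> X" "z = Complex (1 / 2) t" using zX by auto
        have "(y - t)\<^sup>2 \<le> (1 / 2)\<^sup>2" using X(2)[OF t(1)] by (intro abs_le_square_iff[THEN iffD1]) (auto simp: abs_minus_commute)
        then have "(dist ?c z)\<^sup>2 \<le> (8 / 5)\<^sup>2" unfolding t dist_norm cmod_power2 by (simp add: power2_eq_square)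
        then have "dist ?c z \<le> 8 / 5" by (rule power2_le_imp_le) simp
        then show ?thesis using X(2)[OF t(1)] t by simp
      qed
      show "norm (zeta z) \<le> norm (zeta ?c) * exp (K * ln y)" if "dist ?c z = 19 / 10" for z
        using K(2)[OF y, of z] that by simp
    qed auto
    moreover have "card (Complex (1 / 2) ` X) = card X" by (intro card_image) (auto simp: inj_on_def)
    moreover have "norm (zeta ?c) > 0" using norm_zeta_two_ge[of y] by linarith
    ultimately have "(19 / 16) ^ card X \<le> exp (K * ln y)" by simp
    then have "exp (real (card X) * q) \<le> exp (K * ln y)"
      by (simp add: q_def exp_of_nat_mult)
    then show "real (card X) \<le> K / q * ln y" using q by (simp add: field_simps)
  qed
qed

text \<open>Pigeonhole: \<open>m\<close> test heights at spacing 2 \<eta> cannot all have a zero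
  within \<eta>, since different heights would have different zeros and \<open>m\<close> exceeds the
  possible number of them. So some height keeps a distance of order 1 / ln y from all zeros.\<close>

lemma good_height:
  obtains K where "K > 1" "\<And>y. y \<ge> 4 \<Longrightarrow> \<exists>u\<in>{y..y + 1 / 4}. \<forall>t. zeta (Complex (1 / 2) t) = 0 \<longrightarrow> \<bar>t - u\<bar> \<ge> 1 / (K * ln y)"
proof -
  obtain K where K: "K > 0" "\<And>y X. y \<ge> 4 \<Longrightarrow> finite X \<Longrightarrow> (\<And>t. t \<in> X \<Longrightarrow> \<bar>t - y\<bar> \<le> 1 / 2 \<and> zeta (Complex (1 / 2) t) = 0) \<Longrightarrow> real (card X) \<le> K * ln y"
    by (rule card_critical_zeros_bound) blast
  show ?thesis
  proof (rule that[of "8 * (K + 1)"])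
    show "8 * (K + 1) > 1" using K by simp
    fix y :: real assume y: "y \<ge> 4"
    have ln1: "ln y \<ge> 1"
    proof -
      have "exp 1 \<le> y" using y exp_le by linarith
      then show ?thesis using y by (subst ln_ge_iff) auto
    qed
    define m where "m = nat \<lfloor>K * ln y\<rfloor> + 1"
    have m: "real m > K * ln y" "real m \<le> K * ln y + 1" "m > 0"
      using K ln1 unfolding m_def by (auto simp: of_nat_nat, linarith+)
    \<comment> \<open>Chosen so that \<open>m\<close> steps of length 2 \<eta> fill exactly the
      interval of length 1/4.\<close>
    define \<eta> where "\<eta> = 1 / (8 * real m)"
    have \<eta>: "\<eta> > 0" using m by (simp add: \<eta>_def)
    have "real m \<le> (K + 1) * ln y" using m(2) ln1 by (simp add: algebra_simps)
    then have \<eta>1: "1 / (8 * (K + 1) * ln y) \<le> \<eta>" unfolding \<eta>_def using m(3) K(1) ln1 by (intro divide_left_mono mult_pos_pos) (auto simp: algebra_simps)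
    show "\<exists>u\<in>{y..y + 1 / 4}. \<forall>t. zeta (Complex (1 / 2) t) = 0 \<longrightarrow> \<bar>t - u\<bar> \<ge> 1 / (8 * (K + 1) * ln y)"
    proof (rule ccontr)
      assume neg: "\<not> ?thesis"
      define u where "u = (\<lambda>j. y + 2 * \<eta> * real j)"
      have u: "u j \<in> {y..y + 1 / 4}" if "j < m" for j
      proof -
        have "2 * \<eta> * real j \<le> 2 * \<eta> * real m" using that \<eta> by (intro mult_left_mono) auto
        also have "\<dots> = 1 / 4" using m by (simp add: \<eta>_def)
        finally show ?thesis using \<eta> by (simp add: u_def)
      qed
      have "\<exists>t. zeta (Complex (1 / 2) t) = 0 \<and> \<bar>t - u j\<bar> < \<eta>" if "j < m" for j
      proof -
        obtain t where "zeta (Complex (1 / 2) t) = 0" "\<bar>t - u j\<bar> < 1 / (8 * (K + 1) * ln y)"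
          using neg u[OF \<open>j < m\<close>] by (meson not_le)
        then show ?thesis using \<eta>1 by (intro exI[of _ t]) linarith
      qed
      then obtain t where t: "\<And>j. j < m \<Longrightarrow> zeta (Complex (1 / 2) (t j)) = 0 \<and> \<bar>t j - u j\<bar> < \<eta>" by metis
      have inj: "inj_on t {..<m}"
      proof (rule inj_onI, rule ccontr)
        fix i j assume ij: "i \<in> {..<m}" "j \<in> {..<m}" "t i = t j" "i \<noteq> j"
        have "\<bar>u i - u j\<bar> < 2 * \<eta>" using t[of i] t[of j] ij by auto
        moreover have "\<bar>u i - u j\<bar> = 2 * \<eta> * \<bar>real i - real j\<bar>"
          using \<eta> by (simp add: u_def abs_mult right_diff_distrib[symmetric])
        moreover have "\<bar>real i - real j\<bar> \<ge> 1" using ij(4) by linarith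
        ultimately show False using \<eta> by (smt (verit) mult_le_cancel_left1)
      qed
      have "real (card (t ` {..<m})) \<le> K * ln y"
      proof (rule K(2)[OF y])
        fix x assume "x \<in> t ` {..<m}"
        then obtain j where j: "j < m" "x = t j" by auto
        have "\<eta> \<le> 1 / 8" using m by (simp add: \<eta>_def)
        moreover have "\<bar>x - u j\<bar> < \<eta>" "y \<le> u j" "u j \<le> y + 1 / 4" using t[OF j(1)] u[OF j(1)] j(2) by auto
        ultimately have "\<bar>x - y\<bar> \<le> 1 / 2" by linarith
        then show "\<bar>x - y\<bar> \<le> 1 / 2 \<and> zeta (Complex (1 / 2) x) = 0" using t[OF j(1)] j(2) by simp
      qed simp
      then show False using m(1) card_image[OF inj] by simp
    qed
  qed
qed

text \<open>Under RH the disc of radius 3/2 about 2 + i y is free of zeros, but it only touches the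
  critical line. Near the line a second disc is used, with centre 1/2 + \<eta>/4 + i y and radius 3
  \<eta>/4, kept free of zeros by the gap \<eta> between y and their ordinates; the first disc
  bounds zeta from below at its centre. The small radii cost the factor \<eta>^(-2).\<close>

lemma zeta_log_deriv_horizontal_bound:
  assumes RH: "Riemann_hypothesis"
  obtains K where "K > 0" "\<And>y \<eta> \<sigma>. y \<ge> 4 \<Longrightarrow> 0 < \<eta> \<Longrightarrow> \<eta> \<le> 1 / 4 \<Longrightarrow> (\<And>t. zeta (Complex (1 / 2) t) = 0 \<Longrightarrow> \<bar>t - y\<bar> \<ge> \<eta>)
     \<Longrightarrow> 1 / 2 \<le> \<sigma> \<Longrightarrow> \<sigma> \<le> 3 / 2 \<Longrightarrow> norm (deriv zeta (Complex \<sigma> y) / zeta (Complex \<sigma> y)) \<le> K * ln y / \<eta>\<^sup>2"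
proof -
  obtain K where K: "K > 0" "\<And>y z. y \<ge> 4 \<Longrightarrow> dist (Complex 2 y) z < 39 / 20 \<Longrightarrow> norm (zeta z) < norm (zeta (Complex 2 y)) * exp (K * ln y)"
    by (rule zeta_disc_bound) blast
  show ?thesis
  proof (rule that[of "312 * K"])
    \<comment> \<open>312 = 24 * 13 comes from the second disc; the first one gives only 48.\<close>
    show "312 * K > 0" using K by simp
    fix y \<eta> \<sigma> :: real assume y: "y \<ge> 4" and \<eta>: "0 < \<eta>" "\<eta> \<le> 1 / 4" and
      gap: "\<And>t. zeta (Complex (1 / 2) t) = 0 \<Longrightarrow> \<bar>t - y\<bar> \<ge> \<eta>" and \<sigma>: "1 / 2 \<le> \<sigma>" "\<sigma> \<le> 3 / 2"
    define A where "A = K * ln y"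
    have A: "A > 0" using K y by (simp add: A_def)
    let ?c = "Complex 2 y"
    have Im_ne: "Im z \<noteq> 0 \<and> z \<noteq> 1" if "dist (Complex x y) z < 2" for x z
    proof -
      have "\<bar>y - Im z\<bar> < 2" using that abs_Im_le_cmod[of "Complex x y - z"] by (simp add: dist_norm)
      then show ?thesis using y by auto
    qed
    have hol: "zeta holomorphic_on ball (Complex x y) R" if "R \<le> 2" for x R
      by (rule holomorphic_on_subset[OF holomorphic_zeta]) (use Im_ne[of x 1] that in auto)
    have nz0: "zeta z \<noteq> 0" if "z \<in> ball ?c (3 / 2)" for z
    proof (rule RH_zeta_nonzero[OF RH])
      show "Re z > 1 / 2" using that abs_Re_le_cmod[of "?c - z"] by (simp add: dist_norm)
      show "Im z \<noteq> 0" using Im_ne[of 2 z] that by auto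
    qed
    have bd0: "norm (zeta z) < norm (zeta ?c) * exp A" if "z \<in> ball ?c (3 / 2)" for z
      using K(2)[OF y, of z] that by (simp add: A_def)
    note D0 = zero_free_disc_bounds[OF hol[of "3/2" 2] nz0 bd0]
    show "norm (deriv zeta (Complex \<sigma> y) / zeta (Complex \<sigma> y)) \<le> 312 * K * ln y / \<eta>\<^sup>2"
    proof (cases "\<sigma> \<ge> 1 / 2 + \<eta> / 2")
      case True
      have d: "dist ?c (Complex \<sigma> y) \<le> 3 / 2 - \<eta> / 2"
      proof -
        have "?c - Complex \<sigma> y = of_real (2 - \<sigma>)" by (simp add: complex_eq_iff)
        then have "dist ?c (Complex \<sigma> y) = \<bar>2 - \<sigma>\<bar>" unfolding dist_norm by (metis norm_of_real)
        then show ?thesis using True \<sigma> by simp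
      qed
      have "norm (deriv zeta (Complex \<sigma> y) / zeta (Complex \<sigma> y)) \<le> 8 * A * (3 / 2) / (3 / 2 - (3 / 2 - \<eta> / 2))\<^sup>2"
        by (rule D0(2)[OF _ _ _ d]) (use \<eta> in auto)
      also have "\<dots> = 48 * A / \<eta>\<^sup>2" by (simp add: power_divide)
      also have "\<dots> \<le> 312 * A / \<eta>\<^sup>2" using A by (intro divide_right_mono) auto
      finally show ?thesis by (simp add: A_def)
    next
      case False
      define c1 where "c1 = Complex (1 / 2 + \<eta> / 4) y"
      have d1: "dist ?c c1 \<le> 3 / 2 - \<eta> / 4"
      proof -
        have "?c - c1 = of_real (3 / 2 - \<eta> / 4)" by (simp add: complex_eq_iff c1_def)
        then have "dist ?c c1 = \<bar>3 / 2 - \<eta> / 4\<bar>" unfolding dist_norm by (metis norm_of_real)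
        then show ?thesis using \<eta> by simp
      qed
      have "norm (zeta ?c) * exp (- (2 * A * (3 / 2 - \<eta> / 4) / (3 / 2 - (3 / 2 - \<eta> / 4)))) \<le> norm (zeta c1)"
        by (rule D0(1)[OF _ _ _ d1]) (use \<eta> in auto)
      moreover have "2 * A * (3 / 2 - \<eta> / 4) / (3 / 2 - (3 / 2 - \<eta> / 4)) \<le> 12 * A / \<eta>"
      proof -
        have "2 * A * (3 / 2 - \<eta> / 4) / (3 / 2 - (3 / 2 - \<eta> / 4)) = 8 * A * (3 / 2 - \<eta> / 4) / \<eta>" using \<eta> by (simp add: field_simps)
        also have "\<dots> \<le> 12 * A / \<eta>" using \<eta> A by (intro divide_right_mono) auto
        finally show ?thesis .
      qed
      then have "norm (zeta ?c) * exp (- (12 * A / \<eta>)) \<le> norm (zeta ?c) * exp (- (2 * A * (3 / 2 - \<eta> / 4) / (3 / 2 - (3 / 2 - \<eta> / 4))))"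
        by (intro mult_left_mono) auto
      ultimately have c1: "norm (zeta ?c) * exp (- (12 * A / \<eta>)) \<le> norm (zeta c1)" by linarith
      \<comment> \<open>Relative to the new centre, the growth exponent is \<open>A\<close> plus the
        12 * A / \<eta> that zeta may have lost on the way from 2 + i y to
        \<open>c1\<close>.\<close>
      define A1 where "A1 = A + 12 * A / \<eta>"
      have d2: "dist c1 (Complex \<sigma> y) \<le> \<eta> / 4"
      proof -
        have "c1 - Complex \<sigma> y = of_real (1 / 2 + \<eta> / 4 - \<sigma>)" by (simp add: complex_eq_iff c1_def)
        then have "dist c1 (Complex \<sigma> y) = \<bar>1 / 2 + \<eta> / 4 - \<sigma>\<bar>" unfolding dist_norm by (metis norm_of_real)
        moreover have "\<bar>1 / 2 + \<eta> / 4 - \<sigma>\<bar> \<le> \<eta> / 4" using False \<sigma> \<eta> by linarith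
        ultimately show ?thesis by simp
      qed
      have "norm (deriv zeta (Complex \<sigma> y) / zeta (Complex \<sigma> y)) \<le> 8 * A1 * (3 * \<eta> / 4) / (3 * \<eta> / 4 - \<eta> / 4)\<^sup>2"
      proof (rule zero_free_disc_bounds(2)[OF _ _ _ d2])
        show "zeta holomorphic_on ball c1 (3 * \<eta> / 4)" unfolding c1_def by (rule hol) (use \<eta> in simp)
        fix z assume z: "z \<in> ball c1 (3 * \<eta> / 4)"
        then have zI: "\<bar>y - Im z\<bar> < 3 * \<eta> / 4" and zR: "\<bar>1 / 2 + \<eta> / 4 - Re z\<bar> < 3 * \<eta> / 4"
          using abs_Im_le_cmod[of "c1 - z"] abs_Re_le_cmod[of "c1 - z"] by (auto simp: dist_norm c1_def)
        show "zeta z \<noteq> 0"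
        proof
          assume 0: "zeta z = 0"
          have "0 < Re z" "Re z < 1" using zR \<eta> by linarith+
          then have "Re z = 1 / 2" using RH 0 unfolding Riemann_hypothesis_def by blast
          then have "z = Complex (1 / 2) (Im z)" by (simp add: complex_eq_iff)
          then have "\<bar>Im z - y\<bar> \<ge> \<eta>" using gap[of "Im z"] 0 by metis
          then show False using zI \<eta> by linarith
        qed
        have "dist ?c z \<le> dist ?c c1 + dist c1 z" by (rule dist_triangle)
        also have "\<dots> < 39 / 20" using d1 z \<eta> by simp
        finally have "norm (zeta z) < norm (zeta ?c) * exp A" using K(2)[OF y, of z] by (simp add: A_def)
        also have "\<dots> = norm (zeta ?c) * exp (- (12 * A / \<eta>)) * exp A1" by (simp add: A1_def mult.assoc exp_add[symmetric])
        also have "\<dots> \<le> norm (zeta c1) * exp A1" using c1 by (intro mult_right_mono) auto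
        finally show "norm (zeta z) < norm (zeta c1) * exp A1" .
      qed (use \<eta> in auto)
      also have "\<dots> = 24 * A1 / \<eta>" using \<eta> by (simp add: power2_eq_square field_simps)
      also have "A1 \<le> 13 * A / \<eta>"
      proof -
        have "A \<le> A / \<eta>" using A \<eta> by (simp add: pos_le_divide_eq)
        then show ?thesis unfolding A1_def by simp
      qed
      then have "24 * A1 / \<eta> \<le> 24 * (13 * A / \<eta>) / \<eta>" using \<eta> by (intro divide_right_mono mult_left_mono) auto
      also have "24 * (13 * A / \<eta>) / \<eta> = 312 * A / \<eta>\<^sup>2" by (simp add: power2_eq_square)
      finally show ?thesis by (simp add: A_def)
    qed
  qed
qed

section \<open>The function theta and Gram points\<close>

definition arch_log_deriv :: "complex \<Rightarrow> complex" where
  "arch_log_deriv s = (Digamma (s / 2) - of_real (ln pi)) / 2"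

text \<open>A holomorphic logarithm of the archimedean factor on Re s > 0. Along the critical line
  its imaginary part is a continuous branch of the argument, so \<open>theta\<close> is a difference
  of two of its values.\<close>

definition arch_log :: "complex \<Rightarrow> complex" where
  "arch_log s = ln_Gamma (s / 2) - s / 2 * of_real (ln pi)"

lemma half_notin_nonpos_Reals: "Re s > 0 \<Longrightarrow> s / 2 \<notin> \<real>\<^sub>\<le>\<^sub>0"
  by (auto simp: complex_nonpos_Reals_iff)

lemma exp_arch_log:
  assumes "Re s > 0"
  shows "exp (arch_log s) = of_real pi powr (- s / 2) * Gamma (s / 2)"
proof -
  have "exp (ln_Gamma (s / 2)) = Gamma (s / 2)"
    using half_notin_nonpos_Reals[OF assms] nonpos_Ints_subset_nonpos_Reals by (auto simp: Gamma_complex_altdef)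
  moreover have "of_real pi powr (- s / 2) = exp (- (s / 2 * of_real (ln pi)))"
    by (simp add: powr_def Ln_of_real)
  moreover have "exp (arch_log s) = exp (ln_Gamma (s / 2)) * exp (- (s / 2 * of_real (ln pi)))"
    unfolding arch_log_def exp_add[symmetric] by (simp only: add_uminus_conv_diff)
  ultimately show ?thesis by (simp only: mult.commute)
qed

lemma arch_log_has_field_derivative:
  assumes "Re s > 0"
  shows "(arch_log has_field_derivative arch_log_deriv s) (at s)"
proof -
  have "((\<lambda>s. ln_Gamma (s / 2)) has_field_derivative Digamma (s / 2) * (1 / 2)) (at s)"
    by (rule DERIV_chain2[OF has_field_derivative_ln_Gamma_complex]) (use half_notin_nonpos_Reals[OF assms] in \<open>auto intro!: derivative_eq_intros\<close>)
  then have "(arch_log has_field_derivative Digamma (s / 2) * (1 / 2) - 1 / 2 * of_real (ln pi)) (at s)"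
    unfolding arch_log_def
  proof (rule DERIV_diff)
    show "((\<lambda>s. s / 2 * complex_of_real (ln pi)) has_field_derivative 1 / 2 * of_real (ln pi)) (at s)"
      by (auto intro!: derivative_eq_intros)
  qed
  then show ?thesis by (simp add: arch_log_deriv_def field_simps)
qed

lemma holomorphic_arch_log_deriv: "arch_log_deriv holomorphic_on {s. Re s > 0}"
proof -
  have "arch_log holomorphic_on {s. Re s > 0}"
    using arch_log_has_field_derivative by (auto simp: holomorphic_on_open open_halfspace_Re_gt)
  then have "deriv arch_log holomorphic_on {s. Re s > 0}" by (intro holomorphic_deriv open_halfspace_Re_gt)
  moreover have "deriv arch_log s = arch_log_deriv s" if "s \<in> {s. Re s > 0}" for s
    using arch_log_has_field_derivative[of s] that by (simp add: DERIV_imp_deriv)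
  ultimately show ?thesis by (metis (no_types, lifting) holomorphic_cong)
qed

text \<open>Two branches differ by a continuous function with values in 2 \<pi> Z, hence by a
  constant. This makes the \<open>THE\<close> in \<open>arg_increment\<close> well defined for the
  path in question.\<close>

lemma continuous_Arg_unique:
  fixes \<phi> \<psi> :: "real \<Rightarrow> real"
  assumes "continuous_on {0..1} \<phi>" "continuous_on {0..1} \<psi>"
    and "\<And>u. u \<in> {0..1} \<Longrightarrow> is_Arg (f u) (\<phi> u) \<and> is_Arg (f u) (\<psi> u) \<and> f u \<noteq> 0"
  shows "\<phi> 1 - \<phi> 0 = \<psi> 1 - \<psi> 0"
proof -
  have "(\<lambda>u. \<phi> u - \<psi> u) constant_on {0..1}"
  proof (rule continuous_discrete_range_constant)
    show "continuous_on {0..1} (\<lambda>u. \<phi> u - \<psi> u)" by (intro continuous_intros assms)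
    have *: "\<exists>n::int. \<phi> u - \<psi> u = 2 * pi * of_int n" if "u \<in> {0..1}" for u
    proof -
      have "exp (\<i> * of_real (\<phi> u)) = exp (\<i> * of_real (\<psi> u))" using assms(3)[OF that] unfolding is_Arg_def
        by (metis mult_cancel_left norm_eq_zero of_real_eq_0_iff)
      then obtain n :: int where "\<i> * of_real (\<phi> u) = \<i> * of_real (\<psi> u) + of_real (of_int (2 * n) * pi) * \<i>"
        by (auto simp: exp_eq)
      then have "\<phi> u = \<psi> u + of_int (2 * n) * pi" by (simp add: complex_eq_iff)
      then show ?thesis by (intro exI[of _ n]) simp
    qed
    show "\<exists>e>0. \<forall>y. y \<in> {0..1} \<and> \<phi> y - \<psi> y \<noteq> \<phi> x - \<psi> x \<longrightarrow> e \<le> norm (\<phi> y - \<psi> y - (\<phi> x - \<psi> x))"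
      if x: "x \<in> {0..1}" for x
    proof (intro exI[of _ "2 * pi"] conjI allI impI)
      fix y assume y: "y \<in> {0..1} \<and> \<phi> y - \<psi> y \<noteq> \<phi> x - \<psi> x"
      obtain n where n: "\<phi> x - \<psi> x = 2 * pi * of_int n" using *[OF x] by blast
      obtain m where m: "\<phi> y - \<psi> y = 2 * pi * of_int m" using *[of y] y by blast
      have "m \<noteq> n" using n m y by auto
      then have "1 \<le> \<bar>real_of_int (m - n)\<bar>" by linarith
      then have "2 * pi * 1 \<le> 2 * pi * \<bar>real_of_int (m - n)\<bar>" by (intro mult_left_mono) auto
      also have "\<dots> = norm (\<phi> y - \<psi> y - (\<phi> x - \<psi> x))" unfolding n m by (simp add: abs_mult right_diff_distrib[symmetric])
      finally show "2 * pi \<le> norm (\<phi> y - \<psi> y - (\<phi> x - \<psi> x))" by simp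
    qed simp
  qed simp
  then obtain c where "\<And>u. u \<in> {0..1} \<Longrightarrow> \<phi> u - \<psi> u = c" unfolding constant_on_def by auto
  from this[of 0] this[of 1] show ?thesis by simp
qed

lemma theta_eq: "theta t = Im (arch_log (Complex (1 / 2) t)) - Im (arch_log (Complex (1 / 2) 0))"
proof -
  let ?f = "\<lambda>s. of_real pi powr (- s / 2) * Gamma (s / 2) :: complex"
  define p where "p = linepath (1 / 2) (Complex (1 / 2) t)"
  have p: "p u = Complex (1 / 2) (u * t)" for u
    by (simp add: p_def linepath_def complex_eq_iff field_simps)
  define \<phi> where "\<phi> = (\<lambda>u. Im (arch_log (p u)))"
  have fe: "?f (p u) = exp (arch_log (p u))" for u
    by (subst exp_arch_log) (auto simp: p)
  have cont: "continuous_on {0..1} \<phi>"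
  proof -
    have "continuous_on {s. Re s > 0} arch_log"
      using arch_log_has_field_derivative by (auto intro!: continuous_at_imp_continuous_on DERIV_isCont)
    then have "continuous_on {0..1} (\<lambda>u. arch_log (p u))"
      by (rule continuous_on_compose2) (auto simp: p intro!: continuous_intros)
    then show ?thesis unfolding \<phi>_def by (intro continuous_intros)
  qed
  have arg: "is_Arg (?f (p u)) (\<phi> u)" for u
  proof -
    have "exp (arch_log (p u)) = of_real (exp (Re (arch_log (p u)))) * exp (\<i> * of_real (Im (arch_log (p u))))"
      by (metis exp_eq_polar cis_conv_exp)
    then show ?thesis unfolding is_Arg_def fe \<phi>_def norm_exp_eq_Re .
  qed
  have "theta t = \<phi> 1 - \<phi> 0"
    unfolding theta_def arg_increment_def p_def[symmetric]
  proof (rule the_equality)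
    show "\<exists>\<phi>'. continuous_on {0..1} \<phi>' \<and> (\<forall>u\<in>{0..1}. is_Arg (?f (p u)) (\<phi>' u)) \<and> \<phi> 1 - \<phi> 0 = \<phi>' 1 - \<phi>' 0"
      using cont arg by blast
    fix d assume "\<exists>\<phi>'. continuous_on {0..1} \<phi>' \<and> (\<forall>u\<in>{0..1}. is_Arg (?f (p u)) (\<phi>' u)) \<and> d = \<phi>' 1 - \<phi>' 0"
    then obtain \<psi> where \<psi>: "continuous_on {0..1} \<psi>" "\<forall>u\<in>{0..1}. is_Arg (?f (p u)) (\<psi> u)" "d = \<psi> 1 - \<psi> 0" by blast
    have "\<psi> 1 - \<psi> 0 = \<phi> 1 - \<phi> 0"
      by (rule continuous_Arg_unique[where f = "\<lambda>u. ?f (p u)", OF \<psi>(1) cont]) (use \<psi> arg fe in auto)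
    then show "d = \<phi> 1 - \<phi> 0" using \<psi> by simp
  qed
  then show ?thesis by (simp add: \<phi>_def p)
qed

lemma theta_has_derivative: "(theta has_real_derivative Re (arch_log_deriv (Complex (1 / 2) t))) (at t)"
proof -
  have "((\<lambda>t. Complex (1 / 2) t) has_vector_derivative \<i>) (at t)"
    unfolding Complex_eq by (auto intro!: derivative_eq_intros has_vector_derivative_real_field simp: has_vector_derivative_def scaleR_conv_of_real)
  moreover have "(arch_log has_field_derivative arch_log_deriv (Complex (1 / 2) t)) (at (Complex (1 / 2) t))"
    by (rule arch_log_has_field_derivative) simp
  ultimately have "((\<lambda>t. arch_log (Complex (1 / 2) t)) has_vector_derivative (\<i> * arch_log_deriv (Complex (1 / 2) t))) (at t)"
    using field_vector_diff_chain_at[of "\<lambda>t. Complex (1 / 2) t" \<i> t arch_log] by (simp add: o_def)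
  then have "((\<lambda>t. Im (arch_log (Complex (1 / 2) t))) has_vector_derivative Im (\<i> * arch_log_deriv (Complex (1 / 2) t))) (at t)"
    by (rule bounded_linear.has_vector_derivative[OF bounded_linear_Im])
  then have "((\<lambda>t. Im (arch_log (Complex (1 / 2) t))) has_real_derivative Re (arch_log_deriv (Complex (1 / 2) t))) (at t)"
    by (simp add: has_real_derivative_iff_has_vector_derivative)
  then have "((\<lambda>t. Im (arch_log (Complex (1 / 2) t)) - Im (arch_log (Complex (1 / 2) 0))) has_real_derivative Re (arch_log_deriv (Complex (1 / 2) t)) - 0) (at t)"
    by (intro derivative_intros)
  then show ?thesis by (simp add: theta_eq[abs_def])
qed

lemma deriv_theta: "deriv theta t = Re (arch_log_deriv (Complex (1 / 2) t))"
  using theta_has_derivative by (rule DERIV_imp_deriv)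

text \<open>The real part of the Digamma series at 1/4 + i t/2. In a difference everything
  independent of t cancels, ln \<pi> and Euler's constant included, and the remaining terms increase
  with t >= 0; monotonicity and growth of the derivative can be read off.\<close>

lemma deriv_theta_diff_sums:
  fixes t u :: real
  defines "c \<equiv> \<lambda>k t. (t / 2)\<^sup>2 / ((1 / 4 + real k) * ((1 / 4 + real k)\<^sup>2 + (t / 2)\<^sup>2))"
  shows "(\<lambda>k. (c k t - c k u) / 2) sums (deriv theta t - deriv theta u)"
proof -
  have *: "(\<lambda>k. inverse (real (Suc k)) - Re (inverse (Complex (1 / 4) (v / 2) + of_nat k))) sums (2 * deriv theta v + ln pi + euler_mascheroni)" for v
  proof -
    define z where "z = Complex (1 / 4) (v / 2)"
    have "z \<noteq> 0" by (simp add: z_def complex_eq_iff)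
    from summable_sums[OF summable_Digamma[OF this]]
    have "(\<lambda>k. inverse (of_nat (Suc k)) - inverse (z + of_nat k)) sums (Digamma z + euler_mascheroni)"
      by (simp add: Digamma_def)
    then have "(\<lambda>k. Re (inverse (of_nat (Suc k)) - inverse (z + of_nat k))) sums Re (Digamma z + euler_mascheroni)"
      by (rule sums_Re)
    moreover have "Re (inverse (of_nat (Suc k)) :: complex) = inverse (real (Suc k))" for k
      by (metis Re_complex_of_real of_real_inverse of_real_of_nat_eq)
    moreover have "Re (euler_mascheroni :: complex) = euler_mascheroni" by (metis Re_complex_of_real of_real_euler_mascheroni)
    moreover have "Complex (1 / 2) v / 2 = z" by (simp add: z_def complex_eq_iff)
    then have "Re (Digamma z) = 2 * deriv theta v + ln pi"
      by (simp add: deriv_theta arch_log_deriv_def diff_divide_distrib)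
    ultimately show ?thesis by (simp add: z_def)
  qed
  have re: "Re (inverse (Complex (1 / 4) (v / 2) + of_nat k)) = 1 / (1 / 4 + real k) - c k v" for v k
  proof -
    define a where "a = 1 / 4 + real k"
    have a: "a > 0" by (simp add: a_def add_pos_nonneg)
    have "Re (inverse (Complex (1 / 4) (v / 2) + of_nat k)) = a / (a\<^sup>2 + (v / 2)\<^sup>2)" by (simp add: a_def)
    also have "\<dots> = 1 / a - (v / 2)\<^sup>2 / (a * (a\<^sup>2 + (v / 2)\<^sup>2))"
    proof -
      have "a\<^sup>2 + (v / 2)\<^sup>2 > 0" using a by (simp add: add_pos_nonneg)
      then show ?thesis using a by (simp add: divide_simps) (simp add: power2_eq_square algebra_simps)
    qed
    finally show ?thesis by (simp add: a_def c_def)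
  qed
  have "(\<lambda>k. ((inverse (real (Suc k)) - Re (inverse (Complex (1 / 4) (t / 2) + of_nat k))) - (inverse (real (Suc k)) - Re (inverse (Complex (1 / 4) (u / 2) + of_nat k)))) / 2)
    sums (((2 * deriv theta t + ln pi + euler_mascheroni) - (2 * deriv theta u + ln pi + euler_mascheroni)) / 2)"
    by (intro sums_divide sums_diff *)
  then show ?thesis unfolding re by (simp add: diff_divide_distrib)
qed

lemma deriv_theta_strict_mono:
  assumes "0 \<le> u" "u < t"
  shows "deriv theta u < deriv theta t"
proof -
  define c where "c = (\<lambda>k t. (t / 2)\<^sup>2 / ((1 / 4 + real k) * ((1 / 4 + real k)\<^sup>2 + (t / 2)\<^sup>2)))"
  have sums: "(\<lambda>k. (c k t - c k u) / 2) sums (deriv theta t - deriv theta u)"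
    using deriv_theta_diff_sums[of t u] by (simp add: c_def)
  have lt: "c k u < c k t" for k
  proof -
    define a where "a = 1 / 4 + real k"
    have a: "a > 0" by (simp add: a_def add_pos_nonneg)
    define p q where "p = (u / 2)\<^sup>2" and "q = (t / 2)\<^sup>2"
    have pq: "0 \<le> p" "p < q" unfolding p_def q_def using assms by (auto intro!: power_strict_mono)
    have pos: "a\<^sup>2 + p > 0" "a\<^sup>2 + q > 0" using a pq by (auto simp: add_pos_nonneg)
    have "p * (a\<^sup>2 + q) < q * (a\<^sup>2 + p)" using pq a by (simp add: algebra_simps)
    then have "p / (a\<^sup>2 + p) < q / (a\<^sup>2 + q)" using pos by (simp add: divide_simps mult.commute)
    then have "p / (a\<^sup>2 + p) / a < q / (a\<^sup>2 + q) / a" using a by (rule divide_strict_right_mono)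
    then show ?thesis unfolding c_def a_def[symmetric] p_def[symmetric] q_def[symmetric] by (simp add: mult.commute)
  qed
  have "0 < (\<Sum>k. (c k t - c k u) / 2)"
    using sums lt by (intro suminf_pos) (auto simp: sums_iff)
  then show ?thesis using sums by (simp add: sums_iff)
qed

text \<open>For k < N and 2 N <= t one has 1/4 + k <= t/2, so the term of index k is at least 1 / (4
  (k + 1)), and the harmonic series does the rest.\<close>

lemma filterlim_deriv_theta: "filterlim (deriv theta) at_top at_top"
proof -
  define c where "c = (\<lambda>k t. (t / 2)\<^sup>2 / ((1 / 4 + real k) * ((1 / 4 + real k)\<^sup>2 + (t / 2)\<^sup>2)))"
  have sums: "(\<lambda>k. c k t / 2) sums (deriv theta t - deriv theta 0)" for t
    using deriv_theta_diff_sums[of t 0] by (simp add: c_def)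
  have c0: "c k t \<ge> 0" for k t unfolding c_def by (intro divide_nonneg_nonneg mult_nonneg_nonneg) auto
  have big: "harm N / 4 + deriv theta 0 \<le> deriv theta t" if t: "t \<ge> 2 * real N" "t > 0" for N t
  proof -
    have "inverse (real (Suc k)) / 4 \<le> c k t / 2" if k: "k < N" for k
    proof -
      define a where "a = 1 / 4 + real k"
      have a: "0 < a" "a \<le> real (Suc k)" "a \<le> t / 2" using t k by (auto simp: a_def add_pos_nonneg)
      have a2: "a\<^sup>2 \<le> (t / 2)\<^sup>2" using a by (intro power_mono) auto
      have "inverse (real (Suc k)) / 4 \<le> 1 / (4 * a)" using a by (simp add: field_simps)
      also have "\<dots> = (t / 2)\<^sup>2 / (a * ((t / 2)\<^sup>2 + (t / 2)\<^sup>2)) / 2" using t a by (simp add: field_simps)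
      also have "\<dots> \<le> (t / 2)\<^sup>2 / (a * (a\<^sup>2 + (t / 2)\<^sup>2)) / 2"
        using a a2 t by (intro divide_right_mono divide_left_mono mult_left_mono mult_pos_pos add_pos_pos) auto
      finally show ?thesis by (simp add: c_def a_def)
    qed
    then have "(\<Sum>k<N. inverse (real (Suc k)) / 4) \<le> (\<Sum>k<N. c k t / 2)" by (intro sum_mono) auto
    also have "\<dots> \<le> (\<Sum>k. c k t / 2)" using sums[of t] c0 by (intro sum_le_suminf) (auto simp: sums_iff)
    also have "\<dots> = deriv theta t - deriv theta 0" using sums[of t] by (simp add: sums_iff)
    finally show ?thesis by (simp add: harm_altdef sum_divide_distrib)
  qed
  show ?thesis unfolding filterlim_at_top
  proof
    fix Z :: real
    have "eventually (\<lambda>N. harm N \<ge> 4 * (Z - deriv theta 0)) sequentially" using harm_at_top by (simp add: filterlim_at_top)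
    then obtain N where N: "harm N \<ge> 4 * (Z - deriv theta 0)" by (metis eventually_sequentially order_refl)
    have "deriv theta t \<ge> Z" if "t \<ge> 2 * real N + 1" for t using big[of N t] that N by (simp add: field_simps)
    then show "eventually (\<lambda>t. Z \<le> deriv theta t) at_top" using eventually_at_top_linorder by blast
  qed
qed

lemma harm_le_ln: "n > 0 \<Longrightarrow> harm n \<le> 1 + ln (real n)"
proof (induction n rule: nat_induct_non_zero)
  case 1
  then show ?case by (simp add: harm_expand)
next
  case (Suc n)
  have "ln (real n / real (Suc n)) \<le> real n / real (Suc n) - 1" using Suc by (intro ln_le_minus_one) auto
  also have "\<dots> = - inverse (real (Suc n))" by (simp add: field_simps)
  finally have "inverse (real (Suc n)) \<le> ln (real (Suc n)) - ln (real n)" using Suc by (simp add: ln_div)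
  then show ?case using Suc by (simp add: harm_Suc)
qed

text \<open>The series is split near k = Im z. Before that point the terms are O(1 / k) and their
  harmonic sum gives the logarithm; after it they are O(Im z / k^2) and telescope to O(1).\<close>

lemma Digamma_bound:
  fixes z :: complex
  assumes z: "0 < Re z" "Re z \<le> 1" "Im z \<ge> 1"
  shows "norm (Digamma z) \<le> 8 + 2 * ln (Im z + 1)"
proof -
  define y where "y = Im z"
  define m where "m = nat \<lceil>y\<rceil>"
  have m: "real m \<ge> y" "real m \<le> y + 1" "m > 0" 
  proof -
    have "\<lceil>y\<rceil> > 0" using z by (simp add: y_def)
    then have "real m = of_int \<lceil>y\<rceil>" "m > 0" by (auto simp: m_def)
    then show "real m \<ge> y" "real m \<le> y + 1" "m > 0" by linarith+
  qed
  define f where "f = (\<lambda>k. inverse (of_nat (Suc k)) - inverse (z + of_nat k))"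
  have z0: "z + of_nat k \<noteq> 0" for k using z by (auto simp: complex_eq_iff)
  have sf: "summable f" unfolding f_def using summable_Digamma[of z] z0[of 0] by simp
  have nf: "norm (f k) = norm (z - 1) / (real (Suc k) * norm (z + of_nat k))" for k
  proof -
    have "f k = (z - 1) / (of_nat (Suc k) * (z + of_nat k))"
      using z0[of k] of_nat_neq_0[of k, where 'a = complex] unfolding f_def by (simp add: field_simps)
    then show ?thesis by (simp only: norm_divide norm_mult norm_of_nat)
  qed
  have z1: "norm (z - 1) \<le> 2 * y"
  proof -
    have "norm (z - 1) \<le> \<bar>Re (z - 1)\<bar> + \<bar>Im (z - 1)\<bar>" by (rule cmod_le)
    also have "\<dots> \<le> 2 * y" using z by (simp add: y_def)
    finally show ?thesis .
  qed
  have y1: "y \<ge> 1" using z by (simp add: y_def)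
  have b1: "norm (f k) \<le> 2 * inverse (real (Suc k))" for k
  proof -
    have "y \<le> norm (z + of_nat k)" using abs_Im_le_cmod[of "z + of_nat k"] y1 by (simp add: y_def)
    then have "norm (f k) \<le> (2 * y) / (real (Suc k) * y)" unfolding nf using z1 y1 by (intro frac_le mult_left_mono) auto
    also have "\<dots> = 2 * inverse (real (Suc k))" using y1 by (simp add: divide_inverse del: of_nat_Suc)
    finally show ?thesis .
  qed
  have b2: "norm (f (k + m)) \<le> 2 * y * (inverse (real (k + m)) - inverse (real (Suc (k + m))))" for k
  proof -
    have "real (k + m) \<le> Re (z + of_nat (k + m))" using z by simp
    also have "\<dots> \<le> norm (z + of_nat (k + m))" by (rule complex_Re_le_cmod)
    finally have "norm (f (k + m)) \<le> (2 * y) / (real (Suc (k + m)) * real (k + m))" unfolding nf using z1 y1 m(3)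
      by (intro frac_le mult_left_mono mult_pos_pos) auto
    also have "\<dots> = 2 * y * (inverse (real (k + m)) - inverse (real (Suc (k + m))))" using m(3) by (simp add: field_simps)
    finally show ?thesis .
  qed
  have "(\<lambda>k. inverse (real (k + m)) - inverse (real (Suc k + m))) sums (inverse (real (0 + m)) - 0)"
    by (rule telescope_sums') (use m in real_asymp)
  then have tel: "(\<lambda>k. 2 * y * (inverse (real (k + m)) - inverse (real (Suc (k + m))))) sums (2 * y * inverse (real m))"
    using sums_mult[of _ _ "2 * y"] by fastforce
  have "(\<Sum>k. f k) = (\<Sum>k. f (k + m)) + (\<Sum>k<m. f k)" by (rule suminf_split_initial_segment[OF sf])
  also have "norm \<dots> \<le> norm (\<Sum>k. f (k + m)) + norm (\<Sum>k<m. f k)" by (rule norm_triangle_ineq)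
  also have "\<dots> \<le> 2 * y * inverse (real m) + (\<Sum>k<m. 2 * inverse (real (Suc k)))"
  proof (rule add_mono)
    show "norm (\<Sum>k. f (k + m)) \<le> 2 * y * inverse (real m)"
      using norm_suminf_le[OF b2 sums_summable[OF tel]] tel by (simp add: sums_iff)
    show "norm (\<Sum>k<m. f k) \<le> (\<Sum>k<m. 2 * inverse (real (Suc k)))" by (intro sum_norm_le b1)
  qed
  also have "(\<Sum>k<m. 2 * inverse (real (Suc k))) = 2 * harm m" by (simp add: harm_altdef sum_distrib_left)
  also have "2 * y * inverse (real m) \<le> 2" using m by (simp add: field_simps)
  also have "harm m \<le> 1 + ln (real m)" by (rule harm_le_ln[OF m(3)])
  also have "ln (real m) \<le> ln (y + 1)" using m y1 by simp
  finally have "norm (\<Sum>k. f k) \<le> 4 + 2 * ln (y + 1)" by simp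
  moreover have "norm (Digamma z) \<le> norm (\<Sum>k. f k) + norm (euler_mascheroni :: complex)"
    unfolding Digamma_def f_def by (rule norm_triangle_ineq4)
  moreover have "norm (euler_mascheroni :: complex) \<le> 1"
  proof -
    have "norm (euler_mascheroni :: complex) = \<bar>euler_mascheroni :: real\<bar>" by (metis norm_of_real of_real_euler_mascheroni)
    then show ?thesis using euler_mascheroni_less_13_over_22 euler_mascheroni_gt_19_over_33 by linarith
  qed
  ultimately show ?thesis by (simp add: y_def)
qed

lemma arch_log_deriv_bound:
  obtains K where "K > 0" "\<And>\<sigma> t. 1 / 2 \<le> \<sigma> \<Longrightarrow> \<sigma> \<le> 3 / 2 \<Longrightarrow> t \<ge> 4 \<Longrightarrow> norm (arch_log_deriv (Complex \<sigma> t)) \<le> K * ln t"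
proof (rule that[of "6 + \<bar>ln pi\<bar>"])
  show "6 + \<bar>ln pi\<bar> > 0" by simp
next
  fix \<sigma> t :: real assume \<sigma>: "1 / 2 \<le> \<sigma>" "\<sigma> \<le> 3 / 2" and t: "t \<ge> 4"
  have ln1: "ln t \<ge> 1"
  proof -
    have "exp 1 \<le> t" using t exp_le by linarith
    then show ?thesis using t by (subst ln_ge_iff) auto
  qed
  have "norm (Digamma (Complex \<sigma> t / 2)) \<le> 8 + 2 * ln (Im (Complex \<sigma> t / 2) + 1)"
    by (rule Digamma_bound) (use \<sigma> t in auto)
  also have "ln (Im (Complex \<sigma> t / 2) + 1) \<le> ln t" using t by simp
  finally have "norm (Digamma (Complex \<sigma> t / 2)) \<le> 8 + 2 * ln t" by simp
  then have "norm (Digamma (Complex \<sigma> t / 2) - of_real (ln pi)) \<le> 8 + 2 * ln t + \<bar>ln pi\<bar>"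
    using norm_triangle_ineq4[of "Digamma (Complex \<sigma> t / 2)" "of_real (ln pi)"] by simp
  also have "\<dots> \<le> (10 + \<bar>ln pi\<bar>) * ln t"
  proof -
    have "8 * 1 \<le> 8 * ln t" "\<bar>ln pi\<bar> * 1 \<le> \<bar>ln pi\<bar> * ln t" using ln1 by (intro mult_left_mono; simp)+
    then show ?thesis by (simp add: algebra_simps)
  qed
  finally have "norm (arch_log_deriv (Complex \<sigma> t)) \<le> (10 + \<bar>ln pi\<bar>) * ln t / 2"
    unfolding arch_log_deriv_def norm_divide by simp
  also have "\<dots> \<le> (6 + \<bar>ln pi\<bar>) * ln t"
  proof -
    have "(10 + \<bar>ln pi\<bar>) * ln t \<le> (2 * (6 + \<bar>ln pi\<bar>)) * ln t" using ln1 by (intro mult_right_mono) auto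
    then show ?thesis by linarith
  qed
  finally show "norm (arch_log_deriv (Complex \<sigma> t)) \<le> (6 + \<bar>ln pi\<bar>) * ln t" .
qed

section \<open>Gram points\<close>

lemma theta_increment_ge:
  assumes "a \<le> x" "x \<le> y" and "\<And>t. t \<ge> a \<Longrightarrow> deriv theta t \<ge> B"
  shows "theta y - theta x \<ge> B * (y - x)"
proof (cases "x = y")
  case False
  then have "x < y" using assms by simp
  then obtain \<xi> where "x < \<xi>" "theta y - theta x = (y - x) * Re (arch_log_deriv (Complex (1 / 2) \<xi>))"
    using MVT2[of x y theta "\<lambda>t. Re (arch_log_deriv (Complex (1 / 2) t))"] theta_has_derivative by blast
  then show ?thesis using assms(3)[of \<xi>] assms(1,2) by (simp add: deriv_theta[symmetric] mult.commute[of _ "y - x"] mult_left_mono)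
qed simp

lemma continuous_on_theta: "continuous_on A theta"
  using theta_has_derivative by (auto intro!: continuous_at_imp_continuous_on DERIV_isCont)

text \<open>The derivative of \<open>theta\<close> increases on t >= 0, so once positive it stays
  positive, and \<open>theta\<close> is strictly increasing from there on. Two points satisfying the
  description therefore coincide.\<close>

lemma gram_point_eqI:
  assumes "t > 0" "theta t = (real n - 1) * pi" "deriv theta t > 0"
  shows "gram_point n = t"
  unfolding gram_point_def
proof (rule the_equality)
  fix u assume u: "u > 0 \<and> theta u = (real n - 1) * pi \<and> deriv theta u > 0"
  have *: "theta x < theta y" if "0 < x" "x < y" "deriv theta x > 0" for x y
  proof -
    have "theta y - theta x \<ge> deriv theta x * (y - x)"
      using that deriv_theta_strict_mono by (intro theta_increment_ge[of x]) (auto simp: le_less)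
    moreover have "deriv theta x * (y - x) > 0" using that by simp
    ultimately show ?thesis by linarith
  qed
  show "u = t" using *[of u t] *[of t u] u assms by (metis less_irrefl linorder_neqE_linordered_idom)
qed (use assms in auto)

text \<open>Beyond \<open>Y\<close> the derivative is at least 4 \<pi> with room to spare, so an
  increase by \<pi> takes a length of at most 1/4. The nearest Gram points outside [y1, y2] thus
  stick out by at most 1/4.\<close>

lemma gram_points_cover:
  obtains Y where "Y \<ge> 4" "\<And>t. t \<ge> Y \<Longrightarrow> deriv theta t > 0"
    "\<And>y1 y2. Y \<le> y1 \<Longrightarrow> y1 < y2 \<Longrightarrow> \<exists>k1 k2. k1 < k2 \<and> gram_point k1 \<ge> y1 - 1 / 4 \<and> gram_point k1 \<le> y1 \<and> y2 \<le> gram_point k2 \<and> gram_point k2 \<le> y2 + 1 / 4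
       \<and> (\<forall>k\<in>{k1..k2}. theta (gram_point k) = (real k - 1) * pi) \<and> (\<forall>i\<in>{k1..k2}. \<forall>j\<in>{k1..k2}. i \<le> j \<longrightarrow> gram_point i \<le> gram_point j)"
proof -
  have "eventually (\<lambda>t. deriv theta t \<ge> 4 * pi) at_top" using filterlim_deriv_theta by (simp add: filterlim_at_top)
  then obtain a0 where a0: "\<And>t. t \<ge> a0 \<Longrightarrow> deriv theta t \<ge> 4 * pi" by (auto simp: eventually_at_top_linorder)
  define a where "a = max a0 4"
  have a: "a \<ge> 4" "\<And>t. t \<ge> a \<Longrightarrow> deriv theta t \<ge> 4 * pi" using a0 by (auto simp: a_def)
  have inc: "theta y - theta x \<ge> 4 * pi * (y - x)" if "a \<le> x" "x \<le> y" for x y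
    by (rule theta_increment_ge[OF that a(2)])
  have gp: "gram_point n \<ge> a \<and> theta (gram_point n) = (real n - 1) * pi" if n: "(real n - 1) * pi \<ge> theta a" for n
  proof -
    define b where "b = a + ((real n - 1) * pi - theta a) / (4 * pi)"
    have b: "b \<ge> a" using n by (simp add: b_def)
    have "theta b \<ge> (real n - 1) * pi" using inc[of a b] b by (simp add: b_def)
    then obtain t where t: "a \<le> t" "t \<le> b" "theta t = (real n - 1) * pi"
      using IVT'[of theta a "(real n - 1) * pi" b] n b continuous_on_theta by auto
    have "deriv theta t > 0" using a(2)[OF t(1)] pi_gt_zero by (smt (verit))
    then have "gram_point n = t" using t a(1) by (intro gram_point_eqI) auto
    then show ?thesis using t by simp
  qed
  have le: "x \<le> y" if "a \<le> x" "a \<le> y" "theta x \<le> theta y" for x y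
  proof (rule ccontr)
    assume "\<not> x \<le> y"
    then have "4 * pi * (x - y) > 0" by simp
    then show False using inc[of y x] that \<open>\<not> x \<le> y\<close> by linarith
  qed
  have gap: "y - x \<le> 1 / 4" if "a \<le> x" "x \<le> y" "theta y - theta x \<le> pi" for x y
  proof -
    have "4 * pi * (y - x) \<le> pi" using inc[OF that(1,2)] that(3) by linarith
    then have "pi * (4 * (y - x)) \<le> pi * 1" by simp
    then have "4 * (y - x) \<le> 1" by (subst (asm) mult_le_cancel_left_pos) auto
    then show ?thesis by simp
  qed
  define Y where "Y = a + 1 + \<bar>theta a\<bar> / (4 * pi)"
  have Ya: "Y \<ge> a + 1" by (simp add: Y_def)
  have Yt: "theta y \<ge> 4 * pi \<and> theta y \<ge> theta a + 4 * pi" if "y \<ge> Y" for y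
  proof -
    have "theta y - theta a \<ge> 4 * pi * (y - a)" using that Ya by (intro inc) auto
    also have "4 * pi * (y - a) \<ge> 4 * pi * (Y - a)" using that by simp
    moreover have "4 * pi * (Y - a) = 4 * pi + \<bar>theta a\<bar>" by (simp add: Y_def algebra_simps)
    ultimately show ?thesis by linarith
  qed
  show ?thesis
  proof (rule that[of Y])
    show "Y \<ge> 4" using Ya a by linarith
    show "deriv theta t > 0" if "t \<ge> Y" for t using a(2)[of t] that Ya pi_gt_zero by (smt (verit))
  next
    fix y1 y2 assume y: "Y \<le> y1" "y1 < y2"
    \<comment> \<open>The shift by one matches theta (gram_point k) = (k - 1) \<pi>; rounding down
      at \<open>y1\<close> and up at \<open>y2\<close> makes the block cover the interval. The
      arguments of \<open>nat\<close> are positive because \<open>theta\<close> is at least 4 \<pi>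
      beyond \<open>Y\<close>.\<close>
    define k1 where "k1 = nat (\<lfloor>theta y1 / pi\<rfloor> + 1)"
    define k2 where "k2 = nat (\<lceil>theta y2 / pi\<rceil> + 1)"
    have ya: "a \<le> y1" "a \<le> y2" using y Ya by auto
    have "4 * pi * (y2 - y1) > 0" using y by simp
    then have y12: "theta y1 < theta y2" using inc[of y1 y2] y Ya by linarith
    have pos: "theta y1 / pi \<ge> 4" "theta y2 / pi \<ge> 4" using Yt[of y1] Yt[of y2] y by (auto simp: field_simps)
    have k1: "real k1 - 1 = of_int \<lfloor>theta y1 / pi\<rfloor>" using pos unfolding k1_def by (subst of_nat_nat) auto
    have k2: "real k2 - 1 = of_int \<lceil>theta y2 / pi\<rceil>" using pos unfolding k2_def by (subst of_nat_nat) auto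
    have K1: "(real k1 - 1) * pi \<le> theta y1" "theta y1 - pi \<le> (real k1 - 1) * pi"
    proof -
      have "of_int \<lfloor>theta y1 / pi\<rfloor> * pi \<le> theta y1 / pi * pi" "(theta y1 / pi - 1) * pi \<le> of_int \<lfloor>theta y1 / pi\<rfloor> * pi"
        by (rule mult_right_mono; linarith?; simp)+
      then show "(real k1 - 1) * pi \<le> theta y1" "theta y1 - pi \<le> (real k1 - 1) * pi" unfolding k1 by (auto simp: left_diff_distrib)
    qed
    have K2: "theta y2 \<le> (real k2 - 1) * pi" "(real k2 - 1) * pi \<le> theta y2 + pi"
    proof -
      have "theta y2 / pi * pi \<le> of_int \<lceil>theta y2 / pi\<rceil> * pi" "of_int \<lceil>theta y2 / pi\<rceil> * pi \<le> (theta y2 / pi + 1) * pi"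
        by (rule mult_right_mono; linarith?; simp)+
      then show "theta y2 \<le> (real k2 - 1) * pi" "(real k2 - 1) * pi \<le> theta y2 + pi" unfolding k2 by (auto simp: distrib_right)
    qed
    have k12: "k1 < k2"
    proof -
      have "(real k1 - 1) * pi < (real k2 - 1) * pi" using K1 K2 y12 by linarith
      then show ?thesis by simp
    qed
    have g: "gram_point k \<ge> a \<and> theta (gram_point k) = (real k - 1) * pi" if "k \<in> {k1..k2}" for k
    proof (rule gp)
      have "theta a \<le> theta y1 - pi" using Yt[of y1] y pi_gt_zero by linarith
      also have "\<dots> \<le> (real k1 - 1) * pi" by (rule K1)
      also have "\<dots> \<le> (real k - 1) * pi" using that by (intro mult_right_mono) auto
      finally show "theta a \<le> (real k - 1) * pi" .
    qed
    have g1: "gram_point k1 \<ge> a" "theta (gram_point k1) = (real k1 - 1) * pi" using g[of k1] k12 by auto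
    have g2: "gram_point k2 \<ge> a" "theta (gram_point k2) = (real k2 - 1) * pi" using g[of k2] k12 by auto
    have l1: "gram_point k1 \<le> y1" by (rule le) (use g1 K1 ya in auto)
    have l2: "y2 \<le> gram_point k2" by (rule le) (use g2 K2 ya in auto)
    have "y1 - gram_point k1 \<le> 1 / 4" by (rule gap) (use g1 K1 ya l1 in auto)
    moreover have "gram_point k2 - y2 \<le> 1 / 4" by (rule gap) (use g2 K2 ya l2 in auto)
    moreover have "gram_point i \<le> gram_point j" if "i \<in> {k1..k2}" "j \<in> {k1..k2}" "i \<le> j" for i j
      by (rule le) (use g[OF that(1)] g[OF that(2)] that(3) in auto)
    ultimately show "\<exists>k1 k2. k1 < k2 \<and> gram_point k1 \<ge> y1 - 1 / 4 \<and> gram_point k1 \<le> y1 \<and> y2 \<le> gram_point k2 \<and> gram_point k2 \<le> y2 + 1 / 4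
       \<and> (\<forall>k\<in>{k1..k2}. theta (gram_point k) = (real k - 1) * pi) \<and> (\<forall>i\<in>{k1..k2}. \<forall>j\<in>{k1..k2}. i \<le> j \<longrightarrow> gram_point i \<le> gram_point j)"
      using k12 l1 l2 g by (intro exI[of _ k1] exI[of _ k2]) auto
  qed
qed

section \<open>Simultaneous approximation with logarithms of primes\<close>

text \<open>With positive and negative coefficients on opposite sides, an integer relation is an
  equality of two products of prime powers; comparing multiplicities forces the exponents to
  agree.\<close>

lemma ln_primes_independent:
  fixes r :: "nat \<Rightarrow> int"
  assumes S: "finite S" "\<And>p. p \<in> S \<Longrightarrow> prime p" and sum: "(\<Sum>p\<in>S. of_int (r p) * ln (real p)) = 0" and q: "q \<in> S"
  shows "r q = 0"
proof -
  define a b where "a = (\<lambda>p. nat (r p))" and "b = (\<lambda>p. nat (- r p))"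
  have pos: "\<And>p. p \<in> S \<Longrightarrow> p > 0" using S(2) prime_gt_0_nat by blast
  have lnprod: "ln (real (\<Prod>p\<in>S. p ^ f p)) = (\<Sum>p\<in>S. real (f p) * ln (real p))" for f :: "nat \<Rightarrow> nat"
    unfolding of_nat_prod using pos S(1) by (subst ln_prod) (auto simp: ln_realpow)
  have "real_of_int (r p) = real (a p) - real (b p)" for p unfolding a_def b_def by simp
  then have "(\<Sum>p\<in>S. real (a p) * ln (real p)) - (\<Sum>p\<in>S. real (b p) * ln (real p)) = 0"
    using sum by (simp add: left_diff_distrib sum_subtractf)
  then have "ln (real (\<Prod>p\<in>S. p ^ a p)) = ln (real (\<Prod>p\<in>S. p ^ b p))" unfolding lnprod by simp
  moreover have "(\<Prod>p\<in>S. p ^ f p) > 0" for f :: "nat \<Rightarrow> nat" using pos by (intro prod_pos) auto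
  ultimately have "real (\<Prod>p\<in>S. p ^ a p) = real (\<Prod>p\<in>S. p ^ b p)" by (subst (asm) ln_inj_iff) (simp_all only: of_nat_0_less_iff)
  then have "(\<Prod>p\<in>S. p ^ a p) = (\<Prod>p\<in>S. p ^ b p)" by (simp only: of_nat_eq_iff)
  then have "multiplicity q (\<Prod>p\<in>S. p ^ a p) = multiplicity q (\<Prod>p\<in>S. p ^ b p)" by simp
  then have "a q = b q" using S q by (simp add: multiplicity_prod_prime_powers)
  then show ?thesis by (simp add: a_def b_def)
qed

lemma norm_cis_diff_le: "norm (cis a - cis b) \<le> \<bar>a - b\<bar>"
proof -
  have "norm (cis a - cis b) = norm (cis b * (cis (a - b) - 1))" by (simp add: right_diff_distrib cis_mult)
  also have "\<dots> = norm (iexp (a - b) - 1)" by (simp add: norm_mult cis_conv_exp)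
  also have "\<dots> \<le> \<bar>a - b\<bar>" using iexp_approx1[of "a - b" 0] by simp
  finally show ?thesis .
qed

text \<open>Kronecker's theorem alone gives no control over the size of t. Up to an error 1 / M
  there are finitely many targets modulo 1; one t is fixed in advance for each, and \<open>L\<close>
  is the sum of their absolute values. Starting from T merely moves the target by - T * \<theta>
  i.\<close>

lemma kronecker_uniform:
  fixes \<theta> :: "nat \<Rightarrow> real" and n :: nat
  assumes indp: "module.independent (\<lambda>r. (*) (real_of_int r)) (\<theta> ` {..<n})"
    and inj: "inj_on \<theta> {..<n}" and \<epsilon>: "\<epsilon> > 0"
  obtains L where "\<And>T \<beta>. \<exists>u h. \<bar>u - T\<bar> \<le> L \<and> (\<forall>i<n. \<bar>u * \<theta> i - of_int (h i) - \<beta> i\<bar> < \<epsilon>)"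
proof -
  obtain M :: nat where M: "M > 0" "1 / real M < \<epsilon> / 2"
    using reals_Archimedean[of "\<epsilon> / 2"] \<epsilon> by (metis half_gt_zero inverse_eq_divide zero_less_Suc)
  define G where "G = PiE {..<n} (\<lambda>_. {..<M})"
  have finG: "finite G" unfolding G_def by (intro finite_PiE) auto
  have "\<exists>t h. \<forall>i<n. \<bar>t * \<theta> i - of_int (h i) - real (j i) / real M\<bar> < \<epsilon> / 2" for j :: "nat \<Rightarrow> nat"
    by (rule Kronecker_thm_1[OF indp inj, of "\<epsilon> / 2" "\<lambda>i. real (j i) / real M"]) (use \<epsilon> in auto)
  then obtain t h where th: "\<And>j i. i < n \<Longrightarrow> \<bar>t j * \<theta> i - of_int (h j i) - real (j i) / real M\<bar> < \<epsilon> / 2" by metis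
  define L where "L = (\<Sum>j\<in>G. \<bar>t j\<bar>)"
  show ?thesis
  proof (rule that[of L])
    fix T and \<beta> :: "nat \<Rightarrow> real"
    define \<gamma> where "\<gamma> = (\<lambda>i. frac (\<beta> i - T * \<theta> i))"
    have \<gamma>: "0 \<le> \<gamma> i" "\<gamma> i < 1" for i by (auto simp: \<gamma>_def frac_lt_1)
    define j where "j = (\<lambda>i. if i < n then nat \<lfloor>real M * \<gamma> i\<rfloor> else undefined)"
    have jM: "\<bar>real (j i) / real M - \<gamma> i\<bar> \<le> 1 / real M" "j i < M" if "i < n" for i
    proof -
      have "real M * \<gamma> i \<ge> 0" using \<gamma>[of i] M by simp
      then have e: "real (j i) = of_int \<lfloor>real M * \<gamma> i\<rfloor>" using that by (simp add: j_def)
      have "real (j i) \<le> real M * \<gamma> i" "real M * \<gamma> i - 1 \<le> real (j i)" unfolding e by linarith+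
      then show "\<bar>real (j i) / real M - \<gamma> i\<bar> \<le> 1 / real M" 
      proof -
        have "real (j i) / real M - \<gamma> i = (real (j i) - real M * \<gamma> i) / real M" using M(1) by (simp add: diff_divide_distrib)
        then have "\<bar>real (j i) / real M - \<gamma> i\<bar> = \<bar>real (j i) - real M * \<gamma> i\<bar> / real M" by simp
        also have "\<dots> \<le> 1 / real M" using \<open>real (j i) \<le> real M * \<gamma> i\<close> \<open>real M * \<gamma> i - 1 \<le> real (j i)\<close>
          by (intro divide_right_mono) auto
        finally show ?thesis .
      qed
      have "real (j i) < real M" using \<open>real (j i) \<le> real M * \<gamma> i\<close> \<gamma>[of i] M by (smt (verit) mult_less_cancel_left2 of_nat_0_less_iff)
      then show "j i < M" by simp
    qed
    have "j \<in> G" unfolding G_def using jM(2) by (auto simp: PiE_iff extensional_def j_def)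
    then have "\<bar>t j\<bar> \<le> L" unfolding L_def using finG by (intro member_le_sum) auto
    moreover have "\<bar>(T + t j) * \<theta> i - of_int (h j i - \<lfloor>\<beta> i - T * \<theta> i\<rfloor>) - \<beta> i\<bar> < \<epsilon>" if "i < n" for i
    proof -
      have "\<gamma> i = \<beta> i - T * \<theta> i - of_int \<lfloor>\<beta> i - T * \<theta> i\<rfloor>" by (simp add: \<gamma>_def frac_def)
      then have "(T + t j) * \<theta> i - of_int (h j i - \<lfloor>\<beta> i - T * \<theta> i\<rfloor>) - \<beta> i = (t j * \<theta> i - of_int (h j i) - real (j i) / real M) + (real (j i) / real M - \<gamma> i)"
        by (simp add: algebra_simps)
      then show ?thesis using th[OF that, of j] jM(1)[OF that] M(2) by linarith
    qed
    ultimately show "\<exists>u h. \<bar>u - T\<bar> \<le> L \<and> (\<forall>i<n. \<bar>u * \<theta> i - of_int (h i) - \<beta> i\<bar> < \<epsilon>)"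
      by (intro exI[of _ "T + t j"] exI[of _ "\<lambda>i. h j i - \<lfloor>\<beta> i - T * \<theta> i\<rfloor>"]) auto
  qed
qed

lemma kronecker_primes:
  fixes N :: nat and \<alpha> :: "nat \<Rightarrow> real" and \<epsilon> :: real
  assumes \<epsilon>: "\<epsilon> > 0"
  obtains L where "\<And>T. \<exists>\<tau>. \<bar>\<tau> - T\<bar> \<le> L \<and> (\<forall>p. prime p \<longrightarrow> p \<le> N \<longrightarrow> norm (cis (- (\<tau> * ln (real p))) - cis (\<alpha> p)) < \<epsilon>)"
proof -
  define S where "S = {p. prime p \<and> p \<le> N}"
  have S: "finite S" "\<And>p. p \<in> S \<Longrightarrow> prime p" by (auto simp: S_def)
  define n where "n = card S"
  obtain e where e: "bij_betw e {..<n} S" using ex_bij_betw_nat_finite[OF S(1)] by (auto simp: n_def atLeast0LessThan)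
  define f where "f = (\<lambda>p::nat. ln (real p) / (2 * pi))"
  have finj: "inj_on f S"
  proof (rule inj_onI)
    fix p q assume "p \<in> S" "q \<in> S" "f p = f q"
    then have "ln (real p) = ln (real q)" "p > 0" "q > 0" using S(2) prime_gt_0_nat by (auto simp: f_def)
    then show "p = q" by simp
  qed
  interpret Modules.module "(\<lambda>r. (*) (real_of_int r))"
    by (simp add: Modules.module.intro distrib_left mult.commute)
  have "independent (f ` S)"
    unfolding independent_explicit_module
  proof (intro allI impI)
    fix t u v assume t: "finite t" "t \<subseteq> f ` S" "(\<Sum>v\<in>t. real_of_int (u v) * v) = 0" "v \<in> t"
    define R where "R = {p \<in> S. f p \<in> t}"
    have R: "t = f ` R" "inj_on f R" "finite R" using t finj S by (auto simp: R_def inj_on_def)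
    have "(\<Sum>p\<in>R. of_int (u (f p)) * ln (real p)) = (\<Sum>p\<in>R. real_of_int (u (f p)) * f p) * (2 * pi)"
      by (simp add: f_def sum_distrib_right)
    also have "(\<Sum>p\<in>R. real_of_int (u (f p)) * f p) = 0" using t(3) R by (simp add: sum.reindex)
    finally have "(\<Sum>p\<in>R. of_int (u (f p)) * ln (real p)) = 0" by simp
    moreover obtain p where "p \<in> R" "v = f p" using t(4) R by auto
    moreover have "prime p" if "p \<in> R" for p using that S(2) by (simp add: R_def)
    ultimately show "u v = 0" using ln_primes_independent[OF R(3), of "\<lambda>p. u (f p)" p] by simp
  qed
  then have "independent ((f \<circ> e) ` {..<n})" using e by (metis bij_betw_def image_comp)
  moreover have "inj_on (f \<circ> e) {..<n}" using e finj by (auto simp: bij_betw_def intro!: comp_inj_on)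
  moreover have "\<epsilon> / (2 * pi) > 0" using \<epsilon> by simp
  ultimately obtain L where L: "\<And>T \<beta>. \<exists>u h. \<bar>u - T\<bar> \<le> L \<and> (\<forall>i<n. \<bar>u * (f \<circ> e) i - of_int (h i) - \<beta> i\<bar> < \<epsilon> / (2 * pi))"
    by (rule kronecker_uniform) blast
  show ?thesis
  proof (rule that[of L])
    fix T
    obtain u h where u: "\<bar>u - T\<bar> \<le> L" "\<And>i. i < n \<Longrightarrow> \<bar>u * (f \<circ> e) i - of_int (h i) - (- \<alpha> (e i) / (2 * pi))\<bar> < \<epsilon> / (2 * pi)"
      using L[of T "\<lambda>i. - \<alpha> (e i) / (2 * pi)"] by blast
    have "norm (cis (- (u * ln (real p))) - cis (\<alpha> p)) < \<epsilon>" if "prime p" "p \<le> N" for p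
    proof -
      have "p \<in> S" using that by (simp add: S_def)
      then obtain i where i: "i < n" "p = e i" using e by (auto simp: bij_betw_def)
      define d where "d = u * (f \<circ> e) i - of_int (h i) - (- \<alpha> (e i) / (2 * pi))"
      have "- (u * ln (real p)) + 2 * pi * of_int (h i) - \<alpha> p = - (2 * pi * d)"
        unfolding d_def i by (simp add: f_def field_simps)
      moreover have "cis (- (u * ln (real p)) + 2 * pi * of_int (h i)) = cis (- (u * ln (real p)))"
        by (subst cis_mult[symmetric]) (simp add: cis_multiple_2pi)
      ultimately have "norm (cis (- (u * ln (real p))) - cis (\<alpha> p)) \<le> \<bar>2 * pi * d\<bar>"
        using norm_cis_diff_le[of "- (u * ln (real p)) + 2 * pi * of_int (h i)" "\<alpha> p"] by simp
      also have "\<dots> = 2 * pi * \<bar>d\<bar>" by (simp add: abs_mult)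
      also have "\<dots> < \<epsilon>" using u(2)[OF i(1)] unfolding d_def[symmetric] by (simp add: field_simps)
      finally show ?thesis .
    qed
    then show "\<exists>\<tau>. \<bar>\<tau> - T\<bar> \<le> L \<and> (\<forall>p. prime p \<longrightarrow> p \<le> N \<longrightarrow> norm (cis (- (\<tau> * ln (real p))) - cis (\<alpha> p)) < \<epsilon>)"
      using u(1) by blast
  qed
qed

section \<open>Sums over primes and prime powers\<close>

lemma prime_power_sum_bound:
  fixes \<theta> :: real and k0 :: nat
  assumes \<theta>: "\<theta> > 0" "real k0 * \<theta> \<ge> 3 / 2"
  obtains C where "\<And>A. finite A \<Longrightarrow> (\<And>n. n \<in> A \<Longrightarrow> \<exists>p k. prime p \<and> k \<ge> k0 \<and> n = p ^ k) \<Longrightarrow> (\<Sum>n\<in>A. mangoldt n * real n powr (- \<theta>)) \<le> C"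
proof -
  \<comment> \<open>With x = p powr (- \<theta>) <= 2 powr (- \<theta>), the exponents from k0 on
    sum to at most c * x^k0, and x^k0 <= p powr (- 3/2) makes the sum over p converge. The cases
    needed are \<theta> = 1 from squares on and \<theta> = 1/2 from cubes on.\<close>
  define c where "c = 1 / (1 - 2 powr (- \<theta>))"
  have c2: "(2::real) powr (- \<theta>) < 1" using powr_less_mono[of "- \<theta>" 0 2] \<theta> by simp
  have c: "c > 0" using c2 by (simp add: c_def)
  define C where "C = c * (\<Sum>n. ln (real n) * real n powr (- (3 / 2)))"
  have sm: "summable (\<lambda>n. ln (real n) * real n powr (- (3 / 2)))" by (rule summable_ln_powr) simp
  have k0: "k0 > 0" using \<theta> by (intro gr0I) auto
  show ?thesis
  proof (rule that[of C])
    fix A :: "nat set" assume A: "finite A" "\<And>n. n \<in> A \<Longrightarrow> \<exists>p k. prime p \<and> k \<ge> k0 \<and> n = p ^ k"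
    define N where "N = Max (insert 1 A)"
    have N: "n \<le> N" if "n \<in> A" for n using that A(1) by (simp add: N_def)
    define g where "g = (\<lambda>(p::nat, k::nat). ln (real p) * (real p powr (- \<theta>)) ^ k)"
    have "(\<Sum>n\<in>A. mangoldt n * real n powr (- \<theta>)) \<le> (\<Sum>x\<in>{1..N} \<times> {k0..N}. g x)"
    proof (rule sum_le_included[where i = "\<lambda>(p, k). p ^ k"])
      show "\<forall>x\<in>{1..N} \<times> {k0..N}. 0 \<le> g x" by (auto simp: g_def)
      show "\<forall>n\<in>A. \<exists>x\<in>{1..N} \<times> {k0..N}. (case x of (p, k) \<Rightarrow> p ^ k) = n \<and> mangoldt n * real n powr (- \<theta>) \<le> g x"
      proof
        fix n assume n: "n \<in> A"
        obtain p k where pk: "prime p" "k \<ge> k0" "n = p ^ k" using A(2)[OF n] by blast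
        have p2: "p \<ge> 2" using pk(1) by (rule prime_ge_2_nat)
        have "k < 2 ^ k" by (rule less_exp)
        also have "(2::nat) ^ k \<le> p ^ k" using p2 by (rule power_mono) simp
        finally have "k \<le> N" using N[OF n] pk by linarith
        moreover have "p \<le> N"
        proof -
          have "p ^ 1 \<le> p ^ k" using p2 pk(2) k0 by (intro power_increasing) auto
          then show ?thesis using N[OF n] pk by simp
        qed
        moreover have "mangoldt n * real n powr (- \<theta>) = g (p, k)"
        proof -
          have "real n powr (- \<theta>) = (real p powr real k) powr (- \<theta>)" using pk p2 by (simp add: powr_realpow)
          also have "\<dots> = (real p powr (- \<theta>)) powr real k" by (simp add: powr_powr mult.commute)
          also have "\<dots> = (real p powr (- \<theta>)) ^ k" using p2 by (simp add: powr_realpow)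
          finally show ?thesis using pk k0 by (simp add: g_def)
        qed
        ultimately show "\<exists>x\<in>{1..N} \<times> {k0..N}. (case x of (p, k) \<Rightarrow> p ^ k) = n \<and> mangoldt n * real n powr (- \<theta>) \<le> g x"
          using pk p2 by (intro bexI[of _ "(p, k)"]) auto
      qed
    qed (use A in auto)
    also have "\<dots> = (\<Sum>p\<in>{1..N}. ln (real p) * (\<Sum>k\<in>{k0..N}. (real p powr (- \<theta>)) ^ k))"
      by (simp add: g_def sum.cartesian_product[symmetric] sum_distrib_left)
    also have "\<dots> \<le> (\<Sum>p\<in>{1..N}. c * (ln (real p) * real p powr (- (3 / 2))))"
    proof (rule sum_mono)
      fix p assume p: "p \<in> {1..N}"
      show "ln (real p) * (\<Sum>k\<in>{k0..N}. (real p powr (- \<theta>)) ^ k) \<le> c * (ln (real p) * real p powr (- (3 / 2)))"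
      proof (cases "p = 1")
        case False
        then have p2: "p \<ge> 2" using p by simp
        define x where "x = real p powr (- \<theta>)"
        have x: "0 < x" "x \<le> 2 powr (- \<theta>)" "x < 1"
          using p2 \<theta> c2 powr_mono2'[of "- \<theta>" 2 "real p"] by (auto simp: x_def)
        have "(\<Sum>k\<in>{k0..N}. x ^ k) \<le> (\<Sum>k. x ^ (k + k0))"
        proof -
          have "{k0..N} \<subseteq> (\<lambda>k. k + k0) ` {..N}"
          proof
            fix k assume "k \<in> {k0..N}"
            then show "k \<in> (\<lambda>k. k + k0) ` {..N}" by (intro image_eqI[of _ _ "k - k0"]) auto
          qed
          then have "(\<Sum>k\<in>{k0..N}. x ^ k) \<le> (\<Sum>k\<in>(\<lambda>k. k + k0) ` {..N}. x ^ k)"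
            using x by (intro sum_mono2) auto
          also have "\<dots> = (\<Sum>k\<le>N. x ^ (k + k0))" by (subst sum.reindex) auto
          also have "\<dots> \<le> (\<Sum>k. x ^ (k + k0))" using x by (intro sum_le_suminf summable_ignore_initial_segment summable_geometric) auto
          finally show ?thesis .
        qed
        also have "\<dots> = x ^ k0 * (1 / (1 - x))"
        proof -
          have "(\<lambda>k. x ^ k0 * x ^ k) sums (x ^ k0 * (1 / (1 - x)))" using x by (intro sums_mult geometric_sums) simp
          then show ?thesis by (simp add: sums_iff power_add mult.commute)
        qed
        also have "\<dots> \<le> x ^ k0 * c" unfolding c_def using x c2 by (intro mult_left_mono divide_left_mono) auto
        also have "x ^ k0 = real p powr (- (real k0 * \<theta>))" using p2 by (simp add: x_def powr_power mult.commute)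
        also have "\<dots> \<le> real p powr (- (3 / 2))" using \<theta> p2 by (intro powr_mono) auto
        finally have "(\<Sum>k\<in>{k0..N}. x ^ k) \<le> real p powr (- (3 / 2)) * c" using c by (simp add: mult_right_mono)
        then have "ln (real p) * (\<Sum>k\<in>{k0..N}. x ^ k) \<le> ln (real p) * (real p powr (- (3 / 2)) * c)" using p2 by (intro mult_left_mono) auto
        then show ?thesis by (simp add: x_def mult_ac)
      qed simp
    qed
    also have "\<dots> = c * (\<Sum>p\<in>{1..N}. ln (real p) * real p powr (- (3 / 2)))" by (simp add: sum_distrib_left)
    also have "\<dots> \<le> C" unfolding C_def using c sm
    proof (intro mult_left_mono sum_le_suminf)
      show "0 \<le> ln (real n) * real n powr (- (3 / 2))" for n by (cases "n = 0") auto
    qed auto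
    finally show "(\<Sum>n\<in>A. mangoldt n * real n powr (- \<theta>)) \<le> C" .
  qed
qed

text \<open>Chebyshev's identity: ln (N!) is the sum over d of the von Mangoldt function times floor
  (N / d) <= N / d. From below, N! >= (N / e)^N, because N^N / N! is one term of the series for exp
  N.\<close>

lemma sum_mangoldt_over_n_ge:
  assumes "N > 0"
  shows "(\<Sum>d\<in>{1..N}. mangoldt d / real d) \<ge> ln (real N) - 1"
proof -
  have "ln (fact N) = (\<Sum>n\<in>{1..N}. ln (real n))" by (induction N) (simp_all add: ln_mult)
  also have "\<dots> = (\<Sum>n\<in>{1..N}. \<Sum>d | d dvd n. mangoldt d)" by (intro sum.cong refl) (subst mangoldt_sum, auto)
  also have "\<dots> = (\<Sum>n\<in>{1..N}. \<Sum>d\<in>{1..N}. if d dvd n then mangoldt d else 0)"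
  proof (rule sum.cong[OF refl])
    fix n assume n: "n \<in> {1..N}"
    have "d \<in> {1..N}" if d: "d dvd n" for d
    proof -
      have "d \<le> n" using d n by (intro dvd_imp_le) auto
      moreover have "d \<noteq> 0" using d n by (intro notI) simp
      ultimately show ?thesis using n by simp
    qed
    then have "{d. d dvd n} = {d \<in> {1..N}. d dvd n}" by blast
    then show "(\<Sum>d | d dvd n. mangoldt d) = (\<Sum>d\<in>{1..N}. if d dvd n then (mangoldt d :: real) else 0)"
      by (simp only: sum.inter_filter[OF finite_atLeastAtMost])
  qed
  also have "\<dots> = (\<Sum>d\<in>{1..N}. \<Sum>n\<in>{1..N}. if d dvd n then mangoldt d else 0)" by (rule sum.swap)
  also have "\<dots> = (\<Sum>d\<in>{1..N}. mangoldt d * real (card {n\<in>{1..N}. d dvd n}))"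
    by (rule sum.cong[OF refl], simp only: sum.inter_filter[OF finite_atLeastAtMost, symmetric] sum_constant) (simp add: mult.commute)
  also have "\<dots> \<le> (\<Sum>d\<in>{1..N}. mangoldt d * (real N / real d))"
  proof (intro sum_mono mult_left_mono mangoldt_nonneg)
    fix d assume d: "d \<in> {1..N}"
    have "{n\<in>{1..N}. d dvd n} \<subseteq> (\<lambda>k. d * k) ` {1..N div d}"
    proof
      fix n assume "n \<in> {n\<in>{1..N}. d dvd n}"
      then obtain k where k: "n = d * k" "1 \<le> n" "n \<le> N" by (auto elim!: dvdE)
      then have "k \<in> {1..N div d}" using d by (auto simp: less_eq_div_iff_mult_less_eq mult.commute intro!: Suc_leI gr0I)
      then show "n \<in> (\<lambda>k. d * k) ` {1..N div d}" using k by auto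
    qed
    then have "card {n\<in>{1..N}. d dvd n} \<le> card ((\<lambda>k. d * k) ` {1..N div d})" by (intro card_mono) auto
    also have "\<dots> \<le> N div d" using card_image_le[of "{1..N div d}" "\<lambda>k. d * k"] by simp
    finally have "real (card {n\<in>{1..N}. d dvd n}) \<le> real (N div d)" by simp
    also have "\<dots> \<le> real N / real d" by (rule of_nat_div_le_of_nat)
    finally show "real (card {n\<in>{1..N}. d dvd n}) \<le> real N / real d" .
  qed
  also have "\<dots> = real N * (\<Sum>d\<in>{1..N}. mangoldt d / real d)" by (simp add: sum_distrib_left mult_ac)
  finally have 1: "ln (fact N) \<le> real N * (\<Sum>d\<in>{1..N}. mangoldt d / real d)" .
  have "real N ^ N / fact N \<le> exp (real N)"
  proof -
    have s: "(\<lambda>n. real N ^ n /\<^sub>R fact n) sums exp (real N)" by (rule exp_converges)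
    have "(\<Sum>n\<in>{N}. real N ^ n /\<^sub>R fact n) \<le> (\<Sum>n. real N ^ n /\<^sub>R fact n)"
      using s by (intro sum_le_suminf) (auto simp: sums_iff)
    then show ?thesis using s by (simp add: sums_iff divide_inverse mult.commute)
  qed
  then have "real N ^ N \<le> exp (real N) * fact N" by (simp add: divide_le_eq)
  then have "ln (real N ^ N) \<le> ln (exp (real N) * fact N)" using assms by (subst ln_le_cancel_iff) auto
  then have "real N * ln (real N) \<le> real N + ln (fact N)" using assms by (simp add: ln_realpow ln_mult)
  with 1 have "real N * (ln (real N) - 1) \<le> real N * (\<Sum>d\<in>{1..N}. mangoldt d / real d)" by (simp add: algebra_simps)
  then show ?thesis using assms by simp
qed

text \<open>Mertens-type input suffices: the sum of ln p / p up to x is at least ln x - O(1). Primes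
  beyond y gain the factor sqrt p >= 2 * B, and for large x they still carry half of ln x.\<close>

lemma sum_ln_over_sqrt_primes_unbounded:
  fixes B :: real
  obtains x :: nat where "x \<ge> 2" "(\<Sum>p | prime p \<and> p \<le> x. ln (real p) / sqrt (real p)) \<ge> B * ln (real x)"
proof -
  obtain C where C: "\<And>A. finite A \<Longrightarrow> (\<And>n. n \<in> A \<Longrightarrow> \<exists>p k. prime p \<and> k \<ge> 2 \<and> n = p ^ k) \<Longrightarrow> (\<Sum>n\<in>A. mangoldt n * real n powr (- 1)) \<le> C"
    by (rule prime_power_sum_bound[of 1 2]) auto
  define P where "P = (\<lambda>x. {p::nat. prime p \<and> p \<le> x})"
  have finP: "finite (P x)" for x by (auto simp: P_def)
  have P1: "(\<Sum>p\<in>P x. ln (real p) / real p) \<ge> ln (real x) - 1 - C" if x: "x > 0" for x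
  proof -
    define A where "A = {n\<in>{1..x}. primepow n \<and> \<not> prime n}"
    have "(\<Sum>n\<in>A. mangoldt n * real n powr (- 1)) \<le> C"
    proof (rule C)
      fix n assume "n \<in> A"
      then obtain p k where pk: "prime p" "k > 0" "n = p ^ k" "\<not> prime n" by (auto simp: A_def primepow_def)
      then have "k \<noteq> 1" by auto
      then show "\<exists>p k. prime p \<and> k \<ge> 2 \<and> n = p ^ k" using pk by (intro exI[of _ p] exI[of _ k]) auto
    qed (simp add: A_def)
    then have A: "(\<Sum>n\<in>A. mangoldt n / real n) \<le> C" by (simp add: powr_minus_divide)
    have "(\<Sum>n\<in>{1..x}. mangoldt n / real n) = (\<Sum>n\<in>A \<union> P x. mangoldt n / real n)"
    proof (rule sum.mono_neutral_right)
      show "A \<union> P x \<subseteq> {1..x}" by (auto simp: A_def P_def intro!: Suc_leI prime_gt_0_nat)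
      show "\<forall>i\<in>{1..x} - (A \<union> P x). mangoldt i / real i = 0" by (auto simp: A_def P_def mangoldt_def)
    qed simp
    also have "\<dots> = (\<Sum>n\<in>A. mangoldt n / real n) + (\<Sum>n\<in>P x. mangoldt n / real n)"
      using finP by (intro sum.union_disjoint) (auto simp: A_def P_def)
    also have "(\<Sum>n\<in>P x. mangoldt n / real n) = (\<Sum>p\<in>P x. ln (real p) / real p)"
      by (intro sum.cong refl) (auto simp: P_def)
    finally show ?thesis using A sum_mangoldt_over_n_ge[OF x] by linarith
  qed
  obtain y0 :: nat where "real y0 \<ge> (2 * B)\<^sup>2" using real_arch_simple by blast
  then obtain y :: nat where y: "real y \<ge> (2 * B)\<^sup>2" "y > 0" by (intro that[of "Suc y0"]) auto
  have sy: "sqrt (real y) \<ge> 2 * B" using y real_le_rsqrt by blast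
  define Sy where "Sy = (\<Sum>p\<in>P y. ln (real p) / real p)"
  \<comment> \<open>So large that the constants and the primes up to y take at most half of ln
    x.\<close>
  obtain x0 :: nat where x0: "real x0 \<ge> exp (2 * (1 + C + Sy))" using real_arch_simple by blast
  define x where "x = max x0 (max y 2)"
  have x: "x \<ge> 2" "x \<ge> y" by (auto simp: x_def)
  have "real x \<ge> exp (2 * (1 + C + Sy))" using x0 by (simp add: x_def)
  then have lnx: "ln (real x) \<ge> 2 * (1 + C + Sy)" using x by (subst ln_ge_iff) auto
  have "(\<Sum>p\<in>P x. ln (real p) / sqrt (real p)) \<ge> (\<Sum>p\<in>P x - P y. ln (real p) / sqrt (real p))"
    using finP by (intro sum_mono2) (auto simp: P_def dest: prime_gt_0_nat)
  moreover have "(\<Sum>p\<in>P x - P y. ln (real p) / sqrt (real p)) \<ge> (\<Sum>p\<in>P x - P y. sqrt (real y) * (ln (real p) / real p))"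
  proof (rule sum_mono)
    fix p assume "p \<in> P x - P y"
    then have p: "prime p" "p > y" by (auto simp: P_def)
    have p0: "real p > 0" "ln (real p) \<ge> 0" using prime_ge_2_nat[OF p(1)] by auto
    have "sqrt (real y) \<le> sqrt (real p)" using p by simp
    then have "sqrt (real y) * (ln (real p) / real p) \<le> sqrt (real p) * (ln (real p) / real p)" using p0 by (intro mult_right_mono) auto
    also have "\<dots> = ln (real p) / sqrt (real p)" using p0 by (simp add: field_simps)
    finally show "sqrt (real y) * (ln (real p) / real p) \<le> ln (real p) / sqrt (real p)" .
  qed
  moreover have "(\<Sum>p\<in>P x - P y. sqrt (real y) * (ln (real p) / real p)) \<ge> B * ln (real x)"
  proof -
    have "P y \<subseteq> P x" using x by (auto simp: P_def)
    then have "(\<Sum>p\<in>P x - P y. ln (real p) / real p) = (\<Sum>p\<in>P x. ln (real p) / real p) - Sy"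
      unfolding Sy_def using finP by (intro sum_diff) auto
    also have "\<dots> \<ge> ln (real x) / 2" using P1[of x] x(1) lnx by simp
    finally have "(\<Sum>p\<in>P x - P y. ln (real p) / real p) \<ge> ln (real x) / 2" .
    then have "sqrt (real y) * (ln (real x) / 2) \<le> sqrt (real y) * (\<Sum>p\<in>P x - P y. ln (real p) / real p)" by (intro mult_left_mono) auto
    moreover have "2 * B * (ln (real x) / 2) \<le> sqrt (real y) * (ln (real x) / 2)" using sy x by (intro mult_right_mono) auto
    ultimately show ?thesis by (simp add: sum_distrib_left)
  qed
  ultimately show ?thesis using that[of x] x by (simp add: P_def)
qed

section \<open>The weight function\<close>

text \<open>The weight in the variable w = s - 1/2 - i \<tau>: on the imaginary axis, which is the
  critical line, cos becomes cosh. The leading \<open>b\<close> in the exponent normalises the peak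
  to 1; the width of the peak is about 1 / sqrt b.\<close>

definition bump :: "real \<Rightarrow> complex \<Rightarrow> complex" where
  "bump b w = exp (of_real b - of_real b * cos (of_real (5 / 4) * w))"

definition rbump :: "real \<Rightarrow> real \<Rightarrow> real" where
  "rbump b y = exp (b - b * cosh (5 / 4 * y))"

lemma cos_Complex: "Re (cos (of_real c * Complex x y)) = cos (c * x) * cosh (c * y)"
  by (simp add: Re_cos cosh_def exp_minus add.commute)

lemma norm_bump: "norm (bump b (Complex x y)) = exp (b - b * (cos (5 / 4 * x) * cosh (5 / 4 * y)))"
proof -
  have "Re (of_real b - of_real b * z) = b - b * Re z" for z by simp
  then show ?thesis unfolding bump_def norm_exp_eq_Re by (simp only: cos_Complex)
qed

lemma bump_imag: "bump b (Complex 0 y) = of_real (rbump b y)"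
proof -
  have "of_real (5 / 4) * Complex 0 y = \<i> * of_real (5 / 4 * y)" by (simp add: complex_eq_iff)
  then have "cos (of_real (5 / 4) * Complex 0 y) = of_real (cosh (5 / 4 * y))"
    by (simp only: ) (simp add: cos_exp_eq cosh_def exp_of_real[symmetric] exp_minus field_simps)
  then show ?thesis by (simp add: bump_def rbump_def exp_of_real[symmetric])
qed

text \<open>The reflection w -> - cnj w is s -> 1 - cnj s across the critical line, the symmetry of
  the completed zeta function.\<close>

lemma bump_reflect: "bump b (- cnj w) = cnj (bump b w)"
  by (simp add: bump_def exp_cnj cnj_cos)

lemma holomorphic_bump: "bump b holomorphic_on A"
  unfolding bump_def by (intro holomorphic_intros)

lemma continuous_on_bump: "continuous_on A (bump b)"
  by (rule holomorphic_on_imp_continuous_on[OF holomorphic_bump])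

text \<open>The least value of cos (5 x / 4) on |x| <= 1, that is, the worst decay rate on the strip
  in which contours move.\<close>

definition bump_kappa :: real where "bump_kappa = cos (5 / 4)"

lemma bump_kappa_pos: "bump_kappa > 0"
proof -
  have "5 / 4 < pi / 2" using pi_gt3 by simp
  then show ?thesis unfolding bump_kappa_def by (intro cos_gt_zero) auto
qed

lemma cosh_ge_quadratic: "cosh (x::real) \<ge> 1 + x\<^sup>2 / 2"
proof -
  have "cosh x = 1 + 2 * (sinh (x / 2))\<^sup>2" using cosh_double[of "x / 2"] by (simp add: cosh_square_eq)
  moreover have "(x / 2)\<^sup>2 \<le> (sinh (x / 2))\<^sup>2"
  proof (rule abs_le_square_iff[THEN iffD1])
    have "\<bar>y\<bar> \<le> \<bar>sinh y\<bar>" for y :: real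
    proof -
      have *: "y \<le> sinh y" if "y \<ge> 0" for y :: real
      proof -
        have "sinh 0 - 0 \<le> sinh y - y"
          by (rule DERIV_nonneg_imp_nondecreasing[OF that]) (auto intro!: exI derivative_eq_intros cosh_real_ge_1)
        then show ?thesis by simp
      qed
      show ?thesis
      proof (cases "y \<ge> 0")
        case True
        then show ?thesis using *[of y] by simp
      next
        case False
        then show ?thesis using *[of "-y"] by simp
      qed
    qed
    then show "\<bar>x / 2\<bar> \<le> \<bar>sinh (x / 2)\<bar>" .
  qed
  ultimately show ?thesis by (simp add: power_divide)
qed

lemma norm_bump_le:
  assumes "b \<ge> 0" "\<bar>x\<bar> \<le> 1"
  shows "norm (bump b (Complex x y)) \<le> exp (b - b * bump_kappa * cosh (5 / 4 * y))"
proof -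
  have "bump_kappa \<le> cos (5 / 4 * x)"
  proof -
    have "cos (5 / 4) \<le> cos \<bar>5 / 4 * x\<bar>" using assms pi_gt3 by (intro cos_monotone_0_pi_le) (auto simp: abs_mult)
    then show ?thesis by (simp only: bump_kappa_def cos_abs_real)
  qed
  then have "bump_kappa * cosh (5 / 4 * y) \<le> cos (5 / 4 * x) * cosh (5 / 4 * y)" using cosh_real_pos[of "5/4*y"] by (intro mult_right_mono) auto
  then have "b * (bump_kappa * cosh (5 / 4 * y)) \<le> b * (cos (5 / 4 * x) * cosh (5 / 4 * y))" using assms by (intro mult_left_mono) auto
  then show ?thesis unfolding norm_bump by simp
qed

lemma integrable_exp_square: "c > 0 \<Longrightarrow> integrable lborel (\<lambda>y::real. exp (- (c * y\<^sup>2)))"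
  and integrable_exp_square_moment: "c > 0 \<Longrightarrow> integrable lborel (\<lambda>y::real. y\<^sup>2 * exp (- (c * y\<^sup>2)))"
proof -
  assume c: "c > 0"
  define r where "r = sqrt (2 * c)"
  have r: "r \<noteq> 0" "r\<^sup>2 = 2 * c" using c by (auto simp: r_def)
  have eq: "std_normal_density (0 + r * y) = 1 / sqrt (2 * pi) * exp (- (c * y\<^sup>2))" for y
    using r by (simp add: std_normal_density_def power_mult_distrib)
  have "integrable lborel (\<lambda>y. std_normal_density (0 + r * y))"
    by (rule lborel_integrable_real_affine[OF _ r(1)]) (use integrable_std_normal_moment[of 0] in simp)
  then have "integrable lborel (\<lambda>y. sqrt (2 * pi) * std_normal_density (0 + r * y))" by simp
  then show "integrable lborel (\<lambda>y::real. exp (- (c * y\<^sup>2)))" unfolding eq by simp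
  have "integrable lborel (\<lambda>y. (\<lambda>z. std_normal_density z * z ^ 2) (0 + r * y))"
    by (rule lborel_integrable_real_affine[OF integrable_std_normal_moment r(1)])
  then have "integrable lborel (\<lambda>y. (sqrt (2 * pi) / r\<^sup>2) * (std_normal_density (0 + r * y) * (0 + r * y) ^ 2))"
    by (intro integrable_mult_right) simp
  then show "integrable lborel (\<lambda>y::real. y\<^sup>2 * exp (- (c * y\<^sup>2)))"
    unfolding eq using r(1) by (simp add: power_mult_distrib mult_ac)
qed

text \<open>The quadratic lower bound for cosh yields a Gaussian majorant, which is all that
  integrability takes; the doubly exponential decay matters only near the ends of the
  window.\<close>

lemma integrable_bump:
  assumes b: "b > 0" and x: "\<bar>x\<bar> \<le> 1" and h: "continuous_on UNIV h" "\<And>y. norm (h y) \<le> M"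
  shows "integrable lborel (\<lambda>y. h y * bump b (Complex x y) :: complex)"
proof (rule Bochner_Integration.integrable_bound)
  define c where "c = b * bump_kappa * (25 / 32)"
  have c: "c > 0" using b bump_kappa_pos by (simp add: c_def)
  show "integrable lborel (\<lambda>y. M * exp b * exp (- (c * y\<^sup>2)))"
    by (intro integrable_mult_right integrable_exp_square c)
  have "continuous_on UNIV (\<lambda>y. h y * bump b (Complex x y))"
    by (intro continuous_on_mult h continuous_on_compose2[OF continuous_on_bump[of UNIV]]) (auto simp: Complex_eq intro!: continuous_intros)
  then show "(\<lambda>y. h y * bump b (Complex x y)) \<in> borel_measurable lborel"
    using borel_measurable_continuous_onI by simp
  have M: "M \<ge> 0" using h(2)[of 0] norm_ge_zero order_trans by blast
  show "AE y in lborel. norm (h y * bump b (Complex x y)) \<le> norm (M * exp b * exp (- (c * y\<^sup>2)))"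
  proof (rule AE_I2)
    fix y
    have "b * bump_kappa * (1 + (5 / 4 * y)\<^sup>2 / 2) \<le> b * bump_kappa * cosh (5 / 4 * y)"
      using b bump_kappa_pos by (intro mult_left_mono cosh_ge_quadratic) auto
    moreover have "b * bump_kappa * (1 + (5 / 4 * y)\<^sup>2 / 2) = b * bump_kappa + c * y\<^sup>2" by (simp add: c_def power2_eq_square algebra_simps)
    moreover have "b * bump_kappa > 0" using b bump_kappa_pos by simp
    ultimately have "b - b * bump_kappa * cosh (5 / 4 * y) \<le> b + - (c * y\<^sup>2)" by linarith
    then have "norm (bump b (Complex x y)) \<le> exp b * exp (- (c * y\<^sup>2))"
      using norm_bump_le[OF less_imp_le[OF b] x, of y] unfolding exp_add[symmetric] by (meson exp_le_cancel_iff order_trans)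
    then have "norm (h y) * norm (bump b (Complex x y)) \<le> M * (exp b * exp (- (c * y\<^sup>2)))"
      using h(2)[of y] M by (intro mult_mono) auto
    then show "norm (h y * bump b (Complex x y)) \<le> norm (M * exp b * exp (- (c * y\<^sup>2)))"
      using M by (simp add: norm_mult mult.assoc)
  qed
qed

lemma continuous_on_rbump: "continuous_on A (rbump b)"
  unfolding rbump_def by (intro continuous_intros)

lemma rbump_measurable [measurable]: "rbump b \<in> borel_measurable borel"
  by (rule borel_measurable_continuous_onI[OF continuous_on_rbump])

lemma rbump_le_1: "b \<ge> 0 \<Longrightarrow> rbump b y \<le> 1"
  using mult_left_mono[OF cosh_real_ge_1[of "5 / 4 * y"], of b] by (simp add: rbump_def)

lemma rbump_pos: "rbump b y > 0" by (simp add: rbump_def)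

lemma rbump_minus: "rbump b (- y) = rbump b y"
  by (simp add: rbump_def)

lemma rbump_mono:
  assumes "b \<ge> 0" "\<bar>x\<bar> \<le> \<bar>y\<bar>"
  shows "rbump b y \<le> rbump b x"
proof -
  have "cosh \<bar>5 / 4 * x\<bar> \<le> cosh \<bar>5 / 4 * y\<bar>" using assms by (subst cosh_real_nonneg_le_iff) (auto simp: abs_mult)
  then have "cosh (5 / 4 * x) \<le> cosh (5 / 4 * y)" by (simp only: cosh_real_abs)
  then show ?thesis unfolding rbump_def using assms(1) by (simp add: mult_left_mono)
qed

lemma rbump_le_gauss: "b \<ge> 0 \<Longrightarrow> rbump b y \<le> exp (- (b * (25 / 32) * y\<^sup>2))"
proof -
  assume b: "b \<ge> 0"
  have "b * (1 + (5 / 4 * y)\<^sup>2 / 2) \<le> b * cosh (5 / 4 * y)" using b by (intro mult_left_mono cosh_ge_quadratic)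
  moreover have "b * (1 + (5 / 4 * y)\<^sup>2 / 2) = b + b * (25 / 32) * y\<^sup>2" by (simp add: power2_eq_square algebra_simps)
  ultimately show ?thesis unfolding rbump_def by simp
qed

lemma integrable_rbump: "b > 0 \<Longrightarrow> integrable lborel (rbump b)"
proof -
  assume b: "b > 0"
  have "integrable lborel (\<lambda>y. 1 * bump b (Complex 0 y))" by (rule integrable_bump[OF b, where M = 1]) auto
  then have "integrable lborel (\<lambda>y. complex_of_real (rbump b y))" by (simp add: bump_imag)
  then show ?thesis using integrable_Re by fastforce
qed

section \<open>Fourier transform of the weight\<close>

definition bump_hat :: "real \<Rightarrow> real \<Rightarrow> real" where
  "bump_hat b \<xi> = (LINT y|lborel. cos (\<xi> * y) * rbump b y)"

lemma integrable_cos_rbump: "b > 0 \<Longrightarrow> integrable lborel (\<lambda>y. cos (\<xi> * y) * rbump b y)"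
  by (rule Bochner_Integration.integrable_bound[OF integrable_rbump])
     (auto simp: abs_mult intro!: mult_left_le_one_le)

text \<open>Cauchy's theorem moves the line Re w = 1, over which the Dirichlet series converges, to
  Re w = 0, where the weight is real and even; the sine part drops out by parity.\<close>

lemma bump_fourier:
  assumes b: "b > 0"
  shows "(LINT y|lborel. exp (- (of_real \<xi> * Complex 1 y)) * bump b (Complex 1 y)) = of_real (bump_hat b \<xi>)"
proof -
  define f where "f = (\<lambda>w. exp (- (of_real \<xi> * w)) * bump b w)"
  have fc: "continuous_on A f" for A unfolding f_def by (intro continuous_intros continuous_on_bump)
  have fh: "f holomorphic_on A" for A unfolding f_def by (intro holomorphic_intros holomorphic_bump)
  have nf: "norm (f (Complex x y)) \<le> exp \<bar>\<xi>\<bar> * exp (b - b * bump_kappa * cosh (5 / 4 * y))" if "\<bar>x\<bar> \<le> 1" for x y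
  proof -
    have "- (\<xi> * x) \<le> \<bar>\<xi>\<bar>" using that abs_le_D2[of "\<xi> * x" "\<bar>\<xi>\<bar>"] by (simp add: abs_mult mult_left_le)
    then have "norm (exp (- (of_real \<xi> * Complex x y))) \<le> exp \<bar>\<xi>\<bar>" by (simp add: norm_exp_eq_Re)
    then show ?thesis unfolding f_def norm_mult using norm_bump_le[of b x y] b that by (intro mult_mono) auto
  qed
  have int: "integrable lborel (\<lambda>y. f (Complex x y))" if "\<bar>x\<bar> \<le> 1" for x
    unfolding f_def
  proof (rule integrable_bump[OF b that, where M = "exp \<bar>\<xi>\<bar>"])
    show "continuous_on UNIV (\<lambda>y. exp (- (complex_of_real \<xi> * Complex x y)))" by (auto simp: Complex_eq intro!: continuous_intros)
    have "- (\<xi> * x) \<le> \<bar>\<xi>\<bar>" using that abs_le_D2[of "\<xi> * x" "\<bar>\<xi>\<bar>"] by (simp add: abs_mult mult_left_le)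
    then show "norm (exp (- (complex_of_real \<xi> * Complex x y))) \<le> exp \<bar>\<xi>\<bar>" for y by (simp add: norm_exp_eq_Re)
  qed
  have rect: "\<i> * integral {- real n..real n} (\<lambda>y. f (Complex 1 y)) - \<i> * integral {- real n..real n} (\<lambda>y. f (Complex 0 y)) =
     integral {0..1} (\<lambda>x. f (Complex x (real n))) - integral {0..1} (\<lambda>x. f (Complex x (- real n)))" for n
  proof -
    have "contour_integral (rectpath (Complex 0 (- real n)) (Complex 1 (real n))) f = 0"
      by (rule contour_integral_unique[OF Cauchy_theorem_convex_simple[of f UNIV]]) (auto intro: fh)
    then show ?thesis using contour_integral_rectpath[of 0 1 "- real n" "real n" f] fc by (simp add: algebra_simps)
  qed
  have hor: "(\<lambda>n. integral {0..1} (\<lambda>x. f (Complex x (\<sigma> * real n)))) \<longlonglongrightarrow> 0" if \<sigma>: "\<sigma> = 1 \<or> \<sigma> = -1" for \<sigma>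
  proof (rule Lim_null_comparison)
    show "\<forall>\<^sub>F n in sequentially. norm (integral {0..1} (\<lambda>x. f (Complex x (\<sigma> * real n)))) \<le> exp \<bar>\<xi>\<bar> * exp (b - b * bump_kappa * cosh (5 / 4 * real n)) * (1 - 0)"
    proof (intro always_eventually allI integral_bound)
      fix n
      show "continuous_on {0..1} (\<lambda>x. f (Complex x (\<sigma> * real n)))"
        by (rule continuous_on_compose2[OF fc[of UNIV]]) (auto simp: Complex_eq intro!: continuous_intros)
      fix x :: real assume "x \<in> {0..1}"
      then have "norm (f (Complex x (\<sigma> * real n))) \<le> exp \<bar>\<xi>\<bar> * exp (b - b * bump_kappa * cosh (5 / 4 * (\<sigma> * real n)))" by (intro nf) auto
      also have "cosh (5 / 4 * (\<sigma> * real n)) = cosh (5 / 4 * real n)" using \<sigma> by auto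
      finally show "norm (f (Complex x (\<sigma> * real n))) \<le> exp \<bar>\<xi>\<bar> * exp (b - b * bump_kappa * cosh (5 / 4 * real n))" .
    qed auto
    have "filterlim (\<lambda>n. b * bump_kappa * cosh (5 / 4 * real n) - b) at_top sequentially"
    proof (rule filterlim_at_top_mono)
      define k where "k = b * bump_kappa"
      have k: "k > 0" using b bump_kappa_pos by (simp add: k_def)
      show "filterlim (\<lambda>n. k * (1 + (5 / 4 * real n)\<^sup>2 / 2) - b) at_top sequentially" using k by real_asymp
      show "\<forall>\<^sub>F n in sequentially. k * (1 + (5 / 4 * real n)\<^sup>2 / 2) - b \<le> b * bump_kappa * cosh (5 / 4 * real n) - b"
        unfolding k_def[symmetric] using k by (intro always_eventually allI diff_right_mono mult_left_mono cosh_ge_quadratic) auto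
    qed
    then have "(\<lambda>n. exp (- (b * bump_kappa * cosh (5 / 4 * real n) - b))) \<longlonglongrightarrow> 0"
      by (intro filterlim_compose[OF exp_at_bot] filterlim_compose[OF filterlim_uminus_at_bot_at_top])
    then show "(\<lambda>n. exp \<bar>\<xi>\<bar> * exp (b - b * bump_kappa * cosh (5 / 4 * real n)) * (1 - 0)) \<longlonglongrightarrow> 0"
      by (auto intro!: tendsto_mult_right_zero)
  qed
  have "(\<lambda>n. \<i> * integral {- real n..real n} (\<lambda>y. f (Complex 1 y)) - \<i> * integral {- real n..real n} (\<lambda>y. f (Complex 0 y))) \<longlonglongrightarrow> \<i> * (LINT y|lborel. f (Complex 1 y)) - \<i> * (LINT y|lborel. f (Complex 0 y))"
    by (intro tendsto_intros tendsto_integral_symmetric int filterlim_real_sequentially) auto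
  moreover have "(\<lambda>n. \<i> * integral {- real n..real n} (\<lambda>y. f (Complex 1 y)) - \<i> * integral {- real n..real n} (\<lambda>y. f (Complex 0 y))) \<longlonglongrightarrow> 0 - 0"
    unfolding rect using tendsto_diff[OF hor[of 1] hor[of "-1"]] by simp
  ultimately have eq: "(LINT y|lborel. f (Complex 1 y)) = (LINT y|lborel. f (Complex 0 y))"
    using LIMSEQ_unique by fastforce
  have f0: "f (Complex 0 y) = of_real (cos (\<xi> * y) * rbump b y) - \<i> * of_real (sin (\<xi> * y) * rbump b y)" for y
  proof -
    have "- (of_real \<xi> * Complex 0 y) = \<i> * of_real (- (\<xi> * y))" by (simp add: complex_eq_iff)
    then have "exp (- (of_real \<xi> * Complex 0 y)) = cis (- (\<xi> * y))" by (simp only: cis_conv_exp)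
    then show ?thesis unfolding f_def bump_imag by (simp add: complex_eq_iff)
  qed
  have ints: "integrable lborel (\<lambda>y. sin (\<xi> * y) * rbump b y)"
    by (rule Bochner_Integration.integrable_bound[OF integrable_rbump[OF b]])
       (auto simp: abs_mult intro!: mult_left_le_one_le)
  have "(LINT y|lborel. sin (\<xi> * y) * rbump b y) = (LINT y|lborel. sin (\<xi> * (0 + (-1) * y)) * rbump b (0 + (-1) * y))"
    using lborel_integral_real_affine[of "-1" "\<lambda>y. sin (\<xi> * y) * rbump b y" 0] by simp
  also have "\<dots> = - (LINT y|lborel. sin (\<xi> * y) * rbump b y)" by (simp add: rbump_minus)
  finally have s0: "(LINT y|lborel. sin (\<xi> * y) * rbump b y) = 0" by simp
  have "(LINT y|lborel. f (Complex 0 y)) = (LINT y|lborel. complex_of_real (cos (\<xi> * y) * rbump b y)) - (LINT y|lborel. \<i> * complex_of_real (sin (\<xi> * y) * rbump b y))"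
    unfolding f0 using integrable_cos_rbump[OF b] ints by (intro Bochner_Integration.integral_diff integrable_mult_right integrable_of_real)
  also have "\<dots> = of_real (bump_hat b \<xi>)"
    using s0 by (simp only: integral_mult_right_zero integral_complex_of_real bump_hat_def) simp
  finally show ?thesis using eq by (simp add: f_def)
qed

text \<open>The Gaussian majorant for b = 1 serves all b >= 1, so the constant can be fixed before
  \<open>b\<close> is chosen.\<close>

lemma bump_hat_0_le:
  obtains C where "C > 0" "\<And>b. b \<ge> 1 \<Longrightarrow> bump_hat b 0 \<le> C" "\<And>b \<xi>. b \<ge> 1 \<Longrightarrow> \<bar>bump_hat b \<xi>\<bar> \<le> C"
proof -
  define C where "C = (LINT y|lborel. exp (- (25 / 32 * (y::real)\<^sup>2))) + 1"
  have int: "integrable lborel (\<lambda>y::real. exp (- (25 / 32 * y\<^sup>2)))" by (rule integrable_exp_square) simp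
  have C: "C > 0" unfolding C_def by (intro add_nonneg_pos integral_nonneg_AE) auto
  have *: "\<bar>bump_hat b \<xi>\<bar> \<le> C" if b: "b \<ge> 1" for b \<xi>
  proof -
    have "\<bar>bump_hat b \<xi>\<bar> \<le> (LINT y|lborel. norm (cos (\<xi> * y) * rbump b y))"
      unfolding bump_hat_def real_norm_def[symmetric] by (rule integral_norm_bound)
    also have "\<dots> \<le> (LINT y|lborel. exp (- (25 / 32 * (y::real)\<^sup>2)))"
    proof (rule integral_mono)
      show "integrable lborel (\<lambda>y. norm (cos (\<xi> * y) * rbump b y))" using integrable_cos_rbump[of b \<xi>] b by simp
      fix y :: real
      have "norm (cos (\<xi> * y) * rbump b y) \<le> 1 * rbump b y" using rbump_pos[of b y] by (simp add: abs_mult mult_left_le_one_le)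
      also have "1 * rbump b y \<le> exp (- (b * (25 / 32) * y\<^sup>2))" using rbump_le_gauss[of b y] b by simp
      also have "\<dots> \<le> exp (- (25 / 32 * y\<^sup>2))"
      proof -
        have "1 * (25 / 32 * y\<^sup>2) \<le> b * (25 / 32 * y\<^sup>2)" using b by (intro mult_right_mono) auto
        then show ?thesis by simp
      qed
      finally show "norm (cos (\<xi> * y) * rbump b y) \<le> exp (- (25 / 32 * y\<^sup>2))" .
    qed (rule int)
    finally show ?thesis by (simp add: C_def)
  qed
  show ?thesis using that[OF C] * by (meson abs_le_D1)
qed

lemma cosh_le_quadratic:
  obtains D :: real where "D > 0" "\<And>x. \<bar>x\<bar> \<le> 5 / 4 \<Longrightarrow> cosh x \<le> 1 + D * x\<^sup>2"
proof (rule that[of "(cosh (5 / 8))\<^sup>2 / 2"])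
  show "(cosh (5 / 8 :: real))\<^sup>2 / 2 > 0" using cosh_real_pos[of "5 / 8"] by simp
next
  have *: "sinh z \<le> z * cosh z" if "z \<ge> 0" for z :: real
  proof -
    have "0 * cosh 0 - sinh 0 \<le> z * cosh z - sinh z"
    proof (rule DERIV_nonneg_imp_nondecreasing[OF that])
      fix x :: real assume "0 \<le> x"
      then have "((\<lambda>x. x * cosh x - sinh x) has_real_derivative x * sinh x) (at x)" "0 \<le> x * sinh x"
        by (auto intro!: derivative_eq_intros)
      then show "\<exists>y. ((\<lambda>x. x * cosh x - sinh x) has_real_derivative y) (at x) \<and> 0 \<le> y" by blast
    qed
    then show ?thesis by simp
  qed
  fix x :: real assume x: "\<bar>x\<bar> \<le> 5 / 4"
  have "sinh (\<bar>x\<bar> / 2) \<le> \<bar>x\<bar> / 2 * cosh (\<bar>x\<bar> / 2)" by (rule *) simp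
  also have "cosh (\<bar>x\<bar> / 2) \<le> cosh (5 / 8)" using x by (subst cosh_real_nonneg_le_iff) auto
  then have "\<bar>x\<bar> / 2 * cosh (\<bar>x\<bar> / 2) \<le> \<bar>x\<bar> / 2 * cosh (5 / 8)" by (intro mult_left_mono) auto
  finally have "(sinh (\<bar>x\<bar> / 2))\<^sup>2 \<le> (\<bar>x\<bar> / 2 * cosh (5 / 8))\<^sup>2" by (intro power_mono) auto
  moreover have "cosh \<bar>x\<bar> = 1 + 2 * (sinh (\<bar>x\<bar> / 2))\<^sup>2" using cosh_double[of "\<bar>x\<bar> / 2"] by (simp add: cosh_square_eq)
  ultimately have "cosh \<bar>x\<bar> \<le> 1 + 2 * (\<bar>x\<bar> / 2 * cosh (5 / 8))\<^sup>2" by linarith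
  also have "2 * (\<bar>x\<bar> / 2 * cosh (5 / 8))\<^sup>2 = (cosh (5 / 8))\<^sup>2 / 2 * x\<^sup>2" by (simp add: power_mult_distrib power_divide)
  finally show "cosh x \<le> 1 + (cosh (5 / 8))\<^sup>2 / 2 * x\<^sup>2" by (simp only: cosh_real_abs)
qed

lemma cos_ge_quadratic: "cos (x::real) \<ge> 1 - x\<^sup>2 / 2"
proof -
  have "cos x = 1 - 2 * (sin (x / 2))\<^sup>2" using cos_double_sin[of "x / 2"] by simp
  moreover have "(sin (x / 2))\<^sup>2 \<le> (x / 2)\<^sup>2" by (rule abs_le_square_iff[THEN iffD1]) (rule abs_sin_x_le_abs_x)
  ultimately show ?thesis by (simp add: power_divide)
qed

text \<open>By cos x >= 1 - x^2 / 2 the transform is at least the zeroth moment of the weight minus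
  \<xi>^2 / 2 times its second moment. With w = 1 / sqrt b these are at least 2 q w and at most M2
  w^3, so for \<xi> <= c2 * sqrt b an amount q w survives.\<close>

lemma bump_hat_lower:
  obtains c1 c2 :: real where "c1 > 0" "c2 > 0" "c2 \<le> 1 / 2" "\<And>b \<xi>. b \<ge> 1 \<Longrightarrow> 0 \<le> \<xi> \<Longrightarrow> \<xi> \<le> c2 * sqrt b \<Longrightarrow> bump_hat b \<xi> \<ge> c1 / sqrt b"
proof -
  obtain D :: real where D: "D > 0" "\<And>x. \<bar>x\<bar> \<le> 5 / 4 \<Longrightarrow> cosh x \<le> 1 + D * x\<^sup>2" by (rule cosh_le_quadratic) blast
  define q where "q = exp (- (D * 25 / 16))"
  have q: "q > 0" by (simp add: q_def)
  define M2 where "M2 = (LINT y|lborel. (y::real)\<^sup>2 * exp (- (25 / 32 * y\<^sup>2)))"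
  have M2: "M2 \<ge> 0" unfolding M2_def by (intro integral_nonneg_AE) auto
  \<comment> \<open>The square root makes c2^2 * M2 / 2 <= q, the loss that can be afforded. The cap
    1/2 guarantees ln x / c2 >= 1 for x >= 2, hence b >= 1 where \<open>b\<close> is chosen.\<close>
  define c2 where "c2 = min (1 / 2) (sqrt (2 * q / (M2 + 1)))"
  have c2: "c2 > 0" "c2 \<le> 1 / 2" "c2\<^sup>2 * M2 / 2 \<le> q"
  proof -
    show "c2 > 0" "c2 \<le> 1 / 2" using q M2 by (auto simp: c2_def)
    have "c2\<^sup>2 \<le> (sqrt (2 * q / (M2 + 1)))\<^sup>2" using \<open>c2 > 0\<close> by (intro power_mono) (auto simp: c2_def)
    also have "\<dots> = 2 * q / (M2 + 1)" using q M2 by simp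
    finally have "c2\<^sup>2 * M2 / 2 \<le> 2 * q / (M2 + 1) * M2 / 2" using M2 by (intro divide_right_mono mult_right_mono) auto
    also have "\<dots> = q * (M2 / (M2 + 1))" using M2 by (simp add: divide_simps)
    also have "\<dots> \<le> q * 1" using q M2 by (intro mult_left_mono) auto
    finally show "c2\<^sup>2 * M2 / 2 \<le> q" by simp
  qed
  show ?thesis
  proof (rule that[OF q c2(1,2)])
    fix b \<xi> :: real assume b: "b \<ge> 1" and \<xi>: "0 \<le> \<xi>" "\<xi> \<le> c2 * sqrt b"
    define w where "w = 1 / sqrt b"
    have w: "w > 0" "w \<le> 1" "w\<^sup>2 * b = 1" using b by (auto simp: w_def power_divide)
    have g: "integrable lborel (rbump b)" using b by (intro integrable_rbump) simp
    have bnd: "y\<^sup>2 * rbump b y \<le> y\<^sup>2 * exp (- (b * (25 / 32) * y\<^sup>2))" for y using rbump_le_gauss[of b y] b by (intro mult_left_mono) auto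
    have m: "integrable lborel (\<lambda>y. y\<^sup>2 * exp (- (b * (25 / 32) * y\<^sup>2)))" using b by (intro integrable_exp_square_moment) simp
    have y2: "integrable lborel (\<lambda>y. y\<^sup>2 * rbump b y)"
    proof (rule Bochner_Integration.integrable_bound[OF m])
      show "(\<lambda>y. y\<^sup>2 * rbump b y) \<in> borel_measurable lborel" by measurable
      show "AE y in lborel. norm (y\<^sup>2 * rbump b y) \<le> norm (y\<^sup>2 * exp (- (b * (25 / 32) * y\<^sup>2)))"
        using bnd by (intro AE_I2) (simp add: abs_mult abs_of_pos[OF rbump_pos])
    qed
    have G0: "(LINT y|lborel. rbump b y) \<ge> 2 * w * q"
    proof -
      have "(LINT y|lborel. q * indicator {-w..w} y) \<le> (LINT y|lborel. rbump b y)"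
      proof (rule integral_mono)
        have "integrable lborel (indicator {-w..w} :: real \<Rightarrow> real)" by (rule integrable_real_indicator) (use w in auto)
        then show "integrable lborel (\<lambda>y. q * indicator {-w..w} y)" by (rule integrable_mult_right)
        show "integrable lborel (rbump b)" by (rule g)
        fix y show "q * indicator {-w..w} y \<le> rbump b y"
        proof (cases "y \<in> {-w..w}")
          case True
          then have yw: "\<bar>y\<bar> \<le> w" by auto
          then have "\<bar>5 / 4 * y\<bar> \<le> 5 / 4" using w by (simp add: abs_mult)
          then have "cosh (5 / 4 * y) \<le> 1 + D * (5 / 4 * y)\<^sup>2" by (rule D(2))
          also have "(5 / 4 * y)\<^sup>2 = 25 / 16 * y\<^sup>2" by (simp add: power2_eq_square)
          also have "1 + D * (25 / 16 * y\<^sup>2) \<le> 1 + D * (25 / 16 * w\<^sup>2)"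
          proof -
            have "y\<^sup>2 \<le> w\<^sup>2" using yw w by (intro abs_le_square_iff[THEN iffD1]) auto
            then show ?thesis using D(1) by simp
          qed
          finally have "cosh (5 / 4 * y) \<le> 1 + D * (25 / 16 * w\<^sup>2)" .
          then have "b * cosh (5 / 4 * y) \<le> b * (1 + D * (25 / 16 * w\<^sup>2))" using b by (intro mult_left_mono) auto
          also have "\<dots> = b + D * 25 / 16 * (w\<^sup>2 * b)" by (simp add: algebra_simps)
          finally have "q \<le> rbump b y" unfolding q_def rbump_def w(3) by simp
          then show ?thesis using True by simp
        qed (use rbump_pos[of b y] in simp)
      qed
      then show ?thesis using w by (simp add: mult_ac)
    qed
    have G2: "(LINT y|lborel. y\<^sup>2 * rbump b y) \<le> w * (w\<^sup>2 * M2)"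
    proof -
      have "(LINT y|lborel. y\<^sup>2 * rbump b y) \<le> (LINT y|lborel. y\<^sup>2 * exp (- (b * (25 / 32) * y\<^sup>2)))"
        by (rule integral_mono[OF y2 m bnd])
      also have "\<dots> = w * (LINT v|lborel. (0 + w * v)\<^sup>2 * exp (- (b * (25 / 32) * (0 + w * v)\<^sup>2)))"
        using lborel_integral_real_affine[of w "\<lambda>y. y\<^sup>2 * exp (- (b * (25 / 32) * y\<^sup>2))" 0] w by simp
      also have "(\<lambda>v. (0 + w * v)\<^sup>2 * exp (- (b * (25 / 32) * (0 + w * v)\<^sup>2))) = (\<lambda>v. w\<^sup>2 * (v\<^sup>2 * exp (- (25 / 32 * v\<^sup>2))))"
      proof
        fix v
        have "b * (25 / 32) * (0 + w * v)\<^sup>2 = (w\<^sup>2 * b) * (25 / 32 * v\<^sup>2)" by (simp add: power_mult_distrib mult_ac)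
        then show "(0 + w * v)\<^sup>2 * exp (- (b * (25 / 32) * (0 + w * v)\<^sup>2)) = w\<^sup>2 * (v\<^sup>2 * exp (- (25 / 32 * v\<^sup>2)))"
          unfolding w(3) by (simp add: power_mult_distrib)
      qed
      also have "(LINT v|lborel. w\<^sup>2 * (v\<^sup>2 * exp (- (25 / 32 * v\<^sup>2)))) = w\<^sup>2 * M2" by (simp add: M2_def)
      finally show ?thesis .
    qed
    have "bump_hat b \<xi> \<ge> (LINT y|lborel. rbump b y - \<xi>\<^sup>2 / 2 * (y\<^sup>2 * rbump b y))"
      unfolding bump_hat_def
    proof (rule integral_mono)
      show "integrable lborel (\<lambda>y. rbump b y - \<xi>\<^sup>2 / 2 * (y\<^sup>2 * rbump b y))" by (intro Bochner_Integration.integrable_diff integrable_mult_right g y2)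
      show "integrable lborel (\<lambda>y. cos (\<xi> * y) * rbump b y)" using b by (intro integrable_cos_rbump) simp
      fix y
      have "(1 - (\<xi> * y)\<^sup>2 / 2) * rbump b y \<le> cos (\<xi> * y) * rbump b y" using rbump_pos[of b y] by (intro mult_right_mono cos_ge_quadratic) auto
      then show "rbump b y - \<xi>\<^sup>2 / 2 * (y\<^sup>2 * rbump b y) \<le> cos (\<xi> * y) * rbump b y" by (simp add: power_mult_distrib algebra_simps)
    qed
    also have "(LINT y|lborel. rbump b y - \<xi>\<^sup>2 / 2 * (y\<^sup>2 * rbump b y)) = (LINT y|lborel. rbump b y) - \<xi>\<^sup>2 / 2 * (LINT y|lborel. y\<^sup>2 * rbump b y)"
      using g y2 by (subst Bochner_Integration.integral_diff) auto
    finally have 1: "bump_hat b \<xi> \<ge> (LINT y|lborel. rbump b y) - \<xi>\<^sup>2 / 2 * (LINT y|lborel. y\<^sup>2 * rbump b y)" .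
    have "\<xi>\<^sup>2 \<le> (c2 * sqrt b)\<^sup>2" using \<xi> by (intro power_mono) auto
    then have x2: "\<xi>\<^sup>2 \<le> c2\<^sup>2 * b" using b by (simp add: power_mult_distrib)
    have "\<xi>\<^sup>2 / 2 * (LINT y|lborel. y\<^sup>2 * rbump b y) \<le> (c2\<^sup>2 * b) / 2 * (w * (w\<^sup>2 * M2))"
    proof (rule mult_mono)
      show "0 \<le> (LINT y|lborel. y\<^sup>2 * rbump b y)" by (intro integral_nonneg_AE AE_I2 mult_nonneg_nonneg less_imp_le[OF rbump_pos]) auto
    qed (use x2 G2 b in auto)
    also have "\<dots> = w * (c2\<^sup>2 * M2 / 2) * (w\<^sup>2 * b)" by (simp add: mult_ac)
    also have "\<dots> \<le> w * q" unfolding w(3) using c2(3) w(1) by simp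
    finally have "\<xi>\<^sup>2 / 2 * (LINT y|lborel. y\<^sup>2 * rbump b y) \<le> w * q" .
    then have "bump_hat b \<xi> \<ge> w * q" using 1 G0 by linarith
    then show "q / sqrt b \<le> bump_hat b \<xi>" by (simp add: w_def)
  qed
qed

section \<open>Large values of the prime sum\<close>

definition mangoldt_tail :: "nat \<Rightarrow> real" where
  "mangoldt_tail N = (\<Sum>n. mangoldt (n + N) * real (n + N) powr (- (3 / 2)))"

lemma mangoldt_tail_tendsto: "mangoldt_tail \<longlonglongrightarrow> 0"
  unfolding mangoldt_tail_def
  by (rule suminf_exist_split2) (rule summable_mangoldt_powr, simp)

definition bump_mass :: "real \<Rightarrow> real" where
  "bump_mass b = (LINT y|lborel. norm (bump b (Complex 1 y)))"

text \<open>3/2 is read as 1/2 + 1: the critical line supplies 1 / sqrt n, the height \<tau>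
  supplies the phase to be steered, and the rest is the Fourier kernel on the line Re w = 1.\<close>

lemma dirichlet_term_split:
  assumes "n > 0"
  shows "1 / of_nat n powr Complex (3 / 2) (\<tau> + y) =
    of_real (1 / sqrt (real n)) * cis (- (\<tau> * ln (real n))) * exp (- (of_real (ln (real n)) * Complex 1 y))"
proof -
  have Ln: "Ln (of_nat n) = of_real (ln (real n))" using Ln_of_real[of "real n"] assms by simp
  have "1 / of_nat n powr Complex (3 / 2) (\<tau> + y) = exp (- (Complex (3 / 2) (\<tau> + y) * of_real (ln (real n))))"
    using assms by (simp add: powr_def Ln exp_minus inverse_eq_divide)
  also have "- (Complex (3 / 2) (\<tau> + y) * of_real (ln (real n))) =
      of_real (- ln (real n) / 2) + (\<i> * of_real (- (\<tau> * ln (real n))) + - (of_real (ln (real n)) * Complex 1 y))"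
    by (simp add: complex_eq_iff algebra_simps)
  also have "exp \<dots> = of_real (exp (- ln (real n) / 2)) * (cis (- (\<tau> * ln (real n))) * exp (- (of_real (ln (real n)) * Complex 1 y)))"
    by (simp only: exp_add exp_of_real cis_conv_exp)
  also have "exp (- ln (real n) / 2) = 1 / sqrt (real n)"
  proof -
    have "exp (- ln (real n) / 2) = real n powr (- (1 / 2))" using assms by (simp add: powr_def)
    also have "\<dots> = 1 / sqrt (real n)" using assms by (simp add: powr_minus_divide powr_half_sqrt)
    finally show ?thesis .
  qed
  finally show ?thesis by (simp add: mult.assoc)
qed

text \<open>The Dirichlet series of - \<zeta>'/\<zeta> is cut at N. Its finite part is integrated
  term by term through \<open>bump_fourier\<close>; the remainder is at most the tail of the
  absolutely convergent series times the L1 norm of the weight on Re w = 1.\<close>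

lemma prime_side_lower_bound:
  assumes b: "b > 0"
  shows "integrable lborel (\<lambda>y. deriv zeta (Complex (3 / 2) (\<tau> + y)) / zeta (Complex (3 / 2) (\<tau> + y)) * bump b (Complex 1 y))"
    and "Re (LINT y|lborel. deriv zeta (Complex (3 / 2) (\<tau> + y)) / zeta (Complex (3 / 2) (\<tau> + y)) * bump b (Complex 1 y))
      \<ge> - (\<Sum>n\<le>N. mangoldt n / sqrt (real n) * bump_hat b (ln (real n)) * cos (\<tau> * ln (real n))) - mangoldt_tail (Suc N) * bump_mass b"
proof -
  define D where "D = (\<lambda>y. mangoldt_series (Complex (3 / 2) (\<tau> + y)))"
  define S where "S = (\<lambda>y. \<Sum>n\<le>N. mangoldt n / of_nat n powr Complex (3 / 2) (\<tau> + y))"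
  define t where "t = (\<lambda>n. mangoldt n * real n powr (- (3 / 2)))"
  have st: "summable t" unfolding t_def by (rule summable_mangoldt_powr) simp
  have ld: "deriv zeta (Complex (3 / 2) (\<tau> + y)) / zeta (Complex (3 / 2) (\<tau> + y)) = - D y" for y
    unfolding D_def by (rule zeta_log_deriv) simp
  have nt: "norm (mangoldt n / of_nat n powr Complex (3 / 2) (\<tau> + y) :: complex) = t n" for n y
    unfolding norm_dirichlet_term t_def by simp
  have Dsum: "(\<lambda>n. mangoldt n / of_nat n powr Complex (3 / 2) (\<tau> + y)) sums D y" for y
    unfolding D_def by (rule mangoldt_series_sums) simp
  have Dn: "norm (D y) \<le> suminf t" for y
    using norm_suminf_le[OF _ st, of "\<lambda>n. mangoldt n / of_nat n powr Complex (3 / 2) (\<tau> + y)"] Dsum[of y] nt by (simp add: sums_iff)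
  have DS: "norm (D y - S y) \<le> mangoldt_tail (Suc N)" for y
  proof -
    have "D y = (\<Sum>n. mangoldt (n + Suc N) / of_nat (n + Suc N) powr Complex (3 / 2) (\<tau> + y)) + (\<Sum>n<Suc N. mangoldt n / of_nat n powr Complex (3 / 2) (\<tau> + y))"
      using suminf_split_initial_segment[OF sums_summable[OF Dsum[of y]], of "Suc N"] Dsum[of y] by (simp add: sums_iff)
    then have "D y - S y = (\<Sum>n. mangoldt (n + Suc N) / of_nat (n + Suc N) powr Complex (3 / 2) (\<tau> + y))"
      by (simp add: S_def lessThan_Suc_atMost)
    also have "norm \<dots> \<le> (\<Sum>n. t (n + Suc N))"
    proof (rule norm_suminf_le)
      show "norm (mangoldt (n + Suc N) / of_nat (n + Suc N) powr Complex (3 / 2) (\<tau> + y) :: complex) \<le> t (n + Suc N)" for n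
        using nt[of "n + Suc N" y] by (rule eq_refl)
      show "summable (\<lambda>n. t (n + Suc N))" using st by (rule summable_ignore_initial_segment)
    qed
    finally show ?thesis by (simp add: mangoldt_tail_def t_def)
  qed
  have Dc: "continuous_on UNIV D"
    unfolding D_def
    by (rule continuous_on_compose2[OF holomorphic_on_imp_continuous_on[OF holomorphic_mangoldt_series]])
       (auto simp: Complex_eq intro!: continuous_intros)
  have Dint: "integrable lborel (\<lambda>y. D y * bump b (Complex 1 y))"
    by (rule integrable_bump[OF b _ Dc Dn]) simp
  show "integrable lborel (\<lambda>y. deriv zeta (Complex (3 / 2) (\<tau> + y)) / zeta (Complex (3 / 2) (\<tau> + y)) * bump b (Complex 1 y))"
    unfolding ld using Dint by simp
  define f where "f = (\<lambda>n y. exp (- (of_real (ln (real n)) * Complex 1 y)) * bump b (Complex 1 y))"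
  have fint: "integrable lborel (f n)" for n
    unfolding f_def
  proof (rule integrable_bump[OF b])
    show "continuous_on UNIV (\<lambda>y. exp (- (complex_of_real (ln (real n)) * Complex 1 y)))" by (auto simp: Complex_eq intro!: continuous_intros)
    show "norm (exp (- (complex_of_real (ln (real n)) * Complex 1 y))) \<le> exp (- ln (real n))" for y by (simp add: norm_exp_eq_Re)
  qed simp
  define c where "c = (\<lambda>n. complex_of_real (mangoldt n / sqrt (real n)) * cis (- (\<tau> * ln (real n))))"
  have Sf: "S y * bump b (Complex 1 y) = (\<Sum>n\<le>N. c n * f n y)" for y
    unfolding S_def sum_distrib_right
  proof (rule sum.cong[OF refl])
    fix n assume "n \<in> {..N}"
    show "mangoldt n / of_nat n powr Complex (3 / 2) (\<tau> + y) * bump b (Complex 1 y) = c n * f n y"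
    proof (cases "n = 0")
      case False
      have "mangoldt n / of_nat n powr Complex (3 / 2) (\<tau> + y) = of_real (mangoldt n) * (1 / of_nat n powr Complex (3 / 2) (\<tau> + y))" by simp
      also have "\<dots> = of_real (mangoldt n) * (of_real (1 / sqrt (real n)) * cis (- (\<tau> * ln (real n))) * exp (- (of_real (ln (real n)) * Complex 1 y)))"
        using False by (subst dirichlet_term_split) auto
      finally show ?thesis by (simp add: c_def f_def mult_ac)
    qed (simp add: c_def)
  qed
  have Sint: "integrable lborel (\<lambda>y. S y * bump b (Complex 1 y))" unfolding Sf by (intro Bochner_Integration.integrable_sum integrable_mult_right fint)
  have Sval: "(LINT y|lborel. S y * bump b (Complex 1 y)) = (\<Sum>n\<le>N. c n * of_real (bump_hat b (ln (real n))))"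
    unfolding Sf using fint bump_fourier[OF b] by (subst Bochner_Integration.integral_sum) (auto simp: f_def)
  have ReS: "Re (LINT y|lborel. S y * bump b (Complex 1 y)) = (\<Sum>n\<le>N. mangoldt n / sqrt (real n) * bump_hat b (ln (real n)) * cos (\<tau> * ln (real n)))"
    unfolding Sval Re_sum by (intro sum.cong refl) (simp add: c_def mult_ac)
  have "(LINT y|lborel. D y * bump b (Complex 1 y)) - (LINT y|lborel. S y * bump b (Complex 1 y)) = (LINT y|lborel. (D y - S y) * bump b (Complex 1 y))"
    using Dint Sint by (subst Bochner_Integration.integral_diff[symmetric]) (auto simp: left_diff_distrib)
  also have "norm \<dots> \<le> (LINT y|lborel. norm ((D y - S y) * bump b (Complex 1 y)))" by (rule integral_norm_bound)
  also have "\<dots> \<le> (LINT y|lborel. mangoldt_tail (Suc N) * norm (bump b (Complex 1 y)))"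
  proof (rule integral_mono)
    show "integrable lborel (\<lambda>y. norm ((D y - S y) * bump b (Complex 1 y)))"
      using Dint Sint by (intro integrable_norm) (simp add: left_diff_distrib)
    have "integrable lborel (\<lambda>y. 1 * bump b (Complex 1 y))" by (rule integrable_bump[OF b, where M = 1]) auto
    then show "integrable lborel (\<lambda>y. mangoldt_tail (Suc N) * norm (bump b (Complex 1 y)))" by (intro integrable_mult_right integrable_norm) simp
    show "norm ((D y - S y) * bump b (Complex 1 y)) \<le> mangoldt_tail (Suc N) * norm (bump b (Complex 1 y))" for y
      unfolding norm_mult by (intro mult_right_mono DS) auto
  qed
  also have "\<dots> = mangoldt_tail (Suc N) * bump_mass b" by (simp add: bump_mass_def)
  finally have "Re (LINT y|lborel. D y * bump b (Complex 1 y)) - Re (LINT y|lborel. S y * bump b (Complex 1 y)) \<le> mangoldt_tail (Suc N) * bump_mass b"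
    using complex_Re_le_cmod by (metis minus_complex.sel(1) order_trans)
  then show "Re (LINT y|lborel. deriv zeta (Complex (3 / 2) (\<tau> + y)) / zeta (Complex (3 / 2) (\<tau> + y)) * bump b (Complex 1 y))
      \<ge> - (\<Sum>n\<le>N. mangoldt n / sqrt (real n) * bump_hat b (ln (real n)) * cos (\<tau> * ln (real n))) - mangoldt_tail (Suc N) * bump_mass b"
    unfolding ld ReS by simp
qed

lemma norm_power_diff_le:
  fixes z w :: complex
  assumes "norm z = 1" "norm w = 1"
  shows "norm (z ^ k - w ^ k) \<le> real k * norm (z - w)"
proof (induction k)
  case (Suc k)
  have "z ^ Suc k - w ^ Suc k = z * (z ^ k - w ^ k) + (z - w) * w ^ k" by (simp add: algebra_simps)
  also have "norm \<dots> \<le> norm (z * (z ^ k - w ^ k)) + norm ((z - w) * w ^ k)" by (rule norm_triangle_ineq)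
  also have "\<dots> = norm (z ^ k - w ^ k) + norm (z - w)" using assms by (simp add: norm_mult norm_power)
  finally show ?case using Suc by (simp add: algebra_simps)
qed simp

text \<open>Turning every prime to the angle \<open>3\<pi>/4\<close> (or its opposite, according to the sign of the
  weight) makes the prime terms add up while the squares of primes contribute nothing,
  since \<open>cos (3\<pi>/2) = 0\<close>.\<close>

lemma large_prime_side:
  fixes A :: real
  obtains b L :: real where "b \<ge> 1" "\<And>T. \<exists>\<tau>. \<bar>\<tau> - T\<bar> \<le> L \<and>
    Re (LINT y|lborel. deriv zeta (Complex (3 / 2) (\<tau> + y)) / zeta (Complex (3 / 2) (\<tau> + y)) * bump b (Complex 1 y)) \<ge> A"
proof -
  obtain c1 c2 :: real where c: "c1 > 0" "c2 > 0" "c2 \<le> 1 / 2" "\<And>b \<xi>. b \<ge> 1 \<Longrightarrow> 0 \<le> \<xi> \<Longrightarrow> \<xi> \<le> c2 * sqrt b \<Longrightarrow> bump_hat b \<xi> \<ge> c1 / sqrt b"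
    by (rule bump_hat_lower) blast
  obtain C0 where C0: "C0 > 0" "\<And>b \<xi>. b \<ge> 1 \<Longrightarrow> \<bar>bump_hat b \<xi>\<bar> \<le> C0" by (rule bump_hat_0_le) blast
  obtain C3 where C3: "\<And>A. finite A \<Longrightarrow> (\<And>n. n \<in> A \<Longrightarrow> \<exists>p k. prime p \<and> k \<ge> 3 \<and> n = p ^ k) \<Longrightarrow> (\<Sum>n\<in>A. mangoldt n * real n powr (- (1 / 2))) \<le> C3"
    by (rule prime_power_sum_bound[of "1 / 2" 3]) auto
  \<comment> \<open>Solves c1 * c2 * B / sqrt 2 = A + C0 * C3 + 2: the aligned primes must outweigh
    the cubes and higher powers (C0 * C3), the phase errors (1) and the tail (1), and still leave
    \<open>A\<close>.\<close>
  define B where "B = (A + C0 * C3 + 2) * sqrt 2 / (c1 * c2)"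
  obtain x :: nat where x: "x \<ge> 2" "(\<Sum>p | prime p \<and> p \<le> x. ln (real p) / sqrt (real p)) \<ge> B * ln (real x)"
    by (rule sum_ln_over_sqrt_primes_unbounded)
  \<comment> \<open>ln x = c2 * sqrt b brings all primes up to x into the range where the transform
    is at least c1 / sqrt b. The loss 1 / sqrt b = c2 / ln x is compensated by the factor ln x in
    the choice of \<open>x\<close>.\<close>
  define b where "b = (ln (real x) / c2)\<^sup>2"
  have lnx: "ln (real x) \<ge> 1 / 2"
  proof -
    have "ln (real x) \<ge> ln 2" using x by simp
    then show ?thesis using ln2_ge_two_thirds by linarith
  qed
  have sb: "sqrt b = ln (real x) / c2" using lnx c by (simp add: b_def)
  have b1: "b \<ge> 1"
  proof -
    have "ln (real x) / c2 \<ge> 1" using lnx c by (simp add: le_divide_eq)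
    then show ?thesis unfolding b_def by simp
  qed
  have "eventually (\<lambda>N. mangoldt_tail N * bump_mass b < 1) sequentially"
  proof -
    have "(\<lambda>N. mangoldt_tail N * bump_mass b) \<longlonglongrightarrow> 0 * bump_mass b" by (intro tendsto_intros mangoldt_tail_tendsto)
    then show ?thesis by (intro order_tendstoD) auto
  qed
  then obtain N0 where N0: "\<And>N. N \<ge> N0 \<Longrightarrow> mangoldt_tail N * bump_mass b < 1" by (auto simp: eventually_sequentially)
  \<comment> \<open>\<open>N\<close> may exceed \<open>x\<close>, because the tail must be small for
    the chosen \<open>b\<close>. The primes in between are aligned as well: the sign of their weight
    is unknown, but after alignment their terms cannot hurt.\<close>
  define N where "N = max N0 x"
  have N: "mangoldt_tail (Suc N) * bump_mass b \<le> 1" "x \<le> N" 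
  proof -
    show "mangoldt_tail (Suc N) * bump_mass b \<le> 1" by (rule less_imp_le, rule N0) (simp add: N_def)
    show "x \<le> N" by (simp add: N_def)
  qed
  define h where "h = (\<lambda>n::nat. bump_hat b (ln (real n)))"
  have h: "\<bar>h n\<bar> \<le> C0" for n using C0 b1 by (simp add: h_def)
  define \<beta> where "\<beta> = 3 * pi / 4"
  have \<beta>1: "cos \<beta> = - (1 / sqrt 2)"
  proof -
    have "cos \<beta> = cos (pi - pi / 4)" by (simp add: \<beta>_def field_simps)
    also have "\<dots> = - (sqrt 2 / 2)" by (simp only: cos_pi_minus cos_45)
    also have "sqrt 2 / 2 = 1 / sqrt 2" by (simp add: field_simps)
    finally show ?thesis .
  qed
  have \<beta>2: "cos (\<beta> + pi) = 1 / sqrt 2" using \<beta>1 by (simp add: cos_periodic_pi)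
  have \<beta>3: "cos (2 * \<beta>) = 0" using \<beta>1 by (simp add: cos_double_cos power_divide)
  have \<beta>4: "cos (2 * (\<beta> + pi)) = 0" using \<beta>2 by (subst cos_double_cos) (simp add: power_divide)
  define \<alpha> where "\<alpha> = (\<lambda>p::nat. if h p \<ge> 0 then \<beta> else \<beta> + pi)"
  \<comment> \<open>A phase error below \<epsilon> at p grows to at most N * \<epsilon> at a power
    p^k <= N, so Q * \<epsilon> bounds the total error of the sum.\<close>
  define Q where "Q = real N * C0 * (\<Sum>n\<le>N. mangoldt n / sqrt (real n))"
  have Q: "Q \<ge> 0" unfolding Q_def using C0 by (intro mult_nonneg_nonneg sum_nonneg) (auto simp: mangoldt_nonneg)
  define \<epsilon> where "\<epsilon> = 1 / (Q + 1)"
  have \<epsilon>: "\<epsilon> > 0" "Q * \<epsilon> \<le> 1" using Q by (auto simp: \<epsilon>_def)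
  obtain L where L: "\<And>T. \<exists>\<tau>. \<bar>\<tau> - T\<bar> \<le> L \<and> (\<forall>p. prime p \<longrightarrow> p \<le> N \<longrightarrow> norm (cis (- (\<tau> * ln (real p))) - cis (\<alpha> p)) < \<epsilon>)"
    by (rule kronecker_primes[OF \<epsilon>(1), of N \<alpha>]) blast
  show ?thesis
  proof (rule that[OF b1, of L])
    fix T
    obtain \<tau> where \<tau>: "\<bar>\<tau> - T\<bar> \<le> L" "\<And>p. prime p \<Longrightarrow> p \<le> N \<Longrightarrow> norm (cis (- (\<tau> * ln (real p))) - cis (\<alpha> p)) < \<epsilon>" using L[of T] by blast
    \<comment> \<open>A majorant of h n * cos (k * \<alpha> p) at n = p^k, that is, under perfect
      alignment: exact for primes and squares of primes, trivial for higher powers.\<close>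
    define e where "e = (\<lambda>n. if prime n then - (1 / sqrt 2) * \<bar>h n\<bar> else if \<exists>p. prime p \<and> n = p ^ 2 then 0 else \<bar>h n\<bar>)"
    have trm: "mangoldt n / sqrt (real n) * h n * cos (\<tau> * ln (real n)) \<le> mangoldt n / sqrt (real n) * (e n + C0 * (real N * \<epsilon>))" if n: "n \<le> N" for n
    proof (cases "primepow n")
      case True
      then obtain p k where pk: "prime p" "k > 0" "n = p ^ k" by (auto simp: primepow_def)
      have p2: "p \<ge> 2" using pk(1) by (rule prime_ge_2_nat)
      have pn: "p \<le> N"
      proof -
        have "p ^ 1 \<le> p ^ k" using p2 pk(2) by (intro power_increasing) auto
        then show ?thesis using n pk by simp
      qed
      have "k < 2 ^ k" by (rule less_exp)
      also have "(2::nat) ^ k \<le> p ^ k" using p2 by (rule power_mono) simp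
      finally have kN: "k \<le> N" using n pk by linarith
      have "norm (cis (- (\<tau> * ln (real p))) ^ k - cis (\<alpha> p) ^ k) \<le> real k * norm (cis (- (\<tau> * ln (real p))) - cis (\<alpha> p))"
        by (rule norm_power_diff_le) auto
      also have "\<dots> \<le> real N * \<epsilon>" using \<tau>(2)[OF pk(1) pn] kN by (intro mult_mono) auto
      finally have "norm (cis (- (\<tau> * ln (real p))) ^ k - cis (\<alpha> p) ^ k) \<le> real N * \<epsilon>" .
      then have "\<bar>Re (cis (- (\<tau> * ln (real p))) ^ k - cis (\<alpha> p) ^ k)\<bar> \<le> real N * \<epsilon>" using abs_Re_le_cmod order_trans by blast
      moreover have "Re (cis (- (\<tau> * ln (real p))) ^ k) = cos (\<tau> * ln (real n))"
      proof -
        have "real k * - (\<tau> * ln (real p)) = - (\<tau> * ln (real n))" using p2 by (simp add: pk(3) ln_realpow mult_ac)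
        then have "cis (- (\<tau> * ln (real p))) ^ k = cis (- (\<tau> * ln (real n)))" by (metis Complex.DeMoivre)
        then show ?thesis by (simp only: cis.sel cos_minus)
      qed
      ultimately have d: "\<bar>cos (\<tau> * ln (real n)) - cos (real k * \<alpha> p)\<bar> \<le> real N * \<epsilon>" by (simp only: minus_complex.sel Complex.DeMoivre[of "\<alpha> p"] cis.sel)
      have X: "h n * cos (\<tau> * ln (real n)) = h n * cos (real k * \<alpha> p) + h n * (cos (\<tau> * ln (real n)) - cos (real k * \<alpha> p))" by (simp add: algebra_simps)
      have "h n * (cos (\<tau> * ln (real n)) - cos (real k * \<alpha> p)) \<le> \<bar>h n\<bar> * \<bar>cos (\<tau> * ln (real n)) - cos (real k * \<alpha> p)\<bar>"
        by (metis abs_ge_self abs_mult)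
      also have "\<dots> \<le> C0 * (real N * \<epsilon>)" using h[of n] d C0(1) by (intro mult_mono) auto
      finally have Y: "h n * (cos (\<tau> * ln (real n)) - cos (real k * \<alpha> p)) \<le> C0 * (real N * \<epsilon>)" .
      have "h n * cos (real k * \<alpha> p) \<le> e n"
      proof -
        consider "k = 1" | "k = 2" | "k \<ge> 3" using pk(2) by linarith
        then show ?thesis
        proof cases
          case 1
          have "h n * cos (real k * \<alpha> p) = - (1 / sqrt 2) * \<bar>h n\<bar>" using 1 pk \<beta>1 \<beta>2 by (simp add: \<alpha>_def)
          then show ?thesis using 1 pk by (simp add: e_def)
        next
          case 2
          have "cos (real k * \<alpha> p) = 0" using 2 \<beta>3 \<beta>4 by (simp only: \<alpha>_def) simp
          moreover have "\<not> prime n" using pk 2 by (simp add: prime_power_iff)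
          moreover have "\<exists>p. prime p \<and> n = p ^ 2" using pk 2 by blast
          ultimately show ?thesis by (simp add: e_def)
        next
          case 3
          have "\<not> prime n" using pk 3 by (simp add: prime_power_iff)
          moreover have "\<not> (\<exists>q. prime q \<and> n = q ^ 2)"
          proof
            assume "\<exists>q. prime q \<and> n = q ^ 2"
            then obtain q where q: "prime q" "p ^ k = q ^ 2" using pk by auto
            have "p dvd q ^ 2" using q(2) pk(2) by (metis dvd_power)
            then have "p dvd q" using pk(1) prime_dvd_power by blast
            then have "p = q" using pk(1) q(1) primes_dvd_imp_eq by blast
            then have "p ^ k = p ^ 2" using q(2) by simp
            then have "k = 2" using p2 by (subst (asm) power_inject_exp) auto
            then show False using 3 by simp
          qed
          moreover have "h n * cos (real k * \<alpha> p) \<le> \<bar>h n\<bar> * 1"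
          proof -
            have "h n * cos (real k * \<alpha> p) \<le> \<bar>h n\<bar> * \<bar>cos (real k * \<alpha> p)\<bar>" by (metis abs_ge_self abs_mult)
            also have "\<dots> \<le> \<bar>h n\<bar> * 1" by (intro mult_left_mono) auto
            finally show ?thesis .
          qed
          ultimately show ?thesis by (auto simp: e_def)
        qed
      qed
      then have "h n * cos (\<tau> * ln (real n)) \<le> e n + C0 * (real N * \<epsilon>)" using X Y by linarith
      then have "mangoldt n / sqrt (real n) * (h n * cos (\<tau> * ln (real n))) \<le> mangoldt n / sqrt (real n) * (e n + C0 * (real N * \<epsilon>))"
        by (intro mult_left_mono) (auto simp: mangoldt_nonneg)
      then show ?thesis by (simp add: mult.assoc)
    qed (simp add: mangoldt_def)
    have "(\<Sum>n\<le>N. mangoldt n / sqrt (real n) * h n * cos (\<tau> * ln (real n))) \<le> (\<Sum>n\<le>N. mangoldt n / sqrt (real n) * (e n + C0 * (real N * \<epsilon>)))"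
      by (intro sum_mono trm) simp
    also have "\<dots> = (\<Sum>n\<le>N. mangoldt n / sqrt (real n) * e n) + Q * \<epsilon>"
      by (simp add: Q_def distrib_left sum.distrib sum_distrib_left sum_distrib_right mult_ac)
    finally have R1: "(\<Sum>n\<le>N. mangoldt n / sqrt (real n) * h n * cos (\<tau> * ln (real n))) \<le> (\<Sum>n\<le>N. mangoldt n / sqrt (real n) * e n) + Q * \<epsilon>" .
    have "(\<Sum>n\<le>N. mangoldt n / sqrt (real n) * e n) \<le> C0 * C3 - (A + C0 * C3 + 2)"
    proof -
      define A3 where "A3 = {n. n \<le> N \<and> primepow n \<and> \<not> prime n \<and> \<not> (\<exists>p. prime p \<and> n = p ^ 2)}"
      have fA3: "finite A3" unfolding A3_def by (rule finite_subset[of _ "{..N}"]) auto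
      have b3: "(\<Sum>n\<in>A3. mangoldt n * real n powr (- (1 / 2))) \<le> C3"
      proof (rule C3[OF fA3])
        fix n assume n: "n \<in> A3"
        then obtain p k where pk: "prime p" "k > 0" "n = p ^ k" by (auto simp: A3_def primepow_def)
        then have "k \<noteq> 1" "k \<noteq> 2" using n by (auto simp: A3_def)
        then have "k \<ge> 3" using pk(2) by linarith
        then show "\<exists>p k. prime p \<and> k \<ge> 3 \<and> n = p ^ k" using pk by blast
      qed
      have sq: "real n powr (- (1 / 2)) = 1 / sqrt (real n)" for n :: nat
        by (cases "n = 0") (simp_all add: powr_minus_divide powr_half_sqrt)
      define P where "P = {p. prime p \<and> p \<le> x}"
      \<comment> \<open>Primes in (x, N] have nonpositive terms and are dropped, and squares vanish;
        what remains are the primes up to x and the powers with exponent at least 3.\<close>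
      have "mangoldt n / sqrt (real n) * e n \<le> (if n \<in> P then - (c1 / sqrt b / sqrt 2) * (ln (real n) / sqrt (real n)) else 0) + (if n \<in> A3 then C0 * (mangoldt n * real n powr (- (1 / 2))) else 0)"
        if n: "n \<le> N" for n
      proof (cases "prime n")
        case True
        then have nA3: "n \<notin> A3" by (simp add: A3_def)
        have n2: "n \<ge> 2" using True by (rule prime_ge_2_nat)
        have m: "mangoldt n / sqrt (real n) * e n = - (ln (real n) / sqrt (real n)) * (\<bar>h n\<bar> / sqrt 2)" using True by (simp add: e_def)
        show ?thesis
        proof (cases "n \<in> P")
          case True
          then have "ln (real n) \<le> c2 * sqrt b" unfolding sb using n2 c(2) by (simp add: P_def)
          then have "h n \<ge> c1 / sqrt b" unfolding h_def using b1 n2 by (intro c(4)) auto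
          then have "c1 / sqrt b / sqrt 2 \<le> \<bar>h n\<bar> / sqrt 2" by (intro divide_right_mono) auto
          then have "(ln (real n) / sqrt (real n)) * (c1 / sqrt b / sqrt 2) \<le> (ln (real n) / sqrt (real n)) * (\<bar>h n\<bar> / sqrt 2)"
            using n2 by (intro mult_left_mono) auto
          then show ?thesis using m True nA3 by (simp add: mult.commute)
        next
          case False
          have "(ln (real n) / sqrt (real n)) * (\<bar>h n\<bar> / sqrt 2) \<ge> 0" using n2 by (intro mult_nonneg_nonneg) auto
          then show ?thesis using m False nA3 by simp
        qed
      next
        case False
        then have nP: "n \<notin> P" by (simp add: P_def)
        show ?thesis
        proof (cases "n \<in> A3")
          case True
          then have "e n = \<bar>h n\<bar>" by (auto simp: A3_def e_def)
          then have "mangoldt n / sqrt (real n) * e n \<le> mangoldt n / sqrt (real n) * C0" using h[of n] by (intro mult_left_mono) (auto simp: mangoldt_nonneg)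
          then show ?thesis using True nP by (simp add: sq mult_ac)
        next
          case nA: False
          then have "mangoldt n = (0::real) \<or> e n = 0" using False n by (auto simp: A3_def e_def mangoldt_def)
          then show ?thesis using nA nP by auto
        qed
      qed
      then have "(\<Sum>n\<le>N. mangoldt n / sqrt (real n) * e n) \<le> (\<Sum>n\<le>N. (if n \<in> P then - (c1 / sqrt b / sqrt 2) * (ln (real n) / sqrt (real n)) else 0) + (if n \<in> A3 then C0 * (mangoldt n * real n powr (- (1 / 2))) else 0))"
        by (intro sum_mono) auto
      also have "\<dots> = (\<Sum>n\<in>{..N} \<inter> P. - (c1 / sqrt b / sqrt 2) * (ln (real n) / sqrt (real n))) + (\<Sum>n\<in>{..N} \<inter> A3. C0 * (mangoldt n * real n powr (- (1 / 2))))"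
        unfolding sum.distrib by (simp only: sum.inter_restrict[OF finite_atMost])
      also have "{..N} \<inter> P = P" using N(2) by (auto simp: P_def)
      also have "{..N} \<inter> A3 = A3" by (auto simp: A3_def)
      also have "(\<Sum>n\<in>P. - (c1 / sqrt b / sqrt 2) * (ln (real n) / sqrt (real n))) = - (c1 / sqrt b / sqrt 2) * (\<Sum>n\<in>P. ln (real n) / sqrt (real n))"
        by (rule sum_distrib_left[symmetric])
      also have "(\<Sum>n\<in>A3. C0 * (mangoldt n * real n powr (- (1 / 2)))) = C0 * (\<Sum>n\<in>A3. mangoldt n * real n powr (- (1 / 2)))"
        by (rule sum_distrib_left[symmetric])
      finally have 1: "(\<Sum>n\<le>N. mangoldt n / sqrt (real n) * e n) \<le> - (c1 / sqrt b / sqrt 2) * (\<Sum>n\<in>P. ln (real n) / sqrt (real n)) + C0 * (\<Sum>n\<in>A3. mangoldt n * real n powr (- (1 / 2)))" .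
      have 2: "C0 * (\<Sum>n\<in>A3. mangoldt n * real n powr (- (1 / 2))) \<le> C0 * C3" using b3 C0(1) by (intro mult_left_mono) auto
      have "(c1 / sqrt b / sqrt 2) * (B * ln (real x)) \<le> (c1 / sqrt b / sqrt 2) * (\<Sum>n\<in>P. ln (real n) / sqrt (real n))"
        using x(2) c(1) b1 unfolding P_def by (intro mult_left_mono) auto
      moreover have "(c1 / sqrt b / sqrt 2) * (B * ln (real x)) = A + C0 * C3 + 2"
        unfolding sb B_def using c(1,2) lnx by simp
      ultimately show ?thesis using 1 2 by linarith
    qed
    then have "(\<Sum>n\<le>N. mangoldt n / sqrt (real n) * h n * cos (\<tau> * ln (real n))) \<le> - A - 1" using R1 \<epsilon>(2) by linarith
    then have "Re (LINT y|lborel. deriv zeta (Complex (3 / 2) (\<tau> + y)) / zeta (Complex (3 / 2) (\<tau> + y)) * bump b (Complex 1 y)) \<ge> A"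
      using prime_side_lower_bound(2)[where b = b and N = N and \<tau> = \<tau>] b1 N(1) unfolding h_def by linarith
    then show "\<exists>\<tau>. \<bar>\<tau> - T\<bar> \<le> L \<and> Re (LINT y|lborel. deriv zeta (Complex (3 / 2) (\<tau> + y)) / zeta (Complex (3 / 2) (\<tau> + y)) * bump b (Complex 1 y)) \<ge> A"
      using \<tau>(1) by blast
  qed
qed

section \<open>The explicit formula\<close>

lemma holomorphic_zeta_completed: "zeta_completed holomorphic_on {s. Im s \<noteq> 0}"
proof (rule holomorphic_transform[of "\<lambda>s. theta_mellin s + 1 / (s - 1) - 1 / s"])
  show "(\<lambda>s. theta_mellin s + 1 / (s - 1) - 1 / s) holomorphic_on {s. Im s \<noteq> 0}"
    by (intro holomorphic_intros holomorphic_on_subset[OF holomorphic_theta_mellin]) auto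
qed (auto simp: zeta_completed_eq)

lemma open_nonreal: "open {s. Im s \<noteq> 0}"
proof -
  have "{s. Im s \<noteq> 0} = {s. Im s > 0} \<union> {s. Im s < 0}" by auto
  then show ?thesis by (simp add: open_Un open_halfspace_Im_gt open_halfspace_Im_lt)
qed

lemma arch_factor_nonzero:
  assumes "Im s \<noteq> 0"
  shows "of_real pi powr (- s / 2) * Gamma (s / 2) \<noteq> (0 :: complex)"
proof -
  have "s / 2 \<notin> \<int>\<^sub>\<le>\<^sub>0" using assms by (auto elim!: nonpos_Ints_cases simp: complex_eq_iff)
  then show ?thesis by (simp add: Gamma_eq_zero_iff)
qed

lemma zeta_completed_zero_iff: "Im s \<noteq> 0 \<Longrightarrow> zeta_completed s = 0 \<longleftrightarrow> zeta s = 0"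
  using arch_factor_nonzero[of s] by (auto simp: zeta_completed_def)

text \<open>The functional equation carries zeros left of the critical line to its right, so every
  non-real point of the plane is covered, including those outside the strip of the
  hypothesis.\<close>

lemma RH_zeta_completed_zero:
  assumes "Riemann_hypothesis" "Im s \<noteq> 0" "zeta_completed s = 0"
  shows "Re s = 1 / 2"
proof (rule ccontr)
  assume "Re s \<noteq> 1 / 2"
  then consider "Re s > 1 / 2" | "Re (1 - s) > 1 / 2" by fastforce
  then show False
  proof cases
    case 1
    then show ?thesis using RH_zeta_nonzero[OF assms(1) 1 assms(2)] assms zeta_completed_zero_iff by blast
  next
    case 2
    have "zeta_completed (1 - s) = 0" using zeta_functional_equation[OF assms(2)] assms(3) by simp
    then show ?thesis using RH_zeta_nonzero[OF assms(1) 2] assms(2) zeta_completed_zero_iff[of "1 - s"] by simp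
  qed
qed

lemma zeta_completed_reflect: "Im s \<noteq> 0 \<Longrightarrow> zeta_completed (1 - cnj s) = cnj (zeta_completed s)"
  using zeta_functional_equation[of "cnj s"] zeta_completed_cnj[of s] by simp

lemma zeta_completed_has_derivative: "Im s \<noteq> 0 \<Longrightarrow> (zeta_completed has_field_derivative deriv zeta_completed s) (at s)"
  by (rule holomorphic_derivI[OF holomorphic_zeta_completed open_nonreal]) simp

lemma deriv_zeta_completed_reflect:
  assumes "Im s \<noteq> 0"
  shows "deriv zeta_completed (1 - cnj s) = - cnj (deriv zeta_completed s)"
proof -
  have nr: "eventually (\<lambda>z. z \<in> {z. Im z \<noteq> 0}) (nhds w)" if "Im w \<noteq> 0" for w
    using that by (intro eventually_nhds_in_open open_nonreal) auto
  have 1: "deriv zeta_completed (cnj s) = - deriv zeta_completed (1 - cnj s)"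
  proof -
    have "((\<lambda>z. zeta_completed (1 - z)) has_field_derivative deriv zeta_completed (1 - cnj s) * (- 1)) (at (cnj s))"
      by (rule DERIV_chain2[of _ _ "\<lambda>z. 1 - z"]) (use assms in \<open>auto intro!: zeta_completed_has_derivative derivative_eq_intros\<close>)
    moreover have "eventually (\<lambda>z. zeta_completed (1 - z) = zeta_completed z) (nhds (cnj s))"
      using nr[of "cnj s"] assms by (auto elim!: eventually_mono simp: zeta_functional_equation)
    ultimately have "(zeta_completed has_field_derivative deriv zeta_completed (1 - cnj s) * (- 1)) (at (cnj s))"
      by (subst (asm) DERIV_cong_ev) auto
    then show ?thesis by (simp add: DERIV_imp_deriv)
  qed
  have 2: "deriv zeta_completed (cnj s) = cnj (deriv zeta_completed s)"
  proof -
    have "((cnj \<circ> zeta_completed \<circ> cnj) has_field_derivative cnj (deriv zeta_completed s)) (at (cnj s))"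
      using has_field_derivative_cnj_cnj[of zeta_completed "deriv zeta_completed s" "cnj s"] zeta_completed_has_derivative[OF assms] by simp
    moreover have "eventually (\<lambda>z. (cnj \<circ> zeta_completed \<circ> cnj) z = zeta_completed z) (nhds (cnj s))"
      using nr[of "cnj s"] assms by (auto elim!: eventually_mono simp: zeta_completed_cnj)
    ultimately have "(zeta_completed has_field_derivative cnj (deriv zeta_completed s)) (at (cnj s))"
      by (subst (asm) DERIV_cong_ev) auto
    then show ?thesis by (simp add: DERIV_imp_deriv)
  qed
  from 1 2 show ?thesis by simp
qed

lemma zeta_completed_log_deriv:
  assumes "Re s > 0" "Im s \<noteq> 0" "zeta s \<noteq> 0"
  shows "deriv zeta_completed s / zeta_completed s = arch_log_deriv s + deriv zeta s / zeta s"
proof -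
  have zd: "(zeta has_field_derivative deriv zeta s) (at s)"
    by (rule holomorphic_derivI[OF holomorphic_zeta]) (use assms in \<open>auto simp: open_Compl\<close>)
  have "((\<lambda>s. exp (arch_log s) * zeta s) has_field_derivative exp (arch_log s) * arch_log_deriv s * zeta s + exp (arch_log s) * deriv zeta s) (at s)"
    by (auto intro!: derivative_eq_intros zd arch_log_has_field_derivative assms)
  moreover have "eventually (\<lambda>z. z \<in> {z. Re z > 0}) (nhds s)"
    using assms by (intro eventually_nhds_in_open open_halfspace_Re_gt) auto
  then have "eventually (\<lambda>z. exp (arch_log z) * zeta z = zeta_completed z) (nhds s)"
    by eventually_elim (simp add: exp_arch_log zeta_completed_def)
  ultimately have "(zeta_completed has_field_derivative exp (arch_log s) * arch_log_deriv s * zeta s + exp (arch_log s) * deriv zeta s) (at s)"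
    by (subst (asm) DERIV_cong_ev) auto
  then have "deriv zeta_completed s = exp (arch_log s) * arch_log_deriv s * zeta s + exp (arch_log s) * deriv zeta s" by (rule DERIV_imp_deriv)
  moreover have "zeta_completed s = exp (arch_log s) * zeta s" using assms by (simp add: exp_arch_log zeta_completed_def)
  moreover have "(E * a * z + E * d) / (E * z) = a + d / z" if "E \<noteq> 0" "z \<noteq> 0" for E a z d :: complex
    using that by (simp add: field_simps)
  ultimately show ?thesis using assms by simp
qed

lemma eventually_zeta_nonzero:
  assumes "s \<noteq> 1"
  shows "eventually (\<lambda>z. zeta z \<noteq> 0) (at s)"
proof -
  have "eventually (\<lambda>z. zeta z \<noteq> 0 \<and> z \<in> - {1}) (at s)"
  proof (rule non_zero_neighbour_alt[where S = "- {1}" and \<beta> = 2])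
    show "connected (- {1::complex})" by (rule connected_punctured_universe) simp
    show "zeta 2 \<noteq> 0" by (rule zeta_nonzero_gt_1) simp
  qed (use assms holomorphic_zeta in \<open>auto simp: open_Compl\<close>)
  then show ?thesis by eventually_elim blast
qed

lemma zorder_zeta_completed:
  assumes "Im s \<noteq> 0"
  shows "zorder zeta_completed s = zorder zeta s"
proof -
  define g where "g = (\<lambda>s. of_real pi powr (- s / 2) * Gamma (s / 2) :: complex)"
  have U: "s \<in> {s. Im s \<noteq> 0}" using assms by simp
  have nn: "z / 2 \<notin> \<int>\<^sub>\<le>\<^sub>0" if "Im z \<noteq> 0" for z using that by (auto elim!: nonpos_Ints_cases simp: complex_eq_iff)
  have "g holomorphic_on {s. Im s \<noteq> 0}" unfolding g_def using nn by (intro holomorphic_intros) auto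
  then have ga: "g analytic_on {s}" using open_nonreal U by (meson analytic_on_open analytic_on_subset empty_subsetI insert_subset)
  have "zeta holomorphic_on {s. Im s \<noteq> 0}" by (rule holomorphic_on_subset[OF holomorphic_zeta]) auto
  then have za: "zeta analytic_on {s}" using open_nonreal U by (meson analytic_on_open analytic_on_subset empty_subsetI insert_subset)
  have "eventually (\<lambda>z. zeta z \<noteq> 0) (at s)" by (rule eventually_zeta_nonzero) (use assms in auto)
  moreover have "eventually (\<lambda>z. z \<in> {z. Im z \<noteq> 0}) (at s)"
    using U open_nonreal by (intro eventually_at_in_open') auto
  ultimately have "eventually (\<lambda>z. g z * zeta z \<noteq> 0) (at s)"
    by eventually_elim (use arch_factor_nonzero in \<open>auto simp: g_def\<close>)
  from zorder_times_analytic[OF ga za this] have "zorder (\<lambda>z. g z * zeta z) s = zorder g s + zorder zeta s" .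
  moreover have "zorder g s = 0" using ga arch_factor_nonzero[OF assms] by (intro zorder_eq_0I) (auto simp: g_def)
  moreover have "zeta_completed = (\<lambda>z. g z * zeta z)" by (auto simp: zeta_completed_def g_def)
  ultimately show ?thesis by simp
qed

section \<open>Zeros in rectangles\<close>

lemma finite_zeta_zeros_box: "finite {z \<in> cbox (Complex a c) (Complex b d). zeta z = 0}" if "c > 0"
proof -
  have "finite {z \<in> cbox (Complex a c) (Complex b d). zeta z = 0}"
  proof (rule holomorphic_compact_finite_zeros[where S = "- {1}"])
    show "connected (- {1::complex})" by (rule connected_punctured_universe) simp
    show "cbox (Complex a c) (Complex b d) \<subseteq> - {1}" using that by (auto simp: in_cbox_complex_iff)
    show "\<not> zeta constant_on - {1}"
    proof
      assume "zeta constant_on - {1}"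
      then obtain k where k: "\<And>x. x \<noteq> 1 \<Longrightarrow> zeta x = k" unfolding constant_on_def by auto
      have "deriv zeta (Complex 2 0) = 0"
      proof -
        have "eventually (\<lambda>z. z \<in> - {1}) (nhds (Complex 2 0))" by (intro eventually_nhds_in_open) (auto simp: open_Compl complex_eq_iff)
        then have "eventually (\<lambda>z. zeta z = k) (nhds (Complex 2 0))" by eventually_elim (auto simp: k)
        then have "deriv zeta (Complex 2 0) = deriv (\<lambda>_. k) (Complex 2 0)" by (rule deriv_cong_ev) simp
        then show ?thesis by simp
      qed
      \<comment> \<open>If zeta were constant, its logarithmic derivative would vanish at 2, but the
        von Mangoldt series there has the positive term n = 2.\<close>
      then have "mangoldt_series (Complex 2 0) = 0" using zeta_mult_mangoldt_series[of "Complex 2 0"] zeta_nonzero_gt_1[of "Complex 2 0"] by simp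
      then have z: "(\<lambda>n. mangoldt n * real n powr (- 2) * cos (0 * ln (real n))) sums 0" using Re_mangoldt_series_sums[of 2 0] by simp
      have "(\<Sum>n\<in>{2::nat}. mangoldt n * real n powr (- 2) * cos (0 * ln (real n))) \<le> (\<Sum>n. mangoldt n * real n powr (- 2) * cos (0 * ln (real n)))"
        using z by (intro sum_le_suminf) (auto simp: sums_iff mangoldt_nonneg)
      moreover have "mangoldt 2 = ln (2::real)" using mangoldt_prime[of 2, where 'a = real] by (simp add: two_is_prime_nat)
      ultimately show False using z by (auto simp: sums_iff mult_le_0_iff)
    qed
  qed (use holomorphic_zeta in \<open>auto simp: open_Compl\<close>)
  then show ?thesis .
qed

lemma continuous_on_vertical:
  assumes "continuous_on S f" "\<And>y. y \<in> A \<Longrightarrow> Complex x y \<in> S"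
  shows "continuous_on A (\<lambda>y. f (Complex x y))"
  by (rule continuous_on_compose2[OF assms(1)]) (use assms(2) in \<open>auto simp: Complex_eq intro!: continuous_intros\<close>)

lemma continuous_on_horizontal:
  assumes "continuous_on S f" "\<And>x. x \<in> A \<Longrightarrow> Complex x y \<in> S"
  shows "continuous_on A (\<lambda>x. f (Complex x y))"
  by (rule continuous_on_compose2[OF assms(1)]) (use assms(2) in \<open>auto simp: Complex_eq intro!: continuous_intros\<close>)

text \<open>The argument principle weighted by an entire \<open>h\<close>. The rectangle is
  symmetric about the critical line; under RH the zeros inside lie on that line, and by
  \<open>nz\<close> none lies on the boundary. The orders are those of zeta, since the archimedean
  factor is analytic and nonzero there.\<close>

lemma zeta_completed_rectangle_zeros:
  assumes RH: "Riemann_hypothesis" and y: "4 \<le> y1" "y1 < y2"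
    and nz: "zeta (Complex (1 / 2) y1) \<noteq> 0" "zeta (Complex (1 / 2) y2) \<noteq> 0"
    and h: "h holomorphic_on UNIV"
  shows "contour_integral (rectpath (Complex (- (1 / 2)) y1) (Complex (3 / 2) y2)) (\<lambda>s. deriv zeta_completed s * h s / zeta_completed s)
    = 2 * of_real pi * \<i> * (\<Sum>t | y1 < t \<and> t < y2 \<and> zeta (Complex (1 / 2) t) = 0. of_int (zorder zeta (Complex (1 / 2) t)) * h (Complex (1 / 2) t))"
    and "continuous_on (path_image (rectpath (Complex (- (1 / 2)) y1) (Complex (3 / 2) y2))) (\<lambda>s. deriv zeta_completed s * h s / zeta_completed s)"
    and "finite {t. y1 < t \<and> t < y2 \<and> zeta (Complex (1 / 2) t) = 0}"
proof -
  define S where "S = box (Complex (-1) (y1 - 1)) (Complex 2 (y2 + 1))"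
  define g where "g = rectpath (Complex (- (1 / 2)) y1) (Complex (3 / 2) y2)"
  \<comment> \<open>The empty set stands for the poles in the argument principle: off the real axis
    \<open>zeta_completed\<close> has none.\<close>
  define pz where "pz = {w \<in> S. zeta_completed w = 0 \<or> w \<in> {}}"
  define Z where "Z = {t. y1 < t \<and> t < y2 \<and> zeta (Complex (1 / 2) t) = 0}"
  have Sim: "Im w \<noteq> 0" if "w \<in> S" for w using that y by (auto simp: S_def in_box_complex_iff)
  have pzI: "Re w = 1 / 2 \<and> zeta w = 0 \<and> w \<in> S" if "w \<in> pz" for w
    using that Sim[of w] RH_zeta_completed_zero[OF RH, of w] zeta_completed_zero_iff[of w] by (auto simp: pz_def)
  have fin: "finite pz"
  proof (rule finite_subset[OF _ finite_zeta_zeros_box[of "y1 - 1" "-1" 2 "y2 + 1"]])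
    show "pz \<subseteq> {z \<in> cbox (Complex (- 1) (y1 - 1)) (Complex 2 (y2 + 1)). zeta z = 0}"
      using pzI box_subset_cbox unfolding S_def by blast
  qed (use y in auto)
  have Zpz: "Complex (1 / 2) ` Z \<subseteq> pz"
    using y zeta_completed_zero_iff by (auto simp: Z_def pz_def S_def in_box_complex_iff)
  have inj: "inj_on (Complex (1 / 2)) A" for A by (auto simp: inj_on_def)
  show finZ: "finite {t. y1 < t \<and> t < y2 \<and> zeta (Complex (1 / 2) t) = 0}"
    using finite_subset[OF Zpz fin] finite_imageD[OF _ inj] unfolding Z_def by blast
  have pimg: "path_image g \<subseteq> S - pz"
  proof
    fix w assume w: "w \<in> path_image g"
    have "w \<in> S" using w y path_image_rectpath_subset_cbox[of "Complex (- (1 / 2)) y1" "Complex (3 / 2) y2"]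
      by (auto simp: g_def S_def in_box_complex_iff in_cbox_complex_iff)
    moreover have "w \<notin> pz"
    proof
      assume "w \<in> pz"
      from pzI[OF this] have ww: "Re w = 1 / 2" "zeta w = 0" by auto
      then have "Im w = y1 \<or> Im w = y2" using w y by (auto simp: g_def path_image_rectpath)
      then have "w = Complex (1 / 2) y1 \<or> w = Complex (1 / 2) y2" using ww by (auto simp: complex_eq_iff)
      then show False using ww nz by auto
    qed
    ultimately show "w \<in> S - pz" by blast
  qed
  have holS: "zeta_completed holomorphic_on S" using holomorphic_on_subset[OF holomorphic_zeta_completed] Sim by blast
  have "contour_integral g (\<lambda>x. deriv zeta_completed x * h x / zeta_completed x) =
      2 * pi * \<i> * (\<Sum>p\<in>pz. winding_number g p * h p * zorder zeta_completed p)"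
    unfolding pz_def
  proof (rule argument_principle)
    show "open S" "connected S" unfolding S_def by (auto intro: convex_connected)
    show "zeta_completed holomorphic_on S - {}" using holS by simp
    show "h holomorphic_on S" using h holomorphic_on_subset by blast
    show "valid_path g" "pathfinish g = pathstart g" unfolding g_def by auto
    show "path_image g \<subseteq> S - {w \<in> S. zeta_completed w = 0 \<or> w \<in> {}}" using pimg unfolding pz_def .
    show "\<forall>z. z \<notin> S \<longrightarrow> winding_number g z = 0"
    proof (intro allI impI)
      fix z assume "z \<notin> S"
      then show "winding_number g z = 0" unfolding g_def using y
        by (intro winding_number_rectpath_outside) (auto simp: S_def in_box_complex_iff in_cbox_complex_iff)
    qed
    show "finite {w \<in> S. zeta_completed w = 0 \<or> w \<in> {}}" using fin unfolding pz_def .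
  qed auto
  also have "(\<Sum>p\<in>pz. winding_number g p * h p * zorder zeta_completed p) = (\<Sum>p\<in>Complex (1 / 2) ` Z. h p * zorder zeta p)"
  proof (rule sum.mono_neutral_cong_right[OF fin Zpz])
    show "\<forall>p\<in>pz - Complex (1 / 2) ` Z. winding_number g p * h p * zorder zeta_completed p = 0"
    proof
      fix p assume p: "p \<in> pz - Complex (1 / 2) ` Z"
      then have pp: "Re p = 1 / 2" "zeta p = 0" using pzI by auto
      then have "Im p \<notin> Z" using p by (metis DiffD2 complex.collapse image_eqI)
      moreover have "p = Complex (1 / 2) (Im p)" using pp by (simp add: complex_eq_iff)
      then have "zeta (Complex (1 / 2) (Im p)) = 0" using pp by simp
      moreover from this have "Im p \<noteq> y1" "Im p \<noteq> y2" using nz by metis+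
      ultimately have "Im p < y1 \<or> Im p > y2" by (auto simp: Z_def)
      then have "winding_number g p = 0" unfolding g_def using y
        by (intro winding_number_rectpath_outside) (auto simp: in_cbox_complex_iff)
      then show "winding_number g p * h p * zorder zeta_completed p = 0" by simp
    qed
    fix p assume p: "p \<in> Complex (1 / 2) ` Z"
    then have "winding_number g p = 1" unfolding g_def
      by (intro winding_number_rectpath) (auto simp: in_box_complex_iff Z_def)
    moreover have "Im p \<noteq> 0" using p y by (auto simp: Z_def)
    ultimately show "winding_number g p * h p * zorder zeta_completed p = h p * zorder zeta p" by (simp add: zorder_zeta_completed)
  qed
  also have "\<dots> = (\<Sum>t\<in>Z. of_int (zorder zeta (Complex (1 / 2) t)) * h (Complex (1 / 2) t))"
    by (subst sum.reindex[OF inj]) (simp add: mult.commute)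
  finally show "contour_integral (rectpath (Complex (- (1 / 2)) y1) (Complex (3 / 2) y2)) (\<lambda>s. deriv zeta_completed s * h s / zeta_completed s)
    = 2 * of_real pi * \<i> * (\<Sum>t | y1 < t \<and> t < y2 \<and> zeta (Complex (1 / 2) t) = 0. of_int (zorder zeta (Complex (1 / 2) t)) * h (Complex (1 / 2) t))"
    unfolding Z_def g_def by (simp add: mult_ac)
  have "deriv zeta_completed holomorphic_on S" by (rule holomorphic_deriv[OF holS]) (auto simp: S_def intro: open_box)
  then have "continuous_on (path_image g) (deriv zeta_completed)" "continuous_on (path_image g) zeta_completed"
    using holS pimg by (auto intro!: holomorphic_on_imp_continuous_on elim!: holomorphic_on_subset)
  moreover have "continuous_on (path_image g) h" using h holomorphic_on_imp_continuous_on holomorphic_on_subset by blast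
  ultimately show "continuous_on (path_image (rectpath (Complex (- (1 / 2)) y1) (Complex (3 / 2) y2))) (\<lambda>s. deriv zeta_completed s * h s / zeta_completed s)"
    unfolding g_def[symmetric] using pimg by (intro continuous_intros) (auto simp: pz_def)
qed

text \<open>By the reflection the integrand on the left side is minus the conjugate of that on the
  right, so the vertical sides together give 2 i Re X. Imaginary parts then isolate the zero sum up
  to the two horizontal sides, which have length 2 and cost at most 2 * E each; everything is halved
  at the end.\<close>

lemma zeta_completed_zero_sum:
  assumes RH: "Riemann_hypothesis" and y: "4 \<le> y1" "y1 < y2"
    and nz: "zeta (Complex (1 / 2) y1) \<noteq> 0" "zeta (Complex (1 / 2) y2) \<noteq> 0"
    and E: "\<And>x y. 1 / 2 \<le> x \<Longrightarrow> x \<le> 3 / 2 \<Longrightarrow> y \<in> {y1, y2} \<Longrightarrow>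
      norm (deriv zeta_completed (Complex x y) * bump b (Complex (x - 1 / 2) (y - \<tau>)) / zeta_completed (Complex x y)) \<le> E"
  shows "\<bar>pi * (\<Sum>t | y1 < t \<and> t < y2 \<and> zeta (Complex (1 / 2) t) = 0. of_int (zorder zeta (Complex (1 / 2) t)) * rbump b (t - \<tau>))
    - Re (integral {y1..y2} (\<lambda>y. deriv zeta_completed (Complex (3 / 2) y) * bump b (Complex 1 (y - \<tau>)) / zeta_completed (Complex (3 / 2) y)))\<bar> \<le> 2 * E"
proof -
  define h where "h = (\<lambda>s. bump b (s - Complex (1 / 2) \<tau>))"
  define F where "F = (\<lambda>s. deriv zeta_completed s * h s / zeta_completed s)"
  define P where "P = (\<Sum>t | y1 < t \<and> t < y2 \<and> zeta (Complex (1 / 2) t) = 0. of_int (zorder zeta (Complex (1 / 2) t)) * rbump b (t - \<tau>))"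
  define X where "X = integral {y1..y2} (\<lambda>y. F (Complex (3 / 2) y))"
  have hh: "h (Complex x y) = bump b (Complex (x - 1 / 2) (y - \<tau>))" for x y by (simp add: h_def complex_diff)
  have hol: "h holomorphic_on UNIV"
    unfolding h_def bump_def by (intro holomorphic_intros)
  note R = zeta_completed_rectangle_zeros[OF RH y nz hol]
  have refl: "F (Complex (1 - x) y) = - cnj (F (Complex x y))" if "y \<noteq> 0" for x y
  proof -
    have c: "Complex (1 - x) y = 1 - cnj (Complex x y)" by (simp add: complex_eq_iff)
    have "h (1 - cnj (Complex x y)) = bump b (- cnj (Complex x y - Complex (1 / 2) \<tau>))" unfolding h_def by (rule arg_cong[of _ _ "bump b"]) (simp add: complex_eq_iff)
    also have "\<dots> = cnj (h (Complex x y))" unfolding h_def by (rule bump_reflect)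
    finally show ?thesis unfolding F_def c using that by (simp add: deriv_zeta_completed_reflect zeta_completed_reflect)
  qed
  have bnd: "norm (F (Complex x y)) \<le> E" if "- (1 / 2) \<le> x" "x \<le> 3 / 2" "y \<in> {y1, y2}" for x y
  proof (cases "x \<ge> 1 / 2")
    case True
    then show ?thesis using E[of x y] that by (simp add: F_def hh)
  next
    case False
    have "norm (F (Complex x y)) = norm (F (Complex (1 - x) y))" using refl[of y x] that y by auto
    also have "\<dots> \<le> E" using E[of "1 - x" y] that False by (simp add: F_def hh)
    finally show ?thesis .
  qed
  have cont: "continuous_on (path_image (rectpath (Complex (- (1 / 2)) y1) (Complex (3 / 2) y2))) F" using R(2) unfolding F_def .
  have chor: "norm (integral {- (1 / 2)..3 / 2} (\<lambda>x. F (Complex x y))) \<le> E * (3 / 2 - - (1 / 2))" if "y \<in> {y1, y2}" for y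
  proof (rule integral_bound)
    show "continuous_on {- (1 / 2)..3 / 2} (\<lambda>x. F (Complex x y))"
      using that y by (intro continuous_on_horizontal[OF cont]) (auto simp: path_image_rectpath)
  qed (use bnd that in auto)
  have left: "integral {y1..y2} (\<lambda>y. F (Complex (- (1 / 2)) y)) = - cnj X"
  proof -
    have "integral {y1..y2} (\<lambda>y. F (Complex (- (1 / 2)) y)) = integral {y1..y2} (\<lambda>y. - cnj (F (Complex (3 / 2) y)))"
      by (rule Henstock_Kurzweil_Integration.integral_cong) (use refl[of _ "3 / 2"] y in auto)
    then show ?thesis by (simp add: X_def integral_cnj)
  qed
  have "2 * of_real pi * \<i> * of_real P = contour_integral (rectpath (Complex (- (1 / 2)) y1) (Complex (3 / 2) y2)) F"
    unfolding R(1) F_def P_def of_real_sum of_real_mult of_real_of_int_eq bump_imag[symmetric]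
    by (simp add: hh)
  also have "\<dots> = integral {- (1 / 2)..3 / 2} (\<lambda>x. F (Complex x y1)) + \<i> * X - integral {- (1 / 2)..3 / 2} (\<lambda>x. F (Complex x y2)) + \<i> * cnj X"
    using contour_integral_rectpath[of "- (1 / 2)" "3 / 2" y1 y2 F] cont y left by (simp add: X_def)
  finally have eq: "2 * of_real pi * \<i> * of_real P = integral {- (1 / 2)..3 / 2} (\<lambda>x. F (Complex x y1)) + \<i> * X - integral {- (1 / 2)..3 / 2} (\<lambda>x. F (Complex x y2)) + \<i> * cnj X" .
  have "2 * (pi * P - Re X) = Im (integral {- (1 / 2)..3 / 2} (\<lambda>x. F (Complex x y1))) - Im (integral {- (1 / 2)..3 / 2} (\<lambda>x. F (Complex x y2)))"
    using arg_cong[OF eq, of Im] by simp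
  moreover have "\<bar>Im (integral {- (1 / 2)..3 / 2} (\<lambda>x. F (Complex x y)))\<bar> \<le> E * 2" if "y \<in> {y1, y2}" for y
    using abs_Im_le_cmod[of "integral {- (1 / 2)..3 / 2} (\<lambda>x. F (Complex x y))"] chor[OF that] by simp
  from this[of y1] this[of y2] have "\<bar>Im (integral {- (1 / 2)..3 / 2} (\<lambda>x. F (Complex x y1)))\<bar> \<le> E * 2" "\<bar>Im (integral {- (1 / 2)..3 / 2} (\<lambda>x. F (Complex x y2)))\<bar> \<le> E * 2" by auto
  ultimately have "\<bar>2 * (pi * P - Re X)\<bar> \<le> 4 * E" by linarith
  then have "\<bar>pi * P - Re X\<bar> \<le> 2 * E" by (simp only: abs_mult) simp
  then show ?thesis by (simp add: P_def X_def F_def hh)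
qed

text \<open>The archimedean part is holomorphic for Re s > 0, so it may return from 3/2 to the
  critical line, where its real part is the derivative of \<open>theta\<close> and the weight is
  real. Only \<zeta>'/\<zeta> stays at 3/2, for the sake of its Dirichlet series.\<close>

lemma arch_log_deriv_shift:
  assumes y: "4 \<le> y1" "y1 < y2"
    and E: "\<And>x y. 1 / 2 \<le> x \<Longrightarrow> x \<le> 3 / 2 \<Longrightarrow> y \<in> {y1, y2} \<Longrightarrow>
      norm (arch_log_deriv (Complex x y) * bump b (Complex (x - 1 / 2) (y - \<tau>))) \<le> E"
  shows "\<bar>Re (integral {y1..y2} (\<lambda>y. arch_log_deriv (Complex (3 / 2) y) * bump b (Complex 1 (y - \<tau>))))
    - integral {y1..y2} (\<lambda>y. deriv theta y * rbump b (y - \<tau>))\<bar> \<le> 2 * E"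
proof -
  define F where "F = (\<lambda>s. arch_log_deriv s * bump b (s - Complex (1 / 2) \<tau>))"
  have hh: "F (Complex x y) = arch_log_deriv (Complex x y) * bump b (Complex (x - 1 / 2) (y - \<tau>))" for x y by (simp add: F_def complex_diff)
  have hol: "F holomorphic_on {s. Re s > 0}"
    unfolding F_def bump_def by (intro holomorphic_intros holomorphic_arch_log_deriv)
  have cont: "continuous_on {s. Re s > 0} F" using hol by (rule holomorphic_on_imp_continuous_on)
  have sub: "path_image (rectpath (Complex (1 / 2) y1) (Complex (3 / 2) y2)) \<subseteq> {s. Re s > 0}"
    using y by (auto simp: path_image_rectpath)
  have "contour_integral (rectpath (Complex (1 / 2) y1) (Complex (3 / 2) y2)) F = 0"
    by (rule contour_integral_unique[OF Cauchy_theorem_convex_simple[OF hol]]) (use sub in \<open>auto intro: convex_halfspace_Re_gt\<close>)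
  moreover have "contour_integral (rectpath (Complex (1 / 2) y1) (Complex (3 / 2) y2)) F =
     integral {1 / 2..3 / 2} (\<lambda>x. F (Complex x y1)) + \<i> * integral {y1..y2} (\<lambda>y. F (Complex (3 / 2) y))
    - integral {1 / 2..3 / 2} (\<lambda>x. F (Complex x y2)) - \<i> * integral {y1..y2} (\<lambda>y. F (Complex (1 / 2) y))"
    using y continuous_on_subset[OF cont sub] by (intro contour_integral_rectpath) auto
  ultimately have eq: "0 = integral {1 / 2..3 / 2} (\<lambda>x. F (Complex x y1)) + \<i> * integral {y1..y2} (\<lambda>y. F (Complex (3 / 2) y))
    - integral {1 / 2..3 / 2} (\<lambda>x. F (Complex x y2)) - \<i> * integral {y1..y2} (\<lambda>y. F (Complex (1 / 2) y))" by simp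
  have chor: "norm (integral {1 / 2..3 / 2} (\<lambda>x. F (Complex x y))) \<le> E * (3 / 2 - 1 / 2)" if "y \<in> {y1, y2}" for y
    by (rule integral_bound) (use E that in \<open>auto simp: hh[symmetric] intro!: continuous_on_horizontal[OF cont]\<close>)
  have crit: "Re (integral {y1..y2} (\<lambda>y. F (Complex (1 / 2) y))) = integral {y1..y2} (\<lambda>y. deriv theta y * rbump b (y - \<tau>))"
  proof -
    have "(\<lambda>y. F (Complex (1 / 2) y)) integrable_on {y1..y2}"
      by (intro integrable_continuous_interval continuous_on_vertical[OF cont]) auto
    then have "integral {y1..y2} (\<lambda>y. Re (F (Complex (1 / 2) y))) = Re (integral {y1..y2} (\<lambda>y. F (Complex (1 / 2) y)))" using integral_linear[OF _ bounded_linear_Re] by (auto simp: o_def)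
    moreover have "Re (F (Complex (1 / 2) y)) = deriv theta y * rbump b (y - \<tau>)" for y
      using bump_imag[of b "y - \<tau>"] by (simp add: hh deriv_theta)
    ultimately show ?thesis by simp
  qed
  have "Re (integral {y1..y2} (\<lambda>y. F (Complex (3 / 2) y))) - Re (integral {y1..y2} (\<lambda>y. F (Complex (1 / 2) y)))
     = Im (integral {1 / 2..3 / 2} (\<lambda>x. F (Complex x y2))) - Im (integral {1 / 2..3 / 2} (\<lambda>x. F (Complex x y1)))"
    using arg_cong[OF eq, of Im] by simp
  moreover have "\<bar>Im (integral {1 / 2..3 / 2} (\<lambda>x. F (Complex x y)))\<bar> \<le> E" if "y \<in> {y1, y2}" for y
    using abs_Im_le_cmod[of "integral {1 / 2..3 / 2} (\<lambda>x. F (Complex x y))"] chor[OF that] by simp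
  from this[of y1] this[of y2] have "\<bar>Im (integral {1 / 2..3 / 2} (\<lambda>x. F (Complex x y1)))\<bar> \<le> E" "\<bar>Im (integral {1 / 2..3 / 2} (\<lambda>x. F (Complex x y2)))\<bar> \<le> E" by auto
  ultimately show ?thesis using crit by (simp add: hh)
qed

lemma zeta_log_deriv_three_halves_bound:
  obtains M where "M > 0" "\<And>t. norm (deriv zeta (Complex (3 / 2) t) / zeta (Complex (3 / 2) t)) \<le> M"
proof (rule that[of "(\<Sum>n. mangoldt n * real n powr (- (3 / 2))) + 1"])
  define w where "w = (\<lambda>n. mangoldt n * real n powr (- (3 / 2)))"
  have sw: "summable w" unfolding w_def by (rule summable_mangoldt_powr) simp
  show "(\<Sum>n. mangoldt n * real n powr (- (3 / 2))) + 1 > 0"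
    unfolding w_def[symmetric] using sw by (intro add_nonneg_pos suminf_nonneg) (auto simp: w_def mangoldt_nonneg)
  fix t
  have "(\<lambda>n. mangoldt n / of_nat n powr Complex (3 / 2) t) sums mangoldt_series (Complex (3 / 2) t)"
    by (rule mangoldt_series_sums) simp
  moreover have "norm (mangoldt n / of_nat n powr Complex (3 / 2) t :: complex) = w n" for n
    unfolding norm_dirichlet_term w_def by simp
  ultimately have "norm (mangoldt_series (Complex (3 / 2) t)) \<le> suminf w"
    using norm_suminf_le[OF _ sw, of "\<lambda>n. mangoldt n / of_nat n powr Complex (3 / 2) t"] by (simp add: sums_iff)
  then show "norm (deriv zeta (Complex (3 / 2) t) / zeta (Complex (3 / 2) t)) \<le> (\<Sum>n. mangoldt n * real n powr (- (3 / 2))) + 1"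
    by (subst zeta_log_deriv) (auto simp: w_def)
qed

lemma integral_outside_interval_small:
  fixes w :: "real \<Rightarrow> real"
  assumes w: "integrable lborel w" and e: "e > 0"
  obtains R where "R > 0" "(LINT y|lborel. indicator (- {-R..R}) y * w y) \<le> e"
proof -
  have wc: "integrable lborel (\<lambda>y. complex_of_real (w y))" using w by (rule integrable_of_real)
  have "(\<lambda>n. integral {- real n..real n} (\<lambda>y. complex_of_real (w y))) \<longlonglongrightarrow> (LINT y|lborel. complex_of_real (w y))"
    by (rule tendsto_integral_symmetric[OF wc filterlim_real_sequentially])
  then have "eventually (\<lambda>n. dist (integral {- real n..real n} (\<lambda>y. complex_of_real (w y))) (LINT y|lborel. complex_of_real (w y)) < e) sequentially"
    using e by (rule tendstoD)
  then have "eventually (\<lambda>n. dist (integral {- real n..real n} (\<lambda>y. complex_of_real (w y))) (LINT y|lborel. complex_of_real (w y)) < e \<and> n > 0) sequentially"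
    using eventually_gt_at_top[of "0::nat"] by (rule eventually_conj)
  then obtain n :: nat where n: "n > 0" "dist (integral {- real n..real n} (\<lambda>y. complex_of_real (w y))) (LINT y|lborel. complex_of_real (w y)) < e"
    by (auto simp: eventually_sequentially)
  define I where "I = {- real n..real n}"
  have si: "integrable lborel (\<lambda>y. indicator I y * w y)" using integrable_mult_indicator[OF _ w, of I] by (simp add: I_def)
  have "integral I (\<lambda>y. complex_of_real (w y)) = (LINT y|lborel. indicator I y *\<^sub>R complex_of_real (w y))"
    using set_borel_integral_eq_integral(2)[of I "\<lambda>y. complex_of_real (w y)"] integrable_mult_indicator[OF _ wc, of I]
    by (simp add: set_lebesgue_integral_def set_integrable_def I_def)
  also have "(\<lambda>y. indicator I y *\<^sub>R complex_of_real (w y)) = (\<lambda>y. complex_of_real (indicator I y * w y))"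
    by (auto simp: scaleR_conv_of_real)
  also have "(LINT y|lborel. complex_of_real (indicator I y * w y)) = complex_of_real (LINT y|lborel. indicator I y * w y)"
    by (rule integral_complex_of_real)
  finally have "\<bar>(LINT y|lborel. indicator I y * w y) - (LINT y|lborel. w y)\<bar> < e"
    using n(2) unfolding I_def[symmetric] by (simp add: dist_norm flip: of_real_diff)
  moreover have "indicator (- I) y * w y = w y - indicator I y * w y" for y by (auto simp: indicator_def)
  then have "(LINT y|lborel. indicator (- I) y * w y) = (LINT y|lborel. w y) - (LINT y|lborel. indicator I y * w y)"
    using Bochner_Integration.integral_diff[OF w si] by simp
  ultimately have "(LINT y|lborel. indicator (- I) y * w y) \<le> e" by linarith
  then show ?thesis using n(1) by (intro that[of "real n"]) (auto simp: I_def)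
qed

text \<open>On Re s = 3/2 the quotient is bounded uniformly in the height, so \<open>R\<close>
  depends on the weight alone and not on \<tau>: the loss is at most 1 for every window that
  contains [\<tau> - R, \<tau> + R].\<close>

lemma prime_side_truncation:
  assumes b: "b > 0"
  obtains R where "R > 0" "\<And>\<tau> y1 y2. y1 \<le> \<tau> - R \<Longrightarrow> \<tau> + R \<le> y2 \<Longrightarrow>
    Re (LINT y|lborel. deriv zeta (Complex (3 / 2) (\<tau> + y)) / zeta (Complex (3 / 2) (\<tau> + y)) * bump b (Complex 1 y))
    \<le> Re (integral {y1..y2} (\<lambda>y. deriv zeta (Complex (3 / 2) y) / zeta (Complex (3 / 2) y) * bump b (Complex 1 (y - \<tau>)))) + 1"
proof -
  obtain M where M: "M > 0" "\<And>t. norm (deriv zeta (Complex (3 / 2) t) / zeta (Complex (3 / 2) t)) \<le> M"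
    by (rule zeta_log_deriv_three_halves_bound) blast
  define w where "w = (\<lambda>y. norm (bump b (Complex 1 y)))"
  have w: "integrable lborel w" unfolding w_def
    using integrable_bump[OF b, of 1 "\<lambda>_. 1" 1] by (intro integrable_norm) simp
  obtain R where R: "R > 0" "(LINT y|lborel. indicator (- {-R..R}) y * w y) \<le> 1 / M"
    using integral_outside_interval_small[OF w, of "1 / M"] M(1) by auto
  show ?thesis
  proof (rule that[OF R(1)])
    fix \<tau> y1 y2 assume y: "y1 \<le> \<tau> - R" "\<tau> + R \<le> y2"
    define f where "f = (\<lambda>y. deriv zeta (Complex (3 / 2) (\<tau> + y)) / zeta (Complex (3 / 2) (\<tau> + y)) * bump b (Complex 1 y))"
    define I where "I = {y1 - \<tau>..y2 - \<tau>}"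
    have f: "integrable lborel f" unfolding f_def by (rule prime_side_lower_bound(1)[OF b])
    have fI: "integrable lborel (\<lambda>y. indicator A y *\<^sub>R f y)" if "A \<in> sets borel" for A
      using that by (intro integrable_mult_indicator f) auto
    have "indicator (- I) y *\<^sub>R f y = f y - indicator I y *\<^sub>R f y" for y by (auto simp: indicator_def)
    then have "(LINT y|lborel. f y) - (LINT y|lborel. indicator I y *\<^sub>R f y) = (LINT y|lborel. indicator (- I) y *\<^sub>R f y)"
      using Bochner_Integration.integral_diff[OF f fI[of I]] by (simp add: I_def)
    also have "norm \<dots> \<le> (LINT y|lborel. norm (indicator (- I) y *\<^sub>R f y))" by (rule integral_norm_bound)
    also have "\<dots> \<le> (LINT y|lborel. M * (indicator (- {-R..R}) y * w y))"
    proof (rule integral_mono)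
      show "integrable lborel (\<lambda>y. norm (indicator (- I) y *\<^sub>R f y))" by (intro integrable_norm fI) (simp add: I_def)
      show "integrable lborel (\<lambda>y. M * (indicator (- {- R..R}) y * w y))"
        using integrable_mult_indicator[OF _ w, of "- {-R..R}"] by (intro integrable_mult_right) simp
      fix y
      show "norm (indicator (- I) y *\<^sub>R f y) \<le> M * (indicator (- {- R..R}) y * w y)"
      proof (cases "y \<in> I")
        case True
        then show ?thesis using M(1) by (simp add: w_def indicator_def)
      next
        case False
        then have "y \<notin> {-R..R}" using y by (auto simp: I_def)
        then show ?thesis using False M(2)[of "\<tau> + y"] unfolding f_def w_def norm_mult norm_scaleR
          by (simp add: mult_right_mono flip: norm_divide)
      qed
    qed
    also have "\<dots> \<le> 1" using R(2) M(1) by (simp add: field_simps)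
    finally have "norm ((LINT y|lborel. f y) - (LINT y|lborel. indicator I y *\<^sub>R f y)) \<le> 1" .
    then have "Re (LINT y|lborel. f y) \<le> Re (LINT y|lborel. indicator I y *\<^sub>R f y) + 1"
      using complex_Re_le_cmod[of "(LINT y|lborel. f y) - (LINT y|lborel. indicator I y *\<^sub>R f y)"] by simp
    also have "(LINT y|lborel. indicator I y *\<^sub>R f y) = integral I f"
      using set_borel_integral_eq_integral(2)[of I f] fI[of I]
      by (simp add: set_lebesgue_integral_def set_integrable_def I_def)
    also have "integral I f = integral {y1..y2} (\<lambda>y. deriv zeta (Complex (3 / 2) y) / zeta (Complex (3 / 2) y) * bump b (Complex 1 (y - \<tau>)))"
    proof -
      have "set_integrable lborel I f" using fI[of I] by (simp add: set_integrable_def I_def)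
      then have "f integrable_on I" by (rule set_borel_integral_eq_integral(1))
      then have "(f has_integral integral I f) (cbox (y1 - \<tau>) (y2 - \<tau>))" by (simp add: I_def has_integral_integral)
      from has_integral_affinity'[OF this, of 1 "- \<tau>"]
      have "((\<lambda>y. f (y - \<tau>)) has_integral integral I f) {y1..y2}" by simp
      then have "integral I f = integral {y1..y2} (\<lambda>y. f (y - \<tau>))" by (simp add: integral_unique)
      then show ?thesis by (simp add: f_def)
    qed
    finally show "Re (LINT y|lborel. deriv zeta (Complex (3 / 2) (\<tau> + y)) / zeta (Complex (3 / 2) (\<tau> + y)) * bump b (Complex 1 y))
    \<le> Re (integral {y1..y2} (\<lambda>y. deriv zeta (Complex (3 / 2) y) / zeta (Complex (3 / 2) y) * bump b (Complex 1 (y - \<tau>)))) + 1"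
      by (simp add: f_def)
  qed
qed

text \<open>\<open>E\<close> controls both logarithmic derivatives against the weight on the
  horizontal sides. The error is 2 * E from the zero sum and 2 * E from returning the archimedean
  part to the critical line.\<close>

lemma explicit_formula:
  assumes RH: "Riemann_hypothesis" and y: "4 \<le> y1" "y1 < y2"
    and nz: "zeta (Complex (1 / 2) y1) \<noteq> 0" "zeta (Complex (1 / 2) y2) \<noteq> 0"
    and E: "\<And>x y. 1 / 2 \<le> x \<Longrightarrow> x \<le> 3 / 2 \<Longrightarrow> y \<in> {y1, y2} \<Longrightarrow>
      (norm (deriv zeta (Complex x y) / zeta (Complex x y)) + norm (arch_log_deriv (Complex x y))) * norm (bump b (Complex (x - 1 / 2) (y - \<tau>))) \<le> E"
  shows "\<bar>pi * (\<Sum>t | y1 < t \<and> t < y2 \<and> zeta (Complex (1 / 2) t) = 0. of_int (zorder zeta (Complex (1 / 2) t)) * rbump b (t - \<tau>))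
    - (Re (integral {y1..y2} (\<lambda>y. deriv zeta (Complex (3 / 2) y) / zeta (Complex (3 / 2) y) * bump b (Complex 1 (y - \<tau>))))
       + integral {y1..y2} (\<lambda>y. deriv theta y * rbump b (y - \<tau>)))\<bar> \<le> 4 * E"
proof -
  have pos: "zeta (Complex x y) \<noteq> 0" if "1 / 2 \<le> x" "y \<in> {y1, y2}" for x y
    using that nz RH_zeta_nonzero[OF RH, of "Complex x y"] assms(2,3) by (cases "1 / 2 = x") auto
  have nz32: "zeta (Complex (3 / 2) y) \<noteq> 0" for y by (rule zeta_nonzero_gt_1) simp
  have ld: "deriv zeta_completed (Complex x y) * w / zeta_completed (Complex x y)
    = deriv zeta (Complex x y) / zeta (Complex x y) * w + arch_log_deriv (Complex x y) * w"
    if "1 / 2 \<le> x" "y \<noteq> 0" "zeta (Complex x y) \<noteq> 0" for x y w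
  proof -
    have "deriv zeta_completed (Complex x y) * w / zeta_completed (Complex x y) = (deriv zeta_completed (Complex x y) / zeta_completed (Complex x y)) * w" by simp
    also have "deriv zeta_completed (Complex x y) / zeta_completed (Complex x y) = arch_log_deriv (Complex x y) + deriv zeta (Complex x y) / zeta (Complex x y)"
      using that by (intro zeta_completed_log_deriv) auto
    finally show ?thesis by (simp add: algebra_simps)
  qed
  have A: "\<bar>pi * (\<Sum>t | y1 < t \<and> t < y2 \<and> zeta (Complex (1 / 2) t) = 0. of_int (zorder zeta (Complex (1 / 2) t)) * rbump b (t - \<tau>))
    - Re (integral {y1..y2} (\<lambda>y. deriv zeta_completed (Complex (3 / 2) y) * bump b (Complex 1 (y - \<tau>)) / zeta_completed (Complex (3 / 2) y)))\<bar> \<le> 2 * E"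
  proof (rule zeta_completed_zero_sum[OF RH y nz])
    fix x v :: real assume v: "1 / 2 \<le> x" "x \<le> 3 / 2" "v \<in> {y1, y2}"
    have "v \<noteq> 0" using v y by auto
    show "norm (deriv zeta_completed (Complex x v) * bump b (Complex (x - 1 / 2) (v - \<tau>)) / zeta_completed (Complex x v)) \<le> E"
      unfolding ld[OF v(1) \<open>v \<noteq> 0\<close> pos[OF v(1,3)]]
      by (rule order_trans[OF norm_triangle_ineq]) (use E[OF v] in \<open>simp only: norm_mult distrib_right\<close>)
  qed
  have B: "\<bar>Re (integral {y1..y2} (\<lambda>y. arch_log_deriv (Complex (3 / 2) y) * bump b (Complex 1 (y - \<tau>))))
    - integral {y1..y2} (\<lambda>y. deriv theta y * rbump b (y - \<tau>))\<bar> \<le> 2 * E"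
  proof (rule arch_log_deriv_shift[OF y])
    fix x v :: real assume v: "1 / 2 \<le> x" "x \<le> 3 / 2" "v \<in> {y1, y2}"
    have "norm (arch_log_deriv (Complex x v)) * norm (bump b (Complex (x - 1 / 2) (v - \<tau>))) \<le>
       (norm (deriv zeta (Complex x v) / zeta (Complex x v)) + norm (arch_log_deriv (Complex x v))) * norm (bump b (Complex (x - 1 / 2) (v - \<tau>)))"
      by (intro mult_right_mono) auto
    then show "norm (arch_log_deriv (Complex x v) * bump b (Complex (x - 1 / 2) (v - \<tau>))) \<le> E"
      unfolding norm_mult using E[OF v] by linarith
  qed
  have cb: "continuous_on {y1..y2} (\<lambda>y. bump b (Complex 1 (y - \<tau>)))"
    by (rule continuous_on_compose2[OF continuous_on_bump[of UNIV]]) (auto simp: Complex_eq intro!: continuous_intros)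
  have ca: "continuous_on {y1..y2} (\<lambda>y. arch_log_deriv (Complex (3 / 2) y))"
    by (rule continuous_on_vertical[OF holomorphic_on_imp_continuous_on[OF holomorphic_arch_log_deriv]]) auto
  have zh: "zeta holomorphic_on {s. Im s \<noteq> 0}" by (rule holomorphic_on_subset[OF holomorphic_zeta]) auto
  have cz: "continuous_on {y1..y2} (\<lambda>y. zeta (Complex (3 / 2) y))"
    by (rule continuous_on_vertical[OF holomorphic_on_imp_continuous_on[OF zh]]) (use y in auto)
  have cdz: "continuous_on {y1..y2} (\<lambda>y. deriv zeta (Complex (3 / 2) y))"
    by (rule continuous_on_vertical[OF holomorphic_on_imp_continuous_on[OF holomorphic_deriv[OF zh open_nonreal]]]) (use y in auto)
  have "integral {y1..y2} (\<lambda>y. deriv zeta_completed (Complex (3 / 2) y) * bump b (Complex 1 (y - \<tau>)) / zeta_completed (Complex (3 / 2) y))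
     = integral {y1..y2} (\<lambda>y. deriv zeta (Complex (3 / 2) y) / zeta (Complex (3 / 2) y) * bump b (Complex 1 (y - \<tau>)) + arch_log_deriv (Complex (3 / 2) y) * bump b (Complex 1 (y - \<tau>)))"
    by (intro Henstock_Kurzweil_Integration.integral_cong ld) (use y nz32 in auto)
  also have "\<dots> = integral {y1..y2} (\<lambda>y. deriv zeta (Complex (3 / 2) y) / zeta (Complex (3 / 2) y) * bump b (Complex 1 (y - \<tau>)))
      + integral {y1..y2} (\<lambda>y. arch_log_deriv (Complex (3 / 2) y) * bump b (Complex 1 (y - \<tau>)))"
    by (intro Henstock_Kurzweil_Integration.integral_add integrable_continuous_interval continuous_intros cb ca cz cdz) (use nz32 in auto)
  finally have "Re (integral {y1..y2} (\<lambda>y. deriv zeta_completed (Complex (3 / 2) y) * bump b (Complex 1 (y - \<tau>)) / zeta_completed (Complex (3 / 2) y)))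
     = Re (integral {y1..y2} (\<lambda>y. deriv zeta (Complex (3 / 2) y) / zeta (Complex (3 / 2) y) * bump b (Complex 1 (y - \<tau>))))
      + Re (integral {y1..y2} (\<lambda>y. arch_log_deriv (Complex (3 / 2) y) * bump b (Complex 1 (y - \<tau>))))" by simp
  then show ?thesis using A B by linarith
qed

section \<open>Zeros against Gram intervals\<close>

lemma continuous_on_deriv_theta: "continuous_on A (deriv theta)"
  unfolding deriv_theta
  by (intro continuous_intros continuous_on_vertical[OF holomorphic_on_imp_continuous_on[OF holomorphic_arch_log_deriv]]) auto

lemma integral_deriv_theta: "a \<le> c \<Longrightarrow> integral {a..c} (deriv theta) = theta c - theta a"
  by (intro integral_unique fundamental_theorem_of_calculus)
     (use theta_has_derivative in \<open>auto simp: deriv_theta has_real_derivative_iff_has_vector_derivative intro: has_vector_derivative_at_within\<close>)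

lemma integral_theta_rbump_ge:
  assumes "p \<le> q" "\<And>t. p \<le> t \<Longrightarrow> t \<le> q \<Longrightarrow> deriv theta t \<ge> 0" "\<And>t. p \<le> t \<Longrightarrow> t \<le> q \<Longrightarrow> c \<le> rbump b (t - \<tau>)"
  shows "c * (theta q - theta p) \<le> integral {p..q} (\<lambda>t. deriv theta t * rbump b (t - \<tau>))"
proof -
  have cr: "continuous_on {p..q} (\<lambda>t. rbump b (t - \<tau>))"
    by (rule continuous_on_compose2[OF continuous_on_rbump[of UNIV]]) (auto intro!: continuous_intros)
  have "c * (theta q - theta p) = integral {p..q} (\<lambda>t. deriv theta t * c)"
    using integral_deriv_theta[OF assms(1)] by (simp add: mult.commute)
  also have "\<dots> \<le> integral {p..q} (\<lambda>t. deriv theta t * rbump b (t - \<tau>))"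
    by (intro integral_le integrable_continuous_interval continuous_intros cr continuous_on_deriv_theta mult_left_mono)
       (use assms in auto)
  finally show ?thesis .
qed

text \<open>The potential \<open>V\<close> increases along every interval by at least the amount by which the largest
  value of the unimodal weight exceeds its smallest one, and its total increase is at most 2.\<close>

lemma gram_block_zero_sum_le:
  fixes a :: "nat \<Rightarrow> real" and m :: "real \<Rightarrow> real"
  assumes b: "b \<ge> 0" and k: "k1 \<le> k2"
    and th: "\<And>k. k1 \<le> k \<Longrightarrow> k < k2 \<Longrightarrow> theta (a (Suc k)) - theta (a k) = pi"
    and mono: "\<And>k. k1 \<le> k \<Longrightarrow> k < k2 \<Longrightarrow> a k \<le> a (Suc k)"
    and pos: "\<And>t. a k1 \<le> t \<Longrightarrow> deriv theta t \<ge> 0"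
    and Z: "finite Z" and m: "\<And>t. t \<in> Z \<Longrightarrow> m t \<ge> 0"
    and one: "\<And>k. k1 \<le> k \<Longrightarrow> k < k2 \<Longrightarrow> (\<Sum>t\<in>Z \<inter> {a k<..a (Suc k)}. m t) \<le> 1"
  shows "pi * (\<Sum>t\<in>Z \<inter> {a k1<..a k2}. m t * rbump b (t - \<tau>)) \<le> integral {a k1..a k2} (\<lambda>t. deriv theta t * rbump b (t - \<tau>)) + 2 * pi"
proof -
  define g where "g = (\<lambda>t. rbump b (t - \<tau>))"
  \<comment> \<open>The weight unfolded at its peak: both branches have the value 1 at \<tau>, so
    \<open>V\<close> is nondecreasing, with values between 0 and 2.\<close>
  define V where "V = (\<lambda>t. if t \<le> \<tau> then g t else 2 - g t)"
  have g: "0 < g t" "g t \<le> 1" for t using rbump_pos rbump_le_1[OF b] by (auto simp: g_def)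
  have up: "g s \<le> g t" if "s \<le> t" "t \<le> \<tau>" for s t unfolding g_def using that by (intro rbump_mono b) auto
  have down: "g t \<le> g s" if "s \<le> t" "\<tau> \<le> s" for s t unfolding g_def using that by (intro rbump_mono b) auto
  have cr: "continuous_on A g" for A unfolding g_def
    by (rule continuous_on_compose2[OF continuous_on_rbump[of UNIV]]) (auto intro!: continuous_intros)
  have step: "pi * (\<Sum>t\<in>Z \<inter> {p<..q}. m t * g t) \<le> integral {p..q} (\<lambda>t. deriv theta t * g t) + pi * (V q - V p)"
    if pq: "p \<le> q" "a k1 \<le> p" "theta q - theta p = pi" "(\<Sum>t\<in>Z \<inter> {p<..q}. m t) \<le> 1" for p q
  proof -
    have hi: "(\<Sum>t\<in>Z \<inter> {p<..q}. m t * g t) \<le> s" if s: "\<And>t. p \<le> t \<Longrightarrow> t \<le> q \<Longrightarrow> g t \<le> s" for s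
    proof -
      have s0: "s \<ge> 0" using s[of p] g(1)[of p] pq(1) by simp
      have "(\<Sum>t\<in>Z \<inter> {p<..q}. m t * g t) \<le> (\<Sum>t\<in>Z \<inter> {p<..q}. m t * s)"
        by (intro sum_mono mult_left_mono s m) auto
      also have "\<dots> = (\<Sum>t\<in>Z \<inter> {p<..q}. m t) * s" by (simp add: sum_distrib_right)
      also have "\<dots> \<le> 1 * s" by (rule mult_right_mono[OF pq(4) s0])
      finally show ?thesis by simp
    qed
    have lo: "c * pi \<le> integral {p..q} (\<lambda>t. deriv theta t * g t)" if "\<And>t. p \<le> t \<Longrightarrow> t \<le> q \<Longrightarrow> c \<le> g t" for c
      using integral_theta_rbump_ge[OF pq(1), of c b \<tau>] pos that pq(2,3) by (auto simp: g_def)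
    have "\<exists>s c. (\<forall>t. p \<le> t \<and> t \<le> q \<longrightarrow> g t \<le> s) \<and> (\<forall>t. p \<le> t \<and> t \<le> q \<longrightarrow> c \<le> g t) \<and> s \<le> c + (V q - V p)"
    proof -
      consider "q \<le> \<tau>" | "p > \<tau>" | "p \<le> \<tau>" "\<tau> < q" by linarith
      then show ?thesis
      proof cases
        case 1
        then show ?thesis using pq(1) up by (intro exI[of _ "g q"] exI[of _ "g p"]) (auto simp: V_def)
      next
        case 2
        then show ?thesis using pq(1) down by (intro exI[of _ "g p"] exI[of _ "g q"]) (auto simp: V_def)
      next
        \<comment> \<open>The interval contains the peak. The maximum is replaced by 1, and V q - V
          p = (1 - g p) + (1 - g q) covers 1 - min (g p) (g q).\<close>
        case 3
        have "min (g p) (g q) \<le> g t" if "p \<le> t" "t \<le> q" for t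
          using that up[of p t] down[of t q] by (cases "t \<le> \<tau>") auto
        then show ?thesis using 3 g(2)
          by (intro exI[of _ 1] exI[of _ "min (g p) (g q)"]) (auto simp: V_def min_def add_increasing)
      qed
    qed
    then obtain s c where sc: "\<And>t. p \<le> t \<Longrightarrow> t \<le> q \<Longrightarrow> g t \<le> s" "\<And>t. p \<le> t \<Longrightarrow> t \<le> q \<Longrightarrow> c \<le> g t" "s \<le> c + (V q - V p)" by blast
    have "pi * (\<Sum>t\<in>Z \<inter> {p<..q}. m t * g t) \<le> pi * (c + (V q - V p))"
      using hi[OF sc(1)] sc(3) by (intro mult_left_mono) auto
    also have "\<dots> = c * pi + pi * (V q - V p)" by (simp add: algebra_simps)
    finally show ?thesis using lo[OF sc(2)] by linarith
  qed
  have main: "a k1 \<le> a k \<and> pi * (\<Sum>t\<in>Z \<inter> {a k1<..a k}. m t * g t) \<le> integral {a k1..a k} (\<lambda>t. deriv theta t * g t) + pi * (V (a k) - V (a k1))"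
    if "k1 \<le> k" "k \<le> k2" for k
    using that
  proof (induction k rule: dec_induct)
    case (step k)
    then have k: "k1 \<le> k" "k < k2" by auto
    have IH: "a k1 \<le> a k" "pi * (\<Sum>t\<in>Z \<inter> {a k1<..a k}. m t * g t) \<le> integral {a k1..a k} (\<lambda>t. deriv theta t * g t) + pi * (V (a k) - V (a k1))"
      using step k by auto
    have "Z \<inter> {a k1<..a (Suc k)} = (Z \<inter> {a k1<..a k}) \<union> (Z \<inter> {a k<..a (Suc k)})" using IH(1) mono[OF k] by auto
    then have "(\<Sum>t\<in>Z \<inter> {a k1<..a (Suc k)}. m t * g t) = (\<Sum>t\<in>Z \<inter> {a k1<..a k}. m t * g t) + (\<Sum>t\<in>Z \<inter> {a k<..a (Suc k)}. m t * g t)"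
      using Z by (simp only:) (rule sum.union_disjoint, auto)
    moreover have "integral {a k1..a k} (\<lambda>t. deriv theta t * g t) + integral {a k..a (Suc k)} (\<lambda>t. deriv theta t * g t) = integral {a k1..a (Suc k)} (\<lambda>t. deriv theta t * g t)"
      by (intro Henstock_Kurzweil_Integration.integral_combine IH mono k integrable_continuous_interval continuous_intros cr continuous_on_deriv_theta)
    moreover have "pi * (\<Sum>t\<in>Z \<inter> {a k<..a (Suc k)}. m t * g t) \<le> integral {a k..a (Suc k)} (\<lambda>t. deriv theta t * g t) + pi * (V (a (Suc k)) - V (a k))"
      by (intro \<open>\<And>q p. p \<le> q \<Longrightarrow> a k1 \<le> p \<Longrightarrow> theta q - theta p = pi \<Longrightarrow> _ \<Longrightarrow> _\<close> mono th one k IH)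
    ultimately show ?case using IH mono[OF k] by (auto simp: algebra_simps)
  qed auto
  have "V (a k2) - V (a k1) \<le> 2" using g[of "a k1"] g[of "a k2"] by (auto simp: V_def)
  then have "pi * (V (a k2) - V (a k1)) \<le> pi * 2" by (intro mult_left_mono) auto
  moreover have "pi * (\<Sum>t\<in>Z \<inter> {a k1<..a k2}. m t * g t) \<le> integral {a k1..a k2} (\<lambda>t. deriv theta t * g t) + pi * (V (a k2) - V (a k1))"
    using main[OF k order_refl] by blast
  ultimately show ?thesis unfolding g_def by linarith
qed

section \<open>Gram intervals with two zeros\<close>

lemma finite_critical_zeros: "a > 0 \<Longrightarrow> finite {t \<in> {a..c}. zeta (Complex (1 / 2) t) = 0}"
proof -
  assume a: "a > 0"
  have "Complex (1 / 2) ` {t \<in> {a..c}. zeta (Complex (1 / 2) t) = 0} \<subseteq> {z \<in> cbox (Complex (1 / 2) a) (Complex (1 / 2) c). zeta z = 0}"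
    by (auto simp: in_cbox_complex_iff)
  then have "finite (Complex (1 / 2) ` {t \<in> {a..c}. zeta (Complex (1 / 2) t) = 0})"
    using finite_subset finite_zeta_zeros_box[OF a] by blast
  then show ?thesis by (rule finite_imageD) (auto simp: inj_on_def)
qed

lemma zorder_zeta_nonneg:
  assumes "s \<noteq> 1"
  shows "zorder zeta s \<ge> 0"
proof (rule zorder_ge_0)
  show "zeta analytic_on {s}" using holomorphic_zeta assms by (auto simp: analytic_at open_Compl intro!: exI[of _ "- {1}"])
  show "\<exists>\<^sub>F z in at s. zeta z \<noteq> 0" by (rule eventually_frequently[OF at_neq_bot eventually_zeta_nonzero[OF assms]])
qed

text \<open>The explicit formula lives on [y1, y2], whose ends avoid the zeros, whereas the
  comparison needs whole Gram intervals. The block from k1 to k2 covers [y1, y2] with an overhang of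
  at most 1/4 at each end, and \<open>endsE\<close> makes the integrals over the overhangs
  harmless.\<close>

lemma prime_side_le_of_few_zeros:
  assumes RH: "Riemann_hypothesis" and b: "b \<ge> 0" and y: "4 \<le> y1" "y1 < y2"
    and nz: "zeta (Complex (1 / 2) y1) \<noteq> 0" "zeta (Complex (1 / 2) y2) \<noteq> 0"
    and E: "\<And>x y. 1 / 2 \<le> x \<Longrightarrow> x \<le> 3 / 2 \<Longrightarrow> y \<in> {y1, y2} \<Longrightarrow>
      (norm (deriv zeta (Complex x y) / zeta (Complex x y)) + norm (arch_log_deriv (Complex x y))) * norm (bump b (Complex (x - 1 / 2) (y - \<tau>))) \<le> E"
    and k: "k1 < k2"
    and ends: "y1 - 1 / 4 \<le> gram_point k1" "gram_point k1 \<le> y1" "y2 \<le> gram_point k2" "gram_point k2 \<le> y2 + 1 / 4"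
    and th: "\<And>k. k1 \<le> k \<Longrightarrow> k \<le> k2 \<Longrightarrow> theta (gram_point k) = (real k - 1) * pi"
    and mono: "\<And>i j. k1 \<le> i \<Longrightarrow> i \<le> j \<Longrightarrow> j \<le> k2 \<Longrightarrow> gram_point i \<le> gram_point j"
    and pos: "\<And>t. gram_point k1 \<le> t \<Longrightarrow> deriv theta t \<ge> 0"
    and few: "\<And>k. k1 < k \<Longrightarrow> k \<le> k2 \<Longrightarrow> critical_zero_count (gram_interval k) \<le> 1"
    and endsE: "\<And>t. t \<in> {gram_point k1..y1} \<union> {y2..gram_point k2} \<Longrightarrow> deriv theta t * rbump b (t - \<tau>) \<le> E"
  shows "Re (integral {y1..y2} (\<lambda>y. deriv zeta (Complex (3 / 2) y) / zeta (Complex (3 / 2) y) * bump b (Complex 1 (y - \<tau>)))) \<le> 2 * pi + 5 * E"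
proof -
  define Z where "Z = {t. y1 < t \<and> t < y2 \<and> zeta (Complex (1 / 2) t) = 0}"
  define m where "m = (\<lambda>t. real_of_int (zorder zeta (Complex (1 / 2) t)))"
  define f where "f = (\<lambda>t. deriv theta t * rbump b (t - \<tau>))"
  define W where "W = integral {y1..y2} (\<lambda>y. deriv zeta (Complex (3 / 2) y) / zeta (Complex (3 / 2) y) * bump b (Complex 1 (y - \<tau>)))"
  have m0: "m t \<ge> 0" for t using zorder_zeta_nonneg[of "Complex (1 / 2) t"] by (simp add: m_def complex_eq_iff)
  have Zfin: "finite Z" by (rule finite_subset[OF _ finite_critical_zeros[of y1 y2]]) (use y in \<open>auto simp: Z_def\<close>)
  have one: "(\<Sum>t\<in>Z \<inter> {gram_point k<..gram_point (Suc k)}. m t) \<le> 1" if kk: "k1 \<le> k" "k < k2" for k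
  proof -
    \<comment> \<open>\<open>critical_zero_count\<close> is a sum over a set of zeros and would be 0
      by default if that set were infinite; finiteness makes it an upper bound for the partial
      sum.\<close>
    define Q where "Q = {t. t \<in> gram_interval (Suc k) \<and> zeta (Complex (1 / 2) t) = 0}"
    have "gram_point k > 0" using mono[of k1 k] kk ends y by linarith
    then have Qfin: "finite Q"
      by (intro finite_subset[OF _ finite_critical_zeros[of "gram_point k" "gram_point (Suc k)"]]) (auto simp: Q_def gram_interval_def)
    have "(\<Sum>t\<in>Z \<inter> {gram_point k<..gram_point (Suc k)}. m t) \<le> sum m Q"
      by (rule sum_mono2[OF Qfin]) (auto simp: Q_def Z_def gram_interval_def m0)
    also have "\<dots> = real_of_int (critical_zero_count (gram_interval (Suc k)))"
      unfolding critical_zero_count_def Q_def m_def by simp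
    also have "\<dots> \<le> 1" using few[of "Suc k"] kk by simp
    finally show ?thesis .
  qed
  have fc: "continuous_on A f" for A unfolding f_def
    by (intro continuous_intros continuous_on_deriv_theta continuous_on_compose2[OF continuous_on_rbump[of UNIV]]) auto
  have ZI: "Z \<inter> {gram_point k1<..gram_point k2} = Z" using ends by (auto simp: Z_def)
  have main: "pi * (\<Sum>t\<in>Z. m t * rbump b (t - \<tau>)) \<le> integral {gram_point k1..gram_point k2} f + 2 * pi"
    unfolding f_def
  proof (subst ZI[symmetric], rule gram_block_zero_sum_le[OF b])
    show "theta (gram_point (Suc k)) - theta (gram_point k) = pi" if "k1 \<le> k" "k < k2" for k
      using that th[of k] th[of "Suc k"] by (simp add: algebra_simps)
  qed (use k mono pos Zfin m0 one in auto)
  have "integral {gram_point k1..y1} f + integral {y1..gram_point k2} f = integral {gram_point k1..gram_point k2} f"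
    using ends y by (intro Henstock_Kurzweil_Integration.integral_combine integrable_continuous_interval fc) auto
  moreover have "integral {y1..y2} f + integral {y2..gram_point k2} f = integral {y1..gram_point k2} f"
    using ends y by (intro Henstock_Kurzweil_Integration.integral_combine integrable_continuous_interval fc) auto
  moreover have piece: "integral {p..q} f \<le> E * (1 / 4)"
    if pq: "p \<le> q" "q \<le> p + 1 / 4" "{p..q} \<subseteq> {gram_point k1..y1} \<union> {y2..gram_point k2}" for p q
  proof -
    have "0 \<le> f p" unfolding f_def using pq ends y rbump_pos[of b] by (intro mult_nonneg_nonneg pos) (auto intro: less_imp_le)
    also have "f p \<le> E" unfolding f_def using pq by (intro endsE) auto
    finally have E0: "E \<ge> 0" .
    have "integral {p..q} f \<le> integral {p..q} (\<lambda>_. E)"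
      by (intro integral_le integrable_continuous_interval fc) (use pq endsE in \<open>auto simp: f_def\<close>)
    also have "\<dots> = (q - p) * E" using pq by simp
    also have "\<dots> \<le> 1 / 4 * E" using pq E0 by (intro mult_right_mono) auto
    finally show ?thesis by simp
  qed
  have p1: "integral {gram_point k1..y1} f \<le> E * (1 / 4)" by (rule piece) (use ends in auto)
  have p2: "integral {y2..gram_point k2} f \<le> E * (1 / 4)" by (rule piece) (use ends in auto)
  have "\<bar>pi * (\<Sum>t\<in>Z. m t * rbump b (t - \<tau>)) - (Re W + integral {y1..y2} f)\<bar> \<le> 4 * E"
    unfolding Z_def m_def f_def W_def by (rule explicit_formula[OF RH y nz E])
  moreover have "E \<ge> 0"
  proof -
    have "0 \<le> deriv theta y1 * rbump b (y1 - \<tau>)" using pos[of y1] ends rbump_pos[of b] by (intro mult_nonneg_nonneg) (auto intro: less_imp_le)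
    then show ?thesis using endsE[of y1] ends by force
  qed
  \<comment> \<open>4 * E from the explicit formula and E / 4 from each overhang; as E >= 0, this is
    at most 5 * E.\<close>
  ultimately have "Re W \<le> 2 * pi + 5 * E" using main p1 p2 by linarith
  then show ?thesis by (simp add: W_def)
qed

theorem theorem6:
  assumes "Riemann_hypothesis"
  shows "\<exists>T0 c0 :: real. \<forall>T\<ge>T0. \<forall>H. H = 0.8 * ln (ln (ln T)) + c0 \<longrightarrow>
           (\<exists>k\<ge>1. gram_interval k \<subseteq> {T - H..T + H} \<and>
                    critical_zero_count (gram_interval k) \<ge> 2)"
proof -
  note RH = assms
  \<comment> \<open>With E = 1/2, few zeros allow at most 2 \<pi> + 5/2, and truncation loses at
    most 1; the value 2 \<pi> + 5 contradicts this. Note that \<open>b\<close> and \<open>L\<close>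
    are fixed before T.\<close>
  obtain b L :: real where b: "b \<ge> 1" and L: "\<And>T. \<exists>\<tau>. \<bar>\<tau> - T\<bar> \<le> L \<and>
      Re (LINT y|lborel. deriv zeta (Complex (3 / 2) (\<tau> + y)) / zeta (Complex (3 / 2) (\<tau> + y)) * bump b (Complex 1 y)) \<ge> 2 * pi + 5"
    by (rule large_prime_side) blast
  obtain K1 where K1: "K1 > 1" "\<And>y. y \<ge> 4 \<Longrightarrow> \<exists>u\<in>{y..y + 1 / 4}. \<forall>t. zeta (Complex (1 / 2) t) = 0 \<longrightarrow> \<bar>t - u\<bar> \<ge> 1 / (K1 * ln y)"
    by (rule good_height) blast
  obtain K2 where K2: "K2 > 0" "\<And>y \<eta> \<sigma>. y \<ge> 4 \<Longrightarrow> 0 < \<eta> \<Longrightarrow> \<eta> \<le> 1 / 4 \<Longrightarrow> (\<And>t. zeta (Complex (1 / 2) t) = 0 \<Longrightarrow> \<bar>t - y\<bar> \<ge> \<eta>)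
     \<Longrightarrow> 1 / 2 \<le> \<sigma> \<Longrightarrow> \<sigma> \<le> 3 / 2 \<Longrightarrow> norm (deriv zeta (Complex \<sigma> y) / zeta (Complex \<sigma> y)) \<le> K2 * ln y / \<eta>\<^sup>2"
    by (rule zeta_log_deriv_horizontal_bound[OF RH]) blast
  obtain K3 where K3: "K3 > 0" "\<And>\<sigma> t. 1 / 2 \<le> \<sigma> \<Longrightarrow> \<sigma> \<le> 3 / 2 \<Longrightarrow> t \<ge> 4 \<Longrightarrow> norm (arch_log_deriv (Complex \<sigma> t)) \<le> K3 * ln t"
    by (rule arch_log_deriv_bound) blast
  obtain Y where Y: "Y \<ge> 4" "\<And>t. t \<ge> Y \<Longrightarrow> deriv theta t > 0"
    "\<And>y1 y2. Y \<le> y1 \<Longrightarrow> y1 < y2 \<Longrightarrow> \<exists>k1 k2. k1 < k2 \<and> gram_point k1 \<ge> y1 - 1 / 4 \<and> gram_point k1 \<le> y1 \<and> y2 \<le> gram_point k2 \<and> gram_point k2 \<le> y2 + 1 / 4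
       \<and> (\<forall>k\<in>{k1..k2}. theta (gram_point k) = (real k - 1) * pi) \<and> (\<forall>i\<in>{k1..k2}. \<forall>j\<in>{k1..k2}. i \<le> j \<longrightarrow> gram_point i \<le> gram_point j)"
    by (rule gram_points_cover) blast
  have b0: "b > 0" using b by simp
  obtain R where R: "R > 0" "\<And>\<tau> y1 y2. y1 \<le> \<tau> - R \<Longrightarrow> \<tau> + R \<le> y2 \<Longrightarrow>
      Re (LINT y|lborel. deriv zeta (Complex (3 / 2) (\<tau> + y)) / zeta (Complex (3 / 2) (\<tau> + y)) * bump b (Complex 1 y))
      \<le> Re (integral {y1..y2} (\<lambda>y. deriv zeta (Complex (3 / 2) y) / zeta (Complex (3 / 2) y) * bump b (Complex 1 (y - \<tau>)))) + 1"
    by (rule prime_side_truncation[OF b0]) blast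
  define q where "q = b * bump_kappa"
  have q: "q > 0" using b0 bump_kappa_pos by (simp add: q_def)
  \<comment> \<open>\<open>L\<close> pays for the distance of \<tau> from T, 2 for cutting the
    window short of its ends, and the logarithm for exp (5 d / 4) >= 20 / q * ln (ln T) at the
    remaining distance d. As cosh is at least half of this exponential, q * cosh reaches 10 * ln (ln
    T).\<close>
  define c0 where "c0 = L + 2 + 4 / 5 * ln (20 / q)"
  \<comment> \<open>Bounds the sum of the two logarithmic derivatives at a good height: K2 * ln (2
    T) / \<eta>^2 with 1 / \<eta> = 4 * K1 * ln (2 T), plus the archimedean part. This is of order
    (ln T)^3, against a weight of order (ln T)^(-10).\<close>
  define M where "M = (\<lambda>T. K2 * ln (2 * T) * (4 * K1 * ln (2 * T))\<^sup>2 + K3 * ln (2 * T))"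
  have "eventually (\<lambda>T. 0.8 * ln (ln (ln T)) + c0 \<ge> L + 2 + R) at_top" by real_asymp
  moreover have "eventually (\<lambda>T. T - (0.8 * ln (ln (ln T)) + c0) \<ge> Y) at_top" by real_asymp
  moreover have "eventually (\<lambda>T. T + (0.8 * ln (ln (ln T)) + c0) \<le> 2 * T) at_top" by real_asymp
  moreover have "eventually (\<lambda>T::real. ln (2 * T) \<ge> 1) at_top" by real_asymp
  moreover have "eventually (\<lambda>T::real. ln (ln T) > 0) at_top" by real_asymp
  moreover have "eventually (\<lambda>T. M T * exp (b - 10 * ln (ln T)) \<le> 1 / 2) at_top"
    unfolding M_def using K1(1) K2(1) K3(1) by real_asymp
  ultimately have "eventually (\<lambda>T. 0.8 * ln (ln (ln T)) + c0 \<ge> L + 2 + R \<and> T - (0.8 * ln (ln (ln T)) + c0) \<ge> Y \<and> T + (0.8 * ln (ln (ln T)) + c0) \<le> 2 * T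
      \<and> ln (2 * T) \<ge> 1 \<and> ln (ln T) > 0 \<and> M T * exp (b - 10 * ln (ln T)) \<le> 1 / 2) at_top"
    by (simp only: eventually_conj_iff)
  then obtain T0 where T0: "\<And>T. T \<ge> T0 \<Longrightarrow> 0.8 * ln (ln (ln T)) + c0 \<ge> L + 2 + R \<and> T - (0.8 * ln (ln (ln T)) + c0) \<ge> Y \<and> T + (0.8 * ln (ln (ln T)) + c0) \<le> 2 * T
      \<and> ln (2 * T) \<ge> 1 \<and> ln (ln T) > 0 \<and> M T * exp (b - 10 * ln (ln T)) \<le> 1 / 2"
    unfolding eventually_at_top_linorder by blast
  show ?thesis
  proof (rule exI[of _ T0], rule exI[of _ c0], intro allI impI, rule ccontr)
    fix T H assume T: "T \<ge> T0" and H: "H = 0.8 * ln (ln (ln T)) + c0"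
      and no: "\<not> (\<exists>k\<ge>1. gram_interval k \<subseteq> {T - H..T + H} \<and> critical_zero_count (gram_interval k) \<ge> 2)"
    define lT where "lT = ln (2 * T)"
    have TT: "H \<ge> L + 2 + R" "T - H \<ge> Y" "T + H \<le> 2 * T" "lT \<ge> 1" "ln (ln T) > 0" "M T * exp (b - 10 * ln (ln T)) \<le> 1 / 2"
      using T0[OF T] unfolding H lT_def by auto
    obtain \<tau> where \<tau>: "\<bar>\<tau> - T\<bar> \<le> L"
      "Re (LINT y|lborel. deriv zeta (Complex (3 / 2) (\<tau> + y)) / zeta (Complex (3 / 2) (\<tau> + y)) * bump b (Complex 1 y)) \<ge> 2 * pi + 5"
      using L by blast
    \<comment> \<open>The 4 ensures \<eta> <= 1/4, as the horizontal bound demands; with ln (2 T) in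
      place of the logarithm of the actual height, one gap serves both ends.\<close>
    define \<eta> where "\<eta> = 1 / (4 * K1 * lT)"
    have \<eta>: "\<eta> > 0" "\<eta> \<le> 1 / 4"
    proof -
      have "1 * 1 \<le> K1 * lT" using K1 TT(4) by (intro mult_mono) auto
      then show "\<eta> > 0" "\<eta> \<le> 1 / 4" unfolding \<eta>_def by (auto simp: field_simps)
    qed
    have good: "\<exists>u\<in>{v..v + 1 / 4}. \<forall>t. zeta (Complex (1 / 2) t) = 0 \<longrightarrow> \<bar>t - u\<bar> \<ge> \<eta>" if v: "4 \<le> v" "v \<le> 2 * T" for v
    proof -
      obtain u where u: "u \<in> {v..v + 1 / 4}" "\<And>t. zeta (Complex (1 / 2) t) = 0 \<Longrightarrow> \<bar>t - u\<bar> \<ge> 1 / (K1 * ln v)" using K1(2)[OF v(1)] by blast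
      have "ln v \<le> lT" "ln v > 0" using v unfolding lT_def by auto
      then have "K1 * ln v \<le> 4 * K1 * lT" "K1 * ln v > 0" using K1(1) TT(4) by (auto intro!: mult_mono simp: mult.assoc)
      then have "\<eta> \<le> 1 / (K1 * ln v)" unfolding \<eta>_def by (intro divide_left_mono) auto
      then show ?thesis using u by (intro bexI[of _ u]) (auto intro: order_trans)
    qed
    have LH: "L \<ge> 0" "H \<ge> 2" using \<tau>(1) TT(1) R(1) by linarith+
    have T4: "T - H \<ge> 4" using TT(2) Y(1) by linarith
    \<comment> \<open>The cuts \<open>y1\<close> and \<open>y2\<close> lie at least 1 inside the
      window, which leaves room for the overhang 1/4 of the Gram block, and within 2 of its ends,
      where the weight is still tiny.\<close>
    obtain y1 where y1: "T - H + 1 \<le> y1" "y1 \<le> T - H + 5 / 4" "\<And>t. zeta (Complex (1 / 2) t) = 0 \<Longrightarrow> \<bar>t - y1\<bar> \<ge> \<eta>"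
      using good[of "T - H + 1"] T4 TT(3) LH by force
    obtain y2 where y2: "T + H - 2 \<le> y2" "y2 \<le> T + H - 7 / 4" "\<And>t. zeta (Complex (1 / 2) t) = 0 \<Longrightarrow> \<bar>t - y2\<bar> \<ge> \<eta>"
      using good[of "T + H - 2"] T4 TT(3) LH by force
    have y12: "4 \<le> y1" "y1 < y2" "Y \<le> y1" "y2 \<le> 2 * T" "Y \<le> y1 - 1 / 4" using y1 y2 T4 TT R(1) LH by linarith+
    have nz: "zeta (Complex (1 / 2) y1) \<noteq> 0" "zeta (Complex (1 / 2) y2) \<noteq> 0" using y1(3)[of y1] y2(3)[of y2] \<eta>(1) by auto
    obtain k1 k2 where kk: "k1 < k2" "y1 - 1 / 4 \<le> gram_point k1" "gram_point k1 \<le> y1" "y2 \<le> gram_point k2" "gram_point k2 \<le> y2 + 1 / 4"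
      and th: "\<And>k. k1 \<le> k \<Longrightarrow> k \<le> k2 \<Longrightarrow> theta (gram_point k) = (real k - 1) * pi"
      and mono: "\<And>i j. k1 \<le> i \<Longrightarrow> i \<le> j \<Longrightarrow> j \<le> k2 \<Longrightarrow> gram_point i \<le> gram_point j"
      using Y(3)[OF y12(3,2)] by (auto simp: Ball_def)
    define \<epsilon> where "\<epsilon> = exp (b - 10 * ln (ln T))"
    \<comment> \<open>Within 2 of the ends of the window, or beyond them, the distance from \<tau>
      is at least H - L - 2, and \<open>c0\<close> was chosen to make q * cosh at least 10 * ln (ln
      T) there.\<close>
    have far: "norm (bump b (Complex x (t - \<tau>))) \<le> \<epsilon>" if t: "\<bar>x\<bar> \<le> 1" "t \<le> T - H + 2 \<or> t \<ge> T + H - 2" for x t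
    proof -
      have "\<bar>t - \<tau>\<bar> \<ge> H - L - 2" using t(2) \<tau>(1) TT(1) R(1) by linarith
      then have d: "5 / 4 * \<bar>t - \<tau>\<bar> \<ge> ln (ln (ln T)) + ln (20 / q)" unfolding H c0_def by (simp add: field_simps)
      have "20 / q * ln (ln T) = exp (ln (ln (ln T)) + ln (20 / q))" using TT(5) q by (simp add: exp_add)
      also have "\<dots> \<le> exp (5 / 4 * \<bar>t - \<tau>\<bar>)" using d by simp
      also have "\<dots> \<le> 2 * cosh (5 / 4 * \<bar>t - \<tau>\<bar>)" by (simp add: cosh_def)
      also have "cosh (5 / 4 * \<bar>t - \<tau>\<bar>) = cosh (5 / 4 * (t - \<tau>))" by (cases "t \<ge> \<tau>") (auto simp: cosh_minus[of "5 / 4 * (t - \<tau>)", symmetric] simp del: cosh_minus)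
      finally have "10 * ln (ln T) \<le> q * cosh (5 / 4 * (t - \<tau>))" using q by (simp add: field_simps)
      then have "exp (b - q * cosh (5 / 4 * (t - \<tau>))) \<le> \<epsilon>" unfolding \<epsilon>_def by simp
      then show ?thesis using norm_bump_le[of b x "t - \<tau>"] t(1) b0 unfolding q_def by (simp add: order_trans)
    qed
    have arch: "norm (arch_log_deriv (Complex x v)) \<le> K3 * lT" if "1 / 2 \<le> x" "x \<le> 3 / 2" "4 \<le> v" "v \<le> 2 * T" for x v
    proof -
      have "K3 * ln v \<le> K3 * lT" unfolding lT_def using that K3(1) by (intro mult_left_mono) auto
      then show ?thesis using K3(2)[of x v] that by linarith
    qed
    have MT: "M T = K2 * lT / \<eta>\<^sup>2 + K3 * lT" by (simp add: M_def lT_def \<eta>_def power_divide)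
    have "Re (integral {y1..y2} (\<lambda>y. deriv zeta (Complex (3 / 2) y) / zeta (Complex (3 / 2) y) * bump b (Complex 1 (y - \<tau>)))) \<le> 2 * pi + 5 * (1 / 2)"
    proof (rule prime_side_le_of_few_zeros[OF RH _ y12(1,2) nz _ kk(1-5) th mono])
      fix x v :: real assume v: "1 / 2 \<le> x" "x \<le> 3 / 2" "v \<in> {y1, y2}"
      have v4: "4 \<le> v" "v \<le> 2 * T" using v(3) y12 by auto
      have "norm (deriv zeta (Complex x v) / zeta (Complex x v)) \<le> K2 * ln v / \<eta>\<^sup>2"
        by (rule K2(2)) (use v v4 \<eta> y1(3) y2(3) in auto)
      also have "\<dots> \<le> K2 * lT / \<eta>\<^sup>2" unfolding lT_def using v4 K2(1) by (intro divide_right_mono mult_left_mono) auto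
      finally have "norm (deriv zeta (Complex x v) / zeta (Complex x v)) + norm (arch_log_deriv (Complex x v)) \<le> M T"
        unfolding MT using arch[OF v(1,2) v4] by linarith
      moreover have "norm (bump b (Complex (x - 1 / 2) (v - \<tau>))) \<le> \<epsilon>" by (rule far) (use v y1 y2 in auto)
      ultimately have "(norm (deriv zeta (Complex x v) / zeta (Complex x v)) + norm (arch_log_deriv (Complex x v))) * norm (bump b (Complex (x - 1 / 2) (v - \<tau>))) \<le> M T * \<epsilon>"
        by (rule mult_mono') auto
      then show "(norm (deriv zeta (Complex x v) / zeta (Complex x v)) + norm (arch_log_deriv (Complex x v))) * norm (bump b (Complex (x - 1 / 2) (v - \<tau>))) \<le> 1 / 2"
        using TT(6) unfolding \<epsilon>_def by linarith
    next
      fix t assume "gram_point k1 \<le> t"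
      then show "deriv theta t \<ge> 0" using Y(2)[of t] kk(2) y12(5) by simp
    next
      fix k assume k: "k1 < k" "k \<le> k2"
      \<comment> \<open>Each interval of the block lies in the window, and k > k1 gives k >= 1, so
        the negated claim bounds its zero count by 1.\<close>
      have "gram_point k1 \<le> gram_point (k - 1)" "gram_point k \<le> gram_point k2" by (rule mono; use k in simp)+
      then have "gram_interval k \<subseteq> {T - H..T + H}"
        using kk y1(1) y2(2) by (auto simp: gram_interval_def)
      then show "critical_zero_count (gram_interval k) \<le> 1" using no k by force
    next
      fix t assume t: "t \<in> {gram_point k1..y1} \<union> {y2..gram_point k2}"
      have t4: "4 \<le> t" "t \<le> 2 * T" "t \<le> T - H + 2 \<or> t \<ge> T + H - 2" using t kk y1 y2 y12 T4 TT(3) by auto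
      have "rbump b (t - \<tau>) \<le> \<epsilon>" using far[of 0 t] t4(3) rbump_pos[of b "t - \<tau>"] by (simp add: bump_imag)
      moreover have "deriv theta t \<le> M T"
      proof -
        have "deriv theta t \<le> K3 * lT" unfolding deriv_theta using arch[of "1 / 2" t] t4 by (intro order_trans[OF complex_Re_le_cmod]) auto
        also have "\<dots> \<le> M T" unfolding MT using K2(1) TT(4) by simp
        finally show ?thesis .
      qed
      moreover have "deriv theta t \<ge> 0" using Y(2)[of t] t kk y12 by force
      ultimately have "deriv theta t * rbump b (t - \<tau>) \<le> M T * \<epsilon>" using rbump_pos[of b "t - \<tau>"] by (intro mult_mono) auto
      then show "deriv theta t * rbump b (t - \<tau>) \<le> 1 / 2" using TT(6) unfolding \<epsilon>_def by linarith
    qed (use b in auto)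
    moreover have "Re (LINT y|lborel. deriv zeta (Complex (3 / 2) (\<tau> + y)) / zeta (Complex (3 / 2) (\<tau> + y)) * bump b (Complex 1 y))
      \<le> Re (integral {y1..y2} (\<lambda>y. deriv zeta (Complex (3 / 2) y) / zeta (Complex (3 / 2) y) * bump b (Complex 1 (y - \<tau>)))) + 1"
      by (rule R(2)) (use y1 y2 \<tau>(1) TT(1) in linarith)+
    ultimately show False using \<tau>(2) by linarith
  qed
qed

end
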